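(* Let $\Gamma$ be a countable non-MAP nilpotent group, for example $\Gamma=\mathbb H_3(\mathbb Q)=\left\{\begin{pmatrix}1&x&y\\0&1&z\\0&0&1\end{pmatrix}: x,y,z\in\mathbb Q\right\}$. Let $(\Gamma_n)_{n=1}^\infty$ be any increasing sequence of finitely generated subgroups of $\Gamma$ such that $\Gamma=\bigcup_{n\in\mathbb N}\Gamma_n$. Let $\mathcal G=\mathcal G(\Gamma,(\Gamma_n)_{n=1}^\infty)$ be the groupoid described in the context. Then $\mathcal G$ is an amenable étale groupoid with a non-MAP isotropy subgroup, and $C^*(\mathcal G)$ is an RFD C*-algebra.
   Context: A discrete group is MAP if its finite-dimensional unitary representations separate its points. A C*-algebra is RFD if its finite-dimensional representations separate its points. Étale groupoids are assumed locally compact, Hausdorff and second-countable; amenable means topologically amenable; $C^*(\mathcal G)$ is the full groupoid C*-algebra. Construction of $\mathcal G(\Gamma,(\Gamma_n)_{n=1}^\infty)$: let $X=\mathbb N\cup\{\infty\}$ be the one-point compactification of $\mathbb N=\{1,2,\dots\}$, with the usual order. Put $\Gamma_\infty=\Gamma$ and $\mathcal G=\bigsqcup_{x\in X}\Gamma_x=\{(g,x): x\in X,\ g\in\Gamma_x\}$, a bundle of groups: the unit space is $X$, the source and range maps coincide (both are $(g,x)\mapsto x$), and the product is the group multiplication in each fibre. For $n\in\mathbb N$ and $g\in\Gamma_n$ put $U_{g,n}=\{(g,m): m\in X,\ m\ge n\}$. The topology on $\mathcal G$ is given by the basis consisting of all the sets $U_{g,n}$ ($n\in\mathbb N$, $g\in\Gamma_n$)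 together with all singletons $\{(g,n)\}$ ($n\in\mathbb N$, $g\in\Gamma_n$). *)

theory Defs
  imports "HOL-Analysis.Analysis" "HOL-Algebra.Generated_Groups"
begin

section \<open>Hilbert spaces and bounded operators\<close>

text \<open>
  Every complex Hilbert space is isometrically isomorphic to \<open>\<ell>\<^sup>2(I)\<close> for an index set \<open>I\<close>, so
  Hilbert spaces are taken to be of this form; the dimension is the cardinality of \<open>I\<close>.  Vectors
  vanish off \<open>I\<close>, and operators on \<open>\<ell>\<^sup>2(I)\<close> are required to vanish off \<open>\<ell>\<^sup>2(I)\<close>, so that
  equality of operators is equality of functions and the algebraic operations are pointwise.
\<close>

definition ell2 :: "'i set \<Rightarrow> ('i \<Rightarrow> complex) set" where
  "ell2 I = {\<xi>. (\<forall>i. i \<notin> I \<longrightarrow> \<xi> i = 0) \<and> (\<lambda>i. (cmod (\<xi> i))\<^sup>2) summable_on UNIV}"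

definition ell2_inner :: "('i \<Rightarrow> complex) \<Rightarrow> ('i \<Rightarrow> complex) \<Rightarrow> complex" where
  "ell2_inner \<xi> \<eta> = (\<Sum>\<^sub>\<infinity>i. cnj (\<xi> i) * \<eta> i)"

definition ell2_norm :: "('i \<Rightarrow> complex) \<Rightarrow> real" where
  "ell2_norm \<xi> = sqrt (\<Sum>\<^sub>\<infinity>i. (cmod (\<xi> i))\<^sup>2)"

type_synonym 'i operator = "('i \<Rightarrow> complex) \<Rightarrow> ('i \<Rightarrow> complex)"

definition bounded_operators :: "'i set \<Rightarrow> 'i operator set" where
  "bounded_operators I = {T.
     (\<forall>\<xi>. \<xi> \<notin> ell2 I \<longrightarrow> T \<xi> = (\<lambda>_. 0)) \<and>
     (\<forall>\<xi>\<in>ell2 I. T \<xi> \<in> ell2 I) \<and>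
     (\<forall>\<xi>\<in>ell2 I. \<forall>\<eta>\<in>ell2 I. T (\<lambda>i. \<xi> i + \<eta> i) = (\<lambda>i. T \<xi> i + T \<eta> i)) \<and>
     (\<forall>c. \<forall>\<xi>\<in>ell2 I. T (\<lambda>i. c * \<xi> i) = (\<lambda>i. c * T \<xi> i)) \<and>
     (\<exists>C. \<forall>\<xi>\<in>ell2 I. ell2_norm (T \<xi>) \<le> C * ell2_norm \<xi>)}"

definition operator_norm :: "'i set \<Rightarrow> 'i operator \<Rightarrow> real" where
  "operator_norm I T = (SUP \<xi>\<in>{\<xi> \<in> ell2 I. ell2_norm \<xi> \<le> 1}. ell2_norm (T \<xi>))"

definition is_adjoint :: "'i set \<Rightarrow> 'i operator \<Rightarrow> 'i operator \<Rightarrow> bool" where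
  "is_adjoint I T S \<longleftrightarrow> (\<forall>\<xi>\<in>ell2 I. \<forall>\<eta>\<in>ell2 I. ell2_inner (T \<xi>) \<eta> = ell2_inner \<xi> (S \<eta>))"

definition operator_adjoint :: "'i set \<Rightarrow> 'i operator \<Rightarrow> 'i operator" where
  "operator_adjoint I T = (THE S. S \<in> bounded_operators I \<and> is_adjoint I T S)"

definition unitary_group :: "'i set \<Rightarrow> 'i operator monoid" where
  "unitary_group I = \<lparr>
     carrier = {U \<in> bounded_operators I. bij_betw U (ell2 I) (ell2 I) \<and>
       (\<forall>\<xi>\<in>ell2 I. \<forall>\<eta>\<in>ell2 I. ell2_inner (U \<xi>) (U \<eta>) = ell2_inner \<xi> \<eta>)},
     mult = (\<circ>),
     one = (\<lambda>\<xi>. if \<xi> \<in> ell2 I then \<xi> else (\<lambda>_. 0))\<rparr>"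


section \<open>Groups\<close>

definition MAP_group :: "('g, 'b) monoid_scheme \<Rightarrow> bool" where
  "MAP_group G \<longleftrightarrow> (\<forall>g\<in>carrier G. \<forall>h\<in>carrier G. g \<noteq> h \<longrightarrow>
     (\<exists>(I :: nat set) u. finite I \<and> u \<in> hom G (unitary_group I) \<and> u g \<noteq> u h))"

fun lower_central_series :: "('g, 'b) monoid_scheme \<Rightarrow> nat \<Rightarrow> 'g set" where
  "lower_central_series G 0 = carrier G"
| "lower_central_series G (Suc k) = generate G
     {g \<otimes>\<^bsub>G\<^esub> h \<otimes>\<^bsub>G\<^esub> inv\<^bsub>G\<^esub> g \<otimes>\<^bsub>G\<^esub> inv\<^bsub>G\<^esub> h | g h. g \<in> lower_central_series G k \<and> h \<in> carrier G}"

definition nilpotent_group :: "('g, 'b) monoid_scheme \<Rightarrow> bool" where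
  "nilpotent_group G \<longleftrightarrow> group G \<and> (\<exists>c. lower_central_series G c = {\<one>\<^bsub>G\<^esub>})"

definition fin_gen_subgroup :: "('g, 'b) monoid_scheme \<Rightarrow> 'g set \<Rightarrow> bool" where
  "fin_gen_subgroup G H \<longleftrightarrow> subgroup H G \<and> (\<exists>S. finite S \<and> S \<subseteq> carrier G \<and> H = generate G S)"

definition heisenberg_rat :: "(rat^3^3) monoid" where
  "heisenberg_rat = \<lparr>
     carrier = {vector [vector [1, x, y], vector [0, 1, z], vector [0, 0, 1]] | x y z. True},
     mult = (**),
     one = mat 1\<rparr>"


section \<open>Star-algebras, C*-algebras and their representations\<close>

record 'a star_alg = "'a partial_object" +
  sa_zero :: 'a
  sa_add :: "'a \<Rightarrow> 'a \<Rightarrow> 'a"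
  sa_scale :: "complex \<Rightarrow> 'a \<Rightarrow> 'a"
  sa_mult :: "'a \<Rightarrow> 'a \<Rightarrow> 'a"
  sa_star :: "'a \<Rightarrow> 'a"

record 'a normed_star_alg = "'a star_alg" +
  sa_norm :: "'a \<Rightarrow> real"

locale star_algebra =
  fixes A :: "('a, 'm) star_alg_scheme"
  assumes zero_closed: "sa_zero A \<in> carrier A"
    and add_closed: "\<lbrakk>x \<in> carrier A; y \<in> carrier A\<rbrakk> \<Longrightarrow> sa_add A x y \<in> carrier A"
    and scale_closed: "x \<in> carrier A \<Longrightarrow> sa_scale A c x \<in> carrier A"
    and mult_closed: "\<lbrakk>x \<in> carrier A; y \<in> carrier A\<rbrakk> \<Longrightarrow> sa_mult A x y \<in> carrier A"
    and star_closed: "x \<in> carrier A \<Longrightarrow> sa_star A x \<in> carrier A"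
    and add_assoc: "\<lbrakk>x \<in> carrier A; y \<in> carrier A; z \<in> carrier A\<rbrakk> \<Longrightarrow>
      sa_add A (sa_add A x y) z = sa_add A x (sa_add A y z)"
    and add_commute: "\<lbrakk>x \<in> carrier A; y \<in> carrier A\<rbrakk> \<Longrightarrow> sa_add A x y = sa_add A y x"
    and add_zero: "x \<in> carrier A \<Longrightarrow> sa_add A x (sa_zero A) = x"
    and add_minus: "x \<in> carrier A \<Longrightarrow> sa_add A x (sa_scale A (-1) x) = sa_zero A"
    and scale_one: "x \<in> carrier A \<Longrightarrow> sa_scale A 1 x = x"
    and scale_scale: "x \<in> carrier A \<Longrightarrow> sa_scale A c (sa_scale A d x) = sa_scale A (c * d) x"
    and scale_add_left: "x \<in> carrier A \<Longrightarrow>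
      sa_scale A (c + d) x = sa_add A (sa_scale A c x) (sa_scale A d x)"
    and scale_add_right: "\<lbrakk>x \<in> carrier A; y \<in> carrier A\<rbrakk> \<Longrightarrow>
      sa_scale A c (sa_add A x y) = sa_add A (sa_scale A c x) (sa_scale A c y)"
    and mult_assoc: "\<lbrakk>x \<in> carrier A; y \<in> carrier A; z \<in> carrier A\<rbrakk> \<Longrightarrow>
      sa_mult A (sa_mult A x y) z = sa_mult A x (sa_mult A y z)"
    and mult_add_left: "\<lbrakk>x \<in> carrier A; y \<in> carrier A; z \<in> carrier A\<rbrakk> \<Longrightarrow>
      sa_mult A (sa_add A x y) z = sa_add A (sa_mult A x z) (sa_mult A y z)"
    and mult_add_right: "\<lbrakk>x \<in> carrier A; y \<in> carrier A; z \<in> carrier A\<rbrakk> \<Longrightarrow>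
      sa_mult A x (sa_add A y z) = sa_add A (sa_mult A x y) (sa_mult A x z)"
    and mult_scale_left: "\<lbrakk>x \<in> carrier A; y \<in> carrier A\<rbrakk> \<Longrightarrow>
      sa_mult A (sa_scale A c x) y = sa_scale A c (sa_mult A x y)"
    and mult_scale_right: "\<lbrakk>x \<in> carrier A; y \<in> carrier A\<rbrakk> \<Longrightarrow>
      sa_mult A x (sa_scale A c y) = sa_scale A c (sa_mult A x y)"
    and star_star: "x \<in> carrier A \<Longrightarrow> sa_star A (sa_star A x) = x"
    and star_add: "\<lbrakk>x \<in> carrier A; y \<in> carrier A\<rbrakk> \<Longrightarrow>
      sa_star A (sa_add A x y) = sa_add A (sa_star A x) (sa_star A y)"
    and star_scale: "x \<in> carrier A \<Longrightarrow> sa_star A (sa_scale A c x) = sa_scale A (cnj c) (sa_star A x)"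
    and star_mult: "\<lbrakk>x \<in> carrier A; y \<in> carrier A\<rbrakk> \<Longrightarrow>
      sa_star A (sa_mult A x y) = sa_mult A (sa_star A y) (sa_star A x)"

locale cstar_algebra = star_algebra A for A :: "('a, 'm) normed_star_alg_scheme" +
  assumes norm_nonneg: "x \<in> carrier A \<Longrightarrow> 0 \<le> sa_norm A x"
    and norm_eq_zero: "x \<in> carrier A \<Longrightarrow> sa_norm A x = 0 \<longleftrightarrow> x = sa_zero A"
    and norm_add: "\<lbrakk>x \<in> carrier A; y \<in> carrier A\<rbrakk> \<Longrightarrow>
      sa_norm A (sa_add A x y) \<le> sa_norm A x + sa_norm A y"
    and norm_scale: "x \<in> carrier A \<Longrightarrow> sa_norm A (sa_scale A c x) = cmod c * sa_norm A x"
    and norm_mult: "\<lbrakk>x \<in> carrier A; y \<in> carrier A\<rbrakk> \<Longrightarrow>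
      sa_norm A (sa_mult A x y) \<le> sa_norm A x * sa_norm A y"
    and cstar_identity: "x \<in> carrier A \<Longrightarrow> sa_norm A (sa_mult A (sa_star A x) x) = (sa_norm A x)\<^sup>2"
    and complete: "\<lbrakk>\<And>n :: nat. s n \<in> carrier A;
      \<And>e. e > 0 \<Longrightarrow> \<exists>N. \<forall>m\<ge>N. \<forall>n\<ge>N. sa_norm A (sa_add A (s m) (sa_scale A (-1) (s n))) < e\<rbrakk> \<Longrightarrow>
      \<exists>x\<in>carrier A. (\<lambda>n. sa_norm A (sa_add A (s n) (sa_scale A (-1) x))) \<longlonglongrightarrow> 0"

definition star_representation ::
  "('a, 'm) star_alg_scheme \<Rightarrow> 'i set \<Rightarrow> ('a \<Rightarrow> 'i operator) \<Rightarrow> bool" where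
  "star_representation A I \<pi> \<longleftrightarrow>
     (\<forall>a\<in>carrier A. \<pi> a \<in> bounded_operators I) \<and>
     (\<forall>a\<in>carrier A. \<forall>b\<in>carrier A. \<pi> (sa_add A a b) = (\<lambda>\<xi> i. \<pi> a \<xi> i + \<pi> b \<xi> i)) \<and>
     (\<forall>c. \<forall>a\<in>carrier A. \<pi> (sa_scale A c a) = (\<lambda>\<xi> i. c * \<pi> a \<xi> i)) \<and>
     (\<forall>a\<in>carrier A. \<forall>b\<in>carrier A. \<pi> (sa_mult A a b) = \<pi> a \<circ> \<pi> b) \<and>
     (\<forall>a\<in>carrier A. is_adjoint I (\<pi> a) (\<pi> (sa_star A a)))"

definition RFD :: "('a, 'm) star_alg_scheme \<Rightarrow> bool" where
  "RFD A \<longleftrightarrow> (\<forall>a\<in>carrier A. \<forall>b\<in>carrier A. a \<noteq> b \<longrightarrow>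
     (\<exists>(I :: nat set) \<pi>. finite I \<and> star_representation A I \<pi> \<and> \<pi> a \<noteq> \<pi> b))"


section \<open>Etale groupoids\<close>

text \<open>The unit space is a separate space, embedded into the arrows by \<open>gpd_unit\<close>.\<close>

record ('g, 'x) gpd =
  gpd_arrows :: "'g topology"
  gpd_units :: "'x topology"
  gpd_src :: "'g \<Rightarrow> 'x"
  gpd_rng :: "'g \<Rightarrow> 'x"
  gpd_unit :: "'x \<Rightarrow> 'g"
  gpd_mult :: "'g \<Rightarrow> 'g \<Rightarrow> 'g"
  gpd_inv :: "'g \<Rightarrow> 'g"

abbreviation gpd_carrier :: "('g, 'x, 'm) gpd_scheme \<Rightarrow> 'g set" where
  "gpd_carrier G \<equiv> topspace (gpd_arrows G)"

definition composable :: "('g, 'x, 'm) gpd_scheme \<Rightarrow> ('g \<times> 'g) set" where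
  "composable G = {(g, h). g \<in> gpd_carrier G \<and> h \<in> gpd_carrier G \<and> gpd_src G g = gpd_rng G h}"

locale groupoid =
  fixes G :: "('g, 'x, 'm) gpd_scheme"
  assumes src_closed: "g \<in> gpd_carrier G \<Longrightarrow> gpd_src G g \<in> topspace (gpd_units G)"
    and rng_closed: "g \<in> gpd_carrier G \<Longrightarrow> gpd_rng G g \<in> topspace (gpd_units G)"
    and unit_closed: "x \<in> topspace (gpd_units G) \<Longrightarrow> gpd_unit G x \<in> gpd_carrier G"
    and mult_closed: "(g, h) \<in> composable G \<Longrightarrow> gpd_mult G g h \<in> gpd_carrier G"
    and inv_closed: "g \<in> gpd_carrier G \<Longrightarrow> gpd_inv G g \<in> gpd_carrier G"
    and src_unit: "x \<in> topspace (gpd_units G) \<Longrightarrow> gpd_src G (gpd_unit G x) = x"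
    and rng_unit: "x \<in> topspace (gpd_units G) \<Longrightarrow> gpd_rng G (gpd_unit G x) = x"
    and src_mult: "(g, h) \<in> composable G \<Longrightarrow> gpd_src G (gpd_mult G g h) = gpd_src G h"
    and rng_mult: "(g, h) \<in> composable G \<Longrightarrow> gpd_rng G (gpd_mult G g h) = gpd_rng G g"
    and src_inv: "g \<in> gpd_carrier G \<Longrightarrow> gpd_src G (gpd_inv G g) = gpd_rng G g"
    and rng_inv: "g \<in> gpd_carrier G \<Longrightarrow> gpd_rng G (gpd_inv G g) = gpd_src G g"
    and mult_assoc: "\<lbrakk>(g, h) \<in> composable G; (h, k) \<in> composable G\<rbrakk> \<Longrightarrow>
      gpd_mult G (gpd_mult G g h) k = gpd_mult G g (gpd_mult G h k)"
    and unit_left: "g \<in> gpd_carrier G \<Longrightarrow> gpd_mult G (gpd_unit G (gpd_rng G g)) g = g"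
    and unit_right: "g \<in> gpd_carrier G \<Longrightarrow> gpd_mult G g (gpd_unit G (gpd_src G g)) = g"
    and inv_left: "g \<in> gpd_carrier G \<Longrightarrow> gpd_mult G (gpd_inv G g) g = gpd_unit G (gpd_src G g)"
    and inv_right: "g \<in> gpd_carrier G \<Longrightarrow> gpd_mult G g (gpd_inv G g) = gpd_unit G (gpd_rng G g)"

locale topological_groupoid = groupoid +
  assumes continuous_src: "continuous_map (gpd_arrows G) (gpd_units G) (gpd_src G)"
    and continuous_rng: "continuous_map (gpd_arrows G) (gpd_units G) (gpd_rng G)"
    and continuous_unit: "continuous_map (gpd_units G) (gpd_arrows G) (gpd_unit G)"
    and continuous_mult: "continuous_map
      (subtopology (prod_topology (gpd_arrows G) (gpd_arrows G)) (composable G)) (gpd_arrows G)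
      (\<lambda>(g, h). gpd_mult G g h)"
    and continuous_inv: "continuous_map (gpd_arrows G) (gpd_arrows G) (gpd_inv G)"

definition local_homeomorphism :: "'a topology \<Rightarrow> 'b topology \<Rightarrow> ('a \<Rightarrow> 'b) \<Rightarrow> bool" where
  "local_homeomorphism X Y f \<longleftrightarrow> (\<forall>x\<in>topspace X. \<exists>U. openin X U \<and> x \<in> U \<and> openin Y (f ` U) \<and>
     homeomorphic_map (subtopology X U) (subtopology Y (f ` U)) f)"

locale etale_groupoid = topological_groupoid +
  assumes locally_compact: "locally_compact_space (gpd_arrows G)"
    and Hausdorff: "Hausdorff_space (gpd_arrows G)"
    and second_countable: "second_countable (gpd_arrows G)"
    and local_homeo_rng: "local_homeomorphism (gpd_arrows G) (gpd_units G) (gpd_rng G)"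

definition isotropy_group :: "('g, 'x, 'm) gpd_scheme \<Rightarrow> 'x \<Rightarrow> 'g monoid" where
  "isotropy_group G x = \<lparr>
     carrier = {g \<in> gpd_carrier G. gpd_src G g = x \<and> gpd_rng G g = x},
     mult = gpd_mult G,
     one = gpd_unit G x\<rparr>"

text \<open>\<open>C\<^sub>c(G)\<close>, with functions extended by 0 off the arrow space.\<close>

definition cc_functions :: "('g, 'x, 'm) gpd_scheme \<Rightarrow> ('g \<Rightarrow> complex) set" where
  "cc_functions G = {f. continuous_map (gpd_arrows G) euclidean f \<and>
     compactin (gpd_arrows G) (gpd_arrows G closure_of {g \<in> gpd_carrier G. f g \<noteq> 0}) \<and>
     (\<forall>g. g \<notin> gpd_carrier G \<longrightarrow> f g = 0)}"

text \<open>For an etale groupoid the convolution sum has only finitely many nonzero terms.\<close>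

definition cc_algebra :: "('g, 'x, 'm) gpd_scheme \<Rightarrow> ('g \<Rightarrow> complex) star_alg" where
  "cc_algebra G = \<lparr>
     carrier = cc_functions G,
     sa_zero = (\<lambda>_. 0),
     sa_add = (\<lambda>f f' g. f g + f' g),
     sa_scale = (\<lambda>c f g. c * f g),
     sa_mult = (\<lambda>f f' g. \<Sum>\<^sub>\<infinity>(h, k)\<in>{(h, k) \<in> composable G. gpd_mult G h k = g}. f h * f' k),
     sa_star = (\<lambda>f g. if g \<in> gpd_carrier G then cnj (f (gpd_inv G g)) else 0)\<rparr>"

text \<open>
  Topological amenability of an etale groupoid: there is a net of nonnegative functions \<open>\<mu>\<close> in
  \<open>C\<^sub>c(G)\<close> such that
  \<open>\<Sum>\<^bsub>r(h) = r(g)\<^esub> \<mu>(h) \<rightarrow> 1\<close> and \<open>\<Sum>\<^bsub>r(h) = r(g)\<^esub> \<bar>\<mu>(g\<^sup>-\<^sup>1 h) - \<mu>(h)\<bar> \<rightarrow> 0\<close>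
  uniformly for \<open>g\<close> in compact subsets of \<open>G\<close>.  The net is represented by its tail filter \<open>F\<close>.
\<close>

definition topologically_amenable :: "('g, 'x, 'm) gpd_scheme \<Rightarrow> bool" where
  "topologically_amenable G \<longleftrightarrow> (\<exists>F :: ('g \<Rightarrow> real) filter. F \<noteq> bot \<and>
     (\<forall>\<^sub>F \<mu> in F. (\<lambda>g. complex_of_real (\<mu> g)) \<in> cc_functions G \<and> (\<forall>g. 0 \<le> \<mu> g)) \<and>
     (\<forall>K. compactin (gpd_arrows G) K \<longrightarrow>
        uniform_limit K
          (\<lambda>\<mu> g. \<Sum>\<^sub>\<infinity>h\<in>{h \<in> gpd_carrier G. gpd_rng G h = gpd_rng G g}. \<mu> h)
          (\<lambda>_. 1) F \<and>
        uniform_limit K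
          (\<lambda>\<mu> g. \<Sum>\<^sub>\<infinity>h\<in>{h \<in> gpd_carrier G. gpd_rng G h = gpd_rng G g}.
             \<bar>\<mu> (gpd_mult G (gpd_inv G g) h) - \<mu> h\<bar>)
          (\<lambda>_. 0) F))"


section \<open>The full groupoid C*-algebra\<close>

text \<open>
  \<open>C\<^sup>*(G)\<close> is the completion of \<open>C\<^sub>c(G)\<close> in the norm \<open>\<parallel>f\<parallel> = sup \<parallel>\<pi>(f)\<parallel>\<close>, where \<open>\<pi>\<close> ranges over all
  *-representations of \<open>C\<^sub>c(G)\<close> on Hilbert spaces.  It is realised as the norm closure of the image
  of \<open>C\<^sub>c(G)\<close> in the product of the operator algebras of all these representations.

  Hilbert spaces whose dimension is at most the cardinality of \<open>'g \<Rightarrow> complex\<close> suffice: every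
  *-representation is a direct sum of a zero representation and cyclic ones, and a cyclic one has
  a dense subspace that is a quotient of \<open>C\<^sub>c(G) \<subseteq> 'g \<Rightarrow> complex\<close>.
\<close>

type_synonym 'g cc_rep =
  "('g \<Rightarrow> complex) set \<times> (('g \<Rightarrow> complex) \<Rightarrow> ('g \<Rightarrow> complex) operator)"

definition cc_reps :: "('g, 'x, 'm) gpd_scheme \<Rightarrow> 'g cc_rep set" where
  "cc_reps G = {(I, \<pi>). star_representation (cc_algebra G) I \<pi>}"

definition full_cstar ::
  "('g, 'x, 'm) gpd_scheme \<Rightarrow> ('g cc_rep \<Rightarrow> ('g \<Rightarrow> complex) operator) normed_star_alg" where
  "full_cstar G = \<lparr>
     carrier = {a.
       (\<forall>\<rho>. \<rho> \<notin> cc_reps G \<longrightarrow> a \<rho> = (\<lambda>_ _. 0)) \<and>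
       (\<forall>(I, \<pi>)\<in>cc_reps G. a (I, \<pi>) \<in> bounded_operators I) \<and>
       (\<forall>e>0. \<exists>f\<in>cc_functions G. \<forall>(I, \<pi>)\<in>cc_reps G.
          operator_norm I (\<lambda>\<xi> i. a (I, \<pi>) \<xi> i - \<pi> f \<xi> i) \<le> e)},
     sa_zero = (\<lambda>_ _ _. 0),
     sa_add = (\<lambda>a b \<rho> \<xi> i. a \<rho> \<xi> i + b \<rho> \<xi> i),
     sa_scale = (\<lambda>c a \<rho> \<xi> i. c * a \<rho> \<xi> i),
     sa_mult = (\<lambda>a b \<rho>. a \<rho> \<circ> b \<rho>),
     sa_star = (\<lambda>a (I, \<pi>). operator_adjoint I (a (I, \<pi>))),
     sa_norm = (\<lambda>a. SUP (I, \<pi>)\<in>cc_reps G. operator_norm I (a (I, \<pi>)))\<rparr>"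


section \<open>The groupoid of an increasing sequence of subgroups\<close>

text \<open>\<open>X = {1, 2, \<dots>} \<union> {\<infinity>}\<close>, as a subset of \<^typ>\<open>enat\<close>.  The value of \<open>\<Gamma>s\<close> at 0 is never used.\<close>

definition unit_space :: "enat topology" where
  "unit_space = subtopology euclidean {1..}"

definition fibre :: "('g, 'b) monoid_scheme \<Rightarrow> (nat \<Rightarrow> 'g set) \<Rightarrow> enat \<Rightarrow> 'g set" where
  "fibre \<Gamma> \<Gamma>s x = (case x of enat n \<Rightarrow> \<Gamma>s n | \<infinity> \<Rightarrow> carrier \<Gamma>)"

definition basic_open :: "'g \<Rightarrow> nat \<Rightarrow> ('g \<times> enat) set" where
  "basic_open g n = {(g, m) | m. m \<ge> enat n}"

definition bundle_basis :: "(nat \<Rightarrow> 'g set) \<Rightarrow> ('g \<times> enat) set set" where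
  "bundle_basis \<Gamma>s =
     {basic_open g n | g n. 1 \<le> n \<and> g \<in> \<Gamma>s n} \<union> {{(g, enat n)} | g n. 1 \<le> n \<and> g \<in> \<Gamma>s n}"

definition bundle_topology :: "(nat \<Rightarrow> 'g set) \<Rightarrow> ('g \<times> enat) topology" where
  "bundle_topology \<Gamma>s = topology (arbitrary union_of (\<lambda>U. U \<in> bundle_basis \<Gamma>s))"

definition bundle_groupoid ::
  "('g, 'b) monoid_scheme \<Rightarrow> (nat \<Rightarrow> 'g set) \<Rightarrow> ('g \<times> enat, enat) gpd" where
  "bundle_groupoid \<Gamma> \<Gamma>s = \<lparr>
     gpd_arrows = bundle_topology \<Gamma>s,
     gpd_units = unit_space,
     gpd_src = snd,
     gpd_rng = snd,
     gpd_unit = (\<lambda>x. (\<one>\<^bsub>\<Gamma>\<^esub>, x)),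
     gpd_mult = (\<lambda>(g, x) (h, y). (g \<otimes>\<^bsub>\<Gamma>\<^esub> h, x)),
     gpd_inv = (\<lambda>(g, x). (inv\<^bsub>\<Gamma>\<^esub> g, x))\<rparr>"

text \<open>The order topology of \<^typ>\<open>enat\<close> gives the one-point compactification of the discrete \<open>{1, 2, \<dots>}\<close>.\<close>

lemma openin_unit_space:
  "openin unit_space S \<longleftrightarrow> S \<subseteq> {1..} \<and> (\<infinity> \<in> S \<longrightarrow> finite ({1..} - S))"
proof -
  have *: "openin unit_space S \<longleftrightarrow> S \<subseteq> {1..} \<and> open S"
  proof -
    have "open {1 :: enat ..}"
      by (auto simp: open_enat_iff intro!: exI[of _ "1::nat"] simp: one_enat_def)
    then show ?thesis
      by (auto simp: unit_space_def openin_open_eq)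
  qed
  have "open S \<longleftrightarrow> (\<infinity> \<in> S \<longrightarrow> finite ({1..} - S))" if S: "S \<subseteq> {1..}"
  proof -
    have "(\<exists>n::nat. {enat n<..} \<subseteq> S) \<longleftrightarrow> finite ({1..} - S)" if inf: "\<infinity> \<in> S"
    proof
      assume "\<exists>n::nat. {enat n<..} \<subseteq> S"
      then obtain n where "{enat n<..} \<subseteq> S" by blast
      then have "{1..} - S \<subseteq> {..enat n}" by (auto simp: not_less[symmetric])
      then show "finite ({1..} - S)"
        by (rule finite_subset) (rule finite_enat_bounded[of _ n], auto)
    next
      assume f: "finite ({1..} - S)"
      have "\<exists>n. \<forall>m \<in> {1..} - S. m \<le> enat n"
      proof -
        have "\<forall>m \<in> {1..} - S. m \<noteq> \<infinity>" using inf by (metis DiffD2)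
        then have "\<forall>m \<in> {1..} - S. m = enat (the_enat m)" by (metis not_enat_eq the_enat.simps)
        then have "\<forall>m \<in> {1..} - S. m \<le> enat (Max (the_enat ` ({1..} - S)))"
          using f by (metis Max_ge enat_ord_simps(1) finite_imageI image_eqI)
        then show ?thesis by blast
      qed
      then obtain n where n: "\<forall>m \<in> {1..} - S. m \<le> enat n" by blast
      have "{enat n<..} \<subseteq> S"
      proof
        fix m assume m: "m \<in> {enat n<..}"
        then have "m \<ge> 1"
          by (metis greaterThan_iff ileI1 i0_lb le_less_trans one_eSuc)
        with m n show "m \<in> S" by (metis DiffI atLeast_iff greaterThan_iff not_le)
      qed
      then show "\<exists>n::nat. {enat n<..} \<subseteq> S" by blast
    qed
    then show ?thesis by (auto simp: open_enat_iff)
  qed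
  with * show ?thesis by blast
qed

lemma
  assumes incr: "\<And>m n. \<lbrakk>1 \<le> m; m \<le> n\<rbrakk> \<Longrightarrow> \<Gamma>s m \<subseteq> \<Gamma>s n"
  shows openin_bundle_topology:
      "openin (bundle_topology \<Gamma>s) S \<longleftrightarrow> (\<exists>\<U>\<subseteq>bundle_basis \<Gamma>s. S = \<Union>\<U>)"
    and topspace_bundle_topology:
      "(\<Union>n\<in>{1..}. \<Gamma>s n) = carrier \<Gamma> \<Longrightarrow>
       topspace (bundle_topology \<Gamma>s) = {(g, x). x \<in> topspace unit_space \<and> g \<in> fibre \<Gamma> \<Gamma>s x}"
proof -
  have int: "basic_open g n \<inter> V \<in> bundle_basis \<Gamma>s \<or> basic_open g n \<inter> V = {}"
    if g: "1 \<le> n" "g \<in> \<Gamma>s n" and V: "V \<in> bundle_basis \<Gamma>s" for g n V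
  proof -
    consider h m where "V = basic_open h m" "1 \<le> m" "h \<in> \<Gamma>s m"
      | h m where "V = {(h, enat m)}" "1 \<le> m" "h \<in> \<Gamma>s m"
      using V by (auto simp: bundle_basis_def)
    then show ?thesis
    proof cases
      case 1
      show ?thesis
      proof (cases "g = h")
        case True
        then have "basic_open g n \<inter> V = basic_open g (max n m)"
          using 1 by (auto simp: basic_open_def simp flip: max_enat_simps(1) max_def)
        moreover have "g \<in> \<Gamma>s (max n m)" using g 1 True by (auto simp: max_def)
        ultimately show ?thesis using g by (auto simp: bundle_basis_def)
      next
        case False then show ?thesis using 1 by (auto simp: basic_open_def)
      qed
    next
      case 2 then show ?thesis using V by auto
    qed
  qed
  have "U \<inter> V \<in> bundle_basis \<Gamma>s \<or> U \<inter> V = {}"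
    if U: "U \<in> bundle_basis \<Gamma>s" and V: "V \<in> bundle_basis \<Gamma>s" for U V
  proof -
    consider h m where "U = basic_open h m" "1 \<le> m" "h \<in> \<Gamma>s m" | x where "U = {x}"
      using U by (auto simp: bundle_basis_def)
    then show ?thesis using int[of _ _ V] U V by cases auto
  qed
  then have ist: "istopology (arbitrary union_of (\<lambda>U. U \<in> bundle_basis \<Gamma>s))"
    unfolding istopology_base_eq by (metis arbitrary_union_of_empty arbitrary_union_of_inc)
  show op: "openin (bundle_topology \<Gamma>s) S \<longleftrightarrow> (\<exists>\<U>\<subseteq>bundle_basis \<Gamma>s. S = \<Union>\<U>)" for S
    unfolding bundle_topology_def topology_inverse'[OF ist]
    by (auto simp: union_of_def arbitrary_def)
  assume un: "(\<Union>n\<in>{1..}. \<Gamma>s n) = carrier \<Gamma>"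
  have "topspace (bundle_topology \<Gamma>s) = \<Union>(bundle_basis \<Gamma>s)"
  proof
    show "topspace (bundle_topology \<Gamma>s) \<subseteq> \<Union>(bundle_basis \<Gamma>s)"
      using op[of "topspace (bundle_topology \<Gamma>s)"] by fastforce
    have "openin (bundle_topology \<Gamma>s) (\<Union>(bundle_basis \<Gamma>s))"
      using op by blast
    then show "\<Union>(bundle_basis \<Gamma>s) \<subseteq> topspace (bundle_topology \<Gamma>s)"
      by (rule openin_subset)
  qed
  also have "\<dots> = {(g, x). x \<in> topspace unit_space \<and> g \<in> fibre \<Gamma> \<Gamma>s x}"
  proof (intro subset_antisym subsetI)
    fix p assume "p \<in> \<Union>(bundle_basis \<Gamma>s)"
    then obtain g n x where p: "p = (g, x)" "1 \<le> n" "g \<in> \<Gamma>s n" "enat n \<le> x"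
      by (fastforce simp: bundle_basis_def basic_open_def)
    then have "1 \<le> x" by (metis enat_ord_simps(1) one_enat_def order_trans)
    moreover have "g \<in> fibre \<Gamma> \<Gamma>s x"
    proof (cases x)
      case (enat k)
      with p incr[of n k] show ?thesis by (auto simp: fibre_def)
    next
      case infinity
      with p un show ?thesis by (auto simp: fibre_def)
    qed
    ultimately show "p \<in> {(g, x). x \<in> topspace unit_space \<and> g \<in> fibre \<Gamma> \<Gamma>s x}"
      using p by (auto simp: unit_space_def)
  next
    fix p assume "p \<in> {(g, x). x \<in> topspace unit_space \<and> g \<in> fibre \<Gamma> \<Gamma>s x}"
    then obtain g x where p: "p = (g, x)" "1 \<le> x" "g \<in> fibre \<Gamma> \<Gamma>s x"
      by (auto simp: unit_space_def)
    have "\<exists>n. 1 \<le> n \<and> g \<in> \<Gamma>s n \<and> enat n \<le> x"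
      using p un by (cases x) (auto simp: fibre_def one_enat_def)
    then obtain n where "1 \<le> n" "g \<in> \<Gamma>s n" "enat n \<le> x" by blast
    then have "p \<in> basic_open g n" "basic_open g n \<in> bundle_basis \<Gamma>s"
      using p by (auto simp: basic_open_def bundle_basis_def)
    then show "p \<in> \<Union>(bundle_basis \<Gamma>s)" by blast
  qed
  finally show "topspace (bundle_topology \<Gamma>s) =
    {(g, x). x \<in> topspace unit_space \<and> g \<in> fibre \<Gamma> \<Gamma>s x}" .
qed

end

theory Submission
  imports Defs
begin

text \<open>
  The fibres of the groupoid over the points \<open>n \<noteq> \<infinity>\<close> are finitely generated nilpotent groups, which
  are amenable and residually finite.  Amenability of the groupoid and residual
  finite-dimensionality of its C*-algebra come from these fibres, whereas \<open>\<Gamma>\<close> itself appears as the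
  isotropy group at \<open>\<infinity>\<close>.

  \<^emph>\<open>Groups.\<close>  A finitely generated nilpotent group arises from the trivial group by finitely many
  extensions \<open>H \<mapsto> H\<langle>t\<rangle>\<close> by an element \<open>t\<close> that is central modulo the normal subgroup \<open>H\<close>, since the
  factors of its lower central series are finitely generated (\<open>nilpotent_fin_gen_induct\<close>).
  Residual finiteness and the existence of almost invariant probability measures pass through
  such extensions.  Almost invariant measures give amenability of the bundle, because a measure on
  \<open>\<Gamma>\<^sub>N\<close> can be used in all fibres from \<open>N\<close> on, including the one at \<open>\<infinity>\<close> (\<open>ex_almost_invariant\<close>).
  Together the two properties show that the finite permutation representations of a finitely
  generated nilpotent group weakly contain all its unitary representations
  (\<open>nilpotent_weak_containment\<close>).

  \<^emph>\<open>The C*-algebra.\<close>  Elements of \<open>C\<^sub>c(G)\<close> are finite sums of functions on the sections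
  \<open>x \<mapsto> (g, x)\<close>, and such a function has norm at most its supremum in every representation; so the
  full norm is finite, and the completion is a C*-algebra by general facts about bounded operators.
  Given a representation and \<open>f \<in> C\<^sub>c(G)\<close>, continuity at \<open>\<infinity>\<close> allows us to replace \<open>f\<close>, up to a small
  error in norm, by a function constant along the sections on \<open>[N, \<infinity>]\<close>.  On the central
  projection belonging to \<open>[N, \<infinity>]\<close> the representation then only sees the group \<open>\<Gamma>\<^sub>N\<close>, and on those
  belonging to the points \<open>n < N\<close> it sees \<open>\<Gamma>\<^sub>n\<close>.  Hence the norm of \<open>f\<close> is the supremum of its norms
  in finite-dimensional representations (\<open>cc_rep_norm_le\<close>), which is residual
  finite-dimensionality of the completion (\<open>RFD_full_cstar\<close>).

  \<^emph>\<open>The Heisenberg group.\<close>  By divisibility a central element is a commutator of some \<open>a\<^sub>n\<close> with the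
  power \<open>b\<^sup>n\<close> of one fixed \<open>b\<close>, for every \<open>n \<ge> 1\<close>.  A finite-dimensional unitary has powers
  arbitrarily close to the identity, so the central element acts trivially in every
  finite-dimensional unitary representation.
\<close>

section \<open>The Hilbert space of square-summable functions\<close>

lemma ell2_off: "\<xi> \<in> ell2 I \<Longrightarrow> i \<notin> I \<Longrightarrow> \<xi> i = 0"
  by (simp add: ell2_def)

lemma ell2_summable: "\<xi> \<in> ell2 I \<Longrightarrow> (\<lambda>i. (cmod (\<xi> i))\<^sup>2) summable_on UNIV"
  by (simp add: ell2_def)

lemma ell2_norm_nonneg [simp]: "0 \<le> ell2_norm \<xi>"
  by (simp add: ell2_norm_def infsum_nonneg)

lemma ell2_norm_power2: "(ell2_norm \<xi>)\<^sup>2 = (\<Sum>\<^sub>\<infinity>i. (cmod (\<xi> i))\<^sup>2)"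
  by (simp add: ell2_norm_def infsum_nonneg)

lemma finite_sum_le_ell2_norm:
  assumes "\<xi> \<in> ell2 I" "finite F"
  shows "(\<Sum>i\<in>F. (cmod (\<xi> i))\<^sup>2) \<le> (ell2_norm \<xi>)\<^sup>2"
  unfolding ell2_norm_power2
  by (rule finite_sum_le_infsum) (use assms ell2_summable in auto)

lemma L2_set_le_ell2_norm:
  assumes "\<xi> \<in> ell2 I" "finite F"
  shows "L2_set (\<lambda>i. cmod (\<xi> i)) F \<le> ell2_norm \<xi>"
  unfolding L2_set_def using finite_sum_le_ell2_norm[OF assms] by (simp add: real_le_lsqrt sum_nonneg)

lemma
  assumes off: "\<And>i. i \<notin> I \<Longrightarrow> \<xi> i = 0"
    and bd: "\<And>F. finite F \<Longrightarrow> (\<Sum>i\<in>F. (cmod (\<xi> i))\<^sup>2) \<le> c\<^sup>2" and c: "0 \<le> c"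
  shows ell2I_power2: "\<xi> \<in> ell2 I" and ell2_norm_leI_power2: "ell2_norm \<xi> \<le> c"
proof -
  have s: "(\<lambda>i. (cmod (\<xi> i))\<^sup>2) summable_on UNIV"
    by (rule nonneg_bdd_above_summable_on) (auto intro!: bdd_aboveI[of _ "c\<^sup>2"] bd)
  then show "\<xi> \<in> ell2 I" using off by (simp add: ell2_def)
  have "(\<Sum>\<^sub>\<infinity>i. (cmod (\<xi> i))\<^sup>2) \<le> c\<^sup>2" by (rule infsum_le_finite_sums[OF s]) (use bd in auto)
  then show "ell2_norm \<xi> \<le> c" unfolding ell2_norm_def using c by (simp add: real_le_lsqrt)
qed

lemma
  assumes off: "\<And>i. i \<notin> I \<Longrightarrow> \<xi> i = 0"
    and bd: "\<And>F. finite F \<Longrightarrow> L2_set (\<lambda>i. cmod (\<xi> i)) F \<le> c"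
  shows ell2I: "\<xi> \<in> ell2 I" and ell2_norm_leI: "ell2_norm \<xi> \<le> c"
proof -
  have c: "0 \<le> c" using bd[of "{}"] by simp
  have "(\<Sum>i\<in>F. (cmod (\<xi> i))\<^sup>2) \<le> c\<^sup>2" if "finite F" for F
    using bd[OF that] c unfolding L2_set_def by (simp add: sqrt_le_D)
  then show "\<xi> \<in> ell2 I" "ell2_norm \<xi> \<le> c" using ell2I_power2 ell2_norm_leI_power2 off c by blast+
qed

lemma cmod_le_ell2_norm: "\<xi> \<in> ell2 I \<Longrightarrow> cmod (\<xi> i) \<le> ell2_norm \<xi>"
  using L2_set_le_ell2_norm[of \<xi> I "{i}"] by simp

lemma ell2_zero [simp, intro]: "(\<lambda>_. 0) \<in> ell2 I"
  by (simp add: ell2_def)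

lemma ell2_norm_zero [simp]: "ell2_norm (\<lambda>_. 0) = 0"
  by (simp add: ell2_norm_def)

lemma ell2_norm_eq_0: "\<xi> \<in> ell2 I \<Longrightarrow> ell2_norm \<xi> = 0 \<Longrightarrow> \<xi> = (\<lambda>_. 0)"
  using cmod_le_ell2_norm by fastforce

lemma
  assumes "\<xi> \<in> ell2 I" "\<eta> \<in> ell2 I"
  shows ell2_add: "(\<lambda>i. \<xi> i + \<eta> i) \<in> ell2 I"
    and ell2_norm_triangle: "ell2_norm (\<lambda>i. \<xi> i + \<eta> i) \<le> ell2_norm \<xi> + ell2_norm \<eta>"
proof -
  have "L2_set (\<lambda>i. cmod (\<xi> i + \<eta> i)) F \<le> ell2_norm \<xi> + ell2_norm \<eta>" if "finite F" for F
  proof -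
    have "L2_set (\<lambda>i. cmod (\<xi> i + \<eta> i)) F \<le> L2_set (\<lambda>i. cmod (\<xi> i) + cmod (\<eta> i)) F"
      by (rule L2_set_mono) (auto intro: norm_triangle_ineq)
    also have "\<dots> \<le> L2_set (\<lambda>i. cmod (\<xi> i)) F + L2_set (\<lambda>i. cmod (\<eta> i)) F"
      by (rule L2_set_triangle_ineq)
    also have "\<dots> \<le> ell2_norm \<xi> + ell2_norm \<eta>"
      using assms that by (intro add_mono L2_set_le_ell2_norm)
    finally show ?thesis .
  qed
  then show "(\<lambda>i. \<xi> i + \<eta> i) \<in> ell2 I" "ell2_norm (\<lambda>i. \<xi> i + \<eta> i) \<le> ell2_norm \<xi> + ell2_norm \<eta>"
    using assms by (auto intro!: ell2I ell2_norm_leI simp: ell2_off)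
qed

lemma ell2_scale: "\<xi> \<in> ell2 I \<Longrightarrow> (\<lambda>i. c * \<xi> i) \<in> ell2 I"
  by (auto simp: ell2_def norm_mult power_mult_distrib intro: summable_on_cmult_right)

lemma ell2_norm_scale: "ell2_norm (\<lambda>i. c * \<xi> i) = cmod c * ell2_norm \<xi>"
  by (simp add: ell2_norm_def norm_mult power_mult_distrib infsum_cmult_right' real_sqrt_mult)

lemma ell2_uminus: "\<xi> \<in> ell2 I \<Longrightarrow> (\<lambda>i. - \<xi> i) \<in> ell2 I"
  using ell2_scale[of \<xi> I "-1"] by simp

lemma ell2_norm_uminus: "ell2_norm (\<lambda>i. - \<xi> i) = ell2_norm \<xi>"
  using ell2_norm_scale[of "-1" \<xi>] by simp

lemma ell2_diff: "\<xi> \<in> ell2 I \<Longrightarrow> \<eta> \<in> ell2 I \<Longrightarrow> (\<lambda>i. \<xi> i - \<eta> i) \<in> ell2 I"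
  using ell2_add[of \<xi> I "\<lambda>i. - \<eta> i"] ell2_uminus by force

lemma ell2_norm_triangle_sub:
  "\<xi> \<in> ell2 I \<Longrightarrow> \<eta> \<in> ell2 I \<Longrightarrow> ell2_norm \<xi> \<le> ell2_norm \<eta> + ell2_norm (\<lambda>i. \<xi> i - \<eta> i)"
  using ell2_norm_triangle[of \<eta> I "\<lambda>i. \<xi> i - \<eta> i"] ell2_diff[of \<xi> I \<eta>] by force

lemma ell2_sum: "(\<And>g. g \<in> S \<Longrightarrow> x g \<in> ell2 I) \<Longrightarrow> (\<lambda>i. \<Sum>g\<in>S. x g i) \<in> ell2 I"
  by (induction S rule: infinite_finite_induct) (auto intro: ell2_add)

lemma ell2_norm_sum_le:
  "(\<And>g. g \<in> S \<Longrightarrow> x g \<in> ell2 I) \<Longrightarrow> ell2_norm (\<lambda>i. \<Sum>g\<in>S. x g i) \<le> (\<Sum>g\<in>S. ell2_norm (x g))"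
proof (induction S rule: infinite_finite_induct)
  case (insert a S)
  then have "ell2_norm (\<lambda>i. \<Sum>g\<in>insert a S. x g i) \<le> ell2_norm (x a) + ell2_norm (\<lambda>i. \<Sum>g\<in>S. x g i)"
    using ell2_norm_triangle[of "x a" I "\<lambda>i. \<Sum>g\<in>S. x g i"] ell2_sum[of S x I] by auto
  with insert show ?case by auto
qed auto

lemma
  assumes "\<xi> \<in> ell2 I" "\<eta> \<in> ell2 I"
  shows ell2_inner_abs_summable: "(\<lambda>i. norm (cnj (\<xi> i) * \<eta> i)) summable_on UNIV"
    and ell2_Cauchy_Schwarz: "cmod (ell2_inner \<xi> \<eta>) \<le> ell2_norm \<xi> * ell2_norm \<eta>"
proof -
  have bd: "(\<Sum>i\<in>F. norm (cnj (\<xi> i) * \<eta> i)) \<le> ell2_norm \<xi> * ell2_norm \<eta>" if "finite F" for F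
  proof -
    have "(\<Sum>i\<in>F. norm (cnj (\<xi> i) * \<eta> i)) = (\<Sum>i\<in>F. \<bar>cmod (\<xi> i)\<bar> * \<bar>cmod (\<eta> i)\<bar>)"
      by (simp add: norm_mult)
    also have "\<dots> \<le> L2_set (\<lambda>i. cmod (\<xi> i)) F * L2_set (\<lambda>i. cmod (\<eta> i)) F"
      by (rule L2_set_mult_ineq)
    also have "\<dots> \<le> ell2_norm \<xi> * ell2_norm \<eta>"
      using assms that by (intro mult_mono L2_set_le_ell2_norm) auto
    finally show ?thesis .
  qed
  then show s: "(\<lambda>i. norm (cnj (\<xi> i) * \<eta> i)) summable_on UNIV"
    unfolding abs_summable_iff_bdd_above by (auto intro!: bdd_aboveI[of _ "ell2_norm \<xi> * ell2_norm \<eta>"])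
  have "cmod (ell2_inner \<xi> \<eta>) \<le> (\<Sum>\<^sub>\<infinity>i. norm (cnj (\<xi> i) * \<eta> i))"
    unfolding ell2_inner_def by (rule norm_infsum_bound[OF s])
  also have "\<dots> \<le> ell2_norm \<xi> * ell2_norm \<eta>"
    by (rule infsum_le_finite_sums[OF s]) (use bd in auto)
  finally show "cmod (ell2_inner \<xi> \<eta>) \<le> ell2_norm \<xi> * ell2_norm \<eta>" .
qed

lemma ell2_inner_summable:
  "\<xi> \<in> ell2 I \<Longrightarrow> \<eta> \<in> ell2 I \<Longrightarrow> (\<lambda>i. cnj (\<xi> i) * \<eta> i) summable_on UNIV"
  by (rule abs_summable_summable) (rule ell2_inner_abs_summable)

lemma ell2_inner_add_right:
  "\<xi> \<in> ell2 I \<Longrightarrow> \<eta> \<in> ell2 I \<Longrightarrow> \<zeta> \<in> ell2 I \<Longrightarrow>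
    ell2_inner \<xi> (\<lambda>i. \<eta> i + \<zeta> i) = ell2_inner \<xi> \<eta> + ell2_inner \<xi> \<zeta>"
  unfolding ell2_inner_def by (simp add: distrib_left infsum_add ell2_inner_summable)

lemma ell2_inner_commute: "ell2_inner \<xi> \<eta> = cnj (ell2_inner \<eta> \<xi>)"
proof -
  have "(\<lambda>i. cnj (\<xi> i) * \<eta> i) = (\<lambda>i. cnj (cnj (\<eta> i) * \<xi> i))" by auto
  then show ?thesis unfolding ell2_inner_def by (simp only: infsum_cnj)
qed

lemma ell2_inner_add_left:
  "\<xi> \<in> ell2 I \<Longrightarrow> \<eta> \<in> ell2 I \<Longrightarrow> \<zeta> \<in> ell2 I \<Longrightarrow>
    ell2_inner (\<lambda>i. \<eta> i + \<zeta> i) \<xi> = ell2_inner \<eta> \<xi> + ell2_inner \<zeta> \<xi>"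
  by (metis (no_types) ell2_inner_commute ell2_inner_add_right complex_cnj_add)

lemma ell2_inner_scale_right: "ell2_inner \<xi> (\<lambda>i. c * \<eta> i) = c * ell2_inner \<xi> \<eta>"
  unfolding ell2_inner_def by (simp add: mult.left_commute infsum_cmult_right')

lemma ell2_inner_scale_left: "ell2_inner (\<lambda>i. c * \<eta> i) \<xi> = cnj c * ell2_inner \<eta> \<xi>"
  unfolding ell2_inner_def by (simp add: mult.assoc infsum_cmult_right')

lemma ell2_inner_zero [simp]: "ell2_inner (\<lambda>_. 0) \<xi> = 0" "ell2_inner \<xi> (\<lambda>_. 0) = 0"
  by (simp_all add: ell2_inner_def)

lemma ell2_inner_self: "\<xi> \<in> ell2 I \<Longrightarrow> ell2_inner \<xi> \<xi> = of_real ((ell2_norm \<xi>)\<^sup>2)"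
proof -
  assume "\<xi> \<in> ell2 I"
  then have "((\<lambda>i. complex_of_real ((cmod (\<xi> i))\<^sup>2)) has_sum of_real ((ell2_norm \<xi>)\<^sup>2)) UNIV"
    unfolding ell2_norm_power2 has_sum_of_real_iff by (intro has_sum_infsum ell2_summable)
  moreover have "(\<lambda>i. cnj (\<xi> i) * \<xi> i) = (\<lambda>i. of_real ((cmod (\<xi> i))\<^sup>2))"
    by (auto simp only: complex_norm_square mult.commute)
  ultimately show ?thesis unfolding ell2_inner_def by (metis infsumI)
qed

lemma ell2_inner_diff_right:
  "\<xi> \<in> ell2 I \<Longrightarrow> \<eta> \<in> ell2 I \<Longrightarrow> \<zeta> \<in> ell2 I \<Longrightarrow>
    ell2_inner \<xi> (\<lambda>i. \<eta> i - \<zeta> i) = ell2_inner \<xi> \<eta> - ell2_inner \<xi> \<zeta>"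
  using ell2_inner_add_right[of \<xi> I \<eta> "\<lambda>i. (-1) * \<zeta> i"] ell2_inner_scale_right[of \<xi> "-1" \<zeta>]
    ell2_scale[of \<zeta> I "-1"] by simp

lemma ell2_norm_power2_add:
  assumes "\<xi> \<in> ell2 I" "\<eta> \<in> ell2 I"
  shows "(ell2_norm (\<lambda>i. \<xi> i + \<eta> i))\<^sup>2 = (ell2_norm \<xi>)\<^sup>2 + (ell2_norm \<eta>)\<^sup>2 + 2 * Re (ell2_inner \<xi> \<eta>)"
proof -
  have "complex_of_real ((ell2_norm (\<lambda>i. \<xi> i + \<eta> i))\<^sup>2) =
      ell2_inner (\<lambda>i. \<xi> i + \<eta> i) (\<lambda>i. \<xi> i + \<eta> i)"
    using assms by (simp add: ell2_inner_self[OF ell2_add])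
  also have "\<dots> = ell2_inner \<xi> \<xi> + ell2_inner \<eta> \<eta> + (ell2_inner \<xi> \<eta> + ell2_inner \<eta> \<xi>)"
    using assms by (simp add: ell2_inner_add_left[where I=I] ell2_inner_add_right[where I=I] ell2_add)
  also have "ell2_inner \<xi> \<eta> + ell2_inner \<eta> \<xi> = complex_of_real (2 * Re (ell2_inner \<xi> \<eta>))"
    by (subst (2) ell2_inner_commute) (simp add: complex_add_cnj)
  finally have "complex_of_real ((ell2_norm (\<lambda>i. \<xi> i + \<eta> i))\<^sup>2) =
      complex_of_real ((ell2_norm \<xi>)\<^sup>2 + (ell2_norm \<eta>)\<^sup>2 + 2 * Re (ell2_inner \<xi> \<eta>))"
    using assms by (simp add: ell2_inner_self[where I=I])
  then show ?thesis by (simp only: of_real_eq_iff)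
qed

lemma ell2_Pythagoras_sum:
  assumes "finite S" "\<And>a. a \<in> S \<Longrightarrow> x a \<in> ell2 I"
    and "\<And>a b. a \<in> S \<Longrightarrow> b \<in> S \<Longrightarrow> a \<noteq> b \<Longrightarrow> ell2_inner (x a) (x b) = 0"
  shows "(ell2_norm (\<lambda>i. \<Sum>a\<in>S. x a i))\<^sup>2 = (\<Sum>a\<in>S. (ell2_norm (x a))\<^sup>2)"
  using assms
proof (induction S rule: finite_induct)
  case (insert a S)
  have x: "x b \<in> ell2 I" if "b \<in> insert a S" for b using insert.prems(1) that by blast
  have orth: "ell2_inner (x a) (x b) = 0" if "b \<in> S" for b
    using insert.prems(2)[of a b] insert.hyps(2) that by blast
  have "ell2_inner (x a) (\<lambda>i. \<Sum>b\<in>T. x b i) = 0" if "finite T" "T \<subseteq> S" for T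
    using that
  proof (induction T rule: finite_induct)
    case (insert b T)
    have "(\<lambda>i. \<Sum>b\<in>T. x b i) \<in> ell2 I" by (rule ell2_sum) (use insert.prems x in auto)
    then show ?case using insert x orth by (simp add: ell2_inner_add_right[where I=I])
  qed simp
  from this[of S] show ?case
    using insert ell2_norm_power2_add[of "x a" I "\<lambda>i. \<Sum>a\<in>S. x a i"] ell2_sum[of S x I] by auto
qed simp

lemma ell2_zeroI:
  assumes "\<xi> \<in> ell2 I" "\<And>\<eta>. \<eta> \<in> ell2 I \<Longrightarrow> ell2_inner \<eta> \<xi> = 0"
  shows "\<xi> = (\<lambda>_. 0)"
  using assms(2)[OF assms(1)] ell2_norm_eq_0[OF assms(1)] by (simp add: ell2_inner_self[OF assms(1)])

lemma ell2_finite_iff: "finite I \<Longrightarrow> \<xi> \<in> ell2 I \<longleftrightarrow> (\<forall>i. i \<notin> I \<longrightarrow> \<xi> i = 0)"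
proof -
  assume "finite I"
  then have "(\<lambda>i. (cmod (\<xi> i))\<^sup>2) summable_on UNIV" if "\<forall>i. i \<notin> I \<longrightarrow> \<xi> i = 0"
    by (intro finite_nonzero_values_imp_summable_on finite_subset[OF _ \<open>finite I\<close>]) (use that in auto)
  then show ?thesis by (auto simp: ell2_def)
qed

lemma ell2_norm_finite:
  assumes "finite I" "\<And>i. i \<notin> I \<Longrightarrow> \<xi> i = 0"
  shows "(ell2_norm \<xi>)\<^sup>2 = (\<Sum>i\<in>I. (cmod (\<xi> i))\<^sup>2)"
proof -
  have "(\<Sum>\<^sub>\<infinity>i. (cmod (\<xi> i))\<^sup>2) = (\<Sum>\<^sub>\<infinity>i\<in>I. (cmod (\<xi> i))\<^sup>2)"
    by (rule infsum_cong_neutral) (use assms in auto)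
  then show ?thesis unfolding ell2_norm_power2 using assms(1) by simp
qed

lemma ell2_inner_finite:
  assumes "finite I" "\<And>i. i \<notin> I \<Longrightarrow> \<xi> i = 0"
  shows "ell2_inner \<xi> \<eta> = (\<Sum>i\<in>I. cnj (\<xi> i) * \<eta> i)"
proof -
  have "ell2_inner \<xi> \<eta> = (\<Sum>\<^sub>\<infinity>i\<in>I. cnj (\<xi> i) * \<eta> i)"
    unfolding ell2_inner_def by (rule infsum_cong_neutral) (use assms in auto)
  then show ?thesis using assms(1) by simp
qed

section \<open>Bounded operators\<close>

lemma square_le_mult_cancel:
  fixes a b :: real
  assumes "a * a \<le> a * b" "0 \<le> b"
  shows "a \<le> b"
  using assms by (cases "0 < a") auto

lemma bounded_operatorsI:
  assumes "\<And>\<xi>. \<xi> \<notin> ell2 I \<Longrightarrow> T \<xi> = (\<lambda>_. 0)"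
    and "\<And>\<xi>. \<xi> \<in> ell2 I \<Longrightarrow> T \<xi> \<in> ell2 I"
    and "\<And>\<xi> \<eta>. \<xi> \<in> ell2 I \<Longrightarrow> \<eta> \<in> ell2 I \<Longrightarrow> T (\<lambda>i. \<xi> i + \<eta> i) = (\<lambda>i. T \<xi> i + T \<eta> i)"
    and "\<And>c \<xi>. \<xi> \<in> ell2 I \<Longrightarrow> T (\<lambda>i. c * \<xi> i) = (\<lambda>i. c * T \<xi> i)"
    and "\<And>\<xi>. \<xi> \<in> ell2 I \<Longrightarrow> ell2_norm (T \<xi>) \<le> C * ell2_norm \<xi>"
  shows "T \<in> bounded_operators I"
  unfolding bounded_operators_def mem_Collect_eq
proof (intro conjI allI impI ballI exI[of _ C])
qed (use assms in blast)+

context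
  fixes I :: "'i set" and T :: "'i operator"
  assumes T: "T \<in> bounded_operators I"
begin

lemma bop_off: "\<xi> \<notin> ell2 I \<Longrightarrow> T \<xi> = (\<lambda>_. 0)"
  and bop_in: "\<xi> \<in> ell2 I \<Longrightarrow> T \<xi> \<in> ell2 I"
  and bop_add: "\<xi> \<in> ell2 I \<Longrightarrow> \<eta> \<in> ell2 I \<Longrightarrow> T (\<lambda>i. \<xi> i + \<eta> i) = (\<lambda>i. T \<xi> i + T \<eta> i)"
  and bop_scale: "\<xi> \<in> ell2 I \<Longrightarrow> T (\<lambda>i. c * \<xi> i) = (\<lambda>i. c * T \<xi> i)"
  using T unfolding bounded_operators_def by blast+

lemma bop_range: "T \<xi> \<in> ell2 I"
  using bop_off bop_in by (cases "\<xi> \<in> ell2 I") auto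

lemma bop_bound: "\<exists>C\<ge>0. \<forall>\<xi>\<in>ell2 I. ell2_norm (T \<xi>) \<le> C * ell2_norm \<xi>"
proof -
  obtain C where C: "\<forall>\<xi>\<in>ell2 I. ell2_norm (T \<xi>) \<le> C * ell2_norm \<xi>"
    using T unfolding bounded_operators_def by blast
  have "\<forall>\<xi>\<in>ell2 I. ell2_norm (T \<xi>) \<le> max C 0 * ell2_norm \<xi>"
  proof
    fix \<xi> assume "\<xi> \<in> ell2 I"
    then have "ell2_norm (T \<xi>) \<le> C * ell2_norm \<xi>" using C by blast
    also have "\<dots> \<le> max C 0 * ell2_norm \<xi>" by (intro mult_right_mono) auto
    finally show "ell2_norm (T \<xi>) \<le> max C 0 * ell2_norm \<xi>" .
  qed
  then show ?thesis by (intro exI[of _ "max C 0"]) auto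
qed

lemma bop_zero: "T (\<lambda>_. 0) = (\<lambda>_. 0)"
  using bop_scale[OF ell2_zero, of 0] by (simp only: mult_zero_left)

lemma bop_diff: "\<xi> \<in> ell2 I \<Longrightarrow> \<eta> \<in> ell2 I \<Longrightarrow> T (\<lambda>i. \<xi> i - \<eta> i) = (\<lambda>i. T \<xi> i - T \<eta> i)"
  using bop_add[of \<xi> "\<lambda>i. (-1) * \<eta> i"] bop_scale[of \<eta> "-1"] ell2_scale[of \<eta> I "-1"] by simp

lemma bop_sum: "(\<And>a. a \<in> S \<Longrightarrow> x a \<in> ell2 I) \<Longrightarrow> T (\<lambda>i. \<Sum>a\<in>S. x a i) = (\<lambda>i. \<Sum>a\<in>S. T (x a) i)"
proof (induction S rule: infinite_finite_induct)
  case (insert a S)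
  then show ?case
    using bop_add[of "x a" "\<lambda>i. \<Sum>a\<in>S. x a i"] ell2_sum[of S x I] by auto
qed (auto simp: bop_zero)

lemma operator_norm_bdd: "bdd_above ((\<lambda>\<xi>. ell2_norm (T \<xi>)) ` {\<xi> \<in> ell2 I. ell2_norm \<xi> \<le> 1})"
proof -
  obtain C where "C \<ge> 0" and C: "\<forall>\<xi>\<in>ell2 I. ell2_norm (T \<xi>) \<le> C * ell2_norm \<xi>"
    using bop_bound by blast
  then have "ell2_norm (T \<xi>) \<le> C" if "\<xi> \<in> ell2 I" "ell2_norm \<xi> \<le> 1" for \<xi>
    using that by (meson mult_left_le order_trans)
  then show ?thesis by (intro bdd_aboveI[of _ C]) auto
qed

lemma operator_norm_nonneg: "0 \<le> operator_norm I T"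
  unfolding operator_norm_def
  by (rule cSUP_upper2[OF operator_norm_bdd, of "\<lambda>_. 0"]) auto

lemma operator_norm_bound:
  assumes \<xi>: "\<xi> \<in> ell2 I"
  shows "ell2_norm (T \<xi>) \<le> operator_norm I T * ell2_norm \<xi>"
proof (cases "ell2_norm \<xi> = 0")
  case True
  then show ?thesis using ell2_norm_eq_0[OF \<xi>] bop_zero by simp
next
  case False
  define c where "c = complex_of_real (1 / ell2_norm \<xi>)"
  have "cmod c = 1 / ell2_norm \<xi>" unfolding c_def by (simp add: norm_divide)
  then have n1: "ell2_norm (\<lambda>i. c * \<xi> i) = 1" using False by (simp add: ell2_norm_scale)
  have "ell2_norm (T (\<lambda>i. c * \<xi> i)) \<le> operator_norm I T"
    unfolding operator_norm_def
    by (rule cSUP_upper[OF _ operator_norm_bdd]) (use n1 ell2_scale[OF \<xi>] in auto)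
  then have "1 / ell2_norm \<xi> * ell2_norm (T \<xi>) \<le> operator_norm I T"
    using \<open>cmod c = _\<close> \<xi> by (simp add: bop_scale ell2_norm_scale)
  moreover have "0 < ell2_norm \<xi>" using False ell2_norm_nonneg[of \<xi>] by linarith
  ultimately show ?thesis by (simp add: field_simps)
qed

end

lemma operator_norm_leI:
  assumes "0 \<le> C" "\<And>\<xi>. \<xi> \<in> ell2 I \<Longrightarrow> ell2_norm (T \<xi>) \<le> C * ell2_norm \<xi>"
  shows "operator_norm I T \<le> C"
  unfolding operator_norm_def
proof (rule cSUP_least)
  show "{\<xi> \<in> ell2 I. ell2_norm \<xi> \<le> 1} \<noteq> {}" using ell2_zero ell2_norm_zero by (metis (mono_tags, lifting) empty_iff mem_Collect_eq zero_le_one)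
next
  fix \<xi> :: "'a \<Rightarrow> complex" assume "\<xi> \<in> {\<xi> \<in> ell2 I. ell2_norm \<xi> \<le> 1}"
  then show "ell2_norm (T \<xi>) \<le> C" using assms by (fastforce intro: order_trans mult_left_le)
qed

lemma operator_norm_zero [simp]: "operator_norm I (\<lambda>_ _. 0) = 0"
proof -
  have z: "(\<lambda>_ _. 0) \<in> bounded_operators I" by (rule bounded_operatorsI[where C=0]) auto
  have "operator_norm I (\<lambda>_ _. 0) \<le> 0" by (rule operator_norm_leI) auto
  then show ?thesis using operator_norm_nonneg[OF z] by linarith
qed

lemma operator_norm_eq_0:
  assumes T: "T \<in> bounded_operators I" and 0: "operator_norm I T = 0"
  shows "T = (\<lambda>_ _. 0)"
proof
  fix \<xi> show "T \<xi> = (\<lambda>_. 0)"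
  proof (cases "\<xi> \<in> ell2 I")
    case True
    then have "ell2_norm (T \<xi>) = 0" using operator_norm_bound[OF T True] 0 ell2_norm_nonneg[of "T \<xi>"] by auto
    then show ?thesis using ell2_norm_eq_0 bop_in[OF T True] by blast
  qed (rule bop_off[OF T])
qed

lemma bop_zero_op [simp]: "(\<lambda>_ _. 0) \<in> bounded_operators I"
  by (rule bounded_operatorsI[where C=0]) auto

lemma
  assumes S: "S \<in> bounded_operators I" and T: "T \<in> bounded_operators I"
  shows bop_plus: "(\<lambda>\<xi> i. S \<xi> i + T \<xi> i) \<in> bounded_operators I"
    and operator_norm_plus: "operator_norm I (\<lambda>\<xi> i. S \<xi> i + T \<xi> i) \<le> operator_norm I S + operator_norm I T"
    and bop_comp: "S \<circ> T \<in> bounded_operators I"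
    and operator_norm_comp: "operator_norm I (S \<circ> T) \<le> operator_norm I S * operator_norm I T"
proof -
  have b: "ell2_norm (\<lambda>i. S \<xi> i + T \<xi> i) \<le> (operator_norm I S + operator_norm I T) * ell2_norm \<xi>"
    if "\<xi> \<in> ell2 I" for \<xi>
    using ell2_norm_triangle[OF bop_in[OF S that] bop_in[OF T that]]
      operator_norm_bound[OF S that] operator_norm_bound[OF T that] by (simp add: distrib_right)
  show "(\<lambda>\<xi> i. S \<xi> i + T \<xi> i) \<in> bounded_operators I"
    by (rule bounded_operatorsI[OF _ _ _ _ b])
      (use S T in \<open>auto simp: bop_off bop_in bop_add bop_scale ell2_add algebra_simps\<close>)
  show "operator_norm I (\<lambda>\<xi> i. S \<xi> i + T \<xi> i) \<le> operator_norm I S + operator_norm I T"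
    using operator_norm_nonneg[OF S] operator_norm_nonneg[OF T] b by (intro operator_norm_leI) auto
  have c: "ell2_norm ((S \<circ> T) \<xi>) \<le> (operator_norm I S * operator_norm I T) * ell2_norm \<xi>"
    if "\<xi> \<in> ell2 I" for \<xi>
  proof -
    have "ell2_norm (S (T \<xi>)) \<le> operator_norm I S * ell2_norm (T \<xi>)"
      by (rule operator_norm_bound[OF S bop_in[OF T that]])
    also have "\<dots> \<le> operator_norm I S * (operator_norm I T * ell2_norm \<xi>)"
      by (intro mult_left_mono operator_norm_bound[OF T that] operator_norm_nonneg[OF S])
    finally show ?thesis by (simp add: mult.assoc)
  qed
  show "S \<circ> T \<in> bounded_operators I"
    by (rule bounded_operatorsI[OF _ _ _ _ c])
      (use S T in \<open>auto simp: bop_off bop_in bop_add bop_scale bop_zero\<close>)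
  show "operator_norm I (S \<circ> T) \<le> operator_norm I S * operator_norm I T"
    using operator_norm_nonneg[OF S] operator_norm_nonneg[OF T] c by (intro operator_norm_leI) auto
qed

lemma
  assumes T: "T \<in> bounded_operators I"
  shows bop_scaled: "(\<lambda>\<xi> i. c * T \<xi> i) \<in> bounded_operators I"
    and operator_norm_scaled: "operator_norm I (\<lambda>\<xi> i. c * T \<xi> i) = cmod c * operator_norm I T"
proof -
  have b: "ell2_norm (\<lambda>i. c * T \<xi> i) \<le> (cmod c * operator_norm I T) * ell2_norm \<xi>"
    if "\<xi> \<in> ell2 I" for \<xi> c
    using operator_norm_bound[OF T that] by (simp add: ell2_norm_scale mult.assoc mult_left_mono)
  show s: "(\<lambda>\<xi> i. c * T \<xi> i) \<in> bounded_operators I" for c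
    by (rule bounded_operatorsI[OF _ _ _ _ b])
      (use T in \<open>auto simp: bop_off bop_in bop_add bop_scale ell2_scale algebra_simps\<close>)
  have le: "operator_norm I (\<lambda>\<xi> i. c * T \<xi> i) \<le> cmod c * operator_norm I T"
    using operator_norm_nonneg[OF T] b by (intro operator_norm_leI) auto
  moreover have "cmod c * operator_norm I T \<le> operator_norm I (\<lambda>\<xi> i. c * T \<xi> i)"
  proof (cases "c = 0")
    case False
    have "ell2_norm (T \<xi>) \<le> (operator_norm I (\<lambda>\<xi> i. c * T \<xi> i) / cmod c) * ell2_norm \<xi>"
      if "\<xi> \<in> ell2 I" for \<xi>
      using operator_norm_bound[OF s that, of c] False by (simp add: ell2_norm_scale field_simps)
    then have "operator_norm I T \<le> operator_norm I (\<lambda>\<xi> i. c * T \<xi> i) / cmod c"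
      using operator_norm_nonneg[OF s, of c] by (intro operator_norm_leI) auto
    then show ?thesis using False by (simp add: field_simps)
  qed simp
  ultimately show "operator_norm I (\<lambda>\<xi> i. c * T \<xi> i) = cmod c * operator_norm I T" by linarith
qed

lemma bop_minus:
  assumes S: "S \<in> bounded_operators I" and T: "T \<in> bounded_operators I"
  shows "(\<lambda>\<xi> i. S \<xi> i - T \<xi> i) \<in> bounded_operators I"
  using bop_plus[OF S bop_scaled[OF T, of "-1"]] by simp

lemma operator_norm_minus_commute:
  assumes S: "S \<in> bounded_operators I" and T: "T \<in> bounded_operators I"
  shows "operator_norm I (\<lambda>\<xi> i. S \<xi> i - T \<xi> i) = operator_norm I (\<lambda>\<xi> i. T \<xi> i - S \<xi> i)"
  using operator_norm_scaled[OF bop_minus[OF S T], of "-1"] by simp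

lemma operator_norm_triangle_sub:
  assumes S: "S \<in> bounded_operators I" and T: "T \<in> bounded_operators I"
  shows "operator_norm I S \<le> operator_norm I T + operator_norm I (\<lambda>\<xi> i. S \<xi> i - T \<xi> i)"
  using operator_norm_plus[OF T bop_minus[OF S T]] by simp

lemma operator_norm_triangle_mid:
  assumes S: "S \<in> bounded_operators I" and T: "T \<in> bounded_operators I" and R: "R \<in> bounded_operators I"
  shows "operator_norm I (\<lambda>\<xi> i. S \<xi> i - R \<xi> i) \<le>
    operator_norm I (\<lambda>\<xi> i. S \<xi> i - T \<xi> i) + operator_norm I (\<lambda>\<xi> i. T \<xi> i - R \<xi> i)"
  using operator_norm_plus[OF bop_minus[OF S T] bop_minus[OF T R]] by simp

subsection \<open>Adjoints\<close>

lemma ell2_truncation: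
  assumes \<xi>: "\<xi> \<in> ell2 I" and e: "0 < e"
  obtains F where "finite F" "F \<subseteq> I" "ell2_norm (\<lambda>i. if i \<in> F then 0 else \<xi> i) \<le> e"
proof -
  let ?f = "\<lambda>i. (cmod (\<xi> i))\<^sup>2"
  obtain F where F: "finite F" "dist (sum ?f F) (infsum ?f UNIV) \<le> e\<^sup>2"
    using infsum_finite_approximation[OF ell2_summable[OF \<xi>], of "e\<^sup>2"] e by auto
  let ?\<eta> = "\<lambda>i. if i \<in> F \<inter> I then 0 else \<xi> i"
  have "(\<Sum>i\<in>A. (cmod (?\<eta> i))\<^sup>2) \<le> e\<^sup>2" if "finite A" for A
  proof -
    have "(\<Sum>i\<in>A. (cmod (?\<eta> i))\<^sup>2) = (\<Sum>i\<in>A - F. ?f i)"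
      using that by (intro sum.mono_neutral_cong_right) (auto simp: ell2_off[OF \<xi>])
    also have "\<dots> = sum ?f ((A - F) \<union> F) - sum ?f F"
      using F that by (subst sum.union_disjoint) auto
    also have "\<dots> \<le> infsum ?f UNIV - sum ?f F"
      using finite_sum_le_infsum[OF ell2_summable[OF \<xi>], of "(A - F) \<union> F"] F that by auto
    also have "\<dots> \<le> e\<^sup>2" using F(2) by (simp add: dist_real_def)
    finally show ?thesis .
  qed
  then have "ell2_norm ?\<eta> \<le> e" using e by (intro ell2_norm_leI_power2[of I]) (auto simp: ell2_off[OF \<xi>])
  then show thesis using that[of "F \<inter> I"] F by auto
qed

lemma is_adjoint_sym:
  assumes "is_adjoint I T S"
  shows "is_adjoint I S T"
  unfolding is_adjoint_def
proof (intro ballI)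
  fix \<xi> \<eta> :: "'a \<Rightarrow> complex" assume "\<xi> \<in> ell2 I" "\<eta> \<in> ell2 I"
  then have "ell2_inner (T \<eta>) \<xi> = ell2_inner \<eta> (S \<xi>)" using assms unfolding is_adjoint_def by blast
  then show "ell2_inner (S \<xi>) \<eta> = ell2_inner \<xi> (T \<eta>)"
    by (subst (1 2) ell2_inner_commute) simp
qed

lemma is_adjoint_unique:
  assumes "S \<in> bounded_operators I" "S' \<in> bounded_operators I" "is_adjoint I T S" "is_adjoint I T S'"
  shows "S = S'"
proof
  fix \<eta> show "S \<eta> = S' \<eta>"
  proof (cases "\<eta> \<in> ell2 I")
    case True
    have "(\<lambda>i. S \<eta> i - S' \<eta> i) = (\<lambda>_. 0)"
    proof (rule ell2_zeroI)
      show "(\<lambda>i. S \<eta> i - S' \<eta> i) \<in> ell2 I" by (rule ell2_diff[OF bop_in[OF assms(1) True] bop_in[OF assms(2) True]])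
      fix \<xi> assume "\<xi> \<in> ell2 I"
      then have "ell2_inner \<xi> (S \<eta>) = ell2_inner \<xi> (S' \<eta>)"
        using assms(3,4) True unfolding is_adjoint_def by fastforce
      then show "ell2_inner \<xi> (\<lambda>i. S \<eta> i - S' \<eta> i) = 0"
        by (simp add: ell2_inner_diff_right[OF \<open>\<xi> \<in> ell2 I\<close> bop_in[OF assms(1) True] bop_in[OF assms(2) True]])
    qed
    then show ?thesis by (simp add: fun_eq_iff)
  qed (simp add: bop_off[OF assms(1)] bop_off[OF assms(2)])
qed

text \<open>
  The adjoint is written down through its matrix: the coordinates of \<open>T\<^sup>* \<eta>\<close> have to be
  \<open>\<langle>T e\<^sub>i, \<eta>\<rangle>\<close>.  Testing \<open>T\<close> on the truncations of this vector to finite sets bounds its norm, and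
  the adjoint identity passes from finitely supported vectors to all vectors by density.
\<close>

lemma adjoint_exists:
  assumes T: "T \<in> bounded_operators I"
  shows "\<exists>S\<in>bounded_operators I. is_adjoint I T S"
proof -
  define ket where "ket i = (\<lambda>j. if j = i then 1 else 0 :: complex)" for i :: 'a
  have ket: "ket i \<in> ell2 I" if "i \<in> I" for i
  proof -
    have "ket i \<in> ell2 {i}" by (simp add: ell2_finite_iff ket_def)
    then show ?thesis using that by (auto simp: ell2_def)
  qed
  define S where "S \<eta> = (if \<eta> \<in> ell2 I then (\<lambda>i. if i \<in> I then ell2_inner (T (ket i)) \<eta> else 0) else (\<lambda>_. 0))" for \<eta>
  obtain C where "C \<ge> 0" and C: "\<And>\<xi>. \<xi> \<in> ell2 I \<Longrightarrow> ell2_norm (T \<xi>) \<le> C * ell2_norm \<xi>"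
    using bop_bound[OF T] by blast
  have fin_supp: "\<zeta> \<in> ell2 I \<and> ell2_inner (T \<zeta>) \<eta> = (\<Sum>i\<in>F. cnj (\<zeta> i) * S \<eta> i)"
    if "finite F" "F \<subseteq> I" "\<eta> \<in> ell2 I" "\<And>i. i \<notin> F \<Longrightarrow> \<zeta> i = 0" for \<zeta> \<eta> F
  proof -
    have in2: "(\<lambda>i. \<zeta> a * ket a i) \<in> ell2 I" if "a \<in> F" for a
      using ell2_scale ket that \<open>F \<subseteq> I\<close> by blast
    have e: "\<zeta> = (\<lambda>i. \<Sum>a\<in>F. \<zeta> a * ket a i)"
      using that by (auto simp: ket_def fun_eq_iff if_distrib cong: if_cong)
    have "(\<lambda>i. \<Sum>a\<in>F. \<zeta> a * ket a i) \<in> ell2 I" by (rule ell2_sum) (rule in2)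
    then have z: "\<zeta> \<in> ell2 I" by (simp only: e[symmetric])
    have "T (\<lambda>i. \<Sum>a\<in>F. \<zeta> a * ket a i) = (\<lambda>i. \<Sum>a\<in>F. \<zeta> a * T (ket a) i)"
      using in2 bop_scale[OF T ket] \<open>F \<subseteq> I\<close> by (subst bop_sum[OF T]) (auto simp: subset_iff intro!: sum.cong)
    then have T\<zeta>: "T \<zeta> = (\<lambda>i. \<Sum>a\<in>F. \<zeta> a * T (ket a) i)" by (simp only: e[symmetric])
    have "ell2_inner (\<lambda>i. \<Sum>a\<in>G. \<zeta> a * T (ket a) i) \<eta> = (\<Sum>i\<in>G. cnj (\<zeta> i) * S \<eta> i)"
      if "finite G" "G \<subseteq> F" for G
      using that
    proof (induction G rule: finite_induct)
      case (insert a G)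
      then have a: "a \<in> I" "a \<in> F" using \<open>F \<subseteq> I\<close> by auto
      have "(\<lambda>i. \<Sum>a\<in>G. \<zeta> a * T (ket a) i) \<in> ell2 I"
        by (rule ell2_sum) (use insert.prems \<open>F \<subseteq> I\<close> in \<open>intro ell2_scale bop_in[OF T] ket, auto\<close>)
      then have "ell2_inner (\<lambda>i. \<Sum>a\<in>insert a G. \<zeta> a * T (ket a) i) \<eta> =
        ell2_inner (\<lambda>i. \<zeta> a * T (ket a) i) \<eta> + ell2_inner (\<lambda>i. \<Sum>a\<in>G. \<zeta> a * T (ket a) i) \<eta>"
        using insert.hyps ell2_scale[OF bop_in[OF T ket[OF a(1)]]] \<open>\<eta> \<in> ell2 I\<close>
        by (simp add: ell2_inner_add_left[where I=I])
      then show ?case using insert a \<open>\<eta> \<in> ell2 I\<close> by (simp add: ell2_inner_scale_left S_def)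
    qed simp
    from this[OF that(1) order_refl] show ?thesis unfolding T\<zeta> using z by blast
  qed
  have bd: "S \<eta> \<in> ell2 I \<and> ell2_norm (S \<eta>) \<le> C * ell2_norm \<eta>" if \<eta>: "\<eta> \<in> ell2 I" for \<eta>
  proof -
    have "L2_set (\<lambda>i. cmod (S \<eta> i)) F \<le> C * ell2_norm \<eta>" if F: "finite F" for F
    proof -
      define R where "R = L2_set (\<lambda>i. cmod (S \<eta> i)) F"
      define \<zeta> where "\<zeta> i = (if i \<in> F \<inter> I then S \<eta> i else 0)" for i
      have R2: "R\<^sup>2 = (\<Sum>i\<in>F \<inter> I. (cmod (S \<eta> i))\<^sup>2)"
        unfolding R_def L2_set_def using F \<eta>
        by (simp add: sum_nonneg) (intro sum.mono_neutral_right, auto simp: S_def)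
      have f: "\<zeta> \<in> ell2 I" "ell2_inner (T \<zeta>) \<eta> = (\<Sum>i\<in>F \<inter> I. cnj (\<zeta> i) * S \<eta> i)"
      proof -
        have "\<zeta> i = 0" if "i \<notin> F \<inter> I" for i using that by (auto simp: \<zeta>_def)
        with fin_supp[of "F \<inter> I" \<eta> \<zeta>] F \<eta> show "\<zeta> \<in> ell2 I"
          "ell2_inner (T \<zeta>) \<eta> = (\<Sum>i\<in>F \<inter> I. cnj (\<zeta> i) * S \<eta> i)" by auto
      qed
      have "ell2_norm \<zeta> = R"
      proof (rule power2_eq_imp_eq)
        show "(ell2_norm \<zeta>)\<^sup>2 = R\<^sup>2"
          unfolding R2 using F by (subst ell2_norm_finite[of "F \<inter> I"]) (auto simp: \<zeta>_def)
      qed (auto simp: R_def)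
      moreover have "ell2_inner (T \<zeta>) \<eta> = of_real (R\<^sup>2)"
        unfolding f(2) R2 of_real_sum by (intro sum.cong) (auto simp: \<zeta>_def complex_norm_square mult.commute simp del: of_real_power)
      ultimately have "R\<^sup>2 \<le> C * R * ell2_norm \<eta>"
        using ell2_Cauchy_Schwarz[OF bop_in[OF T f(1)] \<eta>] C[OF f(1)]
          mult_right_mono[OF C[OF f(1)] ell2_norm_nonneg[of \<eta>]] by (simp add: norm_power)
      then have "R * R \<le> R * (C * ell2_norm \<eta>)" by (simp add: power2_eq_square mult_ac)
      then show ?thesis
        unfolding R_def[symmetric] by (rule square_le_mult_cancel) (simp add: \<open>C \<ge> 0\<close>)
    qed
    then show ?thesis using \<eta> by (intro conjI ell2I ell2_norm_leI[of I]) (auto simp: S_def)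
  qed
  have adj: "ell2_inner (T \<xi>) \<eta> = ell2_inner \<xi> (S \<eta>)" if \<xi>: "\<xi> \<in> ell2 I" and \<eta>: "\<eta> \<in> ell2 I" for \<xi> \<eta>
  proof -
    have S\<eta>: "S \<eta> \<in> ell2 I" using bd[OF \<eta>] by blast
    define B where "B = C * ell2_norm \<eta> + ell2_norm (S \<eta>)"
    have B: "0 \<le> B" unfolding B_def using \<open>C \<ge> 0\<close> by auto
    have le: "cmod (ell2_inner (T \<xi>) \<eta> - ell2_inner \<xi> (S \<eta>)) \<le> e * B"
      if "0 < e" for e
    proof -
      obtain F where F: "finite F" "F \<subseteq> I" "ell2_norm (\<lambda>i. if i \<in> F then 0 else \<xi> i) \<le> e"
        using ell2_truncation[OF \<xi> \<open>0 < e\<close>] .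
      define \<zeta> where "\<zeta> i = (if i \<in> F then \<xi> i else 0)" for i
      define \<rho> where "\<rho> i = \<xi> i - \<zeta> i" for i
      have z: "\<zeta> \<in> ell2 I" "ell2_inner (T \<zeta>) \<eta> = ell2_inner \<zeta> (S \<eta>)"
        using fin_supp[of F \<eta> \<zeta>] F \<eta> ell2_inner_finite[of F \<zeta> "S \<eta>"] by (auto simp: \<zeta>_def)
      have r: "\<rho> \<in> ell2 I" unfolding \<rho>_def by (rule ell2_diff[OF \<xi> z(1)])
      have re: "ell2_norm \<rho> \<le> e"
      proof -
        have "\<rho> = (\<lambda>i. if i \<in> F then 0 else \<xi> i)" by (auto simp: \<rho>_def \<zeta>_def)
        then show ?thesis using F(3) by simp
      qed
      have eq: "\<xi> = (\<lambda>i. \<zeta> i + \<rho> i)" by (simp add: \<rho>_def)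
      have "ell2_inner (T \<xi>) \<eta> - ell2_inner \<xi> (S \<eta>) = ell2_inner (T \<rho>) \<eta> - ell2_inner \<rho> (S \<eta>)"
        using z(2) by (simp add: eq bop_add[OF T z(1) r] ell2_inner_add_left[OF \<eta> bop_in[OF T z(1)] bop_in[OF T r]]
            ell2_inner_add_left[OF S\<eta> z(1) r])
      also have "cmod \<dots> \<le> cmod (ell2_inner (T \<rho>) \<eta>) + cmod (ell2_inner \<rho> (S \<eta>))"
        by (rule norm_triangle_ineq4)
      also have "\<dots> \<le> C * ell2_norm \<rho> * ell2_norm \<eta> + ell2_norm \<rho> * ell2_norm (S \<eta>)"
        by (intro add_mono order.trans[OF ell2_Cauchy_Schwarz] mult_right_mono C)
          (use r \<eta> S\<eta> bop_in[OF T] in auto)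
      also have "\<dots> = ell2_norm \<rho> * (C * ell2_norm \<eta> + ell2_norm (S \<eta>))" by (simp add: algebra_simps)
      also have "\<dots> \<le> e * (C * ell2_norm \<eta> + ell2_norm (S \<eta>))"
        using re \<open>C \<ge> 0\<close> by (intro mult_right_mono) auto
      finally show ?thesis unfolding B_def .
    qed
    have "cmod (ell2_inner (T \<xi>) \<eta> - ell2_inner \<xi> (S \<eta>)) \<le> 0 + d" if "0 < d" for d
    proof -
      have "d / (B + 1) * B \<le> d" using that B by (simp add: field_simps)
      moreover have "0 < d / (B + 1)" using that B by simp
      ultimately show ?thesis using le[of "d / (B + 1)"] by linarith
    qed
    then have "cmod (ell2_inner (T \<xi>) \<eta> - ell2_inner \<xi> (S \<eta>)) \<le> 0" by (rule field_le_epsilon)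
    then show ?thesis by simp
  qed
  have "S \<in> bounded_operators I"
  proof (rule bounded_operatorsI)
    fix \<xi> \<eta> :: "'a \<Rightarrow> complex" and c
    show "S \<xi> = (\<lambda>_. 0)" if "\<xi> \<notin> ell2 I" using that by (simp add: S_def)
    assume *: "\<xi> \<in> ell2 I"
    show "S \<xi> \<in> ell2 I" "ell2_norm (S \<xi>) \<le> C * ell2_norm \<xi>" using bd[OF *] by blast+
    show "S (\<lambda>i. c * \<xi> i) = (\<lambda>i. c * S \<xi> i)"
      using * by (auto simp: S_def ell2_scale ell2_inner_scale_right)
    assume "\<eta> \<in> ell2 I"
    with * show "S (\<lambda>i. \<xi> i + \<eta> i) = (\<lambda>i. S \<xi> i + S \<eta> i)"
      using ell2_inner_add_right[OF bop_in[OF T ket]] by (auto simp: S_def ell2_add)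
  qed
  moreover have "is_adjoint I T S" unfolding is_adjoint_def using adj by blast
  ultimately show ?thesis by blast
qed

lemma operator_adjoint_eqI:
  assumes S: "S \<in> bounded_operators I" and a: "is_adjoint I T S"
  shows "operator_adjoint I T = S"
  unfolding operator_adjoint_def
proof (rule the_equality)
  show "S \<in> bounded_operators I \<and> is_adjoint I T S" using assms by blast
  show "S' = S" if "S' \<in> bounded_operators I \<and> is_adjoint I T S'" for S'
    using is_adjoint_unique[OF conjunct1[OF that] S conjunct2[OF that] a] .
qed

lemma
  assumes "T \<in> bounded_operators I"
  shows operator_adjoint_bop: "operator_adjoint I T \<in> bounded_operators I"
    and operator_adjoint_adjoint: "is_adjoint I T (operator_adjoint I T)"
proof -
  obtain S where "S \<in> bounded_operators I" "is_adjoint I T S" using adjoint_exists[OF assms] by blast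
  moreover from this have "operator_adjoint I T = S" by (rule operator_adjoint_eqI)
  ultimately show "operator_adjoint I T \<in> bounded_operators I" "is_adjoint I T (operator_adjoint I T)" by simp_all
qed

lemma is_adjoint_plus:
  assumes S: "S \<in> bounded_operators I" and T: "T \<in> bounded_operators I"
    and S': "S' \<in> bounded_operators I" and T': "T' \<in> bounded_operators I"
    and a: "is_adjoint I S S'" "is_adjoint I T T'"
  shows "is_adjoint I (\<lambda>\<xi> i. S \<xi> i + T \<xi> i) (\<lambda>\<xi> i. S' \<xi> i + T' \<xi> i)"
  unfolding is_adjoint_def
proof (intro ballI)
  fix \<xi> \<eta> :: "'a \<Rightarrow> complex" assume x: "\<xi> \<in> ell2 I" and y: "\<eta> \<in> ell2 I"
  then show "ell2_inner (\<lambda>i. S \<xi> i + T \<xi> i) \<eta> = ell2_inner \<xi> (\<lambda>i. S' \<eta> i + T' \<eta> i)"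
    using a unfolding ell2_inner_add_left[OF y bop_in[OF S x] bop_in[OF T x]]
      ell2_inner_add_right[OF x bop_in[OF S' y] bop_in[OF T' y]] is_adjoint_def by simp
qed

lemma is_adjoint_scaled:
  "is_adjoint I S S' \<Longrightarrow> is_adjoint I (\<lambda>\<xi> i. c * S \<xi> i) (\<lambda>\<xi> i. cnj c * S' \<xi> i)"
  unfolding is_adjoint_def ell2_inner_scale_left ell2_inner_scale_right by simp

lemma is_adjoint_comp:
  assumes T: "T \<in> bounded_operators I" and S': "S' \<in> bounded_operators I"
    and a: "is_adjoint I S S'" "is_adjoint I T T'"
  shows "is_adjoint I (S \<circ> T) (T' \<circ> S')"
  unfolding is_adjoint_def o_apply
proof (intro ballI)
  fix \<xi> \<eta> :: "'a \<Rightarrow> complex" assume x: "\<xi> \<in> ell2 I" and y: "\<eta> \<in> ell2 I"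
  have "ell2_inner (S (T \<xi>)) \<eta> = ell2_inner (T \<xi>) (S' \<eta>)"
    using a(1) bop_in[OF T x] y unfolding is_adjoint_def by blast
  also have "\<dots> = ell2_inner \<xi> (T' (S' \<eta>))"
    using a(2) x bop_in[OF S' y] unfolding is_adjoint_def by blast
  finally show "ell2_inner (S (T \<xi>)) \<eta> = ell2_inner \<xi> (T' (S' \<eta>))" .
qed

lemma operator_norm_adjoint_le:
  assumes T: "T \<in> bounded_operators I" and S: "S \<in> bounded_operators I" and a: "is_adjoint I T S"
  shows "operator_norm I S \<le> operator_norm I T"
proof (rule operator_norm_leI[OF operator_norm_nonneg[OF T]])
  fix \<xi> :: "'a \<Rightarrow> complex" assume x: "\<xi> \<in> ell2 I"
  have "complex_of_real ((ell2_norm (S \<xi>))\<^sup>2) = ell2_inner (T (S \<xi>)) \<xi>"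
    using a x bop_in[OF S x] by (simp add: is_adjoint_def ell2_inner_self[where I=I])
  also have "cmod \<dots> \<le> operator_norm I T * ell2_norm (S \<xi>) * ell2_norm \<xi>"
    using ell2_Cauchy_Schwarz[OF bop_in[OF T bop_in[OF S x]] x] operator_norm_bound[OF T bop_in[OF S x]]
    by (meson ell2_norm_nonneg mult_right_mono order_trans)
  finally have "ell2_norm (S \<xi>) * ell2_norm (S \<xi>) \<le> ell2_norm (S \<xi>) * (operator_norm I T * ell2_norm \<xi>)"
    by (simp add: power2_eq_square mult_ac norm_mult)
  then show "ell2_norm (S \<xi>) \<le> operator_norm I T * ell2_norm \<xi>"
    by (rule square_le_mult_cancel) (simp add: operator_norm_nonneg[OF T])
qed

lemma operator_norm_adjoint_comp:
  assumes T: "T \<in> bounded_operators I" and S: "S \<in> bounded_operators I" and a: "is_adjoint I T S"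
  shows "operator_norm I (S \<circ> T) = (operator_norm I T)\<^sup>2"
proof (rule antisym)
  have "operator_norm I (S \<circ> T) \<le> operator_norm I S * operator_norm I T"
    by (rule operator_norm_comp[OF S T])
  also have "\<dots> \<le> operator_norm I T * operator_norm I T"
    by (intro mult_right_mono operator_norm_adjoint_le[OF T S a] operator_norm_nonneg[OF T])
  finally show "operator_norm I (S \<circ> T) \<le> (operator_norm I T)\<^sup>2" by (simp add: power2_eq_square)
  have ST: "S \<circ> T \<in> bounded_operators I" by (rule bop_comp[OF S T])
  have "operator_norm I T \<le> sqrt (operator_norm I (S \<circ> T))"
  proof (rule operator_norm_leI)
    fix \<xi> :: "'a \<Rightarrow> complex" assume x: "\<xi> \<in> ell2 I"
    have "complex_of_real ((ell2_norm (T \<xi>))\<^sup>2) = ell2_inner \<xi> ((S \<circ> T) \<xi>)"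
      using a x bop_in[OF T x] unfolding is_adjoint_def o_apply
      by (metis ell2_inner_self)
    also have "cmod \<dots> \<le> ell2_norm \<xi> * (operator_norm I (S \<circ> T) * ell2_norm \<xi>)"
      using ell2_Cauchy_Schwarz[OF x bop_in[OF ST x]] operator_norm_bound[OF ST x]
      by (meson ell2_norm_nonneg mult_left_mono order_trans)
    finally have "(ell2_norm (T \<xi>))\<^sup>2 \<le> (sqrt (operator_norm I (S \<circ> T)) * ell2_norm \<xi>)\<^sup>2"
      using operator_norm_nonneg[OF ST]
      by (simp add: power_mult_distrib power2_eq_square mult_ac norm_mult del: o_apply)
    then show "ell2_norm (T \<xi>) \<le> sqrt (operator_norm I (S \<circ> T)) * ell2_norm \<xi>"
      by (rule power2_le_imp_le) (simp add: operator_norm_nonneg[OF ST])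
  qed (simp add: operator_norm_nonneg[OF ST])
  then show "(operator_norm I T)\<^sup>2 \<le> operator_norm I (S \<circ> T)"
    using operator_norm_nonneg[OF ST] operator_norm_nonneg[OF T] by (simp add: real_le_rsqrt sqrt_ge_absD)
qed

subsection \<open>Completeness\<close>

text \<open>
  The limit is taken coordinate by coordinate, and the norm estimates survive because they can be
  read off from finitely many coordinates at a time.
\<close>

lemma operator_Cauchy_limit:
  fixes T :: "nat \<Rightarrow> 'i operator"
  assumes T: "\<And>n. T n \<in> bounded_operators I"
    and Cauchy: "\<And>e. 0 < e \<Longrightarrow> \<exists>N. \<forall>m\<ge>N. \<forall>n\<ge>N. operator_norm I (\<lambda>\<xi> i. T m \<xi> i - T n \<xi> i) \<le> e"
  obtains L where "L \<in> bounded_operators I"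
    and "\<And>e N n. \<forall>m\<ge>N. \<forall>n\<ge>N. operator_norm I (\<lambda>\<xi> i. T m \<xi> i - T n \<xi> i) \<le> e \<Longrightarrow> N \<le> n \<Longrightarrow>
      operator_norm I (\<lambda>\<xi> i. L \<xi> i - T n \<xi> i) \<le> e"
proof -
  define L where "L \<xi> i = lim (\<lambda>n. T n \<xi> i)" for \<xi> i
  have df: "ell2_norm (\<lambda>i. T m \<xi> i - T n \<xi> i) \<le> e * ell2_norm \<xi>"
    if "operator_norm I (\<lambda>\<xi> i. T m \<xi> i - T n \<xi> i) \<le> e" "\<xi> \<in> ell2 I" for m n e \<xi>
    using operator_norm_bound[OF bop_minus[OF T[of m] T[of n]] that(2)] that
    by (meson ell2_norm_nonneg mult_right_mono order_trans)
  have lim: "(\<lambda>n. T n \<xi> i) \<longlonglongrightarrow> L \<xi> i" for \<xi> i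
  proof (cases "\<xi> \<in> ell2 I")
    case True
    have "Cauchy (\<lambda>n. T n \<xi> i)"
    proof (rule CauchyI)
      fix e :: real assume e: "0 < e"
      define r where "r = ell2_norm \<xi>"
      have r: "0 \<le> r" by (simp add: r_def)
      then have p: "0 < 2 * (r + 1)" by simp
      define d where "d = e / (2 * (r + 1))"
      have d: "0 < d" using e p by (simp add: d_def)
      have "e * r < e * (2 * (r + 1))"
        using e r by (intro mult_strict_left_mono) auto
      then have d': "d * ell2_norm \<xi> < e" using p by (simp add: d_def pos_divide_less_eq flip: r_def)
      obtain N where N: "\<forall>m\<ge>N. \<forall>n\<ge>N. operator_norm I (\<lambda>\<xi> i. T m \<xi> i - T n \<xi> i) \<le> d"
        using Cauchy[OF d] by blast
      have "cmod (T m \<xi> i - T n \<xi> i) < e" if "m \<ge> N" "n \<ge> N" for m n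
        using cmod_le_ell2_norm[OF ell2_diff[OF bop_in[OF T[of m] True] bop_in[OF T[of n] True]], of i]
          df[of m n d, OF _ True] N that d' by fastforce
      then show "\<exists>N. \<forall>m\<ge>N. \<forall>n\<ge>N. cmod (T m \<xi> i - T n \<xi> i) < e" by blast
    qed
    then show ?thesis unfolding L_def by (simp add: Cauchy_convergent convergent_LIMSEQ_iff[symmetric])
  next
    case False
    then show ?thesis unfolding L_def by (simp add: bop_off[OF T False])
  qed
  have key: "(\<lambda>i. L \<xi> i - T n \<xi> i) \<in> ell2 I \<and> ell2_norm (\<lambda>i. L \<xi> i - T n \<xi> i) \<le> e * ell2_norm \<xi>"
    if N: "\<forall>m\<ge>N. \<forall>n\<ge>N. operator_norm I (\<lambda>\<xi> i. T m \<xi> i - T n \<xi> i) \<le> e" and n: "N \<le> n"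
      and x: "\<xi> \<in> ell2 I" for N n e \<xi>
  proof -
    have "L2_set (\<lambda>i. cmod (L \<xi> i - T n \<xi> i)) F \<le> e * ell2_norm \<xi>" if F: "finite F" for F
    proof (rule LIMSEQ_le_const2)
      show "(\<lambda>m. L2_set (\<lambda>i. cmod (T m \<xi> i - T n \<xi> i)) F) \<longlonglongrightarrow> L2_set (\<lambda>i. cmod (L \<xi> i - T n \<xi> i)) F"
        unfolding L2_set_def by (intro tendsto_intros lim)
      show "\<exists>N. \<forall>m\<ge>N. L2_set (\<lambda>i. cmod (T m \<xi> i - T n \<xi> i)) F \<le> e * ell2_norm \<xi>"
        using L2_set_le_ell2_norm[OF ell2_diff[OF bop_in[OF T x] bop_in[OF T x]] F] df[OF _ x] N n
        by (meson order_trans)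
    qed
    moreover have "L \<xi> i - T n \<xi> i = 0" if "i \<notin> I" for i
    proof -
      have "(\<lambda>n. T n \<xi> i) \<longlonglongrightarrow> 0" using ell2_off[OF bop_in[OF T x] that] by simp
      then show ?thesis using LIMSEQ_unique[OF lim[of \<xi> i]] ell2_off[OF bop_in[OF T x] that] by simp
    qed
    ultimately show ?thesis
      using ell2I[of I "\<lambda>i. L \<xi> i - T n \<xi> i"] ell2_norm_leI[of I "\<lambda>i. L \<xi> i - T n \<xi> i"] by blast
  qed
  obtain N where N: "\<forall>m\<ge>N. \<forall>n\<ge>N. operator_norm I (\<lambda>\<xi> i. T m \<xi> i - T n \<xi> i) \<le> 1"
    using Cauchy[of 1] by auto
  have LN: "L \<xi> \<in> ell2 I \<and> ell2_norm (L \<xi>) \<le> (1 + operator_norm I (T N)) * ell2_norm \<xi>" if x: "\<xi> \<in> ell2 I" for \<xi>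
  proof -
    let ?D = "\<lambda>i. L \<xi> i - T N \<xi> i"
    have D: "?D \<in> ell2 I" "ell2_norm ?D \<le> 1 * ell2_norm \<xi>" using key[OF N order_refl x] by blast+
    have eq: "L \<xi> = (\<lambda>i. ?D i + T N \<xi> i)" by simp
    have "ell2_norm (\<lambda>i. ?D i + T N \<xi> i) \<le> 1 * ell2_norm \<xi> + operator_norm I (T N) * ell2_norm \<xi>"
      using ell2_norm_triangle[OF D(1) bop_in[OF T[of N] x]] D(2) operator_norm_bound[OF T[of N] x] by linarith
    then show ?thesis using ell2_add[OF D(1) bop_in[OF T[of N] x]] by (simp add: distrib_right)
  qed
  have L: "L \<in> bounded_operators I"
  proof (rule bounded_operatorsI)
    fix \<xi> \<eta> :: "'i \<Rightarrow> complex" and c :: complex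
    show "L \<xi> = (\<lambda>_. 0)" if "\<xi> \<notin> ell2 I"
      unfolding L_def by (simp add: bop_off[OF T that])
    assume x: "\<xi> \<in> ell2 I"
    show "ell2_norm (L \<xi>) \<le> (1 + operator_norm I (T N)) * ell2_norm \<xi>" "L \<xi> \<in> ell2 I"
      using LN[OF x] by auto
    have "(\<lambda>n. c * T n \<xi> i) \<longlonglongrightarrow> c * L \<xi> i" for i by (intro tendsto_intros lim)
    then have "(\<lambda>n. T n (\<lambda>i. c * \<xi> i) i) \<longlonglongrightarrow> c * L \<xi> i" for i using bop_scale[OF T x] by simp
    then show "L (\<lambda>i. c * \<xi> i) = (\<lambda>i. c * L \<xi> i)" using LIMSEQ_unique lim by blast
    assume y: "\<eta> \<in> ell2 I"
    have "(\<lambda>n. T n \<xi> i + T n \<eta> i) \<longlonglongrightarrow> L \<xi> i + L \<eta> i" for i by (intro tendsto_intros lim)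
    then have "(\<lambda>n. T n (\<lambda>i. \<xi> i + \<eta> i) i) \<longlonglongrightarrow> L \<xi> i + L \<eta> i" for i using bop_add[OF T x y] by simp
    then show "L (\<lambda>i. \<xi> i + \<eta> i) = (\<lambda>i. L \<xi> i + L \<eta> i)" using LIMSEQ_unique lim by blast
  qed
  show thesis
  proof (rule that[OF L])
    fix e N n assume N: "\<forall>m\<ge>N. \<forall>n\<ge>N. operator_norm I (\<lambda>\<xi> i. T m \<xi> i - T n \<xi> i) \<le> e" "N \<le> n"
    then have "0 \<le> e" using operator_norm_nonneg[OF bop_minus[OF T[of n] T[of n]]] by fastforce
    then show "operator_norm I (\<lambda>\<xi> i. L \<xi> i - T n \<xi> i) \<le> e"
      using key[OF N] by (intro operator_norm_leI) auto
  qed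
qed

section \<open>The full groupoid algebra is a C*-algebra\<close>

lemma ex_small_factor:
  fixes C e :: real
  assumes "0 \<le> C" "0 < e"
  obtains d where "0 < d" "C * d \<le> e"
proof (rule that)
  show "0 < e / (C + 1)" "C * (e / (C + 1)) \<le> e" using assms by (simp_all add: field_simps)
qed

lemma cc_algebra_simps [simp]:
  "carrier (cc_algebra G) = cc_functions G"
  "sa_add (cc_algebra G) = (\<lambda>f f' g. f g + f' g)"
  "sa_scale (cc_algebra G) = (\<lambda>c f g. c * f g)"
  by (simp_all add: cc_algebra_def)

lemma full_cstar_simps:
  "sa_zero (full_cstar G) = (\<lambda>_ _ _. 0)"
  "sa_add (full_cstar G) = (\<lambda>a b \<rho> \<xi> i. a \<rho> \<xi> i + b \<rho> \<xi> i)"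
  "sa_scale (full_cstar G) = (\<lambda>c a \<rho> \<xi> i. c * a \<rho> \<xi> i)"
  "sa_mult (full_cstar G) = (\<lambda>a b \<rho>. a \<rho> \<circ> b \<rho>)"
  "sa_star (full_cstar G) = (\<lambda>a \<rho>. operator_adjoint (fst \<rho>) (a \<rho>))"
  "sa_norm (full_cstar G) = (\<lambda>a. SUP \<rho>\<in>cc_reps G. operator_norm (fst \<rho>) (a \<rho>))"
  by (simp_all add: full_cstar_def case_prod_beta fun_eq_iff)

lemma full_cstar_carrier_iff:
  "a \<in> carrier (full_cstar G) \<longleftrightarrow>
     (\<forall>\<rho>. \<rho> \<notin> cc_reps G \<longrightarrow> a \<rho> = (\<lambda>_ _. 0)) \<and>
     (\<forall>\<rho>\<in>cc_reps G. a \<rho> \<in> bounded_operators (fst \<rho>)) \<and>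
     (\<forall>e>0. \<exists>f\<in>cc_functions G. \<forall>\<rho>\<in>cc_reps G.
          operator_norm (fst \<rho>) (\<lambda>\<xi> i. a \<rho> \<xi> i - snd \<rho> f \<xi> i) \<le> e)"
  by (simp add: full_cstar_def case_prod_beta)

context
  fixes G :: "('g, 'x, 'm) gpd_scheme"
begin

lemma
  assumes "\<rho> \<in> cc_reps G"
  shows cc_rep_bop: "f \<in> cc_functions G \<Longrightarrow> snd \<rho> f \<in> bounded_operators (fst \<rho>)"
    and cc_rep_add: "f \<in> cc_functions G \<Longrightarrow> h \<in> cc_functions G \<Longrightarrow>
      snd \<rho> (\<lambda>g. f g + h g) = (\<lambda>\<xi> i. snd \<rho> f \<xi> i + snd \<rho> h \<xi> i)"
    and cc_rep_scale: "f \<in> cc_functions G \<Longrightarrow> snd \<rho> (\<lambda>g. c * f g) = (\<lambda>\<xi> i. c * snd \<rho> f \<xi> i)"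
    and cc_rep_mult: "f \<in> cc_functions G \<Longrightarrow> h \<in> cc_functions G \<Longrightarrow>
      snd \<rho> (sa_mult (cc_algebra G) f h) = snd \<rho> f \<circ> snd \<rho> h"
    and cc_rep_star: "f \<in> cc_functions G \<Longrightarrow>
      is_adjoint (fst \<rho>) (snd \<rho> f) (snd \<rho> (sa_star (cc_algebra G) f))"
  using assms unfolding cc_reps_def star_representation_def by auto

lemma zero_cc_rep: "({}, \<lambda>_ _ _. 0) \<in> cc_reps G"
  by (simp add: cc_reps_def star_representation_def is_adjoint_def o_def)

lemma full_cstar_off: "a \<in> carrier (full_cstar G) \<Longrightarrow> \<rho> \<notin> cc_reps G \<Longrightarrow> a \<rho> = (\<lambda>_ _. 0)"
  using full_cstar_carrier_iff[of a G] by blast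

lemma full_cstar_bop: "a \<in> carrier (full_cstar G) \<Longrightarrow> a \<rho> \<in> bounded_operators (fst \<rho>)"
  using full_cstar_carrier_iff[of a G] full_cstar_off[of a \<rho>] by (cases "\<rho> \<in> cc_reps G") simp_all

lemma full_cstar_approx:
  "a \<in> carrier (full_cstar G) \<Longrightarrow> 0 < e \<Longrightarrow> \<exists>f\<in>cc_functions G. \<forall>\<rho>\<in>cc_reps G.
     operator_norm (fst \<rho>) (\<lambda>\<xi> i. a \<rho> \<xi> i - snd \<rho> f \<xi> i) \<le> e"
  by (auto simp: full_cstar_carrier_iff)

lemma full_cstar_carrierI:
  assumes "\<And>\<rho>. \<rho> \<notin> cc_reps G \<Longrightarrow> a \<rho> = (\<lambda>_ _. 0)"
    and "\<And>\<rho>. \<rho> \<in> cc_reps G \<Longrightarrow> a \<rho> \<in> bounded_operators (fst \<rho>)"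
    and "\<And>e. 0 < e \<Longrightarrow> \<exists>f\<in>cc_functions G. \<forall>\<rho>\<in>cc_reps G.
          operator_norm (fst \<rho>) (\<lambda>\<xi> i. a \<rho> \<xi> i - snd \<rho> f \<xi> i) \<le> e"
  shows "a \<in> carrier (full_cstar G)"
  using assms by (auto simp: full_cstar_carrier_iff)

lemma operator_adjoint_zero: "operator_adjoint I (\<lambda>_ _. 0) = (\<lambda>_ _. 0)"
  by (rule operator_adjoint_eqI) (auto simp: is_adjoint_def)

text \<open>
  The only analytic input is that every function has bounded norm over all representations; the
  C*-identity and completeness are then inherited from the operator algebras of the single
  representations, uniformly.
\<close>

theorem cstar_algebra_full_cstar:
  assumes zero_cc: "(\<lambda>_. 0) \<in> cc_functions G"
    and add_cc: "\<And>f h. f \<in> cc_functions G \<Longrightarrow> h \<in> cc_functions G \<Longrightarrow> (\<lambda>g. f g + h g) \<in> cc_functions G"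
    and scale_cc: "\<And>c f. f \<in> cc_functions G \<Longrightarrow> (\<lambda>g. c * f g) \<in> cc_functions G"
    and mult_cc: "\<And>f h. f \<in> cc_functions G \<Longrightarrow> h \<in> cc_functions G \<Longrightarrow>
      sa_mult (cc_algebra G) f h \<in> cc_functions G"
    and star_cc: "\<And>f. f \<in> cc_functions G \<Longrightarrow> sa_star (cc_algebra G) f \<in> cc_functions G"
    and bounded_cc: "\<And>f. f \<in> cc_functions G \<Longrightarrow>
      \<exists>C. \<forall>\<rho>\<in>cc_reps G. operator_norm (fst \<rho>) (snd \<rho> f) \<le> C"
  shows "cstar_algebra (full_cstar G)"
proof -
  let ?A = "full_cstar G" and ?R = "cc_reps G"
  let ?n = "\<lambda>a \<rho>. operator_norm (fst \<rho>) (a \<rho>)"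
  have bounded: "\<exists>C\<ge>0. \<forall>\<rho>\<in>?R. ?n a \<rho> \<le> C" if a: "a \<in> carrier ?A" for a
  proof -
    obtain f where f: "f \<in> cc_functions G"
        "\<forall>\<rho>\<in>?R. operator_norm (fst \<rho>) (\<lambda>\<xi> i. a \<rho> \<xi> i - snd \<rho> f \<xi> i) \<le> 1"
      using full_cstar_approx[OF a, of 1] by auto
    obtain C where C: "\<forall>\<rho>\<in>?R. operator_norm (fst \<rho>) (snd \<rho> f) \<le> C" using bounded_cc[OF f(1)] by blast
    have "?n a \<rho> \<le> C + 1" if r: "\<rho> \<in> ?R" for \<rho>
      using operator_norm_triangle_sub[OF full_cstar_bop[OF a] cc_rep_bop[OF r f(1)]] f(2) C r by fastforce
    moreover from this have "0 \<le> C + 1"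
      using operator_norm_nonneg[OF full_cstar_bop[OF a]] zero_cc_rep order_trans by blast
    ultimately show ?thesis by blast
  qed
  have bdd: "bdd_above (?n a ` ?R)" if a: "a \<in> carrier ?A" for a
    using bounded[OF a] by (auto intro: bdd_aboveI)
  have norm_ge: "?n a \<rho> \<le> sa_norm ?A a" if "a \<in> carrier ?A" "\<rho> \<in> ?R" for a \<rho>
    unfolding full_cstar_simps by (rule cSUP_upper[OF that(2) bdd[OF that(1)]])
  have norm_le: "sa_norm ?A a \<le> C" if "\<And>\<rho>. \<rho> \<in> ?R \<Longrightarrow> ?n a \<rho> \<le> C" for a C
    unfolding full_cstar_simps using zero_cc_rep that by (intro cSUP_least) auto
  have norm_nonneg: "0 \<le> sa_norm ?A a" if a: "a \<in> carrier ?A" for a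
    using norm_ge[OF a zero_cc_rep] operator_norm_nonneg[OF full_cstar_bop[OF a]] by (meson order_trans)
  have zeroA: "sa_zero ?A \<in> carrier ?A"
  proof (rule full_cstar_carrierI)
    fix e :: real assume "0 < e"
    have "snd \<rho> (\<lambda>_. 0) = (\<lambda>_ _. 0)" if "\<rho> \<in> ?R" for \<rho>
      using cc_rep_scale[OF that zero_cc, of 0] by simp
    then have "\<forall>\<rho>\<in>?R. operator_norm (fst \<rho>) (\<lambda>\<xi> i. sa_zero ?A \<rho> \<xi> i - snd \<rho> (\<lambda>_. 0) \<xi> i) \<le> e"
      using \<open>0 < e\<close> by (simp add: full_cstar_simps)
    then show "\<exists>f\<in>cc_functions G. \<forall>\<rho>\<in>?R. operator_norm (fst \<rho>) (\<lambda>\<xi> i. sa_zero ?A \<rho> \<xi> i - snd \<rho> f \<xi> i) \<le> e"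
      using zero_cc by blast
  qed (simp_all add: full_cstar_simps)
  have addA: "sa_add ?A a b \<in> carrier ?A" if a: "a \<in> carrier ?A" and b: "b \<in> carrier ?A" for a b
  proof (rule full_cstar_carrierI)
    fix e :: real assume "0 < e"
    then have e: "0 < e / 2" by simp
    obtain f where f: "f \<in> cc_functions G" "\<forall>\<rho>\<in>?R. operator_norm (fst \<rho>) (\<lambda>\<xi> i. a \<rho> \<xi> i - snd \<rho> f \<xi> i) \<le> e / 2"
      using full_cstar_approx[OF a e] by auto
    obtain h where h: "h \<in> cc_functions G" "\<forall>\<rho>\<in>?R. operator_norm (fst \<rho>) (\<lambda>\<xi> i. b \<rho> \<xi> i - snd \<rho> h \<xi> i) \<le> e / 2"
      using full_cstar_approx[OF b e] by auto
    have "operator_norm (fst \<rho>) (\<lambda>\<xi> i. sa_add ?A a b \<rho> \<xi> i - snd \<rho> (\<lambda>g. f g + h g) \<xi> i) \<le> e" if r: "\<rho> \<in> ?R" for \<rho>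
    proof -
      have "(\<lambda>\<xi> i. sa_add ?A a b \<rho> \<xi> i - snd \<rho> (\<lambda>g. f g + h g) \<xi> i) =
          (\<lambda>\<xi> i. (a \<rho> \<xi> i - snd \<rho> f \<xi> i) + (b \<rho> \<xi> i - snd \<rho> h \<xi> i))"
        by (simp add: full_cstar_simps cc_rep_add[OF r f(1) h(1)] algebra_simps)
      then show ?thesis
        using operator_norm_plus[OF bop_minus[OF full_cstar_bop[OF a] cc_rep_bop[OF r f(1)]]
            bop_minus[OF full_cstar_bop[OF b] cc_rep_bop[OF r h(1)]]] f(2) h(2) r by fastforce
    qed
    then show "\<exists>f\<in>cc_functions G. \<forall>\<rho>\<in>?R. operator_norm (fst \<rho>) (\<lambda>\<xi> i. sa_add ?A a b \<rho> \<xi> i - snd \<rho> f \<xi> i) \<le> e"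
      using add_cc[OF f(1) h(1)] by blast
  qed (use bop_plus[OF full_cstar_bop[OF a] full_cstar_bop[OF b]] full_cstar_off[OF a] full_cstar_off[OF b]
       in \<open>simp_all add: full_cstar_simps\<close>)
  have scaleA: "sa_scale ?A c a \<in> carrier ?A" if a: "a \<in> carrier ?A" for c a
  proof (rule full_cstar_carrierI)
    fix e :: real assume e: "0 < e"
    obtain d where d: "0 < d" and cd: "cmod c * d \<le> e" using ex_small_factor[OF norm_ge_zero e] .
    obtain f where f: "f \<in> cc_functions G" "\<forall>\<rho>\<in>?R. operator_norm (fst \<rho>) (\<lambda>\<xi> i. a \<rho> \<xi> i - snd \<rho> f \<xi> i) \<le> d"
      using full_cstar_approx[OF a d] by auto
    have "operator_norm (fst \<rho>) (\<lambda>\<xi> i. sa_scale ?A c a \<rho> \<xi> i - snd \<rho> (\<lambda>g. c * f g) \<xi> i) \<le> e" if r: "\<rho> \<in> ?R" for \<rho>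
    proof -
      have "(\<lambda>\<xi> i. sa_scale ?A c a \<rho> \<xi> i - snd \<rho> (\<lambda>g. c * f g) \<xi> i) =
          (\<lambda>\<xi> i. c * (a \<rho> \<xi> i - snd \<rho> f \<xi> i))"
        by (simp add: full_cstar_simps cc_rep_scale[OF r f(1)] algebra_simps)
      then have "operator_norm (fst \<rho>) (\<lambda>\<xi> i. sa_scale ?A c a \<rho> \<xi> i - snd \<rho> (\<lambda>g. c * f g) \<xi> i) =
          cmod c * operator_norm (fst \<rho>) (\<lambda>\<xi> i. a \<rho> \<xi> i - snd \<rho> f \<xi> i)"
        using operator_norm_scaled[OF bop_minus[OF full_cstar_bop[OF a] cc_rep_bop[OF r f(1)]]] by simp
      also have "\<dots> \<le> cmod c * d" using f(2) r by (intro mult_left_mono) auto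
      finally show ?thesis using cd by simp
    qed
    then show "\<exists>f\<in>cc_functions G. \<forall>\<rho>\<in>?R. operator_norm (fst \<rho>) (\<lambda>\<xi> i. sa_scale ?A c a \<rho> \<xi> i - snd \<rho> f \<xi> i) \<le> e"
      using scale_cc[OF f(1), of c] by blast
  qed (use bop_scaled[OF full_cstar_bop[OF a]] full_cstar_off[OF a] in \<open>simp_all add: full_cstar_simps\<close>)
  have multA: "sa_mult ?A a b \<in> carrier ?A" if a: "a \<in> carrier ?A" and b: "b \<in> carrier ?A" for a b
  proof (rule full_cstar_carrierI)
    fix e :: real assume e: "0 < e"
    obtain C where C: "C \<ge> 0" "\<forall>\<rho>\<in>?R. ?n a \<rho> \<le> C" using bounded[OF a] by blast
    obtain d where d: "0 < d" and Cd: "C * d \<le> e / 2" using ex_small_factor[OF C(1), of "e / 2"] e by auto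
    obtain h where h: "h \<in> cc_functions G" "\<forall>\<rho>\<in>?R. operator_norm (fst \<rho>) (\<lambda>\<xi> i. b \<rho> \<xi> i - snd \<rho> h \<xi> i) \<le> d"
      using full_cstar_approx[OF b d] by auto
    obtain C0 where C0: "\<forall>\<rho>\<in>?R. operator_norm (fst \<rho>) (snd \<rho> h) \<le> C0" using bounded_cc[OF h(1)] by blast
    define C' where "C' = max C0 0"
    have C': "C' \<ge> 0" "\<forall>\<rho>\<in>?R. operator_norm (fst \<rho>) (snd \<rho> h) \<le> C'" using C0 by (auto simp: C'_def le_max_iff_disj)
    obtain d' where d': "0 < d'" and Cd': "d' * C' \<le> e / 2"
      using ex_small_factor[OF C'(1), of "e / 2"] e by (auto simp: mult.commute)
    obtain f where f: "f \<in> cc_functions G" "\<forall>\<rho>\<in>?R. operator_norm (fst \<rho>) (\<lambda>\<xi> i. a \<rho> \<xi> i - snd \<rho> f \<xi> i) \<le> d'"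
      using full_cstar_approx[OF a d'] by auto
    have "operator_norm (fst \<rho>) (\<lambda>\<xi> i. sa_mult ?A a b \<rho> \<xi> i - snd \<rho> (sa_mult (cc_algebra G) f h) \<xi> i) \<le> e" if r: "\<rho> \<in> ?R" for \<rho>
    proof -
      note aB = full_cstar_bop[OF a, of \<rho>] and bB = full_cstar_bop[OF b, of \<rho>]
      note fB = cc_rep_bop[OF r f(1)] and hB = cc_rep_bop[OF r h(1)]
      define X where "X = (\<lambda>\<xi> i. a \<rho> \<xi> i - snd \<rho> f \<xi> i)"
      define Y where "Y = (\<lambda>\<xi> i. b \<rho> \<xi> i - snd \<rho> h \<xi> i)"
      have X: "X \<in> bounded_operators (fst \<rho>)" and Y: "Y \<in> bounded_operators (fst \<rho>)"
        unfolding X_def Y_def by (rule bop_minus[OF aB fB], rule bop_minus[OF bB hB])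
      have "(\<lambda>\<xi> i. sa_mult ?A a b \<rho> \<xi> i - snd \<rho> (sa_mult (cc_algebra G) f h) \<xi> i) =
          (\<lambda>\<xi> i. (a \<rho> \<circ> Y) \<xi> i + (X \<circ> snd \<rho> h) \<xi> i)"
      proof
        fix \<xi>
        have "a \<rho> (Y \<xi>) = (\<lambda>i. a \<rho> (b \<rho> \<xi>) i - a \<rho> (snd \<rho> h \<xi>) i)"
          unfolding Y_def by (rule bop_diff[OF aB bop_range[OF bB] bop_range[OF hB]])
        then show "(\<lambda>i. sa_mult ?A a b \<rho> \<xi> i - snd \<rho> (sa_mult (cc_algebra G) f h) \<xi> i) =
          (\<lambda>i. (a \<rho> \<circ> Y) \<xi> i + (X \<circ> snd \<rho> h) \<xi> i)"
          by (simp add: full_cstar_simps cc_rep_mult[OF r f(1) h(1)] X_def)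
      qed
      then have "operator_norm (fst \<rho>) (\<lambda>\<xi> i. sa_mult ?A a b \<rho> \<xi> i - snd \<rho> (sa_mult (cc_algebra G) f h) \<xi> i)
          \<le> operator_norm (fst \<rho>) (a \<rho> \<circ> Y) + operator_norm (fst \<rho>) (X \<circ> snd \<rho> h)"
        using operator_norm_plus[OF bop_comp[OF aB Y] bop_comp[OF X hB]] by simp
      also have "\<dots> \<le> ?n a \<rho> * operator_norm (fst \<rho>) Y + operator_norm (fst \<rho>) X * operator_norm (fst \<rho>) (snd \<rho> h)"
        by (intro add_mono operator_norm_comp aB Y X hB)
      also have "\<dots> \<le> C * d + d' * C'"
        using C C' f(2) h(2) r d d' operator_norm_nonneg[OF aB] operator_norm_nonneg[OF Y]
          operator_norm_nonneg[OF X] operator_norm_nonneg[OF hB]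
        by (intro add_mono mult_mono) (auto simp: X_def Y_def)
      also have "\<dots> \<le> e" using Cd Cd' by linarith
      finally show ?thesis .
    qed
    then show "\<exists>f\<in>cc_functions G. \<forall>\<rho>\<in>?R. operator_norm (fst \<rho>) (\<lambda>\<xi> i. sa_mult ?A a b \<rho> \<xi> i - snd \<rho> f \<xi> i) \<le> e"
      using mult_cc[OF f(1) h(1)] by blast
  qed (use bop_comp[OF full_cstar_bop[OF a] full_cstar_bop[OF b]] full_cstar_off[OF a]
       in \<open>simp_all add: full_cstar_simps o_def\<close>)
  note adjB = operator_adjoint_bop[OF full_cstar_bop] and adj = operator_adjoint_adjoint[OF full_cstar_bop]
  have starA: "sa_star ?A a \<in> carrier ?A" if a: "a \<in> carrier ?A" for a
  proof (rule full_cstar_carrierI)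
    fix e :: real assume e: "0 < e"
    obtain f where f: "f \<in> cc_functions G" "\<forall>\<rho>\<in>?R. operator_norm (fst \<rho>) (\<lambda>\<xi> i. a \<rho> \<xi> i - snd \<rho> f \<xi> i) \<le> e"
      using full_cstar_approx[OF a e] by auto
    have "operator_norm (fst \<rho>) (\<lambda>\<xi> i. sa_star ?A a \<rho> \<xi> i - snd \<rho> (sa_star (cc_algebra G) f) \<xi> i) \<le> e" if r: "\<rho> \<in> ?R" for \<rho>
    proof -
      note aB = full_cstar_bop[OF a, of \<rho>] and fB = cc_rep_bop[OF r f(1)]
        and sB = cc_rep_bop[OF r star_cc[OF f(1)]]
      have "is_adjoint (fst \<rho>) (\<lambda>\<xi> i. a \<rho> \<xi> i + (-1) * snd \<rho> f \<xi> i)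
         (\<lambda>\<xi> i. operator_adjoint (fst \<rho>) (a \<rho>) \<xi> i + cnj (-1) * snd \<rho> (sa_star (cc_algebra G) f) \<xi> i)"
        by (intro is_adjoint_plus aB bop_scaled[OF fB] adjB[OF a] bop_scaled[OF sB] adj[OF a] is_adjoint_scaled cc_rep_star[OF r f(1)])
      then have "is_adjoint (fst \<rho>) (\<lambda>\<xi> i. a \<rho> \<xi> i - snd \<rho> f \<xi> i)
         (\<lambda>\<xi> i. operator_adjoint (fst \<rho>) (a \<rho>) \<xi> i - snd \<rho> (sa_star (cc_algebra G) f) \<xi> i)" by simp
      from operator_norm_adjoint_le[OF bop_minus[OF aB fB] bop_minus[OF adjB[OF a] sB] this]
      show ?thesis using f(2) r by (fastforce simp: full_cstar_simps)
    qed
    then show "\<exists>f\<in>cc_functions G. \<forall>\<rho>\<in>?R. operator_norm (fst \<rho>) (\<lambda>\<xi> i. sa_star ?A a \<rho> \<xi> i - snd \<rho> f \<xi> i) \<le> e"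
      using star_cc[OF f(1)] by blast
  qed (use adjB[OF a] full_cstar_off[OF a] in \<open>simp_all add: full_cstar_simps operator_adjoint_zero\<close>)
  have sub_eq: "sa_add ?A a (sa_scale ?A (-1) b) = (\<lambda>\<rho> \<xi> i. a \<rho> \<xi> i - b \<rho> \<xi> i)" for a b
    by (simp add: full_cstar_simps)
  show ?thesis
  proof (unfold_locales, goal_cases)
    case 1 show ?case by (rule zeroA)
  next case 2 then show ?case by (rule addA)
  next case 3 then show ?case by (rule scaleA)
  next case 4 then show ?case by (rule multA)
  next case 5 then show ?case by (rule starA)
  next case 6 show ?case by (simp add: full_cstar_simps add.assoc)
  next case 7 show ?case by (simp add: full_cstar_simps add.commute)
  next case 8 show ?case by (simp add: full_cstar_simps)
  next case 9 show ?case by (simp add: full_cstar_simps)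
  next case 10 show ?case by (simp add: full_cstar_simps)
  next case 11 show ?case by (simp add: full_cstar_simps mult.assoc)
  next case 12 show ?case by (simp add: full_cstar_simps distrib_right)
  next case 13 show ?case by (simp add: full_cstar_simps distrib_left)
  next case 14 show ?case by (simp add: full_cstar_simps o_assoc)
  next case 15 show ?case by (simp add: full_cstar_simps o_def)
  next case (16 x y z)
    show ?case
      unfolding full_cstar_simps o_def
      using bop_add[OF full_cstar_bop[OF 16(1)] bop_range[OF full_cstar_bop[OF 16(2)]] bop_range[OF full_cstar_bop[OF 16(3)]]]
      by (intro ext) metis
  next case 17 show ?case by (simp add: full_cstar_simps o_def)
  next case (18 x y c)
    show ?case
      unfolding full_cstar_simps o_def
      using bop_scale[OF full_cstar_bop[OF 18(1)] bop_range[OF full_cstar_bop[OF 18(2)]]]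
      by (intro ext) metis
  next case (19 x)
    show ?case unfolding full_cstar_simps
      by (rule ext, rule operator_adjoint_eqI[OF full_cstar_bop[OF 19] is_adjoint_sym[OF adj[OF 19]]])
  next case (20 x y)
    note B = full_cstar_bop[OF 20(1)] full_cstar_bop[OF 20(2)] adjB[OF 20(1)] adjB[OF 20(2)]
    show ?case unfolding full_cstar_simps
      by (rule ext, rule operator_adjoint_eqI[OF bop_plus[OF B(3,4)] is_adjoint_plus[OF B adj[OF 20(1)] adj[OF 20(2)]]])
  next case (21 x c)
    show ?case unfolding full_cstar_simps
      by (rule ext, rule operator_adjoint_eqI[OF bop_scaled[OF adjB[OF 21]] is_adjoint_scaled[OF adj[OF 21]]])
  next case (22 x y)
    note B = full_cstar_bop[OF 22(1)] full_cstar_bop[OF 22(2)] adjB[OF 22(1)] adjB[OF 22(2)]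
    show ?case unfolding full_cstar_simps
      by (rule ext, rule operator_adjoint_eqI[OF bop_comp[OF B(4,3)] is_adjoint_comp[OF B(2,3) adj[OF 22(1)] adj[OF 22(2)]]])
  next case 23 then show ?case by (rule norm_nonneg)
  next case (24 x)
    show ?case
    proof
      assume 0: "sa_norm ?A x = 0"
      have "x \<rho> = (\<lambda>_ _. 0)" for \<rho>
      proof (cases "\<rho> \<in> ?R")
        case True
        then show ?thesis
          using norm_ge[OF 24 True] 0 operator_norm_nonneg[OF full_cstar_bop[OF 24]]
          by (intro operator_norm_eq_0[OF full_cstar_bop[OF 24]]) (simp add: antisym)
      qed (rule full_cstar_off[OF 24])
      then show "x = sa_zero ?A" by (auto simp: full_cstar_simps)
    next
      assume "x = sa_zero ?A"
      then have "sa_norm ?A x \<le> 0" by (intro norm_le) (simp add: full_cstar_simps)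
      then show "sa_norm ?A x = 0" using norm_nonneg[OF 24] by simp
    qed
  next case (25 x y)
    show ?case
    proof (rule norm_le)
      fix \<rho> assume r: "\<rho> \<in> ?R"
      show "?n (sa_add ?A x y) \<rho> \<le> sa_norm ?A x + sa_norm ?A y"
        using operator_norm_plus[OF full_cstar_bop[OF 25(1), of \<rho>] full_cstar_bop[OF 25(2)]]
          norm_ge[OF 25(1) r] norm_ge[OF 25(2) r] unfolding full_cstar_simps(2) by linarith
    qed
  next case (26 x c)
    have eq: "?n (sa_scale ?A c x) \<rho> = cmod c * ?n x \<rho>" for \<rho>
      unfolding full_cstar_simps(3) by (rule operator_norm_scaled[OF full_cstar_bop[OF 26]])
    show ?case
    proof (rule antisym)
      show "sa_norm ?A (sa_scale ?A c x) \<le> cmod c * sa_norm ?A x"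
        unfolding eq[symmetric] by (rule norm_le) (simp add: eq mult_left_mono norm_ge[OF 26])
      show "cmod c * sa_norm ?A x \<le> sa_norm ?A (sa_scale ?A c x)"
      proof (cases "c = 0")
        case False
        have "sa_norm ?A x \<le> sa_norm ?A (sa_scale ?A c x) / cmod c"
          using norm_ge[OF scaleA[OF 26, of c]] False by (intro norm_le) (simp add: eq field_simps)
        then show ?thesis using False by (simp add: field_simps)
      qed (use norm_nonneg[OF scaleA[OF 26]] in simp)
    qed
  next case (27 x y)
    show ?case
    proof (rule norm_le)
      fix \<rho> assume r: "\<rho> \<in> ?R"
      have "?n (sa_mult ?A x y) \<rho> \<le> ?n x \<rho> * ?n y \<rho>"
        unfolding full_cstar_simps(4) by (rule operator_norm_comp[OF full_cstar_bop[OF 27(1)] full_cstar_bop[OF 27(2)]])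
      also have "\<dots> \<le> sa_norm ?A x * sa_norm ?A y"
        by (intro mult_mono norm_ge 27 r norm_nonneg operator_norm_nonneg full_cstar_bop)
      finally show "?n (sa_mult ?A x y) \<rho> \<le> sa_norm ?A x * sa_norm ?A y" .
    qed
  next case (28 x)
    have eq: "?n (sa_mult ?A (sa_star ?A x) x) \<rho> = (?n x \<rho>)\<^sup>2" for \<rho>
      unfolding full_cstar_simps(4,5)
      by (rule operator_norm_adjoint_comp[OF full_cstar_bop[OF 28] adjB[OF 28] adj[OF 28]])
    have nn: "0 \<le> ?n x \<rho>" for \<rho> by (rule operator_norm_nonneg[OF full_cstar_bop[OF 28]])
    show ?case
    proof (rule antisym)
      show "sa_norm ?A (sa_mult ?A (sa_star ?A x) x) \<le> (sa_norm ?A x)\<^sup>2"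
        by (rule norm_le) (simp add: eq power_mono nn norm_ge[OF 28])
      have "sa_norm ?A x \<le> sqrt (sa_norm ?A (sa_mult ?A (sa_star ?A x) x))"
        using norm_ge[OF multA[OF starA[OF 28] 28]] by (intro norm_le real_le_rsqrt) (simp add: eq)
      then show "(sa_norm ?A x)\<^sup>2 \<le> sa_norm ?A (sa_mult ?A (sa_star ?A x) x)"
        using norm_nonneg[OF 28] norm_nonneg[OF multA[OF starA[OF 28] 28]]
        by (metis power_mono real_sqrt_pow2)
    qed
  next case (29 s)
    let ?d = "\<lambda>\<rho> m n. operator_norm (fst \<rho>) (\<lambda>\<xi> i. s m \<rho> \<xi> i - s n \<rho> \<xi> i)"
    have Cauchy: "\<exists>N. \<forall>\<rho>\<in>?R. \<forall>m\<ge>N. \<forall>n\<ge>N. ?d \<rho> m n \<le> e" if e: "0 < e" for e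
    proof -
      obtain N where N: "\<forall>m\<ge>N. \<forall>n\<ge>N. sa_norm ?A (sa_add ?A (s m) (sa_scale ?A (-1) (s n))) < e"
        using 29(2)[OF e] by blast
      have "?d \<rho> m n \<le> e" if "\<rho> \<in> ?R" "m \<ge> N" "n \<ge> N" for \<rho> m n
        using norm_ge[OF addA[OF 29(1) scaleA[OF 29(1)]] that(1), of m "-1" n] N that(2,3)
        unfolding sub_eq by fastforce
      then show ?thesis by blast
    qed
    let ?lim = "\<lambda>\<rho> L. L \<in> bounded_operators (fst \<rho>) \<and> (\<forall>e N n. (\<forall>m\<ge>N. \<forall>n\<ge>N. ?d \<rho> m n \<le> e) \<longrightarrow> N \<le> n \<longrightarrow>
        operator_norm (fst \<rho>) (\<lambda>\<xi> i. L \<xi> i - s n \<rho> \<xi> i) \<le> e)"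
    have "\<forall>\<rho>\<in>?R. \<exists>L. ?lim \<rho> L"
    proof
      fix \<rho> assume r: "\<rho> \<in> ?R"
      show "\<exists>L. ?lim \<rho> L"
      proof (rule operator_Cauchy_limit[of "\<lambda>n. s n \<rho>" "fst \<rho>"])
        show "s n \<rho> \<in> bounded_operators (fst \<rho>)" for n by (rule full_cstar_bop[OF 29(1)])
        show "\<exists>N. \<forall>m\<ge>N. \<forall>n\<ge>N. ?d \<rho> m n \<le> e" if "0 < e" for e using Cauchy[OF that] r by blast
      qed blast
    qed
    then obtain L where L': "\<forall>\<rho>\<in>?R. ?lim \<rho> (L \<rho>)" by (rule exE[OF bchoice])
    have L: "L \<rho> \<in> bounded_operators (fst \<rho>)" if "\<rho> \<in> ?R" for \<rho> using L' that by blast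
    have lim: "operator_norm (fst \<rho>) (\<lambda>\<xi> i. L \<rho> \<xi> i - s n \<rho> \<xi> i) \<le> e"
      if "\<rho> \<in> ?R" "\<forall>m\<ge>N. \<forall>n\<ge>N. ?d \<rho> m n \<le> e" "N \<le> n" for \<rho> e N n
      using conjunct2[OF bspec[OF L' that(1)]] that(2,3) by blast
    define x where "x \<rho> = (if \<rho> \<in> ?R then L \<rho> else (\<lambda>_ _. 0))" for \<rho>
    have conv: "\<exists>N. \<forall>n\<ge>N. \<forall>\<rho>\<in>?R. operator_norm (fst \<rho>) (\<lambda>\<xi> i. x \<rho> \<xi> i - s n \<rho> \<xi> i) \<le> e" if e: "0 < e" for e
    proof -
      obtain N where N: "\<forall>\<rho>\<in>?R. \<forall>m\<ge>N. \<forall>n\<ge>N. ?d \<rho> m n \<le> e" using Cauchy[OF e] by blast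
      have "operator_norm (fst \<rho>) (\<lambda>\<xi> i. x \<rho> \<xi> i - s n \<rho> \<xi> i) \<le> e" if "N \<le> n" "\<rho> \<in> ?R" for n \<rho>
        using lim[OF that(2) _ that(1)] N that(2) by (simp add: x_def)
      then show ?thesis by blast
    qed
    have x: "x \<in> carrier ?A"
    proof (rule full_cstar_carrierI)
      fix e :: real assume "0 < e"
      then have e: "0 < e / 2" by simp
      obtain N where N: "\<forall>\<rho>\<in>?R. operator_norm (fst \<rho>) (\<lambda>\<xi> i. x \<rho> \<xi> i - s N \<rho> \<xi> i) \<le> e / 2"
        using conv[OF e] by blast
      obtain f where f: "f \<in> cc_functions G" "\<forall>\<rho>\<in>?R. operator_norm (fst \<rho>) (\<lambda>\<xi> i. s N \<rho> \<xi> i - snd \<rho> f \<xi> i) \<le> e / 2"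
        using full_cstar_approx[OF 29(1)[of N] e] by auto
      have "operator_norm (fst \<rho>) (\<lambda>\<xi> i. x \<rho> \<xi> i - snd \<rho> f \<xi> i) \<le> e" if r: "\<rho> \<in> ?R" for \<rho>
      proof -
        have xB: "x \<rho> \<in> bounded_operators (fst \<rho>)" using L[OF r] r by (simp add: x_def)
        show ?thesis
          using operator_norm_triangle_mid[OF xB full_cstar_bop[OF 29(1)[of N]] cc_rep_bop[OF r f(1)]]
            bspec[OF N r] bspec[OF f(2) r] by linarith
      qed
      then show "\<exists>f\<in>cc_functions G. \<forall>\<rho>\<in>?R. operator_norm (fst \<rho>) (\<lambda>\<xi> i. x \<rho> \<xi> i - snd \<rho> f \<xi> i) \<le> e"
        using f(1) by blast
    qed (use L in \<open>auto simp: x_def\<close>)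
    have "(\<lambda>n. sa_norm ?A (sa_add ?A (s n) (sa_scale ?A (-1) x))) \<longlonglongrightarrow> 0"
    proof (rule LIMSEQ_I)
      fix r :: real assume r: "0 < r"
      obtain N where N: "\<forall>n\<ge>N. \<forall>\<rho>\<in>?R. operator_norm (fst \<rho>) (\<lambda>\<xi> i. x \<rho> \<xi> i - s n \<rho> \<xi> i) \<le> r / 2"
        using conv[of "r / 2"] r by auto
      have "norm (sa_norm ?A (sa_add ?A (s n) (sa_scale ?A (-1) x)) - 0) < r" if n: "n \<ge> N" for n
      proof -
        have "sa_norm ?A (sa_add ?A (s n) (sa_scale ?A (-1) x)) \<le> r / 2"
        proof (rule norm_le)
          fix \<rho> assume "\<rho> \<in> ?R"
          then have "operator_norm (fst \<rho>) (\<lambda>\<xi> i. x \<rho> \<xi> i - s n \<rho> \<xi> i) \<le> r / 2" using N n by blast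
          then show "?n (sa_add ?A (s n) (sa_scale ?A (-1) x)) \<rho> \<le> r / 2"
            unfolding sub_eq
            using operator_norm_minus_commute[OF full_cstar_bop[OF x, of \<rho>] full_cstar_bop[OF 29(1)[of n]]]
            by simp
        qed
        then show ?thesis using norm_nonneg[OF addA[OF 29(1)[of n] scaleA[OF x, of "-1"]]] r by simp
      qed
      then show "\<exists>N. \<forall>n\<ge>N. norm (sa_norm ?A (sa_add ?A (s n) (sa_scale ?A (-1) x)) - 0) < r" by blast
    qed
    with x show ?case by blast
  qed
qed

end

section \<open>Finitely generated nilpotent groups as iterated central cyclic extensions\<close>

context group
begin

definition commut :: "'a \<Rightarrow> 'a \<Rightarrow> 'a" where
  "commut x y = x \<otimes> y \<otimes> inv x \<otimes> inv y"

definition central_mod :: "'a set \<Rightarrow> 'a \<Rightarrow> bool" where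
  "central_mod N t \<longleftrightarrow> (\<forall>x\<in>carrier G. commut x t \<in> N)"

definition cyclic_ext :: "'a set \<Rightarrow> 'a \<Rightarrow> 'a set" where
  "cyclic_ext N t = {h \<otimes> t [^] i | h (i :: int). h \<in> N}"

lemma inv_mult_cancel_left:
  "x \<in> carrier G \<Longrightarrow> y \<in> carrier G \<Longrightarrow> inv x \<otimes> (x \<otimes> y) = y"
  "x \<in> carrier G \<Longrightarrow> y \<in> carrier G \<Longrightarrow> x \<otimes> (inv x \<otimes> y) = y"
  by (simp_all flip: m_assoc)

lemmas group_word = m_assoc inv_mult_group inv_mult_cancel_left

lemma commut_closed [simp]: "x \<in> carrier G \<Longrightarrow> y \<in> carrier G \<Longrightarrow> commut x y \<in> carrier G"
  by (simp add: commut_def)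

lemma inv_commut: "x \<in> carrier G \<Longrightarrow> y \<in> carrier G \<Longrightarrow> inv (commut x y) = commut y x"
  by (simp add: commut_def group_word)

lemma normalD:
  assumes "N \<lhd> G"
  shows normal_subgroup: "subgroup N G"
    and normal_sub: "N \<subseteq> carrier G"
    and normal_conj: "x \<in> carrier G \<Longrightarrow> h \<in> N \<Longrightarrow> x \<otimes> h \<otimes> inv x \<in> N"
    and normal_conj': "x \<in> carrier G \<Longrightarrow> h \<in> N \<Longrightarrow> inv x \<otimes> h \<otimes> x \<in> N"
proof -
  show "subgroup N G" using assms by (rule normal_imp_subgroup)
  then show "N \<subseteq> carrier G" by (rule subgroup.subset)
  show "x \<in> carrier G \<Longrightarrow> h \<in> N \<Longrightarrow> x \<otimes> h \<otimes> inv x \<in> N" by (rule normal.inv_op_closed2[OF assms])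
  show "x \<in> carrier G \<Longrightarrow> h \<in> N \<Longrightarrow> inv x \<otimes> h \<otimes> x \<in> N" by (rule normal.inv_op_closed1[OF assms])
qed

lemma normal_commut_sym:
  "N \<lhd> G \<Longrightarrow> x \<in> carrier G \<Longrightarrow> y \<in> carrier G \<Longrightarrow> commut x y \<in> N \<Longrightarrow> commut y x \<in> N"
  using subgroup.m_inv_closed[OF normal_subgroup] inv_commut by metis

lemma normalI_commut:
  assumes Q: "subgroup Q G" and c: "\<And>q y. q \<in> Q \<Longrightarrow> y \<in> carrier G \<Longrightarrow> commut q y \<in> Q"
  shows "Q \<lhd> G"
  unfolding normal_inv_iff
proof (intro conjI ballI Q)
  fix y q assume y: "y \<in> carrier G" and q: "q \<in> Q"
  have qc: "q \<in> carrier G" using Q q subgroup.subset by blast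
  have "q \<otimes> commut (inv q) y \<in> Q"
    by (intro subgroup.m_closed[OF Q] q c subgroup.m_inv_closed[OF Q] y)
  moreover have "q \<otimes> commut (inv q) y = y \<otimes> q \<otimes> inv y"
    using qc y by (simp add: commut_def group_word)
  ultimately show "y \<otimes> q \<otimes> inv y \<in> Q" by simp
qed

text \<open>
  The centralizer of \<open>x N\<close> in the quotient by \<open>N\<close>, pulled back to the group.  Arguments about central
  elements of quotients are carried out through these subgroups, without forming the quotients.
\<close>

lemma subgroup_centralizer_mod:
  assumes N: "N \<lhd> G" and x: "x \<in> carrier G"
  shows "subgroup {y \<in> carrier G. commut y x \<in> N} G"
proof
  note S = normal_subgroup[OF N]
  fix y z assume "y \<in> {y \<in> carrier G. commut y x \<in> N}" "z \<in> {y \<in> carrier G. commut y x \<in> N}"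
  then have y: "y \<in> carrier G" "commut y x \<in> N" and z: "z \<in> carrier G" "commut z x \<in> N" by auto
  have "commut (y \<otimes> z) x = (y \<otimes> commut z x \<otimes> inv y) \<otimes> commut y x"
    using x y(1) z(1) by (simp add: commut_def group_word)
  then show "y \<otimes> z \<in> {y \<in> carrier G. commut y x \<in> N}"
    using y z subgroup.m_closed[OF S normal_conj[OF N y(1) z(2)] y(2)] by simp
next
  note S = normal_subgroup[OF N]
  fix y assume "y \<in> {y \<in> carrier G. commut y x \<in> N}"
  then have y: "y \<in> carrier G" "commut y x \<in> N" by auto
  have "commut (inv y) x = inv y \<otimes> inv (commut y x) \<otimes> y"
    using x y(1) by (simp add: commut_def group_word)
  then show "inv y \<in> {y \<in> carrier G. commut y x \<in> N}"
    using y normal_conj'[OF N y(1) subgroup.m_inv_closed[OF S y(2)]] by simp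
next
  show "\<one> \<in> {y \<in> carrier G. commut y x \<in> N}"
    using x subgroup.one_closed[OF normal_subgroup[OF N]] by (simp add: commut_def)
qed auto

lemma central_mod_int_pow:
  assumes N: "N \<lhd> G" and t: "t \<in> carrier G" "central_mod N t"
  shows "central_mod N (t [^] (i :: int))"
  unfolding central_mod_def
proof
  fix x assume x: "x \<in> carrier G"
  have "t \<in> {y \<in> carrier G. commut y x \<in> N}"
    using t x normal_commut_sym[OF N] by (auto simp: central_mod_def)
  then have "t [^] i \<in> {y \<in> carrier G. commut y x \<in> N}"
    by (rule subgroup_int_pow_closed[OF subgroup_centralizer_mod[OF N x]])
  then show "commut x (t [^] i) \<in> N" using normal_commut_sym[OF N] x by blast
qed

lemma cyclic_ext_normal:
  assumes N: "N \<lhd> G" and t: "t \<in> carrier G" "central_mod N t"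
  shows "cyclic_ext N t \<lhd> G"
proof -
  note S = normal_subgroup[OF N] and sub = normal_sub[OF N]
  have "subgroup (cyclic_ext N t) G"
  proof
    show "cyclic_ext N t \<subseteq> carrier G" using sub t by (auto simp: cyclic_ext_def)
    have "\<one> \<otimes> t [^] (0 :: int) \<in> cyclic_ext N t"
      unfolding cyclic_ext_def using subgroup.one_closed[OF S] by blast
    then show "\<one> \<in> cyclic_ext N t" using t by simp
    fix x assume "x \<in> cyclic_ext N t"
    then obtain h and i :: int where x: "x = h \<otimes> t [^] i" "h \<in> N" "h \<in> carrier G"
      using sub by (auto simp: cyclic_ext_def)
    have "inv x = (inv (t [^] i) \<otimes> inv h \<otimes> t [^] i) \<otimes> t [^] (- i)"
      using x t by (simp add: group_word int_pow_neg)
    then show "inv x \<in> cyclic_ext N t"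
      using normal_conj'[OF N _ subgroup.m_inv_closed[OF S x(2)], of "t [^] i"] t
      unfolding cyclic_ext_def by blast
    fix y assume "y \<in> cyclic_ext N t"
    then obtain k and j :: int where y: "y = k \<otimes> t [^] j" "k \<in> N" "k \<in> carrier G"
      using sub by (auto simp: cyclic_ext_def)
    have "x \<otimes> y = h \<otimes> (t [^] i \<otimes> k \<otimes> inv (t [^] i)) \<otimes> t [^] (i + j)"
      using x y t by (simp add: group_word int_pow_mult)
    moreover have "h \<otimes> (t [^] i \<otimes> k \<otimes> inv (t [^] i)) \<in> N"
      using normal_conj[OF N _ y(2), of "t [^] i"] t by (intro subgroup.m_closed[OF S x(2)]) auto
    ultimately show "x \<otimes> y \<in> cyclic_ext N t"
      unfolding cyclic_ext_def by blast
  qed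
  moreover have "y \<otimes> q \<otimes> inv y \<in> cyclic_ext N t" if y: "y \<in> carrier G" and q0: "q \<in> cyclic_ext N t" for y q
  proof -
    obtain h and i :: int where q: "q = h \<otimes> t [^] i" "h \<in> N" "h \<in> carrier G"
      using q0 sub by (auto simp: cyclic_ext_def)
    have "y \<otimes> q \<otimes> inv y = (y \<otimes> h \<otimes> inv y) \<otimes> commut y (t [^] i) \<otimes> t [^] i"
      using q y t by (simp add: group_word commut_def)
    moreover have "(y \<otimes> h \<otimes> inv y) \<otimes> commut y (t [^] i) \<in> N"
      using central_mod_int_pow[OF N t, of i] y
      by (intro subgroup.m_closed[OF S] normal_conj[OF N y q(2)]) (auto simp: central_mod_def)
    ultimately show ?thesis unfolding cyclic_ext_def by blast
  qed
  ultimately show ?thesis by (simp add: normal_inv_iff)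
qed

lemma
  assumes N: "N \<lhd> G" and t: "t \<in> carrier G"
  shows cyclic_ext_incl: "N \<subseteq> cyclic_ext N t" and cyclic_ext_gen: "t \<in> cyclic_ext N t"
proof -
  have "h \<in> cyclic_ext N t" if "h \<in> N" for h
  proof -
    have "h = h \<otimes> t [^] (0 :: int)" using that normal_sub[OF N] by auto
    then show ?thesis unfolding cyclic_ext_def using that by blast
  qed
  then show "N \<subseteq> cyclic_ext N t" by blast
  have "t = \<one> \<otimes> t [^] (1 :: int)" using t by (simp add: int_pow_1)
  then show "t \<in> cyclic_ext N t"
    unfolding cyclic_ext_def using subgroup.one_closed[OF normal_subgroup[OF N]] by blast
qed

lemma cyclic_ext_least:
  assumes K: "subgroup K G" "N \<subseteq> K" "t \<in> K"
  shows "cyclic_ext N t \<subseteq> K"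
  unfolding cyclic_ext_def
  using subgroup.m_closed[OF K(1)] subgroup_int_pow_closed[OF K(1,3)] K(2) by blast

subsection \<open>The lower central series\<close>

lemma lower_central_series_subset: "lower_central_series G k \<subseteq> carrier G"
  and lower_central_series_normal: "lower_central_series G k \<lhd> G"
  and lower_central_series_Suc_subset: "lower_central_series G (Suc k) \<subseteq> lower_central_series G k"
  and lower_central_series_commut:
    "g \<in> lower_central_series G k \<Longrightarrow> x \<in> carrier G \<Longrightarrow> commut g x \<in> lower_central_series G (Suc k)"
proof -
  have main: "lower_central_series G k \<subseteq> carrier G \<and> lower_central_series G k \<lhd> G \<and>
     lower_central_series G (Suc k) \<subseteq> lower_central_series G k \<and>
     (\<forall>g\<in>lower_central_series G k. \<forall>x\<in>carrier G. commut g x \<in> lower_central_series G (Suc k))" for k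
  proof -
    have step: "lower_central_series G (Suc k) \<subseteq> lower_central_series G k \<and>
      (\<forall>g\<in>lower_central_series G k. \<forall>x\<in>carrier G. commut g x \<in> lower_central_series G (Suc k))"
      if N: "lower_central_series G k \<lhd> G" for k
    proof (intro conjI ballI)
      note S = normal_subgroup[OF N]
      have "g \<otimes> h \<otimes> inv g \<otimes> inv h \<in> lower_central_series G k"
        if g: "g \<in> lower_central_series G k" and h: "h \<in> carrier G" for g h
      proof -
        have "g \<in> carrier G" using g normal_sub[OF N] by blast
        then have "g \<otimes> h \<otimes> inv g \<otimes> inv h = g \<otimes> (h \<otimes> inv g \<otimes> inv h)" using h by (simp add: group_word)
        then show ?thesis
          using subgroup.m_closed[OF S g normal_conj[OF N h subgroup.m_inv_closed[OF S g]]] by simp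
      qed
      then show "lower_central_series G (Suc k) \<subseteq> lower_central_series G k"
        unfolding lower_central_series.simps by (intro generate_subgroup_incl S) auto
      fix g x assume "g \<in> lower_central_series G k" "x \<in> carrier G"
      then show "commut g x \<in> lower_central_series G (Suc k)"
        unfolding lower_central_series.simps commut_def by (intro generate.incl) blast
    qed
    have N: "lower_central_series G k \<lhd> G"
    proof (induction k)
      case 0 show ?case by (simp add: normal_inv_iff subgroup_self)
    next
      case (Suc k)
      note st = step[OF Suc]
      have sub: "{g \<otimes> h \<otimes> inv g \<otimes> inv h |g h. g \<in> lower_central_series G k \<and> h \<in> carrier G} \<subseteq> carrier G"
        using normal_sub[OF Suc] by auto
      show ?case
      proof (rule normalI_commut)
        show "subgroup (lower_central_series G (Suc k)) G"
          unfolding lower_central_series.simps by (rule generate_is_subgroup[OF sub])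
        show "commut q y \<in> lower_central_series G (Suc k)"
          if "q \<in> lower_central_series G (Suc k)" "y \<in> carrier G" for q y
          using st that by blast
      qed
    qed
    with step[OF N] normal_sub[OF N] show ?thesis by blast
  qed
  from main[of k] show "lower_central_series G k \<subseteq> carrier G" "lower_central_series G k \<lhd> G"
    "lower_central_series G (Suc k) \<subseteq> lower_central_series G k"
    "g \<in> lower_central_series G k \<Longrightarrow> x \<in> carrier G \<Longrightarrow> commut g x \<in> lower_central_series G (Suc k)"
    by blast+
qed

text \<open>
  Modulo the next term of the series the commutator is bimultiplicative, so commutators of
  generators generate; this is phrased through centralizers modulo the subgroup \<open>Q\<close> that is to be
  shown to be everything.
\<close>

lemma lower_central_series_fin_gen:
  assumes S: "finite S" "S \<subseteq> carrier G" "carrier G = generate G S"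
  shows "\<exists>T. finite T \<and> T \<subseteq> lower_central_series G k \<and>
    lower_central_series G k = generate G (lower_central_series G (Suc k) \<union> T)"
proof (induction k)
  case 0
  have "generate G S \<subseteq> generate G (lower_central_series G (Suc 0) \<union> S)" by (intro mono_generate) auto
  moreover have "generate G (lower_central_series G (Suc 0) \<union> S) \<subseteq> carrier G"
    by (intro generate_incl) (use S(2) lower_central_series_subset in blast)
  ultimately show ?case using S by (intro exI[of _ S]) (auto simp del: lower_central_series.simps simp: lower_central_series.simps(1))
next
  case (Suc k)
  let ?L = "lower_central_series G"
  obtain T where T: "finite T" "T \<subseteq> ?L k" "?L k = generate G (?L (Suc k) \<union> T)" using Suc by blast
  define T' where "T' = (\<lambda>(t, s). commut t s) ` (T \<times> S)"
  define Q where "Q = generate G (?L (Suc (Suc k)) \<union> T')"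
  have TL: "T' \<subseteq> ?L (Suc k)" unfolding T'_def using T(2) S(2) lower_central_series_commut[of _ k]
    by (auto simp del: lower_central_series.simps)
  have sub: "?L (Suc (Suc k)) \<union> T' \<subseteq> carrier G"
    using TL lower_central_series_subset[of "Suc k"] lower_central_series_subset[of "Suc (Suc k)"] by blast
  have Qs: "subgroup Q G" unfolding Q_def by (rule generate_is_subgroup[OF sub])
  have LQ: "?L (Suc (Suc k)) \<subseteq> Q" and TQ: "T' \<subseteq> Q" unfolding Q_def by (auto intro: generate.incl)
  have QL: "Q \<subseteq> ?L (Suc k)"
    unfolding Q_def
    by (intro generate_subgroup_incl normal_subgroup lower_central_series_normal)
      (use TL lower_central_series_Suc_subset in blast)
  \<comment> \<open>Commutators of elements of \<open>Q\<close> already lie in the next term of the series, hence in \<open>Q\<close>.\<close>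
  have Q: "Q \<lhd> G"
    by (rule normalI_commut[OF Qs]) (use LQ QL lower_central_series_commut in blast)
  have 1: "commut x t \<in> Q" if t: "t \<in> T" and x: "x \<in> carrier G" for t x
  proof -
    have tc: "t \<in> carrier G" using t T(2) lower_central_series_subset by blast
    have "s \<in> {y \<in> carrier G. commut y t \<in> Q}" if s: "s \<in> S" for s
    proof -
      have "commut t s \<in> Q" using TQ t s unfolding T'_def by auto
      then show ?thesis using normal_commut_sym[OF Q tc, of s] s S(2) by auto
    qed
    then have "generate G S \<subseteq> {y \<in> carrier G. commut y t \<in> Q}"
      by (intro generate_subgroup_incl subgroup_centralizer_mod[OF Q tc]) blast
    then show ?thesis using x S(3) by blast
  qed
  have 2: "commut y x \<in> Q" if y: "y \<in> ?L k" and x: "x \<in> carrier G" for y x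
  proof -
    have "?L (Suc k) \<union> T \<subseteq> {y \<in> carrier G. commut y x \<in> Q}"
    proof
      fix z assume z: "z \<in> ?L (Suc k) \<union> T"
      then have zc: "z \<in> carrier G" using T(2) lower_central_series_subset by blast
      have "commut z x \<in> Q"
      proof (cases "z \<in> T")
        case True then show ?thesis using 1[OF _ x] normal_commut_sym[OF Q x zc] by blast
      next
        case False
        then show ?thesis using z lower_central_series_commut[of z "Suc k" x] LQ x by blast
      qed
      with zc show "z \<in> {y \<in> carrier G. commut y x \<in> Q}" by blast
    qed
    then have "generate G (?L (Suc k) \<union> T) \<subseteq> {y \<in> carrier G. commut y x \<in> Q}"
      by (intro generate_subgroup_incl subgroup_centralizer_mod[OF Q x])
    then show ?thesis using y T(3) by blast
  qed
  have "?L (Suc k) \<subseteq> Q"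
    unfolding lower_central_series.simps(2)[of G k]
    by (intro generate_subgroup_incl Qs) (use 2 in \<open>auto simp: commut_def\<close>)
  then have "?L (Suc k) = Q" using QL by blast
  then show ?case using T(1) S(1) TL unfolding Q_def T'_def by (intro exI[of _ T'] conjI) (auto simp: T'_def)
qed

lemma central_generators_induct:
  assumes N: "N \<lhd> G" "P N" and T: "finite T" "\<And>t. t \<in> T \<Longrightarrow> t \<in> carrier G \<and> central_mod N t"
    and step: "\<And>H t. H \<lhd> G \<Longrightarrow> P H \<Longrightarrow> t \<in> carrier G \<Longrightarrow> central_mod H t \<Longrightarrow> P (cyclic_ext H t)"
  shows "P (generate G (N \<union> T))"
proof -
  have "\<exists>H. H \<lhd> G \<and> P H \<and> N \<union> T \<subseteq> H \<and> H \<subseteq> generate G (N \<union> T)"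
    using T
  proof (induction T rule: finite_induct)
    case empty
    then show ?case using N by (intro exI[of _ N]) (auto intro: generate.incl)
  next
    case (insert t T)
    then obtain H where H: "H \<lhd> G" "P H" "N \<union> T \<subseteq> H" "H \<subseteq> generate G (N \<union> T)" by auto
    have t: "t \<in> carrier G" "central_mod H t" using insert.prems[of t] H(3) by (auto simp: central_mod_def)
    have "N \<union> insert t T \<subseteq> carrier G" using normal_sub[OF N(1)] insert.prems by blast
    then have "subgroup (generate G (N \<union> insert t T)) G" by (rule generate_is_subgroup)
    moreover have "H \<subseteq> generate G (N \<union> insert t T)"
      using H(4) mono_generate[of "N \<union> T" "N \<union> insert t T"] by blast
    moreover have "t \<in> generate G (N \<union> insert t T)" by (rule generate.incl) simp
    ultimately have "cyclic_ext H t \<subseteq> generate G (N \<union> insert t T)" by (rule cyclic_ext_least)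
    moreover have "N \<union> insert t T \<subseteq> cyclic_ext H t"
      using H(3) cyclic_ext_incl[OF H(1) t(1)] cyclic_ext_gen[OF H(1) t(1)] by blast
    ultimately show ?case
      using cyclic_ext_normal[OF H(1) t] step[OF H(1,2) t] by blast
  qed
  then obtain H where H: "H \<lhd> G" "P H" "N \<union> T \<subseteq> H" "H \<subseteq> generate G (N \<union> T)" by blast
  have "generate G (N \<union> T) \<subseteq> H" by (rule generate_subgroup_incl[OF H(3) normal_subgroup[OF H(1)]])
  with H show ?thesis by (metis subset_antisym)
qed

text \<open>
  Each term of the lower central series is obtained from the next one by adjoining finitely many
  elements that are central modulo it, and adjoining these one at a time reaches the whole group
  from the trivial one.
\<close>

theorem nilpotent_fin_gen_induct:
  assumes S: "finite S" "S \<subseteq> carrier G" "carrier G = generate G S"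
    and nil: "lower_central_series G c = {\<one>}"
    and base: "P {\<one>}"
    and step: "\<And>H t. H \<lhd> G \<Longrightarrow> P H \<Longrightarrow> t \<in> carrier G \<Longrightarrow> central_mod H t \<Longrightarrow> P (cyclic_ext H t)"
  shows "P (carrier G)"
proof -
  \<comment> \<open>For \<open>k > c\<close> truncated subtraction makes the statement one about the whole group again.\<close>
  have "P (lower_central_series G (c - k))" for k
  proof (induction k)
    case 0 then show ?case using base nil by simp
  next
    case (Suc k)
    show ?case
    proof (cases "k < c")
      case True
      define j where "j = c - Suc k"
      have j: "c - k = Suc j" using True by (simp add: j_def)
      obtain T where T: "finite T" "T \<subseteq> lower_central_series G j"
        "lower_central_series G j = generate G (lower_central_series G (Suc j) \<union> T)"
        using lower_central_series_fin_gen[OF S] by blast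
      have "t \<in> carrier G \<and> central_mod (lower_central_series G (Suc j)) t" if "t \<in> T" for t
      proof -
        have t: "t \<in> lower_central_series G j" "t \<in> carrier G" using that T(2) lower_central_series_subset by blast+
        then show ?thesis
          using lower_central_series_commut[OF t(1)] normal_commut_sym[OF lower_central_series_normal t(2)]
          unfolding central_mod_def by blast
      qed
      then have "P (generate G (lower_central_series G (Suc j) \<union> T))"
        using Suc step unfolding j
        by (intro central_generators_induct[where P=P, OF lower_central_series_normal _ T(1)]) blast+
      then show ?thesis using T(3) by (simp add: j_def)
    next
      case False
      then have "c - Suc k = c - k" by simp
      then show ?thesis using Suc by simp
    qed
  qed
  from this[of c] show ?thesis by simp
qed

end

section \<open>Residual finiteness\<close>

context group
begin

text \<open>
  Finiteness of the index is expressed by a finite set of representatives of the cosets inside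
  \<open>H\<close>, since such sets are easily written down for extensions.
\<close>

definition finite_index_in :: "'a set \<Rightarrow> 'a set \<Rightarrow> bool" where
  "finite_index_in K H \<longleftrightarrow> (\<exists>T. finite T \<and> T \<subseteq> H \<and> (\<forall>h\<in>H. \<exists>\<tau>\<in>T. h \<otimes> inv \<tau> \<in> K))"

text \<open>
  The separating subgroups are required to be normal in the whole group, not only in \<open>H\<close>: this is
  what lets the property pass to cyclic extensions.
\<close>

definition normally_residually_finite :: "'a set \<Rightarrow> bool" where
  "normally_residually_finite H \<longleftrightarrow>
     (\<forall>g\<in>H. g \<noteq> \<one> \<longrightarrow> (\<exists>K. K \<lhd> G \<and> K \<subseteq> H \<and> g \<notin> K \<and> finite_index_in K H))"

lemma finite_index_in_refl: "H \<lhd> G \<Longrightarrow> finite_index_in H H"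
  unfolding finite_index_in_def
  using subgroup.one_closed[OF normal_subgroup] normal_sub
  by (intro exI[of _ "{\<one>}"]) (auto simp: subset_iff)

text \<open>
  The commutators of \<open>t\<^sup>i\<close> with the finitely many generators take finitely many values modulo \<open>K\<close>, so two exponents \<open>i < j\<close> give the same values, and then
  \<open>t\<^sup>j\<^sup>-\<^sup>i\<close> commutes with all generators modulo \<open>K\<close>.
\<close>

lemma ex_central_power:
  assumes S: "finite S" "S \<subseteq> carrier G" "carrier G = generate G S"
    and K: "K \<lhd> G" and H: "H \<lhd> G" "finite_index_in K H" and t: "t \<in> carrier G" "central_mod H t"
  shows "\<exists>r>0. central_mod K (t [^] (int r))"
proof -
  obtain T where T: "finite T" "T \<subseteq> H" "\<forall>h\<in>H. \<exists>\<tau>\<in>T. h \<otimes> inv \<tau> \<in> K"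
    using H(2) by (auto simp: finite_index_in_def)
  obtain \<tau> where \<tau>: "\<And>h. h \<in> H \<Longrightarrow> \<tau> h \<in> T \<and> h \<otimes> inv (\<tau> h) \<in> K" using T(3) by metis
  define c where "c i x = commut x (t [^] (int i))" for i x
  have c: "c i x \<in> H" if "x \<in> carrier G" for i x
    using central_mod_int_pow[OF H(1) t, of "int i"] that by (auto simp: c_def central_mod_def)
  define F where "F i = restrict (\<lambda>x. \<tau> (c i x)) S" for i
  have "range F \<subseteq> (\<Pi>\<^sub>E x\<in>S. T)" using \<tau> c S(2) by (auto simp: F_def)
  then have "finite (range F)" by (rule finite_subset) (simp add: finite_PiE S(1) T(1))
  then have "\<not> inj F" using finite_imageD by blast
  then obtain i j where "F i = F j" "i \<noteq> j" by (auto simp: inj_def)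
  then obtain i j where ij: "F i = F j" "i < j" by (metis linorder_neqE_nat)
  define r where "r = j - i"
  define a where "a = t [^] (int i)"
  define b where "b = t [^] (int r)"
  have ab: "a \<in> carrier G" "b \<in> carrier G" "t [^] (int j) = a \<otimes> b"
    using t ij(2) by (simp_all add: a_def b_def r_def of_nat_diff flip: int_pow_mult)
  have "S \<subseteq> {y \<in> carrier G. commut y b \<in> K}"
  proof
    fix x assume "x \<in> S"
    then have x: "x \<in> carrier G" "\<tau> (c i x) = \<tau> (c j x)" using S(2) fun_cong[OF ij(1), of x] by (auto simp: F_def)
    define u where "u = \<tau> (c i x)"
    have u: "u \<in> carrier G" "c i x \<otimes> inv u \<in> K" "c j x \<otimes> inv u \<in> K"
      using \<tau> c[OF x(1)] x(2) T(2) normal_sub[OF H(1)] unfolding u_def by (auto, metis)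
    have "(c i x \<otimes> inv u) \<otimes> inv (c j x \<otimes> inv u) \<in> K"
      using u(2,3) normal_subgroup[OF K] subgroup.m_closed subgroup.m_inv_closed by metis
    also have "(c i x \<otimes> inv u) \<otimes> inv (c j x \<otimes> inv u) = (x \<otimes> a) \<otimes> commut (inv x) b \<otimes> inv (x \<otimes> a)"
      using x(1) ab u(1) by (simp add: c_def commut_def group_word flip: a_def)
    finally have "(x \<otimes> a) \<otimes> commut (inv x) b \<otimes> inv (x \<otimes> a) \<in> K" .
    from normal_conj'[OF K _ this, of "x \<otimes> a"] have "commut (inv x) b \<in> K"
      using x(1) ab by (simp add: group_word)
    then have "inv x \<in> {y \<in> carrier G. commut y b \<in> K}" using x(1) by simp
    from subgroup.m_inv_closed[OF subgroup_centralizer_mod[OF K ab(2)] this]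
    show "x \<in> {y \<in> carrier G. commut y b \<in> K}" using x(1) by simp
  qed
  then have "carrier G \<subseteq> {y \<in> carrier G. commut y b \<in> K}"
    unfolding S(3) by (intro generate_subgroup_incl) (use subgroup_centralizer_mod[OF K ab(2)] S(3) in auto)
  then have "central_mod K b" by (auto simp: central_mod_def)
  then show ?thesis using ij(2) by (intro exI[of _ r]) (auto simp: r_def b_def)
qed

lemma int_pow_div_mod:
  assumes "t \<in> carrier G"
  shows "t [^] (i :: int) = (t [^] (int r)) [^] (i div int r) \<otimes> t [^] (i mod int r)"
  using assms by (simp add: int_pow_pow flip: int_pow_mult)

lemma finite_index_in_cyclic_ext:
  assumes K: "K \<lhd> G" and H: "H \<lhd> G" "finite_index_in K H" and t: "t \<in> carrier G"
    and r: "0 < r" "central_mod K (t [^] (int r))"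
  shows "finite_index_in (cyclic_ext K (t [^] (int r))) (cyclic_ext H t)"
proof -
  obtain T where T: "finite T" "T \<subseteq> H" "\<forall>h\<in>H. \<exists>\<tau>\<in>T. h \<otimes> inv \<tau> \<in> K"
    using H(2) by (auto simp: finite_index_in_def)
  define T' where "T' = (\<lambda>(\<tau>, s). \<tau> \<otimes> t [^] s) ` (T \<times> {0..<int r})"
  show ?thesis
    unfolding finite_index_in_def
  proof (intro exI[of _ T'] conjI ballI)
    show "finite T'" unfolding T'_def using T(1) by simp
    show "T' \<subseteq> cyclic_ext H t" unfolding T'_def cyclic_ext_def using T(2) by auto
    fix x assume "x \<in> cyclic_ext H t"
    then obtain h i where x: "x = h \<otimes> t [^] (i :: int)" "h \<in> H" by (auto simp: cyclic_ext_def)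
    obtain u where u: "u \<in> T" "h \<otimes> inv u \<in> K" using T(3) x(2) by blast
    have hc: "h \<in> carrier G" and uc: "u \<in> carrier G" using x(2) u(1) T(2) normal_sub[OF H(1)] by auto
    define b where "b = (t [^] (int r)) [^] (i div int r)"
    define d where "d = t [^] (i mod int r)"
    have bd: "b \<in> carrier G" "d \<in> carrier G" "t [^] i = b \<otimes> d"
      using t int_pow_div_mod[OF t, of i r] by (simp_all add: b_def d_def)
    have "x \<otimes> inv (u \<otimes> d) = (h \<otimes> inv u) \<otimes> commut u b \<otimes> b"
      using hc uc bd x(1) by (simp add: group_word commut_def)
    moreover have "(h \<otimes> inv u) \<otimes> commut u b \<in> K"
      using central_mod_int_pow[OF K _ r(2), of "i div int r"] t uc
      by (intro subgroup.m_closed[OF normal_subgroup[OF K] u(2)]) (auto simp: central_mod_def b_def)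
    ultimately have "x \<otimes> inv (u \<otimes> d) \<in> cyclic_ext K (t [^] (int r))"
      unfolding cyclic_ext_def b_def by blast
    moreover have "u \<otimes> d \<in> T'" unfolding T'_def d_def using u(1) r(1) by auto
    ultimately show "\<exists>\<tau>\<in>T'. x \<otimes> inv \<tau> \<in> cyclic_ext K (t [^] (int r))" by blast
  qed
qed

lemma finite_index_in_torsion_ext:
  assumes K: "K \<lhd> G" and H: "H \<lhd> G" "finite_index_in K H" and t: "t \<in> carrier G"
    and r: "0 < r" "t [^] (int r) \<in> H"
  shows "finite_index_in K (cyclic_ext H t)"
proof -
  obtain T where T: "finite T" "T \<subseteq> H" "\<forall>h\<in>H. \<exists>\<tau>\<in>T. h \<otimes> inv \<tau> \<in> K"
    using H(2) by (auto simp: finite_index_in_def)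
  define T' where "T' = (\<lambda>(\<tau>, s). \<tau> \<otimes> t [^] s) ` (T \<times> {0..<int r})"
  show ?thesis
    unfolding finite_index_in_def
  proof (intro exI[of _ T'] conjI ballI)
    show "finite T'" unfolding T'_def using T(1) by simp
    show "T' \<subseteq> cyclic_ext H t" unfolding T'_def cyclic_ext_def using T(2) by auto
    fix x assume "x \<in> cyclic_ext H t"
    then obtain h i where x: "x = h \<otimes> t [^] (i :: int)" "h \<in> H" by (auto simp: cyclic_ext_def)
    define b where "b = (t [^] (int r)) [^] (i div int r)"
    define d where "d = t [^] (i mod int r)"
    have bd: "b \<in> carrier G" "d \<in> carrier G" "t [^] i = b \<otimes> d"
      using t int_pow_div_mod[OF t, of i r] by (simp_all add: b_def d_def)
    have "b \<in> H" unfolding b_def by (rule subgroup_int_pow_closed[OF normal_subgroup[OF H(1)] r(2)])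
    then have hb: "h \<otimes> b \<in> H" using subgroup.m_closed[OF normal_subgroup[OF H(1)] x(2)] by blast
    then obtain u where u: "u \<in> T" "h \<otimes> b \<otimes> inv u \<in> K" using T(3) by blast
    have hc: "h \<in> carrier G" and uc: "u \<in> carrier G" using x(2) u(1) T(2) normal_sub[OF H(1)] by auto
    have "x \<otimes> inv (u \<otimes> d) = h \<otimes> b \<otimes> inv u"
      using hc uc bd x(1) by (simp add: group_word)
    moreover have "u \<otimes> d \<in> T'" unfolding T'_def d_def using u(1) r(1) by auto
    ultimately show "\<exists>\<tau>\<in>T'. x \<otimes> inv \<tau> \<in> K" using u(2) by metis
  qed
qed

text \<open>
  If some power of \<open>t\<close> lies in \<open>H\<close>, the extension is finite and subgroups of \<open>H\<close> serve for it.
  Otherwise the powers of \<open>t\<close> are independent of \<open>H\<close>.  An element \<open>g\<close> of \<open>H\<close> that is missed by \<open>K\<close> is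
  also missed by \<open>K\<langle>t\<^sup>r\<rangle>\<close>, which has finite index; here \<open>r\<close> is chosen such that \<open>t\<^sup>r\<close> is central
  modulo \<open>K\<close>, to keep normality.  An element \<open>h t\<^sup>j\<close> with \<open>j \<noteq> 0\<close> is missed by \<open>H\<langle>t\<^sup>r\<rangle>\<close> for
  \<open>r > \<bar>j\<bar>\<close>.
\<close>

lemma normally_residually_finite_cyclic_ext:
  assumes S: "finite S" "S \<subseteq> carrier G" "carrier G = generate G S"
    and H: "H \<lhd> G" "normally_residually_finite H" and t: "t \<in> carrier G" "central_mod H t"
  shows "normally_residually_finite (cyclic_ext H t)"
  unfolding normally_residually_finite_def
proof (intro ballI impI)
  fix g assume g: "g \<in> cyclic_ext H t" "g \<noteq> \<one>"
  note sH = normal_subgroup[OF H(1)]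
  show "\<exists>K. K \<lhd> G \<and> K \<subseteq> cyclic_ext H t \<and> g \<notin> K \<and> finite_index_in K (cyclic_ext H t)"
  proof (cases "\<exists>r>0. t [^] (int r) \<in> H")
    case True
    then obtain r where r: "0 < r" "t [^] (int r) \<in> H" by blast
    have "\<exists>K. K \<lhd> G \<and> K \<subseteq> H \<and> g \<notin> K \<and> finite_index_in K H"
      using H g(2) finite_index_in_refl[OF H(1)] unfolding normally_residually_finite_def by blast
    then show ?thesis
      using finite_index_in_torsion_ext[OF _ H(1) _ t(1) r] cyclic_ext_incl[OF H(1) t(1)] by blast
  next
    case False
    have inf: "i = 0" if "t [^] (i :: int) \<in> H" for i
    proof (rule ccontr)
      assume "i \<noteq> 0"
      have "t [^] (- i) \<in> H" using subgroup.m_inv_closed[OF sH that] t(1) by (simp add: int_pow_neg)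
      then have "t [^] (int (nat \<bar>i\<bar>)) \<in> H" using that by (cases "i \<ge> 0") auto
      then show False using False \<open>i \<noteq> 0\<close> by (metis abs_eq_0 linorder_neqE_linordered_idom not_less0 nat_0_iff zero_less_abs_iff zero_less_nat_eq)
    qed
    have "\<exists>K r. K \<lhd> G \<and> K \<subseteq> H \<and> finite_index_in K H \<and> 0 < r \<and> central_mod K (t [^] (int r)) \<and>
        g \<notin> cyclic_ext K (t [^] (int r))"
    proof (cases "g \<in> H")
      case True
      then obtain K where K: "K \<lhd> G" "K \<subseteq> H" "g \<notin> K" "finite_index_in K H"
        using H(2) g(2) unfolding normally_residually_finite_def by blast
      obtain r where r: "0 < r" "central_mod K (t [^] (int r))" using ex_central_power[OF S K(1) H(1) K(4) t] by blast
      have "g \<notin> cyclic_ext K (t [^] (int r))"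
      proof
        assume "g \<in> cyclic_ext K (t [^] (int r))"
        then obtain k i where k: "g = k \<otimes> (t [^] (int r)) [^] (i :: int)" "k \<in> K" by (auto simp: cyclic_ext_def)
        have kc: "k \<in> carrier G" using k(2) normal_sub[OF K(1)] by blast
        have "t [^] (int r * i) = inv k \<otimes> g"
          using k(1) kc t(1) by (simp add: int_pow_pow inv_mult_cancel_left)
        then have "t [^] (int r * i) \<in> H"
          using k(2) K(2) True subgroup.m_closed[OF sH subgroup.m_inv_closed[OF sH]] by (metis subsetD)
        then have "int r * i = 0" by (rule inf)
        then have "g = k" using k(1) kc r(1) by simp
        then show False using K(3) k(2) by simp
      qed
      then show ?thesis using K r by blast
    next
      case gH: False
      obtain h j where h: "g = h \<otimes> t [^] (j :: int)" "h \<in> H" using g(1) by (auto simp: cyclic_ext_def)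
      have hc: "h \<in> carrier G" using h(2) normal_sub[OF H(1)] by blast
      have j: "j \<noteq> 0" using h gH hc by auto
      define r where "r = nat (2 * \<bar>j\<bar>)"
      have r: "0 < r" "int r = 2 * \<bar>j\<bar>" using j by (auto simp: r_def)
      have "g \<notin> cyclic_ext H (t [^] (int r))"
      proof
        assume "g \<in> cyclic_ext H (t [^] (int r))"
        then obtain k i where k: "g = k \<otimes> (t [^] (int r)) [^] (i :: int)" "k \<in> H" by (auto simp: cyclic_ext_def)
        have kc: "k \<in> carrier G" using k(2) normal_sub[OF H(1)] by blast
        have e: "h \<otimes> t [^] j = k \<otimes> t [^] (int r * i)" using k(1) h(1) t(1) by (simp add: int_pow_pow)
        have "inv k \<otimes> h = inv k \<otimes> (h \<otimes> t [^] j) \<otimes> inv (t [^] j)" using hc kc t(1) by (simp add: group_word)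
        also have "\<dots> = t [^] (int r * i) \<otimes> t [^] (- j)"
          unfolding e using kc t(1) by (simp add: inv_mult_cancel_left int_pow_neg)
        also have "\<dots> = t [^] (int r * i - j)" using t(1) by (simp flip: int_pow_mult)
        finally have "t [^] (int r * i - j) \<in> H"
          using subgroup.m_closed[OF sH subgroup.m_inv_closed[OF sH k(2)] h(2)] by simp
        then have "int r * i = j" using inf by fastforce
        then have "\<bar>j\<bar> = 2 * \<bar>j\<bar> * \<bar>i\<bar>" using r(2) by (metis abs_mult abs_abs abs_numeral)
        then have "\<bar>j\<bar> * (2 * \<bar>i\<bar> - 1) = 0" by (simp add: algebra_simps)
        then have "2 * \<bar>i\<bar> = 1" using j by simp
        then show False by presburger
      qed
      then show ?thesis
        using H(1) finite_index_in_refl[OF H(1)] r(1) central_mod_int_pow[OF H(1) t] by blast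
    qed
    then obtain K r where K: "K \<lhd> G" "K \<subseteq> H" "finite_index_in K H" "0 < r" "central_mod K (t [^] (int r))"
        "g \<notin> cyclic_ext K (t [^] (int r))" by blast
    have "cyclic_ext K (t [^] (int r)) \<subseteq> cyclic_ext H t"
      by (rule cyclic_ext_least[OF normal_subgroup[OF cyclic_ext_normal[OF H(1) t]]])
        (use K(2) cyclic_ext_incl[OF H(1) t(1)] subgroup_int_pow_closed[OF normal_subgroup[OF cyclic_ext_normal[OF H(1) t]] cyclic_ext_gen[OF H(1) t(1)]] in auto)
    moreover have "cyclic_ext K (t [^] (int r)) \<lhd> G" using cyclic_ext_normal[OF K(1) _ K(5)] t(1) by simp
    ultimately show ?thesis using K(6) finite_index_in_cyclic_ext[OF K(1) H(1) K(3) t(1) K(4,5)] by blast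
  qed
qed

lemma finite_rcosets:
  assumes K: "K \<lhd> G" and f: "finite_index_in K (carrier G)"
  shows "finite (rcosets K)"
proof -
  obtain T where T: "finite T" "T \<subseteq> carrier G" "\<forall>h\<in>carrier G. \<exists>\<tau>\<in>T. h \<otimes> inv \<tau> \<in> K"
    using f by (auto simp: finite_index_in_def)
  have "K #> h \<in> (\<lambda>u. K #> u) ` T" if h: "h \<in> carrier G" for h
  proof -
    obtain u where u: "u \<in> T" "h \<otimes> inv u \<in> K" using T(3) h by blast
    have uc: "u \<in> carrier G" using u(1) T(2) by blast
    have "h = (h \<otimes> inv u) \<otimes> u" using h uc by (simp add: group_word)
    then have "h \<in> K #> u" using u(2) unfolding r_coset_def by blast
    then have "K #> u = K #> h" using repr_independence[OF _ uc normal_subgroup[OF K]] by blast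
    then show ?thesis using u(1) by blast
  qed
  then have "rcosets K \<subseteq> (\<lambda>u. K #> u) ` T" by (auto simp: RCOSETS_def)
  then show ?thesis using T(1) finite_surj by blast
qed

lemma finite_rcosets_Int:
  assumes K: "subgroup K G" "finite (rcosets K)" and L: "subgroup L G" "finite (rcosets L)"
  shows "finite (rcosets (K \<inter> L))"
proof -
  have "(K \<inter> L) #> h = (K #> h) \<inter> (L #> h)" if h: "h \<in> carrier G" for h
  proof -
    have "k = l" if "k \<in> K" "l \<in> L" "k \<otimes> h = l \<otimes> h" for k l
      using that h subgroup.subset[OF K(1)] subgroup.subset[OF L(1)] by (metis right_cancel subsetD)
    then show ?thesis unfolding r_coset_def by fast
  qed
  then have "rcosets (K \<inter> L) \<subseteq> (\<lambda>(A, B). A \<inter> B) ` ((rcosets K) \<times> (rcosets L))"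
    by (fastforce simp: RCOSETS_def)
  then show ?thesis by (rule finite_subset) (use K L in simp)
qed

definition action_on :: "'y set \<Rightarrow> ('a \<Rightarrow> 'y \<Rightarrow> 'y) \<Rightarrow> bool" where
  "action_on I \<alpha> \<longleftrightarrow> (\<forall>g\<in>carrier G. \<forall>y\<in>I. \<alpha> g y \<in> I) \<and> (\<forall>y\<in>I. \<alpha> \<one> y = y) \<and>
     (\<forall>g\<in>carrier G. \<forall>h\<in>carrier G. \<forall>y\<in>I. \<alpha> (g \<otimes> h) y = \<alpha> g (\<alpha> h y))"

text \<open>
  Any infinite type has room for the finitely many cosets of the intersection of subgroups that
  separate the elements of \<open>F\<close> from the identity.
\<close>

theorem nilpotent_fin_gen_finite_action:
  assumes S: "finite S" "S \<subseteq> carrier G" "carrier G = generate G S"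
    and nil: "lower_central_series G c = {\<one>}"
    and F: "finite F" "F \<subseteq> carrier G" "\<one> \<notin> F" and inf: "infinite (UNIV :: 'y set)"
  shows "\<exists>(I :: 'y set) \<alpha> y0. finite I \<and> y0 \<in> I \<and> action_on I \<alpha> \<and> (\<forall>g\<in>F. \<alpha> g y0 \<noteq> y0)"
proof -
  have "normally_residually_finite (carrier G)"
    by (rule nilpotent_fin_gen_induct[OF S nil, where P=normally_residually_finite])
      (auto simp: normally_residually_finite_def[of "{\<one>}"] intro: normally_residually_finite_cyclic_ext[OF S])
  then have rf: "\<exists>K. subgroup K G \<and> finite (rcosets K) \<and> g \<notin> K" if "g \<in> carrier G" "g \<noteq> \<one>" for g
    using that finite_rcosets normal_subgroup unfolding normally_residually_finite_def by blast
  have "\<exists>K. subgroup K G \<and> finite (rcosets K) \<and> K \<inter> F = {}"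
    using F
  proof (induction F rule: finite_induct)
    case empty
    have "rcosets (carrier G) \<subseteq> {carrier G}"
      using coset_join2[OF _ subgroup_self] by (auto simp: RCOSETS_def)
    then show ?case using subgroup_self finite_subset by blast
  next
    case (insert g F)
    then obtain K where "subgroup K G" "finite (rcosets K)" "K \<inter> F = {}" by auto
    moreover obtain L where "subgroup L G" "finite (rcosets L)" "g \<notin> L"
      using rf[of g] insert.prems by auto
    ultimately show ?case
      using finite_rcosets_Int[of K L] subgroups_Inter_pair[of K L]
      by (intro exI[of _ "K \<inter> L"]) auto
  qed
  then obtain K where K: "subgroup K G" "finite (rcosets K)" "K \<inter> F = {}" by blast
  obtain I :: "'y set" where I: "finite I" "card I = card (rcosets K)"
    using infinite_arbitrarily_large[OF inf] by blast
  obtain b where b: "bij_betw b (rcosets K) I"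
    using finite_same_card_bij[OF K(2) I(1)] I(2) by metis
  define b' where "b' = inv_into (rcosets K) b"
  have b': "b' y \<in> rcosets K" "b (b' y) = y" if "y \<in> I" for y
    using that b unfolding b'_def by (auto simp: bij_betw_def inv_into_into f_inv_into_f)
  have bb: "b C \<in> I" "b' (b C) = C" if "C \<in> rcosets K" for C
    using that b unfolding b'_def by (auto simp: bij_betw_def inv_into_f_f)
  have sub: "K \<subseteq> carrier G" by (rule subgroup.subset[OF K(1)])
  define \<alpha> where "\<alpha> g y = b (b' y #> inv g)" for g y
  have move: "C #> h \<in> rcosets K" if "C \<in> rcosets K" "h \<in> carrier G" for C h
    using that coset_mult_assoc[OF sub] by (auto simp: RCOSETS_def)
  have assoc: "C #> h #> k = C #> (h \<otimes> k)" if "C \<in> rcosets K" "h \<in> carrier G" "k \<in> carrier G" for C h k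
    using that coset_mult_assoc[OF sub] by (auto simp: RCOSETS_def m_assoc)
  have one: "C #> \<one> = C" if "C \<in> rcosets K" for C
    using that coset_mult_assoc[OF sub] by (auto simp: RCOSETS_def)
  have "K #> \<one> \<in> rcosets K" by (rule rcosetsI[OF sub one_closed])
  then have KK: "K \<in> rcosets K" using coset_mult_one[OF sub] by simp
  have "action_on I \<alpha>"
    unfolding action_on_def
  proof (intro conjI ballI)
    fix y g h assume y: "y \<in> I"
    show "\<alpha> \<one> y = y" using one b' y by (simp add: \<alpha>_def)
    assume g: "g \<in> carrier G"
    show "\<alpha> g y \<in> I" unfolding \<alpha>_def using move bb(1) b'(1) y g by simp
    assume h: "h \<in> carrier G"
    show "\<alpha> (g \<otimes> h) y = \<alpha> g (\<alpha> h y)"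
      unfolding \<alpha>_def using move bb b'(1) y g h assoc by (simp add: inv_mult_group)
  qed
  moreover have "\<alpha> g (b K) \<noteq> b K" if g: "g \<in> F" for g
  proof
    have gc: "g \<in> carrier G" using g F(2) by blast
    assume "\<alpha> g (b K) = b K"
    then have "b (K #> inv g) = b K" using bb(2)[OF KK] by (simp add: \<alpha>_def)
    then have "K #> inv g = K" using b move[OF KK, of "inv g"] KK gc by (metis bij_betw_def inj_onD inv_closed)
    then have "inv g \<in> K" using coset_join1[OF _ _ K(1)] gc by simp
    then have "g \<in> K" using subgroup.m_inv_closed[OF K(1)] gc by fastforce
    then show False using K(3) g by blast
  qed
  ultimately show ?thesis using I(1) bb(1)[OF KK] by blast
qed

end

section \<open>Approximately invariant probability measures\<close>

lemma
  fixes f :: "'l \<Rightarrow> 'x \<Rightarrow> 'b :: {topological_comm_monoid_add, t2_space}"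
  assumes "\<And>l. l \<in> F \<Longrightarrow> f l summable_on A"
  shows summable_on_finite_sum: "(\<lambda>x. \<Sum>l\<in>F. f l x) summable_on A"
    and infsum_finite_sum: "(\<Sum>\<^sub>\<infinity>x\<in>A. \<Sum>l\<in>F. f l x) = (\<Sum>l\<in>F. \<Sum>\<^sub>\<infinity>x\<in>A. f l x)"
proof -
  have "(\<lambda>x. \<Sum>l\<in>F. f l x) summable_on A \<and> (\<Sum>\<^sub>\<infinity>x\<in>A. \<Sum>l\<in>F. f l x) = (\<Sum>l\<in>F. \<Sum>\<^sub>\<infinity>x\<in>A. f l x)"
    using assms
  proof (induction F rule: infinite_finite_induct)
    case (insert l F)
    then show ?case by (auto intro: summable_on_add simp: infsum_add)
  qed auto
  then show "(\<lambda>x. \<Sum>l\<in>F. f l x) summable_on A"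
    "(\<Sum>\<^sub>\<infinity>x\<in>A. \<Sum>l\<in>F. f l x) = (\<Sum>l\<in>F. \<Sum>\<^sub>\<infinity>x\<in>A. f l x)" by blast+
qed

context group
begin

definition shift_dist :: "'a \<Rightarrow> ('a \<Rightarrow> real) \<Rightarrow> real" where
  "shift_dist s \<mu> = (\<Sum>\<^sub>\<infinity>x\<in>carrier G. \<bar>\<mu> (inv s \<otimes> x) - \<mu> x\<bar>)"

definition finite_prob_on :: "'a set \<Rightarrow> ('a \<Rightarrow> real) \<Rightarrow> bool" where
  "finite_prob_on H \<mu> \<longleftrightarrow> (\<forall>x. 0 \<le> \<mu> x) \<and> finite {x. \<mu> x \<noteq> 0} \<and> {x. \<mu> x \<noteq> 0} \<subseteq> H \<and>
     (\<Sum>\<^sub>\<infinity>x\<in>carrier G. \<mu> x) = 1"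

definition Reiter :: "'a set \<Rightarrow> bool" where
  "Reiter H \<longleftrightarrow> (\<forall>E e. finite E \<longrightarrow> E \<subseteq> H \<longrightarrow> 0 < e \<longrightarrow>
     (\<exists>\<mu>. finite_prob_on H \<mu> \<and> (\<forall>s\<in>E. shift_dist s \<mu> \<le> e)))"

lemma bij_betw_translation: "s \<in> carrier G \<Longrightarrow> bij_betw (\<lambda>x. s \<otimes> x) (carrier G) (carrier G)"
  by (rule bij_betwI[where g = "\<lambda>x. inv s \<otimes> x"]) (auto simp: group_word)

lemma infsum_translation:
  "s \<in> carrier G \<Longrightarrow> (\<Sum>\<^sub>\<infinity>x\<in>carrier G. f (s \<otimes> x)) = (\<Sum>\<^sub>\<infinity>x\<in>carrier G. f x)"
  by (rule infsum_reindex_bij_betw[OF bij_betw_translation])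

lemma finite_support_translation:
  assumes "s \<in> carrier G" "finite {x \<in> carrier G. f x \<noteq> (0 :: real)}"
  shows "finite {x \<in> carrier G. f (s \<otimes> x) \<noteq> 0}"
proof (rule finite_subset)
  show "{x \<in> carrier G. f (s \<otimes> x) \<noteq> 0} \<subseteq> (\<lambda>y. inv s \<otimes> y) ` {x \<in> carrier G. f x \<noteq> 0}"
  proof
    fix x assume x: "x \<in> {x \<in> carrier G. f (s \<otimes> x) \<noteq> 0}"
    then have "x = inv s \<otimes> (s \<otimes> x)" using assms(1) by (simp add: group_word)
    moreover have "s \<otimes> x \<in> {x \<in> carrier G. f x \<noteq> 0}" using x assms(1) by simp
    ultimately show "x \<in> (\<lambda>y. inv s \<otimes> y) ` {x \<in> carrier G. f x \<noteq> 0}" by blast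
  qed
qed (use assms in simp)

lemma shift_summable:
  fixes \<mu> :: "'a \<Rightarrow> real"
  assumes \<mu>: "finite {x \<in> carrier G. \<mu> x \<noteq> 0}" and s: "s \<in> carrier G"
  shows "(\<lambda>x. \<bar>\<mu> (inv s \<otimes> x) - \<mu> x\<bar>) summable_on carrier G"
  by (rule finite_nonzero_values_imp_summable_on,
      rule finite_subset[OF _ finite_UnI[OF finite_support_translation[OF inv_closed[OF s] \<mu>] \<mu>]]) auto

lemma shift_dist_mult:
  assumes \<mu>: "finite {x \<in> carrier G. \<mu> x \<noteq> 0}" and g: "g \<in> carrier G" and h: "h \<in> carrier G"
  shows "shift_dist (g \<otimes> h) \<mu> \<le> shift_dist g \<mu> + shift_dist h \<mu>"
proof -
  let ?f = "\<lambda>x. \<bar>\<mu> (inv h \<otimes> x) - \<mu> x\<bar>"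
  have fin: "finite {x \<in> carrier G. ?f x \<noteq> 0}"
    by (rule finite_subset[OF _ finite_UnI[OF finite_support_translation[OF inv_closed[OF h] \<mu>] \<mu>]]) auto
  have s1: "(\<lambda>x. ?f (inv g \<otimes> x)) summable_on carrier G"
    by (rule finite_nonzero_values_imp_summable_on[OF finite_support_translation[OF inv_closed[OF g] fin]])
  have "shift_dist (g \<otimes> h) \<mu> \<le> (\<Sum>\<^sub>\<infinity>x\<in>carrier G. ?f (inv g \<otimes> x) + \<bar>\<mu> (inv g \<otimes> x) - \<mu> x\<bar>)"
    unfolding shift_dist_def
  proof (rule infsum_mono)
    show "(\<lambda>x. \<bar>\<mu> (inv (g \<otimes> h) \<otimes> x) - \<mu> x\<bar>) summable_on carrier G"
      using shift_summable[OF \<mu>] g h by simp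
    show "(\<lambda>x. ?f (inv g \<otimes> x) + \<bar>\<mu> (inv g \<otimes> x) - \<mu> x\<bar>) summable_on carrier G"
      by (intro summable_on_add s1 shift_summable[OF \<mu> g])
    fix x assume "x \<in> carrier G"
    then show "\<bar>\<mu> (inv (g \<otimes> h) \<otimes> x) - \<mu> x\<bar> \<le> ?f (inv g \<otimes> x) + \<bar>\<mu> (inv g \<otimes> x) - \<mu> x\<bar>"
      using g h by (simp add: group_word)
  qed
  also have "\<dots> = (\<Sum>\<^sub>\<infinity>x\<in>carrier G. ?f (inv g \<otimes> x)) + shift_dist g \<mu>"
    unfolding shift_dist_def by (rule infsum_add[OF s1 shift_summable[OF \<mu> g]])
  also have "(\<Sum>\<^sub>\<infinity>x\<in>carrier G. ?f (inv g \<otimes> x)) = shift_dist h \<mu>"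
    unfolding shift_dist_def by (rule infsum_translation) (use g in simp)
  finally show ?thesis by simp
qed

lemma shift_dist_inv: "g \<in> carrier G \<Longrightarrow> shift_dist (inv g) \<mu> = shift_dist g \<mu>"
proof -
  assume g: "g \<in> carrier G"
  have "shift_dist g \<mu> = (\<Sum>\<^sub>\<infinity>x\<in>carrier G. \<bar>\<mu> (inv g \<otimes> (g \<otimes> x)) - \<mu> (g \<otimes> x)\<bar>)"
    unfolding shift_dist_def by (rule infsum_translation[OF g, symmetric])
  also have "\<dots> = shift_dist (inv g) \<mu>"
    unfolding shift_dist_def by (rule infsum_cong) (use g in \<open>simp add: group_word abs_minus_commute\<close>)
  finally show ?thesis by simp
qed

lemma shift_dist_one: "shift_dist \<one> \<mu> = 0"
proof -
  have "shift_dist \<one> \<mu> = (\<Sum>\<^sub>\<infinity>x\<in>carrier G. 0)" unfolding shift_dist_def by (rule infsum_cong) simp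
  then show ?thesis by simp
qed

lemma shift_dist_int_pow:
  assumes \<mu>: "finite {x \<in> carrier G. \<mu> x \<noteq> 0}" and t: "t \<in> carrier G"
  shows "shift_dist (t [^] (j :: int)) \<mu> \<le> \<bar>real_of_int j\<bar> * shift_dist t \<mu>"
proof -
  have nat: "shift_dist (t [^] int n) \<mu> \<le> n * shift_dist t \<mu>" for n
  proof (induction n)
    case 0 then show ?case by (simp add: shift_dist_one)
  next
    case (Suc n)
    have "shift_dist (t [^] int n \<otimes> t) \<mu> \<le> shift_dist (t [^] int n) \<mu> + shift_dist t \<mu>"
      by (rule shift_dist_mult[OF \<mu>]) (use t in auto)
    moreover have "t [^] int (Suc n) = t [^] int n \<otimes> t"
      using t int_pow_mult[of t "int n" 1] by (simp add: add.commute int_pow_1)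
    ultimately show ?case using Suc by (simp add: distrib_right)
  qed
  show ?thesis
  proof (cases "j \<ge> 0")
    case True then show ?thesis using nat[of "nat j"] by simp
  next
    case False
    then have "t [^] j = inv (t [^] int (nat (- j)))" using t int_pow_neg[of t "- j"] by simp
    then show ?thesis using nat[of "nat (- j)"] False t by (simp add: shift_dist_inv)
  qed
qed

lemma finite_prob_onD:
  assumes "finite_prob_on H \<mu>"
  shows "0 \<le> \<mu> x" "finite {x \<in> carrier G. \<mu> x \<noteq> 0}" "(\<Sum>\<^sub>\<infinity>x\<in>carrier G. \<mu> x) = 1"
    "\<mu> summable_on carrier G"
proof -
  show f: "finite {x \<in> carrier G. \<mu> x \<noteq> 0}"
    using assms by (auto simp: finite_prob_on_def intro: finite_subset)
  show "\<mu> summable_on carrier G" by (rule finite_nonzero_values_imp_summable_on[OF f])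
qed (use assms in \<open>auto simp: finite_prob_on_def\<close>)

text \<open>
  The measure on the extension is the average of the translates by \<open>t\<^sup>0, \<dots>, t\<^sup>n\<^sup>-\<^sup>1\<close> of a measure on
  \<open>H\<close>: telescoping makes it almost invariant under \<open>t\<close>, and it is almost invariant under \<open>h \<in> H\<close>
  as soon as the measure on \<open>H\<close> is so under the conjugates of \<open>h\<close> by these powers.
\<close>

lemma Reiter_cyclic_ext:
  assumes H: "H \<lhd> G" "Reiter H" and t: "t \<in> carrier G"
  shows "Reiter (cyclic_ext H t)"
  unfolding Reiter_def
proof (intro allI impI)
  fix E and e :: real assume E: "finite E" "E \<subseteq> cyclic_ext H t" and e: "0 < e"
  have "\<exists>h j. s = h \<otimes> t [^] (j :: int) \<and> h \<in> H" if "s \<in> E" for s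
    using E(2) that by (auto simp: cyclic_ext_def)
  then obtain h j where hj: "\<And>s. s \<in> E \<Longrightarrow> s = h s \<otimes> t [^] (j s :: int)" "\<And>s. s \<in> E \<Longrightarrow> h s \<in> H"
    by metis
  obtain J where J: "\<And>s. s \<in> E \<Longrightarrow> \<bar>real_of_int (j s)\<bar> \<le> J" "J \<ge> 0"
  proof
    show "\<bar>real_of_int (j s)\<bar> \<le> (\<Sum>s\<in>E. \<bar>real_of_int (j s)\<bar>)" if "s \<in> E" for s
      by (rule member_le_sum[of s E "\<lambda>s. \<bar>real_of_int (j s)\<bar>"]) (use that E(1) in auto)
    show "0 \<le> (\<Sum>s\<in>E. \<bar>real_of_int (j s)\<bar>)" by (simp add: sum_nonneg)
  qed
  obtain n :: nat where n: "4 * J / e < n" using reals_Archimedean2 by blast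
  have "0 \<le> 4 * J / e" using J(2) e by simp
  then have n0: "0 < n" using n by (metis of_nat_0_less_iff order_le_less_trans)
  have nJ: "J * (2 / n) \<le> e / 2" using n n0 e by (simp add: field_simps)
  define p where "p l = t [^] int l" for l
  have p: "p l \<in> carrier G" for l using t by (simp add: p_def)
  define E' where "E' = (\<lambda>(l, s). inv (p l) \<otimes> h s \<otimes> p l) ` ({..<n} \<times> E)"
  have "finite E'" "E' \<subseteq> H"
    unfolding E'_def using E(1) normal_conj'[OF H(1) p] hj(2) by auto
  then obtain \<nu> where \<nu>: "finite_prob_on H \<nu>" "\<And>s. s \<in> E' \<Longrightarrow> shift_dist s \<nu> \<le> e / 2"
    using H(2) e unfolding Reiter_def by (metis half_gt_zero)
  note \<nu>' = finite_prob_onD[OF \<nu>(1)]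
  define \<mu> where "\<mu> x = (if x \<in> carrier G then (\<Sum>l<n. \<nu> (inv (p l) \<otimes> x)) / n else 0)" for x
  have \<mu>_nonneg: "0 \<le> \<mu> x" for x using \<nu>'(1) by (simp add: \<mu>_def sum_nonneg)
  have supp: "{x. \<mu> x \<noteq> 0} \<subseteq> (\<Union>l<n. {x \<in> carrier G. \<nu> (inv (p l) \<otimes> x) \<noteq> 0})"
  proof
    fix x assume "x \<in> {x. \<mu> x \<noteq> 0}"
    then have "x \<in> carrier G" "(\<Sum>l<n. \<nu> (inv (p l) \<otimes> x)) \<noteq> 0" by (auto simp: \<mu>_def split: if_splits)
    then show "x \<in> (\<Union>l<n. {x \<in> carrier G. \<nu> (inv (p l) \<otimes> x) \<noteq> 0})" using sum.neutral by fastforce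
  qed
  have fs: "finite {x \<in> carrier G. \<nu> (inv (p l) \<otimes> x) \<noteq> 0}" for l
    by (rule finite_support_translation[OF inv_closed[OF p] \<nu>'(2)])
  have fin: "finite {x. \<mu> x \<noteq> 0}" by (rule finite_subset[OF supp]) (use fs in auto)
  then have fin': "finite {x \<in> carrier G. \<mu> x \<noteq> 0}" by (rule finite_subset[rotated]) auto
  have prob: "finite_prob_on (cyclic_ext H t) \<mu>"
    unfolding finite_prob_on_def
  proof (intro conjI allI \<mu>_nonneg fin)
    show "{x. \<mu> x \<noteq> 0} \<subseteq> cyclic_ext H t"
    proof
      fix x assume "x \<in> {x. \<mu> x \<noteq> 0}"
      then obtain l where x: "x \<in> carrier G" "inv (p l) \<otimes> x \<in> H"
        using supp \<nu>(1) by (fastforce simp: finite_prob_on_def)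
      have "x = (p l \<otimes> (inv (p l) \<otimes> x) \<otimes> inv (p l)) \<otimes> t [^] int l"
        using x(1) p by (simp add: group_word flip: p_def)
      then show "x \<in> cyclic_ext H t"
        unfolding cyclic_ext_def using normal_conj[OF H(1) p x(2)] by blast
    qed
    have "(\<Sum>\<^sub>\<infinity>x\<in>carrier G. \<mu> x) = (\<Sum>\<^sub>\<infinity>x\<in>carrier G. (1 / n) * (\<Sum>l<n. \<nu> (inv (p l) \<otimes> x)))"
      by (rule infsum_cong) (simp add: \<mu>_def)
    also have "\<dots> = (1 / n) * (\<Sum>\<^sub>\<infinity>x\<in>carrier G. \<Sum>l<n. \<nu> (inv (p l) \<otimes> x))"
      by (rule infsum_cmult_right')
    also have "(\<Sum>\<^sub>\<infinity>x\<in>carrier G. \<Sum>l<n. \<nu> (inv (p l) \<otimes> x)) = (\<Sum>l<n. \<Sum>\<^sub>\<infinity>x\<in>carrier G. \<nu> (inv (p l) \<otimes> x))"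
      by (rule infsum_finite_sum) (rule finite_nonzero_values_imp_summable_on[OF fs])
    also have "\<dots> = n" using infsum_translation[OF inv_closed[OF p], of \<nu>] \<nu>'(3) by simp
    finally show "(\<Sum>\<^sub>\<infinity>x\<in>carrier G. \<mu> x) = 1" using n0 by simp
  qed
  have shift_t: "shift_dist t \<mu> \<le> 2 / n"
  proof -
    have s1: "(\<lambda>x. \<nu> (inv (p n) \<otimes> x)) summable_on carrier G"
      by (rule finite_nonzero_values_imp_summable_on[OF fs])
    have "shift_dist t \<mu> \<le> (\<Sum>\<^sub>\<infinity>x\<in>carrier G. (1 / n) * (\<nu> (inv (p n) \<otimes> x) + \<nu> x))"
      unfolding shift_dist_def
    proof (rule infsum_mono)
      show "(\<lambda>x. \<bar>\<mu> (inv t \<otimes> x) - \<mu> x\<bar>) summable_on carrier G" by (rule shift_summable[OF fin' t])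
      show "(\<lambda>x. (1 / n) * (\<nu> (inv (p n) \<otimes> x) + \<nu> x)) summable_on carrier G"
        by (intro summable_on_cmult_right summable_on_add s1 \<nu>'(4))
      fix x assume x: "x \<in> carrier G"
      have Suc: "inv (p l) \<otimes> (inv t \<otimes> x) = inv (p (Suc l)) \<otimes> x" for l
      proof -
        have "p (Suc l) = t \<otimes> p l"
          using t int_pow_mult[of t 1 "int l"] by (simp add: p_def int_pow_1)
        then show ?thesis using t x p by (simp add: group_word)
      qed
      have "n * (\<mu> (inv t \<otimes> x) - \<mu> x) = (\<Sum>l<n. \<nu> (inv (p (Suc l)) \<otimes> x)) - (\<Sum>l<n. \<nu> (inv (p l) \<otimes> x))"
        using x t n0 by (simp add: \<mu>_def Suc field_simps)
      also have "\<dots> = (\<Sum>l<n. \<nu> (inv (p (Suc l)) \<otimes> x) - \<nu> (inv (p l) \<otimes> x))" by (simp add: sum_subtractf)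
      also have "\<dots> = \<nu> (inv (p n) \<otimes> x) - \<nu> x"
        using x t by (subst sum_lessThan_telescope) (simp add: p_def)
      finally have eq: "\<mu> (inv t \<otimes> x) - \<mu> x = (1 / n) * (\<nu> (inv (p n) \<otimes> x) - \<nu> x)"
        using n0 by (simp add: field_simps)
      show "\<bar>\<mu> (inv t \<otimes> x) - \<mu> x\<bar> \<le> (1 / n) * (\<nu> (inv (p n) \<otimes> x) + \<nu> x)"
        unfolding eq abs_mult using \<nu>'(1)[of x] \<nu>'(1)[of "inv (p n) \<otimes> x"] n0
        by (intro mult_mono) auto
    qed
    also have "\<dots> = (1 / n) * ((\<Sum>\<^sub>\<infinity>x\<in>carrier G. \<nu> (inv (p n) \<otimes> x)) + (\<Sum>\<^sub>\<infinity>x\<in>carrier G. \<nu> x))"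
      by (subst infsum_cmult_right', subst infsum_add[OF s1 \<nu>'(4)]) simp
    also have "\<dots> = 2 / n" using infsum_translation[OF inv_closed[OF p], of \<nu>] \<nu>'(3) by simp
    finally show ?thesis .
  qed
  have shift_h: "shift_dist (h s) \<mu> \<le> e / 2" if s: "s \<in> E" for s
  proof -
    have hc: "h s \<in> carrier G" using hj(2)[OF s] normal_sub[OF H(1)] by blast
    define k where "k l = inv (p l) \<otimes> h s \<otimes> p l" for l
    have kc: "k l \<in> carrier G" for l using hc p by (simp add: k_def)
    let ?f = "\<lambda>l x. \<bar>\<nu> (inv (k l) \<otimes> x) - \<nu> x\<bar>"
    have sf: "(\<lambda>x. ?f l (inv (p l) \<otimes> x)) summable_on carrier G" for l
      by (rule finite_nonzero_values_imp_summable_on, rule finite_support_translation[OF inv_closed[OF p]],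
          rule finite_subset[OF _ finite_UnI[OF finite_support_translation[OF inv_closed[OF kc] \<nu>'(2)] \<nu>'(2)]]) auto
    have "shift_dist (h s) \<mu> \<le> (\<Sum>\<^sub>\<infinity>x\<in>carrier G. (1 / n) * (\<Sum>l<n. ?f l (inv (p l) \<otimes> x)))"
      unfolding shift_dist_def
    proof (rule infsum_mono)
      show "(\<lambda>x. \<bar>\<mu> (inv (h s) \<otimes> x) - \<mu> x\<bar>) summable_on carrier G" by (rule shift_summable[OF fin' hc])
      show "(\<lambda>x. (1 / n) * (\<Sum>l<n. ?f l (inv (p l) \<otimes> x))) summable_on carrier G"
        by (intro summable_on_cmult_right summable_on_finite_sum sf)
      fix x assume x: "x \<in> carrier G"
      have eq: "inv (p l) \<otimes> (inv (h s) \<otimes> x) = inv (k l) \<otimes> (inv (p l) \<otimes> x)" for l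
        using x hc p by (simp add: group_word k_def)
      have "\<mu> (inv (h s) \<otimes> x) - \<mu> x =
          (1 / n) * (\<Sum>l<n. \<nu> (inv (k l) \<otimes> (inv (p l) \<otimes> x)) - \<nu> (inv (p l) \<otimes> x))"
        using x hc by (simp add: \<mu>_def eq sum_subtractf diff_divide_distrib)
      then have "\<bar>\<mu> (inv (h s) \<otimes> x) - \<mu> x\<bar> =
          (1 / n) * \<bar>\<Sum>l<n. \<nu> (inv (k l) \<otimes> (inv (p l) \<otimes> x)) - \<nu> (inv (p l) \<otimes> x)\<bar>"
        by (simp add: abs_mult)
      also have "\<dots> \<le> (1 / n) * (\<Sum>l<n. ?f l (inv (p l) \<otimes> x))"
        by (intro mult_left_mono sum_abs) auto
      finally show "\<bar>\<mu> (inv (h s) \<otimes> x) - \<mu> x\<bar> \<le> (1 / n) * (\<Sum>l<n. ?f l (inv (p l) \<otimes> x))" .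
    qed
    also have "\<dots> = (1 / n) * (\<Sum>l<n. \<Sum>\<^sub>\<infinity>x\<in>carrier G. ?f l (inv (p l) \<otimes> x))"
      by (subst infsum_cmult_right', subst infsum_finite_sum) (auto intro: sf)
    also have "\<dots> = (1 / n) * (\<Sum>l<n. shift_dist (k l) \<nu>)"
      unfolding shift_dist_def by (subst infsum_translation[OF inv_closed[OF p]]) simp
    also have "\<dots> \<le> (1 / n) * (\<Sum>l<n. e / 2)"
      by (intro mult_left_mono sum_mono \<nu>(2)) (use s in \<open>auto simp: E'_def k_def\<close>)
    also have "\<dots> = e / 2" using n0 by simp
    finally show ?thesis .
  qed
  have "shift_dist s \<mu> \<le> e" if s: "s \<in> E" for s
  proof -
    have hc: "h s \<in> carrier G" using hj(2)[OF s] normal_sub[OF H(1)] by blast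
    have "shift_dist s \<mu> \<le> shift_dist (h s) \<mu> + shift_dist (t [^] j s) \<mu>"
      using shift_dist_mult[OF fin' hc, of "t [^] j s"] t hj(1)[OF s] by simp
    also have "shift_dist (t [^] j s) \<mu> \<le> \<bar>real_of_int (j s)\<bar> * shift_dist t \<mu>" by (rule shift_dist_int_pow[OF fin' t])
    also have "\<dots> \<le> J * (2 / n)"
      using J(1)[OF s] J(2) shift_t by (intro mult_mono) (auto simp: shift_dist_def infsum_nonneg)
    finally show ?thesis using shift_h[OF s] nJ by linarith
  qed
  then show "\<exists>\<mu>. finite_prob_on (cyclic_ext H t) \<mu> \<and> (\<forall>s\<in>E. shift_dist s \<mu> \<le> e)" using prob by blast
qed

theorem nilpotent_fin_gen_Reiter:
  assumes S: "finite S" "S \<subseteq> carrier G" "carrier G = generate G S"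
    and nil: "lower_central_series G c = {\<one>}"
  shows "Reiter (carrier G)"
proof (rule nilpotent_fin_gen_induct[OF S nil, where P=Reiter])
  show "Reiter {\<one>}"
    unfolding Reiter_def
  proof (intro allI impI)
    fix E and e :: real assume "E \<subseteq> {\<one>}" "0 < e"
    define \<mu> where "\<mu> x = (if x = \<one> then 1 else 0 :: real)" for x
    have "(\<Sum>\<^sub>\<infinity>x\<in>carrier G. \<mu> x) = (\<Sum>\<^sub>\<infinity>x\<in>{\<one>}. \<mu> x)"
      by (rule infsum_cong_neutral) (auto simp: \<mu>_def)
    then have "finite_prob_on {\<one>} \<mu>" by (auto simp: finite_prob_on_def \<mu>_def)
    moreover have "\<forall>s\<in>E. shift_dist s \<mu> \<le> e" using \<open>E \<subseteq> {\<one>}\<close> \<open>0 < e\<close> shift_dist_one by auto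
    ultimately show "\<exists>\<mu>. finite_prob_on {\<one>} \<mu> \<and> (\<forall>s\<in>E. shift_dist s \<mu> \<le> e)" by blast
  qed
qed (rule Reiter_cyclic_ext)

end

section \<open>Representations of nilpotent groups and finite permutation representations\<close>

lemma L2_set_sum_le: "L2_set (\<lambda>h. \<Sum>g\<in>C. f g h) F \<le> (\<Sum>g\<in>C. L2_set (f g) F)"
proof (induction C rule: infinite_finite_induct)
  case (insert g C)
  have "L2_set (\<lambda>h. \<Sum>g\<in>insert g C. f g h) F = L2_set (\<lambda>h. f g h + (\<Sum>g\<in>C. f g h)) F"
    using insert by simp
  also have "\<dots> \<le> L2_set (f g) F + L2_set (\<lambda>h. \<Sum>g\<in>C. f g h) F" by (rule L2_set_triangle_ineq)
  finally show ?case using insert by simp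
qed (simp_all add: L2_set_def)

lemma power2_sqrt_diff_le:
  fixes a b :: real
  assumes "0 \<le> a" "0 \<le> b"
  shows "(sqrt a - sqrt b)\<^sup>2 \<le> \<bar>a - b\<bar>"
proof -
  have "\<bar>sqrt a - sqrt b\<bar> * \<bar>sqrt a - sqrt b\<bar> \<le> \<bar>sqrt a - sqrt b\<bar> * \<bar>sqrt a + sqrt b\<bar>"
    using real_sqrt_ge_zero[OF assms(1)] real_sqrt_ge_zero[OF assms(2)] by (intro mult_left_mono) linarith+
  also have "\<dots> = \<bar>(sqrt a - sqrt b) * (sqrt a + sqrt b)\<bar>" by (simp add: abs_mult)
  also have "(sqrt a - sqrt b) * (sqrt a + sqrt b) = a - b" using assms by (simp add: algebra_simps)
  finally show ?thesis by (simp add: power2_eq_square)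
qed

text \<open>
  The operator \<open>u \<one>\<close> is a projection that may differ from the identity: the representations met
  below live on the ranges of central projections of a groupoid representation.
\<close>

lemma (in group)
  assumes u: "\<And>g. g \<in> carrier G \<Longrightarrow> u g \<in> bounded_operators I"
    and mult: "\<And>g h. g \<in> carrier G \<Longrightarrow> h \<in> carrier G \<Longrightarrow> u (g \<otimes> h) = u g \<circ> u h"
    and adj: "\<And>g. g \<in> carrier G \<Longrightarrow> is_adjoint I (u g) (u (inv g))"
    and \<xi>: "\<xi> \<in> ell2 I" and g: "g \<in> carrier G"
  shows unitary_rep_norm: "ell2_norm (u g \<xi>) = ell2_norm (u \<one> \<xi>)"
proof -
  have "complex_of_real ((ell2_norm (u g \<xi>))\<^sup>2) = ell2_inner \<xi> (u \<one> \<xi>)" if g: "g \<in> carrier G" for g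
  proof -
    have "complex_of_real ((ell2_norm (u g \<xi>))\<^sup>2) = ell2_inner (u g \<xi>) (u g \<xi>)"
      by (rule ell2_inner_self[symmetric, OF bop_in[OF u[OF g] \<xi>]])
    also have "\<dots> = ell2_inner \<xi> (u (inv g) (u g \<xi>))"
      using adj[OF g] \<xi> bop_in[OF u[OF g] \<xi>] unfolding is_adjoint_def by blast
    also have "u (inv g) (u g \<xi>) = u \<one> \<xi>" using mult[of "inv g" g] g by simp
    finally show ?thesis .
  qed
  from this[OF g] this[OF one_closed] have "(ell2_norm (u g \<xi>))\<^sup>2 = (ell2_norm (u \<one> \<xi>))\<^sup>2"
    by (metis of_real_eq_iff)
  then show ?thesis by (simp add: power2_eq_iff_nonneg)
qed

text \<open>
  Every unitary representation of the group is weakly contained in its finite permutation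
  representations.  With \<open>\<phi> = \<surd>\<mu>\<close> for an almost invariant measure \<open>\<mu>\<close>, the vectors
  \<open>\<Phi> h = \<phi> h u(h\<inverse>) \<xi>\<close> form a finitely supported function on the group with values in the
  Hilbert space, and the convolution of \<open>c\<close> with it is close to \<open>h \<mapsto> \<phi> h u(h\<inverse>) u(c) \<xi>\<close>.  A finite
  action in which the relevant group elements move a point to distinct points carries this
  function, coordinate by coordinate, to a permutation representation without changing norms.
\<close>

theorem (in group) nilpotent_weak_containment:
  fixes u :: "'a \<Rightarrow> 'i operator" and c :: "'a \<Rightarrow> complex"
  assumes S: "finite S" "S \<subseteq> carrier G" "carrier G = generate G S"
    and nil: "lower_central_series G m = {\<one>}"
    and inf: "infinite (UNIV :: 'y set)"
    and u: "\<And>g. g \<in> carrier G \<Longrightarrow> u g \<in> bounded_operators I"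
    and mult: "\<And>g h. g \<in> carrier G \<Longrightarrow> h \<in> carrier G \<Longrightarrow> u (g \<otimes> h) = u g \<circ> u h"
    and adj: "\<And>g. g \<in> carrier G \<Longrightarrow> is_adjoint I (u g) (u (inv g))"
    and C: "finite C" "C \<subseteq> carrier G"
    and M: "0 \<le> M" "\<And>(J :: 'y set) \<alpha> \<psi>. finite J \<Longrightarrow> action_on J \<alpha> \<Longrightarrow>
       (\<Sum>y\<in>J. (cmod (\<Sum>g\<in>C. c g * \<psi> (\<alpha> (inv g) y)))\<^sup>2) \<le> M\<^sup>2 * (\<Sum>y\<in>J. (cmod (\<psi> y))\<^sup>2)"
    and \<xi>: "\<xi> \<in> ell2 I"
  shows "ell2_norm (\<lambda>i. \<Sum>g\<in>C. c g * u g \<xi> i) \<le> M * ell2_norm (u \<one> \<xi>)"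
proof -
  define \<eta> where "\<eta> i = (\<Sum>g\<in>C. c g * u g \<xi> i)" for i
  define r where "r = ell2_norm (u \<one> \<xi>)"
  have r: "0 \<le> r" by (simp add: r_def)
  have iso: "ell2_norm (u g \<zeta>) = ell2_norm (u \<one> \<zeta>)" if "g \<in> carrier G" "\<zeta> \<in> ell2 I" for g \<zeta>
    by (rule unitary_rep_norm[where I=I]) (use u mult adj that in auto)
  have u\<xi>: "u g \<xi> \<in> ell2 I" if "g \<in> carrier G" for g using bop_in[OF u[OF that] \<xi>] .
  have \<eta>: "\<eta> \<in> ell2 I" unfolding \<eta>_def using C(2) u\<xi> by (intro ell2_sum ell2_scale) auto
  define A where "A = (\<Sum>g\<in>C. cmod (c g))"
  have A: "0 \<le> A" by (simp add: A_def sum_nonneg)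
  have main: "ell2_norm \<eta> \<le> M * r + (A * r) * d" if d: "0 < d" for d
  proof -
    obtain \<mu> where \<mu>: "finite_prob_on (carrier G) \<mu>" "\<And>g. g \<in> C \<Longrightarrow> shift_dist g \<mu> \<le> d\<^sup>2"
      using nilpotent_fin_gen_Reiter[OF S nil] C d unfolding Reiter_def by (metis zero_less_power)
    note \<mu>' = finite_prob_onD[OF \<mu>(1)]
    define F where "F = {x. \<mu> x \<noteq> 0}"
    have F: "finite F" "F \<subseteq> carrier G" using \<mu>(1) by (auto simp: finite_prob_on_def F_def)
    define \<phi> where "\<phi> x = sqrt (\<mu> x)" for x
    have \<phi>0: "\<phi> x = 0" if "x \<notin> F" for x using that by (simp add: \<phi>_def F_def)
    have \<phi>2: "(\<phi> x)\<^sup>2 = \<mu> x" for x using \<mu>'(1) by (simp add: \<phi>_def)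
    have sum\<mu>: "(\<Sum>x\<in>B. \<mu> x) = 1" if "finite B" "F \<subseteq> B" "B \<subseteq> carrier G" for B
    proof -
      have "(\<Sum>\<^sub>\<infinity>x\<in>carrier G. \<mu> x) = (\<Sum>\<^sub>\<infinity>x\<in>B. \<mu> x)"
        by (rule infsum_cong_neutral) (use that F in \<open>auto simp: F_def\<close>)
      then show ?thesis using \<mu>'(3) that(1) by simp
    qed
    \<comment> \<open>All elements at which the convolution of \<open>c\<close> with a function supported on \<open>F\<close> can be nonzero.\<close>
    define F' where "F' = F \<union> (\<lambda>(g, h). g \<otimes> h) ` (C \<times> F)"
    have F': "finite F'" "F' \<subseteq> carrier G" "F \<subseteq> F'" "\<And>g h. g \<in> C \<Longrightarrow> h \<in> F \<Longrightarrow> g \<otimes> h \<in> F'"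
      using F C by (auto simp: F'_def)
    define D where "D = (\<lambda>(a, b). inv a \<otimes> b) ` {(a, b). a \<in> F' \<and> b \<in> F' \<and> a \<noteq> b}"
    have "{(a, b). a \<in> F' \<and> b \<in> F' \<and> a \<noteq> b} \<subseteq> F' \<times> F'" by auto
    then have "finite D" unfolding D_def using F'(1) by (meson finite_SigmaI finite_imageI finite_subset)
    moreover have "D \<subseteq> carrier G" unfolding D_def using F'(2) by auto
    moreover have "\<one> \<notin> D"
    proof
      assume "\<one> \<in> D"
      then obtain a b where ab: "a \<in> F'" "b \<in> F'" "a \<noteq> b" "\<one> = inv a \<otimes> b" by (auto simp: D_def)
      then have "a \<otimes> \<one> = a \<otimes> (inv a \<otimes> b)" by simp
      then show False using ab(1,2,3) F'(2) by (simp add: subset_iff inv_mult_cancel_left)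
    qed
    ultimately obtain J :: "'y set" and \<alpha> y0 where J: "finite J" "y0 \<in> J" "action_on J \<alpha>"
      and sep: "\<And>g. g \<in> D \<Longrightarrow> \<alpha> g y0 \<noteq> y0"
      using nilpotent_fin_gen_finite_action[OF S nil _ _ _ inf] by metis
    define \<rho> where "\<rho> h = \<alpha> h y0" for h
    have \<rho>J: "\<rho> h \<in> J" if "h \<in> carrier G" for h using J that by (auto simp: action_on_def \<rho>_def)
    have \<alpha>\<rho>: "\<alpha> g (\<rho> h) = \<rho> (g \<otimes> h)" if "g \<in> carrier G" "h \<in> carrier G" for g h
      using J that by (auto simp: action_on_def \<rho>_def)
    have inj: "inj_on \<rho> F'"
    proof (rule inj_onI, rule ccontr)
      fix a b assume ab: "a \<in> F'" "b \<in> F'" "\<rho> a = \<rho> b" "a \<noteq> b"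
      have ac: "a \<in> carrier G" and bc: "b \<in> carrier G" using ab F'(2) by auto
      have "\<rho> (inv a \<otimes> b) = \<alpha> (inv a) (\<rho> a)" using \<alpha>\<rho>[of "inv a" b] ac bc ab(3) by simp
      also have "\<dots> = \<rho> \<one>" using \<alpha>\<rho>[of "inv a" a] ac by simp
      also have "\<dots> = y0" using J by (auto simp: action_on_def \<rho>_def)
      finally have "\<alpha> (inv a \<otimes> b) y0 = y0" by (simp add: \<rho>_def)
      moreover have "inv a \<otimes> b \<in> D" unfolding D_def using ab by auto
      ultimately show False using sep by blast
    qed
    define \<Phi> where "\<Phi> h i = \<phi> h * u (inv h) \<xi> i" for h i
    define \<psi> where "\<psi> i y = (if y \<in> \<rho> ` F then \<Phi> (inv_into F \<rho> y) i else 0)" for i y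
    have \<psi>: "\<psi> i (\<rho> h) = \<Phi> h i" if "h \<in> F" for h i
      using that inj_on_subset[OF inj F'(3)] by (simp add: \<psi>_def)
    have \<psi>': "\<psi> i (\<alpha> (inv g) (\<rho> h)) = \<Phi> (inv g \<otimes> h) i" if g: "g \<in> C" and h: "h \<in> F'" for i g h
    proof -
      have gc: "g \<in> carrier G" and hc: "h \<in> carrier G" using g h C(2) F'(2) by auto
      have eq: "\<alpha> (inv g) (\<rho> h) = \<rho> (inv g \<otimes> h)" using \<alpha>\<rho> gc hc by simp
      show ?thesis
      proof (cases "inv g \<otimes> h \<in> F")
        case True then show ?thesis using \<psi> eq by simp
      next
        case False
        have "\<rho> (inv g \<otimes> h) \<notin> \<rho> ` F"
        proof
          assume "\<rho> (inv g \<otimes> h) \<in> \<rho> ` F"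
          then obtain k where k: "k \<in> F" "\<rho> (inv g \<otimes> h) = \<rho> k" by auto
          have kc: "k \<in> carrier G" using k(1) F(2) by blast
          have "\<rho> h = \<alpha> g (\<rho> (inv g \<otimes> h))" using \<alpha>\<rho>[of g "inv g \<otimes> h"] gc hc by (simp add: inv_mult_cancel_left)
          also have "\<dots> = \<rho> (g \<otimes> k)" using k(2) \<alpha>\<rho>[OF gc kc] by simp
          finally have "h = g \<otimes> k" using inj h F'(4)[OF g k(1)] by (auto dest: inj_onD)
          then show False using False k(1) gc kc by (simp add: inv_mult_cancel_left)
        qed
        then show ?thesis using False eq \<phi>0 by (simp add: \<psi>_def \<Phi>_def)
      qed
    qed
    define v where "v h i = (\<Sum>g\<in>C. c g * \<Phi> (inv g \<otimes> h) i)" for h i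
    define w where "w h i = (\<Sum>g\<in>C. (c g * \<phi> (inv g \<otimes> h)) * u g \<xi> i)" for h i
    have coord: "(\<Sum>h\<in>F'. (cmod (v h i))\<^sup>2) \<le> M\<^sup>2 * (\<Sum>h\<in>F. (cmod (\<Phi> h i))\<^sup>2)" for i
    proof -
      have "(\<Sum>h\<in>F'. (cmod (v h i))\<^sup>2) = (\<Sum>h\<in>F'. (cmod (\<Sum>g\<in>C. c g * \<psi> i (\<alpha> (inv g) (\<rho> h))))\<^sup>2)"
        unfolding v_def by (intro sum.cong refl arg_cong[where f="\<lambda>z. (cmod z)\<^sup>2"]) (simp add: \<psi>')
      also have "\<dots> = (\<Sum>y\<in>\<rho> ` F'. (cmod (\<Sum>g\<in>C. c g * \<psi> i (\<alpha> (inv g) y)))\<^sup>2)"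
        by (simp add: sum.reindex[OF inj] o_def)
      also have "\<dots> \<le> (\<Sum>y\<in>J. (cmod (\<Sum>g\<in>C. c g * \<psi> i (\<alpha> (inv g) y)))\<^sup>2)"
        by (rule sum_mono2[OF J(1)]) (use \<rho>J F'(2) in auto)
      also have "\<dots> \<le> M\<^sup>2 * (\<Sum>y\<in>J. (cmod (\<psi> i y))\<^sup>2)" by (rule M(2)[OF J(1,3)])
      also have "(\<Sum>y\<in>J. (cmod (\<psi> i y))\<^sup>2) = (\<Sum>y\<in>\<rho> ` F. (cmod (\<psi> i y))\<^sup>2)"
        by (rule sum.mono_neutral_right[OF J(1)]) (use \<rho>J F(2) in \<open>auto simp: \<psi>_def\<close>)
      also have "\<dots> = (\<Sum>h\<in>F. (cmod (\<Phi> h i))\<^sup>2)"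
        by (simp add: sum.reindex[OF inj_on_subset[OF inj F'(3)]] \<psi>)
      finally show ?thesis .
    qed
    have \<Phi>2: "\<Phi> h \<in> ell2 I" if "h \<in> carrier G" for h
      unfolding \<Phi>_def using that by (intro ell2_scale u\<xi>) auto
    have w2: "w h \<in> ell2 I" for h
      unfolding w_def using C(2) by (intro ell2_sum ell2_scale u\<xi>) auto
    have vw: "v h = u (inv h) (w h)" if h: "h \<in> carrier G" for h
    proof -
      have hc: "inv h \<in> carrier G" using h by simp
      have "u (inv h) (w h) = (\<lambda>i. \<Sum>g\<in>C. u (inv h) (\<lambda>i. (c g * \<phi> (inv g \<otimes> h)) * u g \<xi> i) i)"
        unfolding w_def using C(2) by (intro bop_sum[OF u[OF hc]] ell2_scale u\<xi>) auto
      also have "\<dots> = (\<lambda>i. \<Sum>g\<in>C. (c g * \<phi> (inv g \<otimes> h)) * u (inv h) (u g \<xi>) i)"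
        using C(2) by (intro ext sum.cong refl) (subst bop_scale[OF u[OF hc] u\<xi>], auto)
      also have "\<dots> = v h"
      proof -
        have "u (inv (inv g \<otimes> h)) \<xi> = u (inv h) (u g \<xi>)" if "g \<in> C" for g
          using that C(2) h mult[of "inv h" g] by (auto simp: inv_mult_group subset_iff)
        then show ?thesis unfolding v_def \<Phi>_def by (intro ext sum.cong) auto
      qed
      finally show ?thesis by simp
    qed
    have norm_v: "ell2_norm (v h) = ell2_norm (w h)" if h: "h \<in> carrier G" for h
    proof -
      have one: "u \<one> (u g \<xi>) = u g \<xi>" if "g \<in> C" for g
        using mult[of \<one> g] that C(2) by (auto simp: o_def fun_eq_iff subset_iff)
      have "u \<one> (w h) = (\<lambda>i. \<Sum>g\<in>C. u \<one> (\<lambda>i. (c g * \<phi> (inv g \<otimes> h)) * u g \<xi> i) i)"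
        unfolding w_def using C(2) by (intro bop_sum[OF u[OF one_closed]] ell2_scale u\<xi>) auto
      also have "\<dots> = w h"
        unfolding w_def using C(2) one by (intro ext sum.cong refl) (subst bop_scale[OF u[OF one_closed] u\<xi>], auto)
      finally show ?thesis using iso[OF inv_closed[OF h] w2] vw[OF h] by simp
    qed
    have v2: "v h \<in> ell2 I" if "h \<in> carrier G" for h
      using vw[OF that] bop_in[OF u[OF inv_closed[OF that]] w2] by simp
    \<comment> \<open>Summing the bound in the permutation representation over all coordinates \<open>i\<close>.\<close>
    have sq: "(\<Sum>h\<in>F'. (ell2_norm (w h))\<^sup>2) \<le> (M * r)\<^sup>2"
    proof -
      have "(\<Sum>h\<in>F'. (ell2_norm (w h))\<^sup>2) = (\<Sum>h\<in>F'. \<Sum>\<^sub>\<infinity>i. (cmod (v h i))\<^sup>2)"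
        using norm_v F'(2) by (intro sum.cong) (auto simp flip: ell2_norm_power2)
      also have "\<dots> = (\<Sum>\<^sub>\<infinity>i. \<Sum>h\<in>F'. (cmod (v h i))\<^sup>2)"
        using v2 F'(2) ell2_summable by (intro infsum_finite_sum[symmetric]) blast
      also have "\<dots> \<le> (\<Sum>\<^sub>\<infinity>i. M\<^sup>2 * (\<Sum>h\<in>F. (cmod (\<Phi> h i))\<^sup>2))"
        using v2 \<Phi>2 F'(2) F(2) ell2_summable coord
        by (intro infsum_mono summable_on_cmult_right summable_on_finite_sum) blast+
      also have "\<dots> = M\<^sup>2 * (\<Sum>\<^sub>\<infinity>i. \<Sum>h\<in>F. (cmod (\<Phi> h i))\<^sup>2)" by (rule infsum_cmult_right')
      also have "(\<Sum>\<^sub>\<infinity>i. \<Sum>h\<in>F. (cmod (\<Phi> h i))\<^sup>2) = (\<Sum>h\<in>F. (ell2_norm (\<Phi> h))\<^sup>2)"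
        unfolding ell2_norm_power2 using \<Phi>2 F(2) ell2_summable by (intro infsum_finite_sum) blast
      also have "\<dots> = (\<Sum>h\<in>F. \<mu> h * r\<^sup>2)"
      proof (intro sum.cong refl)
        fix h assume "h \<in> F"
        then have h: "h \<in> carrier G" using F(2) by blast
        have "ell2_norm (\<Phi> h) = \<bar>\<phi> h\<bar> * ell2_norm (u (inv h) \<xi>)"
          unfolding \<Phi>_def by (simp add: ell2_norm_scale)
        then show "(ell2_norm (\<Phi> h))\<^sup>2 = \<mu> h * r\<^sup>2"
          using iso[OF inv_closed[OF h] \<xi>] by (simp add: power_mult_distrib \<phi>2 r_def)
      qed
      also have "\<dots> = r\<^sup>2" using sum\<mu>[OF F(1) order_refl F(2)] by (simp flip: sum_distrib_right)
      finally show ?thesis by (simp add: power_mult_distrib)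
    qed
    let ?d = "\<lambda>g h. cmod (c g) * r * \<bar>\<phi> (inv g \<otimes> h) - \<phi> h\<bar>"
    have pt: "\<phi> h * ell2_norm \<eta> \<le> ell2_norm (w h) + (\<Sum>g\<in>C. ?d g h)" for h
    proof -
      have d2: "(\<lambda>i. (c g * (\<phi> (inv g \<otimes> h) - \<phi> h)) * u g \<xi> i) \<in> ell2 I" if "g \<in> C" for g
        using that C(2) by (intro ell2_scale u\<xi>) auto
      have \<phi>\<eta>: "(\<lambda>i. \<phi> h * \<eta> i) \<in> ell2 I" by (rule ell2_scale[OF \<eta>])
      have eq: "(\<lambda>i. w h i - \<phi> h * \<eta> i) = (\<lambda>i. \<Sum>g\<in>C. (c g * (\<phi> (inv g \<otimes> h) - \<phi> h)) * u g \<xi> i)"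
        unfolding w_def \<eta>_def by (simp add: sum_distrib_left sum_subtractf algebra_simps)
      have "\<phi> h * ell2_norm \<eta> = ell2_norm (\<lambda>i. \<phi> h * \<eta> i)"
        using \<mu>'(1) by (simp add: ell2_norm_scale \<phi>_def)
      also have "\<dots> \<le> ell2_norm (w h) + ell2_norm (\<lambda>i. \<phi> h * \<eta> i - w h i)"
        by (rule ell2_norm_triangle_sub[OF \<phi>\<eta> w2])
      also have "ell2_norm (\<lambda>i. \<phi> h * \<eta> i - w h i) = ell2_norm (\<lambda>i. w h i - \<phi> h * \<eta> i)"
        using ell2_norm_uminus[of "\<lambda>i. w h i - \<phi> h * \<eta> i"] by simp
      also have "\<dots> \<le> (\<Sum>g\<in>C. ell2_norm (\<lambda>i. (c g * (\<phi> (inv g \<otimes> h) - \<phi> h)) * u g \<xi> i))"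
        unfolding eq by (rule ell2_norm_sum_le[OF d2])
      also have "\<dots> = (\<Sum>g\<in>C. ?d g h)"
      proof (intro sum.cong refl)
        fix g assume "g \<in> C"
        then have "g \<in> carrier G" using C(2) by blast
        then have "ell2_norm (u g \<xi>) = r" using iso[OF _ \<xi>] unfolding r_def by blast
        moreover have "cmod (complex_of_real (\<phi> (inv g \<otimes> h)) - complex_of_real (\<phi> h)) = \<bar>\<phi> (inv g \<otimes> h) - \<phi> h\<bar>"
          by (simp flip: of_real_diff)
        ultimately show "ell2_norm (\<lambda>i. (c g * (\<phi> (inv g \<otimes> h) - \<phi> h)) * u g \<xi> i) = ?d g h"
          by (simp add: ell2_norm_scale norm_mult)
      qed
      finally show ?thesis by simp
    qed
    have "ell2_norm \<eta> = L2_set (\<lambda>h. \<phi> h * ell2_norm \<eta>) F'"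
      unfolding L2_set_def using sum\<mu>[OF F'(1,3,2)]
      by (simp add: power_mult_distrib \<phi>2 flip: sum_distrib_right)
    also have "\<dots> \<le> L2_set (\<lambda>h. ell2_norm (w h) + (\<Sum>g\<in>C. ?d g h)) F'"
      using pt \<mu>'(1) by (intro L2_set_mono) (auto simp: \<phi>_def)
    also have "\<dots> \<le> L2_set (\<lambda>h. ell2_norm (w h)) F' + L2_set (\<lambda>h. \<Sum>g\<in>C. ?d g h) F'"
      by (rule L2_set_triangle_ineq)
    also have "\<dots> \<le> M * r + (\<Sum>g\<in>C. L2_set (?d g) F')"
    proof (intro add_mono L2_set_sum_le)
      show "L2_set (\<lambda>h. ell2_norm (w h)) F' \<le> M * r"
        unfolding L2_set_def using sq M(1) r by (intro real_le_lsqrt) (auto intro: sum_nonneg)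
    qed
    also have "(\<Sum>g\<in>C. L2_set (?d g) F') \<le> (\<Sum>g\<in>C. cmod (c g) * r * d)"
    proof (rule sum_mono)
      fix g assume g: "g \<in> C"
      have gc: "g \<in> carrier G" using g C(2) by blast
      have "(\<Sum>h\<in>F'. \<bar>\<phi> (inv g \<otimes> h) - \<phi> h\<bar>\<^sup>2) \<le> (\<Sum>h\<in>F'. \<bar>\<mu> (inv g \<otimes> h) - \<mu> h\<bar>)"
        unfolding \<phi>_def power2_abs by (intro sum_mono power2_sqrt_diff_le \<mu>'(1))
      also have "\<dots> \<le> shift_dist g \<mu>"
        unfolding shift_dist_def
        by (rule finite_sum_le_infsum[OF shift_summable[OF \<mu>'(2) gc] F'(1,2)]) auto
      also have "\<dots> \<le> d\<^sup>2" by (rule \<mu>(2)[OF g])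
      finally have "L2_set (\<lambda>h. \<bar>\<phi> (inv g \<otimes> h) - \<phi> h\<bar>) F' \<le> d"
        unfolding L2_set_def using d by (intro real_le_lsqrt) (auto intro: sum_nonneg)
      then have "cmod (c g) * r * L2_set (\<lambda>h. \<bar>\<phi> (inv g \<otimes> h) - \<phi> h\<bar>) F' \<le> cmod (c g) * r * d"
        using r by (intro mult_left_mono) auto
      then show "L2_set (?d g) F' \<le> cmod (c g) * r * d"
        using r by (simp add: L2_set_right_distrib)
    qed
    also have "(\<Sum>g\<in>C. cmod (c g) * r * d) = (A * r) * d" by (simp add: A_def sum_distrib_right)
    finally show ?thesis by simp
  qed
  have "ell2_norm \<eta> \<le> M * r"
  proof (rule field_le_epsilon)
    fix e :: real assume "0 < e"
    then obtain d where "0 < d" "(A * r) * d \<le> e" using ex_small_factor[of "A * r" e] A r by auto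
    then show "ell2_norm \<eta> \<le> M * r + e" using main[of d] by linarith
  qed
  then show ?thesis by (simp add: \<eta>_def[abs_def] r_def)
qed

section \<open>The bundle groupoid\<close>

locale subgroup_exhaustion = group \<Gamma> for \<Gamma> :: "('g, 'b) monoid_scheme" (structure) +
  fixes \<Gamma>s :: "nat \<Rightarrow> 'g set"
  assumes subgroup_stage: "1 \<le> n \<Longrightarrow> subgroup (\<Gamma>s n) \<Gamma>"
    and stage_mono: "1 \<le> m \<Longrightarrow> m \<le> n \<Longrightarrow> \<Gamma>s m \<subseteq> \<Gamma>s n"
    and stage_union: "(\<Union>n\<in>{1..}. \<Gamma>s n) = carrier \<Gamma>"
begin

abbreviation \<G> :: "('g \<times> enat, enat) gpd" where
  "\<G> \<equiv> bundle_groupoid \<Gamma> \<Gamma>s"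

definition arrows :: "('g \<times> enat) set" where
  "arrows = {(g, x). 1 \<le> x \<and> g \<in> fibre \<Gamma> \<Gamma>s x}"

lemma enat_ge_1 [simp]: "1 \<le> enat n \<longleftrightarrow> 1 \<le> n"
  by (simp add: one_enat_def)

lemma fibre_simps [simp]: "fibre \<Gamma> \<Gamma>s (enat n) = \<Gamma>s n" "fibre \<Gamma> \<Gamma>s \<infinity> = carrier \<Gamma>"
  by (simp_all add: fibre_def)

lemma mem_arrows [simp]: "(g, x) \<in> arrows \<longleftrightarrow> 1 \<le> x \<and> g \<in> fibre \<Gamma> \<Gamma>s x"
  by (simp add: arrows_def)

lemma subgroup_fibre: "1 \<le> x \<Longrightarrow> subgroup (fibre \<Gamma> \<Gamma>s x) \<Gamma>"
  by (cases x) (auto simp: subgroup_stage subgroup_self)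

lemma
  assumes "1 \<le> x"
  shows fibre_sub: "g \<in> fibre \<Gamma> \<Gamma>s x \<Longrightarrow> g \<in> carrier \<Gamma>"
    and fibre_mult: "g \<in> fibre \<Gamma> \<Gamma>s x \<Longrightarrow> h \<in> fibre \<Gamma> \<Gamma>s x \<Longrightarrow> g \<otimes> h \<in> fibre \<Gamma> \<Gamma>s x"
    and fibre_inv: "g \<in> fibre \<Gamma> \<Gamma>s x \<Longrightarrow> inv g \<in> fibre \<Gamma> \<Gamma>s x"
    and fibre_one: "\<one> \<in> fibre \<Gamma> \<Gamma>s x"
  by (rule subgroup.mem_carrier[OF subgroup_fibre[OF assms]], assumption,
      rule subgroup.m_closed[OF subgroup_fibre[OF assms]], assumption, assumption,
      rule subgroup.m_inv_closed[OF subgroup_fibre[OF assms]], assumption,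
      rule subgroup.one_closed[OF subgroup_fibre[OF assms]])

lemma stage_sub: "1 \<le> n \<Longrightarrow> g \<in> \<Gamma>s n \<Longrightarrow> g \<in> carrier \<Gamma>"
  using fibre_sub[of "enat n"] by simp

lemma in_stage: "g \<in> carrier \<Gamma> \<Longrightarrow> \<exists>N\<ge>1. \<forall>n\<ge>N. g \<in> \<Gamma>s n"
  using stage_union stage_mono by (metis UN_E atLeast_iff subsetD)

lemma finite_in_stage: "finite S \<Longrightarrow> S \<subseteq> carrier \<Gamma> \<Longrightarrow> \<exists>N\<ge>1. \<forall>n\<ge>N. S \<subseteq> \<Gamma>s n"
proof (induction S rule: finite_induct)
  case (insert g S)
  then obtain N where N: "N \<ge> 1" "\<forall>n\<ge>N. S \<subseteq> \<Gamma>s n" by auto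
  obtain M where M: "M \<ge> 1" "\<forall>n\<ge>M. g \<in> \<Gamma>s n" using in_stage insert.prems by blast
  show ?case using N M by (intro exI[of _ "max M N"]) auto
qed auto

lemma bundle_simps [simp]:
  "gpd_arrows \<G> = bundle_topology \<Gamma>s" "gpd_units \<G> = unit_space"
  "gpd_src \<G> = snd" "gpd_rng \<G> = snd" "gpd_unit \<G> = (\<lambda>x. (\<one>, x))"
  "gpd_mult \<G> = (\<lambda>(g, x) (h, y). (g \<otimes> h, x))" "gpd_inv \<G> = (\<lambda>(g, x). (inv g, x))"
  by (simp_all add: bundle_groupoid_def)

lemma topspace_unit_space [simp]: "topspace unit_space = {1..}"
  by (simp add: unit_space_def)

lemma topspace_bundle [simp]: "topspace (bundle_topology \<Gamma>s) = arrows"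
  using topspace_bundle_topology[OF stage_mono stage_union] by (simp add: arrows_def)

lemma openin_unit_space_iff:
  "openin unit_space S \<longleftrightarrow> S \<subseteq> {1..} \<and> (\<infinity> \<in> S \<longrightarrow> (\<exists>N\<ge>1. \<forall>m\<ge>N. enat m \<in> S))"
proof -
  have "finite ({1..} - S) \<longleftrightarrow> (\<exists>N\<ge>1. \<forall>m\<ge>N. enat m \<in> S)" if inf: "\<infinity> \<in> S"
  proof
    assume fin: "finite ({1..} - S)"
    have "finite {m. 1 \<le> m \<and> enat m \<notin> S}"
      by (rule finite_imageD[where f=enat], rule finite_subset[OF _ fin]) (auto simp: inj_on_def)
    then obtain N where N: "\<forall>m\<in>{m. 1 \<le> m \<and> enat m \<notin> S}. m < N" using finite_nat_set_iff_bounded by blast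
    then show "\<exists>N\<ge>1. \<forall>m\<ge>N. enat m \<in> S" by (intro exI[of _ "max N 1"]) force
  next
    assume "\<exists>N\<ge>1. \<forall>m\<ge>N. enat m \<in> S"
    then obtain N where N: "\<forall>m\<ge>N. enat m \<in> S" by blast
    have "{1..} - S \<subseteq> enat ` {..<N}"
    proof
      fix x assume x: "x \<in> {1..} - S"
      then obtain m where "x = enat m" using inf by (cases x) auto
      moreover from this have "m < N" using N x by (metis DiffD2 not_le)
      ultimately show "x \<in> enat ` {..<N}" by blast
    qed
    then show "finite ({1..} - S)" by (rule finite_subset) simp
  qed
  then show ?thesis by (auto simp: openin_unit_space)
qed

lemma openin_bundle_union: "openin (bundle_topology \<Gamma>s) S \<longleftrightarrow> (\<exists>\<U>\<subseteq>bundle_basis \<Gamma>s. S = \<Union>\<U>)"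
  by (rule openin_bundle_topology[where \<Gamma>s=\<Gamma>s]) (rule stage_mono)

text \<open>
  All topological questions about the bundle reduce to tails of the sections \<open>x \<mapsto> (g, x)\<close>.
\<close>

lemma openin_bundle_iff:
  "openin (bundle_topology \<Gamma>s) W \<longleftrightarrow>
    W \<subseteq> arrows \<and> (\<forall>g. (g, \<infinity>) \<in> W \<longrightarrow> (\<exists>N\<ge>1. \<forall>m\<ge>N. (g, enat m) \<in> W))"
proof
  assume W: "openin (bundle_topology \<Gamma>s) W"
  then obtain \<U> where U: "\<U> \<subseteq> bundle_basis \<Gamma>s" "W = \<Union>\<U>" using openin_bundle_union by blast
  have "\<exists>N\<ge>1. \<forall>m\<ge>N. (g, enat m) \<in> W" if gW: "(g, \<infinity>) \<in> W" for g
  proof -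
    obtain V where V: "V \<in> \<U>" "(g, \<infinity>) \<in> V" using U(2) gW by blast
    then obtain n where "V = basic_open g n" "1 \<le> n"
      using U(1) by (auto simp: bundle_basis_def basic_open_def)
    moreover have "V \<subseteq> W" using V(1) U(2) by blast
    ultimately show ?thesis by (intro exI[of _ n]) (auto simp: basic_open_def)
  qed
  moreover have "W \<subseteq> arrows" using openin_subset[OF W] by simp
  ultimately show "W \<subseteq> arrows \<and> (\<forall>g. (g, \<infinity>) \<in> W \<longrightarrow> (\<exists>N\<ge>1. \<forall>m\<ge>N. (g, enat m) \<in> W))" by blast
next
  assume W: "W \<subseteq> arrows \<and> (\<forall>g. (g, \<infinity>) \<in> W \<longrightarrow> (\<exists>N\<ge>1. \<forall>m\<ge>N. (g, enat m) \<in> W))"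
  have "\<exists>T\<in>bundle_basis \<Gamma>s. p \<in> T \<and> T \<subseteq> W" if p: "p \<in> W" for p
  proof (cases "snd p")
    case (enat n)
    then obtain g where g: "p = (g, enat n)" by (metis prod.collapse)
    then have "1 \<le> n" "g \<in> \<Gamma>s n" using W p by auto
    then have "{(g, enat n)} \<in> bundle_basis \<Gamma>s" unfolding bundle_basis_def by blast
    then show ?thesis using p g by blast
  next
    case infinity
    then obtain g where g: "p = (g, \<infinity>)" by (metis prod.collapse)
    then obtain N where N: "N \<ge> 1" "\<forall>m\<ge>N. (g, enat m) \<in> W" using W p by blast
    have "g \<in> \<Gamma>s N" using N W by auto
    then have "basic_open g N \<in> bundle_basis \<Gamma>s" using N(1) unfolding bundle_basis_def by blast
    moreover have "basic_open g N \<subseteq> W"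
    proof
      fix q assume "q \<in> basic_open g N"
      then obtain x where x: "q = (g, x)" "enat N \<le> x" by (auto simp: basic_open_def)
      then show "q \<in> W" using N(2) p g by (cases x) auto
    qed
    moreover have "p \<in> basic_open g N" using g by (simp add: basic_open_def)
    ultimately show ?thesis by blast
  qed
  then have "W = \<Union>{T \<in> bundle_basis \<Gamma>s. T \<subseteq> W}" by blast
  then show "openin (bundle_topology \<Gamma>s) W" unfolding openin_bundle_union by (intro exI[of _ "{T \<in> bundle_basis \<Gamma>s. T \<subseteq> W}"]) blast
qed

definition section_of :: "'g \<Rightarrow> ('g \<times> enat) set" where
  "section_of g = {p \<in> arrows. fst p = g}"

lemma mem_section_of [simp]: "(h, x) \<in> section_of g \<longleftrightarrow> h = g \<and> 1 \<le> x \<and> g \<in> fibre \<Gamma> \<Gamma>s x"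
  by (auto simp: section_of_def)

lemma openin_tail_section:
  assumes g: "g \<in> carrier \<Gamma>"
  shows "openin (bundle_topology \<Gamma>s) {p \<in> section_of g. enat N \<le> snd p}"
proof -
  obtain M where "M \<ge> 1" "\<forall>n\<ge>M. g \<in> \<Gamma>s n" using in_stage[OF g] by blast
  then show ?thesis
    unfolding openin_bundle_iff by (auto simp: section_of_def intro!: exI[of _ "max M N"])
qed

lemma openin_section: "g \<in> carrier \<Gamma> \<Longrightarrow> openin (bundle_topology \<Gamma>s) (section_of g)"
  using openin_tail_section[of g 0] by (simp flip: zero_enat_def)

lemma openin_section_of_stage:
  assumes "\<And>h. h \<in> S \<Longrightarrow> h \<in> carrier \<Gamma>"
  shows "openin (bundle_topology \<Gamma>s) {p \<in> arrows. fst p \<in> S}"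
proof -
  have "{p \<in> arrows. fst p \<in> S} = \<Union>(section_of ` S)" by (auto simp: section_of_def)
  moreover have "openin (bundle_topology \<Gamma>s) (\<Union>(section_of ` S))"
    using openin_section assms by (intro openin_Union) blast
  ultimately show ?thesis by simp
qed

lemma compactin_section: "g \<in> carrier \<Gamma> \<Longrightarrow> compactin (bundle_topology \<Gamma>s) (section_of g)"
  unfolding compactin_def
proof (intro conjI allI impI)
  show "section_of g \<subseteq> topspace (bundle_topology \<Gamma>s)" by (auto simp: section_of_def)
  fix \<U> assume g: "g \<in> carrier \<Gamma>" and "(\<forall>U\<in>\<U>. openin (bundle_topology \<Gamma>s) U) \<and> section_of g \<subseteq> \<Union>\<U>"
  then have U: "\<And>U. U \<in> \<U> \<Longrightarrow> openin (bundle_topology \<Gamma>s) U" "section_of g \<subseteq> \<Union>\<U>" by blast+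
  have "(g, \<infinity>) \<in> section_of g" using g by simp
  then obtain U0 where U0: "U0 \<in> \<U>" "(g, \<infinity>) \<in> U0" using U(2) by blast
  then obtain N where N: "\<forall>m\<ge>N. (g, enat m) \<in> U0" using U(1)[OF U0(1)] openin_bundle_iff by blast
  define R where "R = {p \<in> section_of g. p \<notin> U0}"
  have "R \<subseteq> (\<lambda>m. (g, enat m)) ` {..<N}"
  proof
    fix p assume p: "p \<in> R"
    then have x: "p = (g, snd p)" "p \<notin> U0" by (auto simp: R_def section_of_def)
    then obtain m where m: "p = (g, enat m)" using U0(2) by (cases "snd p") auto
    moreover from this have "m < N" using N x(2) by (metis not_le)
    ultimately show "p \<in> (\<lambda>m. (g, enat m)) ` {..<N}" by blast
  qed
  then have R: "finite R" by (rule finite_subset) simp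
  have "\<forall>p\<in>R. \<exists>U\<in>\<U>. p \<in> U" using U(2) unfolding R_def by blast
  then obtain V where V: "\<And>p. p \<in> R \<Longrightarrow> V p \<in> \<U> \<and> p \<in> V p" by metis
  show "\<exists>\<F>. finite \<F> \<and> \<F> \<subseteq> \<U> \<and> section_of g \<subseteq> \<Union>\<F>"
  proof (intro exI[of _ "insert U0 (V ` R)"] conjI)
    show "section_of g \<subseteq> \<Union>(insert U0 (V ` R))"
    proof
      fix p assume "p \<in> section_of g"
      then have "p \<in> U0 \<or> p \<in> R" unfolding R_def by blast
      then show "p \<in> \<Union>(insert U0 (V ` R))" using V[of p] by blast
    qed
  qed (use R U0 V in auto)
qed

text \<open>The sections are pairwise disjoint open sets, so a compact set meets only finitely many.\<close>

lemma compactin_sections: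
  assumes K: "compactin (bundle_topology \<Gamma>s) K"
  obtains S where "finite S" "S \<subseteq> carrier \<Gamma>" "\<And>g x. (g, x) \<in> K \<Longrightarrow> g \<in> S"
proof -
  have sub: "K \<subseteq> arrows" using compactin_subset_topspace[OF K] by simp
  have "K \<subseteq> \<Union>(section_of ` carrier \<Gamma>)"
    using sub fibre_sub by (auto simp: section_of_def subset_iff) 
  moreover have "\<forall>U\<in>section_of ` carrier \<Gamma>. openin (bundle_topology \<Gamma>s) U" using openin_section by blast
  ultimately obtain \<F> where F: "finite \<F>" "\<F> \<subseteq> section_of ` carrier \<Gamma>" "K \<subseteq> \<Union>\<F>"
    using K unfolding compactin_def by meson
  obtain S where S: "finite S" "S \<subseteq> carrier \<Gamma>" "\<F> = section_of ` S" using finite_subset_image[OF F(1,2)] by blast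
  show thesis
    by (rule that[OF S(1,2)]) (use F(3) S(3) in \<open>auto simp: section_of_def\<close>)
qed

text \<open>Continuity at the points of the fibre over infinity means convergence along the sections.\<close>

lemma cc_functions_iff:
  "f \<in> cc_functions \<G> \<longleftrightarrow>
    (\<forall>p. p \<notin> arrows \<longrightarrow> f p = 0) \<and> finite {g. \<exists>x. f (g, x) \<noteq> 0} \<and>
    (\<forall>g\<in>carrier \<Gamma>. (\<lambda>m. f (g, enat m)) \<longlonglongrightarrow> f (g, \<infinity>))"
proof
  assume f: "f \<in> cc_functions \<G>"
  then have cont: "continuous_map (bundle_topology \<Gamma>s) euclidean f"
    and comp: "compactin (bundle_topology \<Gamma>s) (bundle_topology \<Gamma>s closure_of {g \<in> arrows. f g \<noteq> 0})"
    and off: "\<forall>p. p \<notin> arrows \<longrightarrow> f p = 0" by (auto simp: cc_functions_def)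
  obtain S where S: "finite S" "\<And>g x. (g, x) \<in> bundle_topology \<Gamma>s closure_of {g \<in> arrows. f g \<noteq> 0} \<Longrightarrow> g \<in> S"
    by (rule compactin_sections[OF comp]) blast
  have "{g. \<exists>x. f (g, x) \<noteq> 0} \<subseteq> S"
  proof
    fix g assume "g \<in> {g. \<exists>x. f (g, x) \<noteq> 0}"
    then obtain x where x: "f (g, x) \<noteq> 0" by blast
    then have "(g, x) \<in> {g \<in> arrows. f g \<noteq> 0}" using off by blast
    then have "(g, x) \<in> bundle_topology \<Gamma>s closure_of {g \<in> arrows. f g \<noteq> 0}"
      using closure_of_subset[of "{g \<in> arrows. f g \<noteq> 0}" "bundle_topology \<Gamma>s"] by auto
    then show "g \<in> S" by (rule S(2))
  qed
  then have "finite {g. \<exists>x. f (g, x) \<noteq> 0}" using S(1) finite_subset by blast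
  moreover have "(\<lambda>m. f (g, enat m)) \<longlonglongrightarrow> f (g, \<infinity>)" if g: "g \<in> carrier \<Gamma>" for g
  proof (rule topological_tendstoI)
    fix V assume V: "open V" "f (g, \<infinity>) \<in> V"
    have "openin (bundle_topology \<Gamma>s) {p \<in> arrows. f p \<in> V}"
      using openin_continuous_map_preimage[OF cont, of V] V(1) by simp
    moreover have "(g, \<infinity>) \<in> {p \<in> arrows. f p \<in> V}" using V(2) g by simp
    ultimately obtain N where "\<forall>m\<ge>N. (g, enat m) \<in> {p \<in> arrows. f p \<in> V}"
      unfolding openin_bundle_iff by blast
    then show "\<forall>\<^sub>F m in sequentially. f (g, enat m) \<in> V" unfolding eventually_sequentially by blast
  qed
  ultimately show "(\<forall>p. p \<notin> arrows \<longrightarrow> f p = 0) \<and> finite {g. \<exists>x. f (g, x) \<noteq> 0} \<and>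
    (\<forall>g\<in>carrier \<Gamma>. (\<lambda>m. f (g, enat m)) \<longlonglongrightarrow> f (g, \<infinity>))" using off by blast
next
  assume *: "(\<forall>p. p \<notin> arrows \<longrightarrow> f p = 0) \<and> finite {g. \<exists>x. f (g, x) \<noteq> 0} \<and>
    (\<forall>g\<in>carrier \<Gamma>. (\<lambda>m. f (g, enat m)) \<longlonglongrightarrow> f (g, \<infinity>))"
  define S where "S = {g. \<exists>x. f (g, x) \<noteq> 0}"
  have S: "finite S" "S \<subseteq> carrier \<Gamma>" using * fibre_sub by (auto simp: S_def arrows_def)
  have cont: "continuous_map (bundle_topology \<Gamma>s) euclidean f"
    unfolding continuous_map_def
  proof (intro conjI allI impI)
    fix V :: "complex set" assume V: "openin euclidean V"
    show "openin (bundle_topology \<Gamma>s) {p \<in> topspace (bundle_topology \<Gamma>s). f p \<in> V}"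
      unfolding openin_bundle_iff
    proof (intro conjI allI impI)
      fix g assume g: "(g, \<infinity>) \<in> {p \<in> topspace (bundle_topology \<Gamma>s). f p \<in> V}"
      then have gc: "g \<in> carrier \<Gamma>" by simp
      then have "\<forall>\<^sub>F m in sequentially. f (g, enat m) \<in> V"
        using * g V by (intro topological_tendstoD) auto
      then obtain N where N: "\<forall>m\<ge>N. f (g, enat m) \<in> V" unfolding eventually_sequentially by blast
      obtain M where "M \<ge> 1" "\<forall>n\<ge>M. g \<in> \<Gamma>s n" using in_stage[OF gc] by blast
      then show "\<exists>N\<ge>1. \<forall>m\<ge>N. (g, enat m) \<in> {p \<in> topspace (bundle_topology \<Gamma>s). f p \<in> V}"
        using N by (intro exI[of _ "max M N"]) auto
    qed auto
  qed auto
  define B where "B = {p \<in> arrows. fst p \<in> S}"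
  have "B = \<Union>(section_of ` S)" by (auto simp: B_def section_of_def)
  then have comp: "compactin (bundle_topology \<Gamma>s) B"
    using S compactin_section by (auto intro!: compactin_Union)
  have "arrows - B = {p \<in> arrows. fst p \<in> carrier \<Gamma> - S}" using fibre_sub by (auto simp: B_def arrows_def)
  then have "openin (bundle_topology \<Gamma>s) (arrows - B)" using openin_section_of_stage[of "carrier \<Gamma> - S"] by auto
  then have "closedin (bundle_topology \<Gamma>s) B" unfolding closedin_def by (auto simp: B_def)
  moreover have "{g \<in> arrows. f g \<noteq> 0} \<subseteq> B" by (auto simp: B_def S_def)
  ultimately have "bundle_topology \<Gamma>s closure_of {g \<in> arrows. f g \<noteq> 0} \<subseteq> B"
    by (intro closure_of_minimal)
  then have "compactin (bundle_topology \<Gamma>s) (bundle_topology \<Gamma>s closure_of {g \<in> arrows. f g \<noteq> 0})"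
    by (rule closed_compactin[OF comp _ closedin_closure_of])
  then show "f \<in> cc_functions \<G>" using cont * by (simp add: cc_functions_def)
qed

lemma composable_iff:
  "((g, x), (h, y)) \<in> composable \<G> \<longleftrightarrow> x = y \<and> 1 \<le> x \<and> g \<in> fibre \<Gamma> \<Gamma>s x \<and> h \<in> fibre \<Gamma> \<Gamma>s x"
  by (auto simp: composable_def)

lemma continuous_mult_bundle:
  "continuous_map (subtopology (prod_topology (bundle_topology \<Gamma>s) (bundle_topology \<Gamma>s)) (composable \<G>))
     (bundle_topology \<Gamma>s) (\<lambda>(g, h). gpd_mult \<G> g h)"
  (is "continuous_map ?P ?T ?m")
  unfolding continuous_map_def
proof (intro conjI allI impI)
  have top: "topspace ?P = composable \<G>"
    by (auto simp: composable_def)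
  show "?m \<in> topspace ?P \<rightarrow> topspace ?T"
    unfolding top using fibre_mult by (auto simp: composable_iff)
  fix W assume W: "openin ?T W"
  show "openin ?P {z \<in> topspace ?P. ?m z \<in> W}"
    unfolding top
  proof (subst openin_subopen, rule ballI)
    fix z assume z: "z \<in> {z \<in> composable \<G>. ?m z \<in> W}"
    then obtain g h x where gh: "z = ((g, x), (h, x))" "1 \<le> x" "g \<in> fibre \<Gamma> \<Gamma>s x" "h \<in> fibre \<Gamma> \<Gamma>s x"
      by (cases z) (auto simp: composable_def)
    have gc: "g \<in> carrier \<Gamma>" and hc: "h \<in> carrier \<Gamma>" using gh fibre_sub by blast+
    have gW: "(g \<otimes> h, x) \<in> W" using z gh(1) by simp
    have "\<exists>U V. openin ?T U \<and> openin ?T V \<and> (g, x) \<in> U \<and> (h, x) \<in> V \<and>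
      (\<forall>a b y. (a, y) \<in> U \<longrightarrow> (b, y) \<in> V \<longrightarrow> (a \<otimes> b, y) \<in> W)"
    proof (cases x)
      case (enat n)
      then show ?thesis
        using gh gW by (intro exI[of _ "{(g, x)}"] exI[of _ "{(h, x)}"]) (auto simp: openin_bundle_iff)
    next
      case infinity
      then obtain N where N: "\<forall>m\<ge>N. (g \<otimes> h, enat m) \<in> W" using W gW openin_bundle_iff by blast
      have "(g \<otimes> h, y) \<in> W" if "enat N \<le> y" for y using that N gW infinity by (cases y) auto
      then show ?thesis
        using gh infinity openin_tail_section[OF gc, of N] openin_tail_section[OF hc, of N]
        by (intro exI[of _ "{p \<in> section_of g. enat N \<le> snd p}"] exI[of _ "{p \<in> section_of h. enat N \<le> snd p}"]) auto
    qed
    then obtain U V where UV: "openin ?T U" "openin ?T V" "(g, x) \<in> U" "(h, x) \<in> V"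
      "\<And>a b y. (a, y) \<in> U \<Longrightarrow> (b, y) \<in> V \<Longrightarrow> (a \<otimes> b, y) \<in> W" by blast
    have "openin ?P ((U \<times> V) \<inter> composable \<G>)"
      using UV(1,2) by (intro openin_subtopology_Int) (simp add: openin_prod_Times_iff)
    moreover have "z \<in> (U \<times> V) \<inter> composable \<G>" using UV(3,4) gh by (simp add: composable_iff)
    moreover have "(U \<times> V) \<inter> composable \<G> \<subseteq> {z \<in> composable \<G>. ?m z \<in> W}"
      using UV(5) by (auto simp: composable_iff)
    ultimately show "\<exists>T. openin ?P T \<and> z \<in> T \<and> T \<subseteq> {z \<in> composable \<G>. ?m z \<in> W}" by blast
  qed
qed

lemma etale_bundle:
  assumes count: "countable (carrier \<Gamma>)"
  shows "etale_groupoid \<G>"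
proof -
  let ?T = "bundle_topology \<Gamma>s"
  have cont_snd: "continuous_map ?T unit_space snd"
    unfolding continuous_map_def
  proof (intro conjI allI impI)
    fix U assume U: "openin unit_space U"
    show "openin ?T {p \<in> topspace ?T. snd p \<in> U}"
      unfolding openin_bundle_iff
    proof (intro conjI allI impI)
      fix g assume g: "(g, \<infinity>) \<in> {p \<in> topspace ?T. snd p \<in> U}"
      then obtain M where M: "M \<ge> 1" "\<forall>n\<ge>M. g \<in> \<Gamma>s n" using in_stage by auto
      obtain N where "\<forall>m\<ge>N. enat m \<in> U" using U g unfolding openin_unit_space_iff by auto
      then show "\<exists>N\<ge>1. \<forall>m\<ge>N. (g, enat m) \<in> {p \<in> topspace ?T. snd p \<in> U}"
        using M by (intro exI[of _ "max M N"]) auto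
    qed auto
  qed auto
  have cont_unit: "continuous_map unit_space ?T (\<lambda>x. (\<one>, x))"
    unfolding continuous_map_def
  proof (intro conjI allI impI)
    show "(\<lambda>x. (\<one>, x)) \<in> topspace unit_space \<rightarrow> topspace ?T" using fibre_one by auto
    fix W assume W: "openin ?T W"
    show "openin unit_space {x \<in> topspace unit_space. (\<one>, x) \<in> W}"
      unfolding openin_unit_space_iff
    proof (intro conjI impI)
      assume "\<infinity> \<in> {x \<in> topspace unit_space. (\<one>, x) \<in> W}"
      then obtain N where "N \<ge> 1" "\<forall>m\<ge>N. (\<one>, enat m) \<in> W" using W unfolding openin_bundle_iff by blast
      then show "\<exists>N\<ge>1. \<forall>m\<ge>N. enat m \<in> {x \<in> topspace unit_space. (\<one>, x) \<in> W}"
        by (intro exI[of _ N]) auto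
    qed auto
  qed
  have cont_inv: "continuous_map ?T ?T (\<lambda>(g, x). (inv g, x))"
    unfolding continuous_map_def
  proof (intro conjI allI impI)
    show "(\<lambda>(g, x). (inv g, x)) \<in> topspace ?T \<rightarrow> topspace ?T" using fibre_inv by auto
    fix W assume W: "openin ?T W"
    show "openin ?T {p \<in> topspace ?T. (case p of (g, x) \<Rightarrow> (inv g, x)) \<in> W}"
      unfolding openin_bundle_iff
    proof (intro conjI allI impI)
      fix g assume g: "(g, \<infinity>) \<in> {p \<in> topspace ?T. (case p of (g, x) \<Rightarrow> (inv g, x)) \<in> W}"
      then obtain N where N: "\<forall>m\<ge>N. (inv g, enat m) \<in> W" using W unfolding openin_bundle_iff by auto
      obtain M where M: "M \<ge> 1" "\<forall>n\<ge>M. g \<in> \<Gamma>s n" using in_stage g by auto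
      then show "\<exists>N\<ge>1. \<forall>m\<ge>N. (g, enat m) \<in> {p \<in> topspace ?T. (case p of (g, x) \<Rightarrow> (inv g, x)) \<in> W}"
        using N by (intro exI[of _ "max M N"]) auto
    qed auto
  qed
  have open_section_img: "openin unit_space (snd ` W)" if W: "openin ?T W" for W
    unfolding openin_unit_space_iff
  proof (intro conjI impI)
    show "snd ` W \<subseteq> {1..}" using W unfolding openin_bundle_iff by auto
    assume "\<infinity> \<in> snd ` W"
    then obtain g where "(g, \<infinity>) \<in> W" by auto
    then obtain N where "N \<ge> 1" "\<forall>m\<ge>N. (g, enat m) \<in> W" using W unfolding openin_bundle_iff by blast
    then show "\<exists>N\<ge>1. \<forall>m\<ge>N. enat m \<in> snd ` W" by force
  qed
  have local_homeo: "local_homeomorphism ?T unit_space snd"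
    unfolding local_homeomorphism_def
  proof
    fix p assume p: "p \<in> topspace ?T"
    define g where "g = fst p"
    have g: "g \<in> carrier \<Gamma>" "p \<in> section_of g" using p fibre_sub by (auto simp: g_def section_of_def arrows_def)
    note op = openin_section[OF g(1)]
    have "homeomorphic_map (subtopology ?T (section_of g)) (subtopology unit_space (snd ` section_of g)) snd"
    proof (rule bijective_open_imp_homeomorphic_map)
      show "continuous_map (subtopology ?T (section_of g)) (subtopology unit_space (snd ` section_of g)) snd"
        by (intro continuous_map_into_subtopology continuous_map_from_subtopology cont_snd) auto
      show "open_map (subtopology ?T (section_of g)) (subtopology unit_space (snd ` section_of g)) snd"
        unfolding open_map_def openin_open_subtopology[OF op] openin_open_subtopology[OF open_section_img[OF op]]
        using open_section_img by blast
      show "snd ` topspace (subtopology ?T (section_of g)) = topspace (subtopology unit_space (snd ` section_of g))"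
        by (auto simp: section_of_def image_iff)
      show "inj_on snd (topspace (subtopology ?T (section_of g)))"
        by (auto simp: inj_on_def section_of_def)
    qed
    then show "\<exists>U. openin ?T U \<and> p \<in> U \<and> openin unit_space (snd ` U) \<and>
        homeomorphic_map (subtopology ?T U) (subtopology unit_space (snd ` U)) snd"
      using op open_section_img[OF op] g(2) by blast
  qed
  have Haus: "Hausdorff_space ?T"
    unfolding Hausdorff_space_def
  proof (intro allI impI)
    have sep: "\<exists>U V. openin ?T U \<and> openin ?T V \<and> (g, enat n) \<in> U \<and> (g, x) \<in> V \<and> disjnt U V"
      if "1 \<le> n" "g \<in> \<Gamma>s n" "(g, x) \<in> arrows" "x \<noteq> enat n" for g n x
    proof -
      have gc: "g \<in> carrier \<Gamma>" using that stage_sub by blast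
      obtain M where "M \<ge> 1" "\<forall>n\<ge>M. g \<in> \<Gamma>s n" using in_stage[OF gc] by blast
      then have "openin ?T (section_of g - {(g, enat n)})"
        unfolding openin_bundle_iff by (auto simp: section_of_def intro!: exI[of _ "max M (Suc n)"])
      moreover have "openin ?T {(g, enat n)}" using that by (auto simp: openin_bundle_iff)
      moreover have "(g, x) \<in> section_of g - {(g, enat n)}" using that by auto
      ultimately show ?thesis by (metis Diff_disjoint disjnt_def insertI1)
    qed
    fix p q assume pq: "p \<in> topspace ?T \<and> q \<in> topspace ?T \<and> p \<noteq> q"
    obtain g x h y where p: "p = (g, x)" and q: "q = (h, y)" by (metis surj_pair)
    have a: "(g, x) \<in> arrows" "(h, y) \<in> arrows" using pq p q by auto
    show "\<exists>U V. openin ?T U \<and> openin ?T V \<and> p \<in> U \<and> q \<in> V \<and> disjnt U V"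
    proof (cases "g = h")
      case False
      have "g \<in> carrier \<Gamma>" "h \<in> carrier \<Gamma>" using a fibre_sub by auto
      then show ?thesis using openin_section a False p q
        by (intro exI[of _ "section_of g"] exI[of _ "section_of h"]) (auto simp: disjnt_def section_of_def)
    next
      case True
      then have "x \<noteq> y" using pq p q by simp
      then consider n where "x = enat n" | n where "y = enat n" by (cases x; cases y) auto
      then show ?thesis
      proof cases
        case 1 then show ?thesis using sep[of n g y] a True \<open>x \<noteq> y\<close> p q by fastforce
      next
        case 2
        then have "1 \<le> n" "g \<in> \<Gamma>s n" "x \<noteq> enat n" using a True \<open>x \<noteq> y\<close> by auto
        from sep[OF this(1,2) a(1) this(3)] show ?thesis using 2 True p q disjnt_sym by blast
      qed
    qed
  qed
  have lc: "locally_compact_space ?T"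
    unfolding locally_compact_space_def
  proof
    fix p assume "p \<in> topspace ?T"
    then have "fst p \<in> carrier \<Gamma>" "p \<in> section_of (fst p)" using fibre_sub by (auto simp: section_of_def arrows_def)
    then show "\<exists>U K. openin ?T U \<and> compactin ?T K \<and> p \<in> U \<and> U \<subseteq> K"
      using openin_section compactin_section by blast
  qed
  have sc: "second_countable ?T"
    unfolding second_countable_def
  proof (intro exI[of _ "bundle_basis \<Gamma>s"] conjI ballI allI impI)
    have "bundle_basis \<Gamma>s \<subseteq> (\<lambda>(g, n). basic_open g n) ` (carrier \<Gamma> \<times> UNIV) \<union> (\<lambda>(g, n). {(g, enat n)}) ` (carrier \<Gamma> \<times> UNIV)"
      using stage_sub by (fastforce simp: bundle_basis_def)
    then show "countable (bundle_basis \<Gamma>s)" by (rule countable_subset) (use count in auto)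
    fix V assume "V \<in> bundle_basis \<Gamma>s"
    then show "openin ?T V" unfolding openin_bundle_union by (intro exI[of _ "{V}"]) blast
  next
    fix U p assume "openin ?T U \<and> p \<in> U"
    moreover from this obtain \<U> where "\<U> \<subseteq> bundle_basis \<Gamma>s" "U = \<Union>\<U>"
      using openin_bundle_union by blast
    ultimately show "\<exists>V\<in>bundle_basis \<Gamma>s. p \<in> V \<and> V \<subseteq> U" by blast
  qed
  show ?thesis
  proof (unfold_locales, goal_cases)
    case (1 p) then show ?case by (cases p) simp
  next case (2 p) then show ?case by (cases p) simp
  next case (3 x) then show ?case using fibre_one by simp
  next case (4 p q) then show ?case using fibre_mult by (cases p; cases q) (simp add: composable_iff)
  next case (5 p) then show ?case using fibre_inv by (cases p) simp
  next case (6 x) then show ?case by simp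
  next case (7 x) then show ?case by simp
  next case (8 p q) then show ?case by (cases p; cases q) (simp add: composable_iff)
  next case (9 p q) then show ?case by (cases p; cases q) (simp add: composable_iff)
  next case (10 p) then show ?case by (cases p) simp
  next case (11 p) then show ?case by (cases p) simp
  next case (12 p q r) then show ?case
      using fibre_sub by (cases p; cases q; cases r) (auto simp: composable_iff m_assoc)
  next case (13 p) then show ?case using fibre_sub[of "snd p" "fst p"] by (cases p) simp
  next case (14 p) then show ?case using fibre_sub[of "snd p" "fst p"] by (cases p) simp
  next case (15 p) then show ?case using fibre_sub[of "snd p" "fst p"] by (cases p) simp
  next case (16 p) then show ?case using fibre_sub[of "snd p" "fst p"] by (cases p) simp
  next case 17 show ?case using cont_snd by simp
  next case 18 show ?case using cont_snd by simp
  next case 19 show ?case using cont_unit by simp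
  next case 20 show ?case using continuous_mult_bundle by simp
  next case 21 show ?case using cont_inv by simp
  next case 22 show ?case using lc by simp
  next case 23 show ?case using Haus by simp
  next case 24 show ?case using sc by simp
  next case 25 show ?case using local_homeo by simp
  qed
qed

lemma isotropy_not_MAP:
  assumes "\<not> MAP_group \<Gamma>"
  shows "\<not> MAP_group (isotropy_group \<G> \<infinity>)"
proof
  assume M: "MAP_group (isotropy_group \<G> \<infinity>)"
  have car: "carrier (isotropy_group \<G> \<infinity>) = {(g, \<infinity>) | g. g \<in> carrier \<Gamma>}"
    by (auto simp: isotropy_group_def)
  have mult: "(g, \<infinity>) \<otimes>\<^bsub>isotropy_group \<G> \<infinity>\<^esub> (h, \<infinity>) = (g \<otimes> h, \<infinity>)" for g h
    by (simp add: isotropy_group_def)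
  have "MAP_group \<Gamma>"
    unfolding MAP_group_def
  proof (intro ballI impI)
    fix g h assume gh: "g \<in> carrier \<Gamma>" "h \<in> carrier \<Gamma>" "g \<noteq> h"
    then have *: "(g, \<infinity>) \<in> carrier (isotropy_group \<G> \<infinity>)" "(h, \<infinity>) \<in> carrier (isotropy_group \<G> \<infinity>)"
      "(g, \<infinity> :: enat) \<noteq> (h, \<infinity>)" by (auto simp: car)
    then obtain I :: "nat set" and u where u: "finite I" "u \<in> hom (isotropy_group \<G> \<infinity>) (unitary_group I)"
        "u (g, \<infinity>) \<noteq> u (h, \<infinity>)"
      using M[unfolded MAP_group_def, rule_format, OF *] by blast
    have "(\<lambda>g. u (g, \<infinity>)) \<in> hom \<Gamma> (unitary_group I)"
      using u(2) by (auto simp: hom_def car Pi_def simp flip: mult)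
    then show "\<exists>(I :: nat set) u. finite I \<and> u \<in> hom \<Gamma> (unitary_group I) \<and> u g \<noteq> u h" using u(1,3) by blast
  qed
  with assms show False by blast
qed

end

section \<open>Amenability\<close>

lemma (in group) lower_central_series_subgroup:
  assumes H: "subgroup H G"
  shows "lower_central_series (G\<lparr>carrier := H\<rparr>) k \<subseteq> lower_central_series G k"
proof (induction k)
  case 0 show ?case using subgroup.subset[OF H] by simp
next
  case (Suc k)
  let ?H = "G\<lparr>carrier := H\<rparr>"
  interpret H: group ?H by (rule subgroup_imp_group[OF H])
  let ?X = "{g \<otimes>\<^bsub>?H\<^esub> h \<otimes>\<^bsub>?H\<^esub> inv\<^bsub>?H\<^esub> g \<otimes>\<^bsub>?H\<^esub> inv\<^bsub>?H\<^esub> h | g h. g \<in> lower_central_series ?H k \<and> h \<in> carrier ?H}"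
  let ?Y = "{g \<otimes> h \<otimes> inv g \<otimes> inv h | g h. g \<in> lower_central_series G k \<and> h \<in> carrier G}"
  have sub: "lower_central_series ?H k \<subseteq> H" using H.lower_central_series_subset by simp
  have "?X \<subseteq> ?Y"
  proof
    fix z assume "z \<in> ?X"
    then obtain g h where z: "z = g \<otimes> h \<otimes> inv\<^bsub>?H\<^esub> g \<otimes> inv\<^bsub>?H\<^esub> h" "g \<in> lower_central_series ?H k" "h \<in> H"
      by auto
    then have "z = g \<otimes> h \<otimes> inv g \<otimes> inv h" using sub m_inv_consistent[OF H] by auto
    then show "z \<in> ?Y" using z Suc subgroup.subset[OF H] by blast
  qed
  moreover have "?X \<subseteq> H" using sub H.m_closed H.inv_closed by (auto simp: subset_iff)
  ultimately show ?case
    unfolding lower_central_series.simps(2) generate_consistent[OF \<open>?X \<subseteq> H\<close> H]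
    by (intro mono_generate)
qed

locale nilpotent_exhaustion = subgroup_exhaustion +
  fixes c :: nat
  assumes nilpotent: "lower_central_series \<Gamma> c = {\<one>}"
    and stage_fin_gen: "1 \<le> n \<Longrightarrow> fin_gen_subgroup \<Gamma> (\<Gamma>s n)"
begin

abbreviation stage :: "nat \<Rightarrow> ('a, 'b) monoid_scheme" where
  "stage n \<equiv> \<Gamma>\<lparr>carrier := \<Gamma>s n\<rparr>"

lemma
  assumes n: "1 \<le> n"
  shows stage_group: "group (stage n)"
    and stage_inv: "g \<in> \<Gamma>s n \<Longrightarrow> inv\<^bsub>stage n\<^esub> g = inv g"
    and stage_nilpotent: "lower_central_series (stage n) c = {\<one>\<^bsub>stage n\<^esub>}"
    and stage_generators: "\<exists>S. finite S \<and> S \<subseteq> carrier (stage n) \<and> carrier (stage n) = generate (stage n) S"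
proof -
  show g: "group (stage n)" by (rule subgroup_imp_group[OF subgroup_stage[OF n]])
  then interpret S: group "stage n" .
  show "g \<in> \<Gamma>s n \<Longrightarrow> inv\<^bsub>stage n\<^esub> g = inv g" by (rule m_inv_consistent[OF subgroup_stage[OF n]])
  have "\<one>\<^bsub>stage n\<^esub> \<in> lower_central_series (stage n) c"
    by (rule subgroup.one_closed[OF S.normal_subgroup[OF S.lower_central_series_normal]])
  then show "lower_central_series (stage n) c = {\<one>\<^bsub>stage n\<^esub>}"
    using lower_central_series_subgroup[OF subgroup_stage[OF n], of c] nilpotent by auto
  obtain S where S: "finite S" "S \<subseteq> carrier \<Gamma>" "\<Gamma>s n = generate \<Gamma> S"
    using stage_fin_gen[OF n] by (auto simp: fin_gen_subgroup_def)
  have "S \<subseteq> \<Gamma>s n" unfolding S(3) by (auto intro: generate.incl)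
  then show "\<exists>S. finite S \<and> S \<subseteq> carrier (stage n) \<and> carrier (stage n) = generate (stage n) S"
    using generate_consistent[OF _ subgroup_stage[OF n], of S] S(1,3) by (intro exI[of _ S]) auto
qed

text \<open>The stage that stands in for the fibre over \<open>x\<close> when everything is constant from \<open>N\<close> on.\<close>

definition cut :: "nat \<Rightarrow> enat \<Rightarrow> nat" where
  "cut N x = (case x of enat n \<Rightarrow> min n N | \<infinity> \<Rightarrow> N)"

lemma cut_simps [simp]: "cut N (enat n) = min n N" "cut N \<infinity> = N"
  by (simp_all add: cut_def)

lemma
  assumes "1 \<le> N" "1 \<le> x"
  shows cut_ge: "1 \<le> cut N x" and cut_le: "cut N x \<le> N" and cut_fibre: "\<Gamma>s (cut N x) \<subseteq> fibre \<Gamma> \<Gamma>s x"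
    and cut_fibre_Int: "\<Gamma>s N \<inter> fibre \<Gamma> \<Gamma>s x \<subseteq> \<Gamma>s (cut N x)"
  using assms stage_mono[of "min _ N" _] stage_sub[OF assms(1)] by (cases x; auto simp: min_def)+

text \<open>
  The measure of the stage \<open>N\<close> serves all fibres from \<open>N\<close> on, including the one over infinity; the
  finitely many earlier fibres get measures of their own.
\<close>

lemma ex_almost_invariant:
  assumes E: "finite E" "E \<subseteq> carrier \<Gamma>" and e: "0 < e"
  shows "\<exists>\<mu>. (\<lambda>p. complex_of_real (\<mu> p)) \<in> cc_functions \<G> \<and> (\<forall>p. 0 \<le> \<mu> p) \<and>
    (\<forall>x\<ge>1. (\<Sum>\<^sub>\<infinity>h\<in>fibre \<Gamma> \<Gamma>s x. \<mu> (h, x)) = 1) \<and>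
    (\<forall>g\<in>E. \<forall>x\<ge>1. g \<in> fibre \<Gamma> \<Gamma>s x \<longrightarrow>
      (\<Sum>\<^sub>\<infinity>h\<in>fibre \<Gamma> \<Gamma>s x. \<bar>\<mu> (inv g \<otimes> h, x) - \<mu> (h, x)\<bar>) \<le> e)"
proof -
  obtain N where N: "N \<ge> 1" "E \<subseteq> \<Gamma>s N" using finite_in_stage[OF E] by blast
  let ?P = "\<lambda>n \<nu>. (\<forall>x. 0 \<le> \<nu> x) \<and> finite {x. \<nu> x \<noteq> 0} \<and> {x. \<nu> x \<noteq> 0} \<subseteq> \<Gamma>s n \<and> (\<Sum>\<^sub>\<infinity>x\<in>\<Gamma>s n. \<nu> x) = (1 :: real) \<and>
      (\<forall>g\<in>E \<inter> \<Gamma>s n. (\<Sum>\<^sub>\<infinity>x\<in>\<Gamma>s n. \<bar>\<nu> (inv g \<otimes> x) - \<nu> x\<bar>) \<le> e)"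
  have "\<forall>n\<in>{1..}. \<exists>\<nu>. ?P n \<nu>"
  proof
    fix n :: nat assume "n \<in> {1..}"
    then have n: "1 \<le> n" by simp
    interpret S: group "stage n" by (rule stage_group[OF n])
    obtain T where "finite T" "T \<subseteq> carrier (stage n)" "carrier (stage n) = generate (stage n) T"
      using stage_generators[OF n] by blast
    from S.nilpotent_fin_gen_Reiter[OF this stage_nilpotent[OF n]]
    have "S.Reiter (\<Gamma>s n)" by simp
    from this[unfolded S.Reiter_def, rule_format, of "E \<inter> \<Gamma>s n" e]
    obtain \<nu> where \<nu>: "S.finite_prob_on (\<Gamma>s n) \<nu>" "\<forall>s\<in>E \<inter> \<Gamma>s n. S.shift_dist s \<nu> \<le> e"
      using E(1) e by blast
    then show "\<exists>\<nu>. ?P n \<nu>"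
      using stage_inv[OF n] by (intro exI[of _ \<nu>]) (auto simp: S.finite_prob_on_def S.shift_dist_def)
  qed
  then obtain \<nu> where \<nu>': "\<forall>n\<in>{1..}. ?P n (\<nu> n)" by (rule exE[OF bchoice])
  have \<nu>: "?P n (\<nu> n)" if "1 \<le> n" for n using bspec[OF \<nu>', of n] that by simp
  have supp: "h \<in> \<Gamma>s n" if "1 \<le> n" "\<nu> n h \<noteq> 0" for n h using \<nu>[OF that(1)] that(2) by blast
  define \<mu> where "\<mu> p = (if 1 \<le> snd p then \<nu> (cut N (snd p)) (fst p) else 0)" for p :: "'a \<times> enat"
  have nn: "0 \<le> \<mu> p" for p using \<nu>[OF cut_ge[OF N(1)]] by (auto simp: \<mu>_def)
  have cc: "(\<lambda>p. complex_of_real (\<mu> p)) \<in> cc_functions \<G>"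
    unfolding cc_functions_iff
  proof (intro conjI allI impI ballI)
    fix p assume "p \<notin> arrows"
    then show "complex_of_real (\<mu> p) = 0"
      using supp[OF cut_ge[OF N(1)]] cut_fibre[OF N(1)] by (cases p) (auto simp: \<mu>_def)
  next
    have "{g. \<exists>x. complex_of_real (\<mu> (g, x)) \<noteq> 0} \<subseteq> (\<Union>n\<in>{1..N}. {h. \<nu> n h \<noteq> 0})"
    proof
      fix g assume "g \<in> {g. \<exists>x. complex_of_real (\<mu> (g, x)) \<noteq> 0}"
      then obtain x where x: "1 \<le> x" "\<nu> (cut N x) g \<noteq> 0" by (auto simp: \<mu>_def split: if_splits)
      then show "g \<in> (\<Union>n\<in>{1..N}. {h. \<nu> n h \<noteq> 0})" using cut_ge[OF N(1)] cut_le[OF N(1)] by auto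
    qed
    then show "finite {g. \<exists>x. complex_of_real (\<mu> (g, x)) \<noteq> 0}"
      by (rule finite_subset) (use \<nu> in auto)
    fix g
    have "\<forall>\<^sub>F m in sequentially. complex_of_real (\<mu> (g, enat m)) = complex_of_real (\<mu> (g, \<infinity>))"
      unfolding eventually_sequentially using N(1) by (intro exI[of _ N]) (auto simp: \<mu>_def min_def)
    then show "(\<lambda>m. complex_of_real (\<mu> (g, enat m))) \<longlonglongrightarrow> complex_of_real (\<mu> (g, \<infinity>))"
      by (rule tendsto_eventually)
  qed
  have sum1: "(\<Sum>\<^sub>\<infinity>h\<in>fibre \<Gamma> \<Gamma>s x. \<mu> (h, x)) = 1" if x: "1 \<le> x" for x
  proof -
    have "(\<Sum>\<^sub>\<infinity>h\<in>fibre \<Gamma> \<Gamma>s x. \<mu> (h, x)) = (\<Sum>\<^sub>\<infinity>h\<in>\<Gamma>s (cut N x). \<nu> (cut N x) h)"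
      by (rule infsum_cong_neutral)
        (use x supp[OF cut_ge[OF N(1) x]] cut_fibre[OF N(1) x] in \<open>auto simp: \<mu>_def\<close>)
    then show ?thesis using \<nu>[OF cut_ge[OF N(1) x]] by simp
  qed
  have shift: "(\<Sum>\<^sub>\<infinity>h\<in>fibre \<Gamma> \<Gamma>s x. \<bar>\<mu> (inv g \<otimes> h, x) - \<mu> (h, x)\<bar>) \<le> e"
    if g: "g \<in> E" and x: "1 \<le> x" "g \<in> fibre \<Gamma> \<Gamma>s x" for g x
  proof -
    let ?n = "cut N x"
    note n = cut_ge[OF N(1) x(1)]
    have gn: "g \<in> \<Gamma>s ?n" using g N(2) x(2) cut_fibre_Int[OF N(1) x(1)] by blast
    have zero: "\<nu> ?n (inv g \<otimes> h) = 0" if h: "h \<in> fibre \<Gamma> \<Gamma>s x" "h \<notin> \<Gamma>s ?n" for h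
    proof (rule ccontr)
      assume "\<nu> ?n (inv g \<otimes> h) \<noteq> 0"
      then have "g \<otimes> (inv g \<otimes> h) \<in> \<Gamma>s ?n"
        using supp[OF n] gn subgroup.m_closed[OF subgroup_stage[OF n]] by blast
      moreover have "g \<in> carrier \<Gamma>" "h \<in> carrier \<Gamma>" using fibre_sub[OF x(1)] x(2) h(1) by blast+
      ultimately show False using h(2) by (simp add: inv_mult_cancel_left)
    qed
    have "(\<Sum>\<^sub>\<infinity>h\<in>fibre \<Gamma> \<Gamma>s x. \<bar>\<mu> (inv g \<otimes> h, x) - \<mu> (h, x)\<bar>) =
        (\<Sum>\<^sub>\<infinity>h\<in>\<Gamma>s ?n. \<bar>\<nu> ?n (inv g \<otimes> h) - \<nu> ?n h\<bar>)"
      by (rule infsum_cong_neutral)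
        (use x supp[OF n] zero cut_fibre[OF N(1) x(1)] in \<open>auto simp: \<mu>_def\<close>)
    then show ?thesis using \<nu>[OF n] g gn by simp
  qed
  show ?thesis using nn cc sum1 shift by blast
qed

lemma infsum_range_fibre:
  assumes "1 \<le> x"
  shows "(\<Sum>\<^sub>\<infinity>p\<in>{p \<in> arrows. snd p = x}. f p) = (\<Sum>\<^sub>\<infinity>h\<in>fibre \<Gamma> \<Gamma>s x. f (h, x))"
proof -
  have "{p \<in> arrows. snd p = x} = (\<lambda>h. (h, x)) ` fibre \<Gamma> \<Gamma>s x" using assms by auto
  then show ?thesis by (simp add: infsum_reindex inj_on_def o_def)
qed

lemma amenable_bundle:
  assumes count: "countable (carrier \<Gamma>)"
  shows "topologically_amenable \<G>"
proof -
  define en where "en = from_nat_into (carrier \<Gamma>)"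
  have en: "range en = carrier \<Gamma>" unfolding en_def using count one_closed by (intro range_from_nat_into) auto
  let ?good = "\<lambda>k \<mu>. (\<lambda>p. complex_of_real (\<mu> p)) \<in> cc_functions \<G> \<and> (\<forall>p. 0 \<le> \<mu> p) \<and>
    (\<forall>x\<ge>1. (\<Sum>\<^sub>\<infinity>h\<in>fibre \<Gamma> \<Gamma>s x. \<mu> (h, x)) = 1) \<and>
    (\<forall>g\<in>en ` {..k}. \<forall>x\<ge>1. g \<in> fibre \<Gamma> \<Gamma>s x \<longrightarrow>
      (\<Sum>\<^sub>\<infinity>h\<in>fibre \<Gamma> \<Gamma>s x. \<bar>\<mu> (inv g \<otimes> h, x) - \<mu> (h, x)\<bar>) \<le> 1 / Suc k)"
  have "\<forall>k. \<exists>\<mu>. ?good k \<mu>"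
    by (rule allI, rule ex_almost_invariant) (use en in auto)
  then obtain \<mu> where "\<forall>k. ?good k (\<mu> k)" by (rule exE[OF choice])
  then have \<mu>: "?good k (\<mu> k)" for k by (rule spec)
  \<comment> \<open>Every finite subset of the group is contained in \<open>en ` {..k}\<close> for large \<open>k\<close>, so a sequence suffices as a net.\<close>
  define F where "F = filtermap \<mu> sequentially"
  show ?thesis
    unfolding topologically_amenable_def
  proof (intro exI[of _ F] conjI allI impI)
    show "F \<noteq> bot" by (simp add: F_def filtermap_bot_iff)
    show "\<forall>\<^sub>F \<mu> in F. (\<lambda>g. complex_of_real (\<mu> g)) \<in> cc_functions \<G> \<and> (\<forall>g. 0 \<le> \<mu> g)"
      unfolding F_def eventually_filtermap using \<mu> by simp
  next
    fix K assume K: "compactin (gpd_arrows \<G>) K"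
    then have "K \<subseteq> arrows" using compactin_subset_topspace by fastforce
    then have Kx: "1 \<le> x" "g \<in> fibre \<Gamma> \<Gamma>s x" if "(g, x) \<in> K" for g x using that by auto
    have sum1: "(\<Sum>\<^sub>\<infinity>h\<in>{h \<in> gpd_carrier \<G>. gpd_rng \<G> h = gpd_rng \<G> p}. \<mu> k h) = 1" if "p \<in> K" for k p
      using infsum_range_fibre[of "snd p" "\<mu> k"] \<mu>[of k] Kx[of "fst p" "snd p"] that by simp
    show "uniform_limit K (\<lambda>\<mu> g. \<Sum>\<^sub>\<infinity>h\<in>{h \<in> gpd_carrier \<G>. gpd_rng \<G> h = gpd_rng \<G> g}. \<mu> h) (\<lambda>_. 1) F"
      unfolding uniform_limit_iff F_def eventually_filtermap using sum1 by simp
    obtain S where S: "finite S" "S \<subseteq> carrier \<Gamma>" "\<And>g x. (g, x) \<in> K \<Longrightarrow> g \<in> S"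
      using compactin_sections[of K] K by auto
    obtain A where A: "finite A" "S = en ` A" using finite_subset_image[OF S(1), of en UNIV] S(2) en by auto
    obtain k0 where k0: "\<forall>a\<in>A. a \<le> k0" using A(1) finite_nat_set_iff_bounded_le by blast
    show "uniform_limit K (\<lambda>\<mu> g. \<Sum>\<^sub>\<infinity>h\<in>{h \<in> gpd_carrier \<G>. gpd_rng \<G> h = gpd_rng \<G> g}.
             \<bar>\<mu> (gpd_mult \<G> (gpd_inv \<G> g) h) - \<mu> h\<bar>) (\<lambda>_. 0) F"
      unfolding uniform_limit_iff F_def eventually_filtermap
    proof (intro allI impI)
      fix e :: real assume e: "0 < e"
      obtain k1 where k1: "1 / Suc k1 < e" using nat_approx_posE[OF e] by auto
      have "dist (\<Sum>\<^sub>\<infinity>h\<in>{h \<in> gpd_carrier \<G>. gpd_rng \<G> h = gpd_rng \<G> p}.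
             \<bar>\<mu> k (gpd_mult \<G> (gpd_inv \<G> p) h) - \<mu> k h\<bar>) 0 < e" if k: "k \<ge> max k0 k1" and p: "p \<in> K" for k p
      proof -
        obtain g x where gx: "p = (g, x)" by (cases p)
        note x = Kx[OF p[unfolded gx]]
        have "g \<in> en ` {..k}" using S(3)[OF p[unfolded gx]] A(2) k0 k by auto
        then have "(\<Sum>\<^sub>\<infinity>h\<in>fibre \<Gamma> \<Gamma>s x. \<bar>\<mu> k (inv g \<otimes> h, x) - \<mu> k (h, x)\<bar>) \<le> 1 / Suc k"
          using \<mu>[of k] x by blast
        also have "1 / Suc k \<le> 1 / Suc k1" using k by (simp add: frac_le)
        also note k1
        finally have "(\<Sum>\<^sub>\<infinity>h\<in>fibre \<Gamma> \<Gamma>s x. \<bar>\<mu> k (inv g \<otimes> h, x) - \<mu> k (h, x)\<bar>) < e" .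
        moreover have "0 \<le> (\<Sum>\<^sub>\<infinity>h\<in>fibre \<Gamma> \<Gamma>s x. \<bar>\<mu> k (inv g \<otimes> h, x) - \<mu> k (h, x)\<bar>)"
          by (rule infsum_nonneg) simp
        ultimately show ?thesis
          using infsum_range_fibre[OF x(1), of "\<lambda>h. \<bar>\<mu> k (gpd_mult \<G> (gpd_inv \<G> p) h) - \<mu> k h\<bar>"]
          by (simp add: gx dist_real_def)
      qed
      then show "\<forall>\<^sub>F k in sequentially. \<forall>p\<in>K. dist (\<Sum>\<^sub>\<infinity>h\<in>{h \<in> gpd_carrier \<G>. gpd_rng \<G> h = gpd_rng \<G> p}.
             \<bar>\<mu> k (gpd_mult \<G> (gpd_inv \<G> p) h) - \<mu> k h\<bar>) 0 < e"
        unfolding eventually_sequentially by blast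
    qed
  qed
qed

end

section \<open>The convolution algebra of the bundle\<close>

context subgroup_exhaustion
begin

lemma cc_off: "f \<in> cc_functions \<G> \<Longrightarrow> f p \<noteq> 0 \<Longrightarrow> p \<in> arrows"
  and cc_finite: "f \<in> cc_functions \<G> \<Longrightarrow> finite {g. \<exists>x. f (g, x) \<noteq> 0}"
  and cc_tendsto: "f \<in> cc_functions \<G> \<Longrightarrow> g \<in> carrier \<Gamma> \<Longrightarrow> (\<lambda>m. f (g, enat m)) \<longlonglongrightarrow> f (g, \<infinity>)"
  unfolding cc_functions_iff by blast+

lemma cc_support_sub: "f \<in> cc_functions \<G> \<Longrightarrow> {g. \<exists>x. f (g, x) \<noteq> 0} \<subseteq> carrier \<Gamma>"
  using cc_off fibre_sub by fastforce

lemma cc_zero: "(\<lambda>_. 0) \<in> cc_functions \<G>"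
  by (simp add: cc_functions_iff)

lemma cc_add:
  assumes f: "f \<in> cc_functions \<G>" and h: "h \<in> cc_functions \<G>"
  shows "(\<lambda>p. f p + h p) \<in> cc_functions \<G>"
  unfolding cc_functions_iff
proof (intro conjI allI impI ballI)
  show "finite {g. \<exists>x. f (g, x) + h (g, x) \<noteq> 0}"
    by (rule finite_subset[OF _ finite_UnI[OF cc_finite[OF f] cc_finite[OF h]]]) force
  show "f p + h p = 0" if "p \<notin> arrows" for p
  proof -
    have "f p = 0" "h p = 0" using cc_off[OF f, of p] cc_off[OF h, of p] that by blast+
    then show ?thesis by simp
  qed
qed (rule tendsto_add[OF cc_tendsto[OF f] cc_tendsto[OF h]])

lemma cc_scale:
  assumes f: "f \<in> cc_functions \<G>"
  shows "(\<lambda>p. c * f p) \<in> cc_functions \<G>"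
  unfolding cc_functions_iff
proof (intro conjI allI impI ballI)
  show "finite {g. \<exists>x. c * f (g, x) \<noteq> 0}" by (rule finite_subset[OF _ cc_finite[OF f]]) auto
  show "c * f p = 0" if "p \<notin> arrows" for p using cc_off[OF f, of p] that by auto
qed (rule tendsto_mult_left[OF cc_tendsto[OF f]])

lemma cc_sum:
  assumes "\<And>a. a \<in> S \<Longrightarrow> F a \<in> cc_functions \<G>"
  shows "(\<lambda>p. \<Sum>a\<in>S. F a p) \<in> cc_functions \<G>"
  using assms by (induction S rule: infinite_finite_induct) (auto intro: cc_add cc_zero)

lemma star_eval: "sa_star (cc_algebra \<G>) f = (\<lambda>(g, x). if (g, x) \<in> arrows then cnj (f (inv g, x)) else 0)"
  by (auto simp: cc_algebra_def fun_eq_iff)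

lemma cc_star:
  assumes f: "f \<in> cc_functions \<G>"
  shows "sa_star (cc_algebra \<G>) f \<in> cc_functions \<G>"
  unfolding cc_functions_iff star_eval
proof (intro conjI allI impI ballI)
  let ?S = "{g. \<exists>x. f (g, x) \<noteq> 0}"
  have "{g. \<exists>x. (case (g, x) of (g, x) \<Rightarrow> if (g, x) \<in> arrows then cnj (f (inv g, x)) else 0) \<noteq> 0} \<subseteq> m_inv \<Gamma> ` ?S"
  proof
    fix g assume "g \<in> {g. \<exists>x. (case (g, x) of (g, x) \<Rightarrow> if (g, x) \<in> arrows then cnj (f (inv g, x)) else 0) \<noteq> 0}"
    then obtain x where "(g, x) \<in> arrows" "f (inv g, x) \<noteq> 0" by (auto split: if_splits)
    then have "g = inv (inv g)" "inv g \<in> ?S" using fibre_sub[of x g] by auto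
    then show "g \<in> m_inv \<Gamma> ` ?S" by (rule image_eqI)
  qed
  then show "finite {g. \<exists>x. (case (g, x) of (g, x) \<Rightarrow> if (g, x) \<in> arrows then cnj (f (inv g, x)) else 0) \<noteq> 0}"
    using cc_finite[OF f] finite_surj by blast
next
  fix g assume g: "g \<in> carrier \<Gamma>"
  obtain M where M: "M \<ge> 1" "\<forall>n\<ge>M. g \<in> \<Gamma>s n" using in_stage[OF g] by blast
  have "(\<lambda>m. cnj (f (inv g, enat m))) \<longlonglongrightarrow> cnj (f (inv g, \<infinity>))"
    using g by (intro tendsto_cnj cc_tendsto[OF f]) auto
  moreover have "\<forall>\<^sub>F m in sequentially. cnj (f (inv g, enat m)) =
      (case (g, enat m) of (g, x) \<Rightarrow> if (g, x) \<in> arrows then cnj (f (inv g, x)) else 0)"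
    unfolding eventually_sequentially using M by (intro exI[of _ M]) auto
  ultimately show "(\<lambda>m. case (g, enat m) of (g, x) \<Rightarrow> if (g, x) \<in> arrows then cnj (f (inv g, x)) else 0) \<longlonglongrightarrow>
      (case (g, \<infinity>) of (g, x) \<Rightarrow> if (g, x) \<in> arrows then cnj (f (inv g, x)) else 0)"
    using g by (simp add: Lim_transform_eventually)
qed auto

lemma conv_off: "p \<notin> arrows \<Longrightarrow> sa_mult (cc_algebra \<G>) f f' p = 0"
proof -
  assume p: "p \<notin> arrows"
  have "{(q, r) \<in> composable \<G>. gpd_mult \<G> q r = p} = {}"
    using p fibre_mult by (auto simp: composable_def)
  then show ?thesis unfolding cc_algebra_def by (simp only: star_alg.simps infsum_empty)
qed

lemma conv_eval:
  assumes k: "(k, x) \<in> arrows" and S: "finite S" "\<And>h. f (h, x) \<noteq> 0 \<Longrightarrow> h \<in> S"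
    and off: "\<And>p. f p \<noteq> 0 \<Longrightarrow> p \<in> arrows"
  shows "sa_mult (cc_algebra \<G>) f f' (k, x) = (\<Sum>h\<in>S. f (h, x) * f' (inv h \<otimes> k, x))"
proof -
  have x: "1 \<le> x" and kx: "k \<in> fibre \<Gamma> \<Gamma>s x" and kc: "k \<in> carrier \<Gamma>" using k fibre_sub by auto
  let ?i = "\<lambda>h. ((h, x), (inv h \<otimes> k, x))"
  have "{(q, r) \<in> composable \<G>. gpd_mult \<G> q r = (k, x)} = ?i ` fibre \<Gamma> \<Gamma>s x"
  proof (intro subset_antisym subsetI)
    fix z assume z: "z \<in> {(q, r) \<in> composable \<G>. gpd_mult \<G> q r = (k, x)}"
    obtain g y h y' where "z = ((g, y), (h, y'))" by (metis surj_pair)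
    then have gh: "z = ((g, x), (h, x))" "g \<in> fibre \<Gamma> \<Gamma>s x" "h \<in> fibre \<Gamma> \<Gamma>s x" "g \<otimes> h = k"
      using z by (auto simp: composable_iff)
    then have "h = inv g \<otimes> k" using fibre_sub[OF x] by (auto simp: inv_mult_cancel_left)
    then show "z \<in> ?i ` fibre \<Gamma> \<Gamma>s x" using gh by blast
  next
    fix z assume "z \<in> ?i ` fibre \<Gamma> \<Gamma>s x"
    then obtain h where h: "z = ?i h" "h \<in> fibre \<Gamma> \<Gamma>s x" by blast
    then show "z \<in> {(q, r) \<in> composable \<G>. gpd_mult \<G> q r = (k, x)}"
      using x kx kc fibre_mult[OF x fibre_inv[OF x h(2)] kx] fibre_sub[OF x h(2)]
      by (auto simp: composable_iff inv_mult_cancel_left)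
  qed
  then have "sa_mult (cc_algebra \<G>) f f' (k, x) = infsum (\<lambda>(q, r). f q * f' r) (?i ` fibre \<Gamma> \<Gamma>s x)"
    by (simp only: cc_algebra_def star_alg.simps)
  also have "\<dots> = (\<Sum>\<^sub>\<infinity>h\<in>fibre \<Gamma> \<Gamma>s x. f (h, x) * f' (inv h \<otimes> k, x))"
    by (subst infsum_reindex) (auto simp: inj_on_def o_def)
  also have "\<dots> = (\<Sum>\<^sub>\<infinity>h\<in>S. f (h, x) * f' (inv h \<otimes> k, x))"
    by (rule infsum_cong_neutral) (use S(2) off in force)+
  finally show ?thesis using S(1) by simp
qed

lemma cc_mult:
  assumes f: "f \<in> cc_functions \<G>" and f': "f' \<in> cc_functions \<G>"
  shows "sa_mult (cc_algebra \<G>) f f' \<in> cc_functions \<G>"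
  unfolding cc_functions_iff
proof (intro conjI allI impI ballI conv_off)
  let ?S = "{g. \<exists>x. f (g, x) \<noteq> 0}" and ?S' = "{g. \<exists>x. f' (g, x) \<noteq> 0}"
  let ?m = "sa_mult (cc_algebra \<G>) f f'"
  note Sc = cc_support_sub[OF f]
  have ev: "?m (k, x) = (\<Sum>h\<in>?S. f (h, x) * f' (inv h \<otimes> k, x))" if "(k, x) \<in> arrows" for k x
    by (rule conv_eval[OF that cc_finite[OF f]]) (use cc_off[OF f] in auto)
  have "{k. \<exists>x. ?m (k, x) \<noteq> 0} \<subseteq> (\<lambda>(g, h). g \<otimes> h) ` (?S \<times> ?S')"
  proof
    fix k assume "k \<in> {k. \<exists>x. ?m (k, x) \<noteq> 0}"
    then obtain x where kx: "?m (k, x) \<noteq> 0" by blast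
    then have a: "(k, x) \<in> arrows" using conv_off by blast
    then have "(\<Sum>h\<in>?S. f (h, x) * f' (inv h \<otimes> k, x)) \<noteq> 0" using ev kx by simp
    then obtain h where h: "h \<in> ?S" "f (h, x) * f' (inv h \<otimes> k, x) \<noteq> 0" by (meson sum.neutral)
    then have "inv h \<otimes> k \<in> ?S'" by auto
    moreover have "k = h \<otimes> (inv h \<otimes> k)"
      using a h(1) Sc fibre_sub[of x k] by (auto simp: inv_mult_cancel_left subset_iff)
    ultimately show "k \<in> (\<lambda>(g, h). g \<otimes> h) ` (?S \<times> ?S')" using h(1) by (intro image_eqI[of _ _ "(h, inv h \<otimes> k)"]) auto
  qed
  then show "finite {k. \<exists>x. ?m (k, x) \<noteq> 0}"
    by (rule finite_subset) (use cc_finite[OF f] cc_finite[OF f'] in simp)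
  fix k assume k: "k \<in> carrier \<Gamma>"
  obtain M where M: "M \<ge> 1" "\<forall>n\<ge>M. k \<in> \<Gamma>s n" using in_stage[OF k] by blast
  have "(\<lambda>m. \<Sum>h\<in>?S. f (h, enat m) * f' (inv h \<otimes> k, enat m)) \<longlonglongrightarrow> (\<Sum>h\<in>?S. f (h, \<infinity>) * f' (inv h \<otimes> k, \<infinity>))"
    using Sc k by (intro tendsto_sum tendsto_mult cc_tendsto f f') auto
  moreover have "\<forall>\<^sub>F m in sequentially. (\<Sum>h\<in>?S. f (h, enat m) * f' (inv h \<otimes> k, enat m)) = ?m (k, enat m)"
    unfolding eventually_sequentially using M ev by (intro exI[of _ M]) auto
  ultimately show "(\<lambda>m. ?m (k, enat m)) \<longlonglongrightarrow> ?m (k, \<infinity>)"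
    using ev[of k \<infinity>] k by (simp add: Lim_transform_eventually)
qed

text \<open>
  Every element of \<open>C\<^sub>c(G)\<close> is a finite sum of functions supported on single sections, and on these
  convolution and involution act as in a group algebra with coefficients in the functions on the
  unit space.
\<close>

definition on_section :: "'g \<Rightarrow> (enat \<Rightarrow> complex) \<Rightarrow> 'g \<times> enat \<Rightarrow> complex" where
  "on_section g a = (\<lambda>(h, x). if h = g then a x else 0)"

definition section_function :: "'g \<Rightarrow> (enat \<Rightarrow> complex) \<Rightarrow> bool" where
  "section_function g a \<longleftrightarrow> g \<in> carrier \<Gamma> \<and> (\<forall>x. a x \<noteq> 0 \<longrightarrow> (g, x) \<in> arrows) \<and> (\<lambda>m. a (enat m)) \<longlonglongrightarrow> a \<infinity>"

lemma on_section_cc: "section_function g a \<Longrightarrow> on_section g a \<in> cc_functions \<G>"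
proof -
  assume a: "section_function g a"
  have "{h. \<exists>x. on_section g a (h, x) \<noteq> 0} \<subseteq> {g}" by (auto simp: on_section_def)
  then have "finite {h. \<exists>x. on_section g a (h, x) \<noteq> 0}" using finite_subset by blast
  with a show ?thesis by (auto simp: cc_functions_iff section_function_def on_section_def)
qed

lemma on_section_mult:
  assumes a: "section_function g a" and b: "section_function h b"
  shows "sa_mult (cc_algebra \<G>) (on_section g a) (on_section h b) = on_section (g \<otimes> h) (\<lambda>x. a x * b x)"
proof
  fix p :: "'g \<times> enat"
  obtain k x where p: "p = (k, x)" by (cases p)
  have gc: "g \<in> carrier \<Gamma>" "h \<in> carrier \<Gamma>" using a b by (auto simp: section_function_def)
  show "sa_mult (cc_algebra \<G>) (on_section g a) (on_section h b) p = on_section (g \<otimes> h) (\<lambda>x. a x * b x) p"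
  proof (cases "p \<in> arrows")
    case True
    then have kc: "k \<in> carrier \<Gamma>" using p fibre_sub by auto
    have "sa_mult (cc_algebra \<G>) (on_section g a) (on_section h b) (k, x) =
        (\<Sum>u\<in>{g}. on_section g a (u, x) * on_section h b (inv u \<otimes> k, x))"
      by (rule conv_eval) (use True p a in \<open>auto simp: on_section_def section_function_def split: if_splits\<close>)
    moreover have "inv g \<otimes> k = h \<longleftrightarrow> k = g \<otimes> h" using gc kc by (auto simp: inv_mult_cancel_left)
    ultimately show ?thesis by (auto simp: p on_section_def)
  next
    case False
    then have "on_section (g \<otimes> h) (\<lambda>x. a x * b x) p = 0"
      using a b fibre_mult[of x g h] by (auto simp: p on_section_def section_function_def)
    then show ?thesis using conv_off[OF False] by simp
  qed
qed

lemma on_section_star: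
  assumes a: "section_function g a"
  shows "sa_star (cc_algebra \<G>) (on_section g a) = on_section (inv g) (\<lambda>x. cnj (a x))"
proof
  fix p :: "'g \<times> enat"
  obtain k x where p: "p = (k, x)" by (cases p)
  have gc: "g \<in> carrier \<Gamma>" using a by (auto simp: section_function_def)
  have "inv k = g \<longleftrightarrow> k = inv g" if "(k, x) \<in> arrows" using that gc fibre_sub[of x k] by auto
  moreover have "a x = 0" if "(inv g, x) \<notin> arrows"
    using that a fibre_inv[of x g] by (auto simp: section_function_def)
  ultimately show "sa_star (cc_algebra \<G>) (on_section g a) p = on_section (inv g) (\<lambda>x. cnj (a x)) p"
    by (auto simp: star_eval p on_section_def)
qed

lemma cc_decompose:
  assumes f: "f \<in> cc_functions \<G>" and S: "finite S" "{g. \<exists>x. f (g, x) \<noteq> 0} \<subseteq> S"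
  shows "f = (\<lambda>p. \<Sum>g\<in>S. on_section g (\<lambda>x. f (g, x)) p)"
proof
  fix p :: "'g \<times> enat"
  obtain k x where p: "p = (k, x)" by (cases p)
  have "(\<Sum>g\<in>S. on_section g (\<lambda>x. f (g, x)) p) = (\<Sum>g\<in>S. if k = g then f (g, x) else 0)"
    by (simp add: p on_section_def)
  also have "\<dots> = f p" using S by (auto simp: p)
  finally show "f p = (\<Sum>g\<in>S. on_section g (\<lambda>x. f (g, x)) p)" by simp
qed

lemma cc_section_function: "f \<in> cc_functions \<G> \<Longrightarrow> g \<in> carrier \<Gamma> \<Longrightarrow> section_function g (\<lambda>x. f (g, x))"
  using cc_off cc_tendsto by (auto simp: section_function_def)

definition unit_function :: "enat \<Rightarrow> complex" where
  "unit_function x = (if 1 \<le> x then 1 else 0)"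

lemma section_function_one:
  assumes "\<And>x. a x \<noteq> 0 \<Longrightarrow> 1 \<le> x" "(\<lambda>m. a (enat m)) \<longlonglongrightarrow> a \<infinity>"
  shows "section_function \<one> a"
  using assms fibre_one by (auto simp: section_function_def)

lemma section_function_unit: "section_function \<one> unit_function"
proof (rule section_function_one)
  have "\<forall>\<^sub>F m in sequentially. unit_function (enat m) = unit_function \<infinity>"
    unfolding eventually_sequentially by (intro exI[of _ 1]) (simp add: unit_function_def)
  then show "(\<lambda>m. unit_function (enat m)) \<longlonglongrightarrow> unit_function \<infinity>" by (rule tendsto_eventually)
qed (auto simp: unit_function_def split: if_splits)

subsection \<open>Representations of the convolution algebra\<close>

context
  fixes \<rho> assumes rep: "\<rho> \<in> cc_reps \<G>"
begin

lemma cc_rep_zero: "snd \<rho> (\<lambda>_. 0) = (\<lambda>_ _. 0)"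
  using cc_rep_scale[OF rep cc_zero, of 0] by simp

lemma cc_rep_sum:
  assumes "\<And>a. a \<in> S \<Longrightarrow> F a \<in> cc_functions \<G>"
  shows "snd \<rho> (\<lambda>p. \<Sum>a\<in>S. F a p) = (\<lambda>\<xi> i. \<Sum>a\<in>S. snd \<rho> (F a) \<xi> i)"
  using assms
proof (induction S rule: infinite_finite_induct)
  case (insert a S)
  then show ?case using cc_rep_add[OF rep, of "F a" "\<lambda>p. \<Sum>a\<in>S. F a p"] cc_sum[of S F] by auto
qed (simp_all add: cc_rep_zero)

lemma cc_rep_inner:
  assumes f: "f \<in> cc_functions \<G>" and h: "h \<in> cc_functions \<G>" and x: "\<xi> \<in> ell2 (fst \<rho>)" and y: "\<eta> \<in> ell2 (fst \<rho>)"
  shows "ell2_inner (snd \<rho> f \<xi>) (snd \<rho> h \<eta>) =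
    ell2_inner \<xi> (snd \<rho> (sa_mult (cc_algebra \<G>) (sa_star (cc_algebra \<G>) f) h) \<eta>)"
  using cc_rep_star[OF rep f] x bop_in[OF cc_rep_bop[OF rep h] y]
  unfolding is_adjoint_def cc_rep_mult[OF rep cc_star[OF f] h] o_apply by blast

lemma cc_rep_norm_power2:
  assumes f: "f \<in> cc_functions \<G>" and x: "\<xi> \<in> ell2 (fst \<rho>)"
  shows "complex_of_real ((ell2_norm (snd \<rho> f \<xi>))\<^sup>2) =
    ell2_inner \<xi> (snd \<rho> (sa_mult (cc_algebra \<G>) (sa_star (cc_algebra \<G>) f) f) \<xi>)"
  using cc_rep_inner[OF f f x x] ell2_inner_self[OF bop_in[OF cc_rep_bop[OF rep f] x]] by simp

lemma cc_rep_unit: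
  assumes x: "\<xi> \<in> ell2 (fst \<rho>)"
  shows "ell2_norm (snd \<rho> (on_section \<one> unit_function) \<xi>) \<le> ell2_norm \<xi>"
    and "complex_of_real ((ell2_norm (snd \<rho> (on_section \<one> unit_function) \<xi>))\<^sup>2) =
      ell2_inner \<xi> (snd \<rho> (on_section \<one> unit_function) \<xi>)"
proof -
  let ?e = "on_section \<one> unit_function"
  note u = section_function_unit and ucc = on_section_cc[OF section_function_unit]
  have uu: "(\<lambda>x. unit_function x * unit_function x) = unit_function" "(\<lambda>x. cnj (unit_function x)) = unit_function"
    by (auto simp: unit_function_def)
  have "sa_mult (cc_algebra \<G>) (sa_star (cc_algebra \<G>) ?e) ?e = ?e"
    by (simp add: on_section_star[OF u] uu on_section_mult[OF u u])
  then show eq: "complex_of_real ((ell2_norm (snd \<rho> ?e \<xi>))\<^sup>2) = ell2_inner \<xi> (snd \<rho> ?e \<xi>)"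
    using cc_rep_norm_power2[OF ucc x] by simp
  have "cmod (ell2_inner \<xi> (snd \<rho> ?e \<xi>)) \<le> ell2_norm \<xi> * ell2_norm (snd \<rho> ?e \<xi>)"
    by (rule ell2_Cauchy_Schwarz[OF x bop_in[OF cc_rep_bop[OF rep ucc] x]])
  then have "ell2_norm (snd \<rho> ?e \<xi>) * ell2_norm (snd \<rho> ?e \<xi>) \<le> ell2_norm (snd \<rho> ?e \<xi>) * ell2_norm \<xi>"
    unfolding eq[symmetric] by (simp add: power2_eq_square norm_mult mult.commute)
  then show "ell2_norm (snd \<rho> ?e \<xi>) \<le> ell2_norm \<xi>" by (rule square_le_mult_cancel) simp
qed

text \<open>
  For \<open>f\<close> supported on one section, \<open>f\<^sup>* f\<close> lives on the unit space, where
  \<open>B\<^sup>2 - f\<^sup>* f\<close> has a square root as soon as \<open>\<bar>f\<bar> \<le> B\<close>.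
\<close>

lemma cc_rep_section_bound:
  assumes a: "section_function g a" and B: "\<And>x. cmod (a x) \<le> B"
  shows "operator_norm (fst \<rho>) (snd \<rho> (on_section g a)) \<le> B"
proof -
  have B0: "0 \<le> B" using B[of 0] norm_ge_zero order_trans by blast
  define h where "h x = (if 1 \<le> x then complex_of_real (sqrt (B\<^sup>2 - (cmod (a x))\<^sup>2)) else 0)" for x :: enat
  have gc: "g \<in> carrier \<Gamma>" and a1: "\<And>x. a x \<noteq> 0 \<Longrightarrow> 1 \<le> x" and lim: "(\<lambda>m. a (enat m)) \<longlonglongrightarrow> a \<infinity>"
    using a by (auto simp: section_function_def)
  have h: "section_function \<one> h"
  proof (rule section_function_one)
    have "(\<lambda>m. complex_of_real (sqrt (B\<^sup>2 - (cmod (a (enat m)))\<^sup>2))) \<longlonglongrightarrow> complex_of_real (sqrt (B\<^sup>2 - (cmod (a \<infinity>))\<^sup>2))"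
      by (intro tendsto_intros lim)
    moreover have "\<forall>\<^sub>F m in sequentially. complex_of_real (sqrt (B\<^sup>2 - (cmod (a (enat m)))\<^sup>2)) = h (enat m)"
      unfolding eventually_sequentially by (intro exI[of _ 1]) (simp add: h_def)
    ultimately show "(\<lambda>m. h (enat m)) \<longlonglongrightarrow> h \<infinity>" by (simp add: h_def Lim_transform_eventually)
  qed (auto simp: h_def split: if_splits)
  let ?A = "cc_algebra \<G>" and ?f = "on_section g a" and ?h = "on_section \<one> h" and ?e = "on_section \<one> unit_function"
  note fcc = on_section_cc[OF a] and hcc = on_section_cc[OF h] and ecc = on_section_cc[OF section_function_unit]
  have a': "section_function (inv g) (\<lambda>x. cnj (a x))"
    using a gc fibre_inv by (auto simp: section_function_def intro: tendsto_cnj)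
  have h': "section_function \<one> (\<lambda>x. cnj (h x))" using h by (auto simp: section_function_def intro: tendsto_cnj)
  have ff: "sa_mult ?A (sa_star ?A ?f) ?f = on_section \<one> (\<lambda>x. cnj (a x) * a x)"
    using gc by (simp add: on_section_star[OF a] on_section_mult[OF a' a])
  have hh: "sa_mult ?A (sa_star ?A ?h) ?h = on_section \<one> (\<lambda>x. cnj (h x) * h x)"
    by (simp add: on_section_star[OF h] on_section_mult[OF h' h])
  have sum: "(\<lambda>p. sa_mult ?A (sa_star ?A ?f) ?f p + sa_mult ?A (sa_star ?A ?h) ?h p) = (\<lambda>p. complex_of_real (B\<^sup>2) * ?e p)"
  proof
    have "cnj (a x) * a x + cnj (h x) * h x = complex_of_real (B\<^sup>2) * unit_function x" for x
    proof (cases "1 \<le> x")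
      case True
      have "0 \<le> B\<^sup>2 - (cmod (a x))\<^sup>2" using B[of x] by (simp add: power_mono)
      then have "cnj (h x) * h x = complex_of_real (B\<^sup>2 - (cmod (a x))\<^sup>2)"
        using True by (simp add: h_def flip: of_real_mult)
      moreover have "cnj (a x) * a x = complex_of_real ((cmod (a x))\<^sup>2)"
        by (simp only: complex_norm_square mult.commute)
      ultimately show ?thesis using True by (simp add: unit_function_def flip: of_real_add)
    next
      case False
      then show ?thesis using a1[of x] by (auto simp: h_def unit_function_def)
    qed
    then show "sa_mult ?A (sa_star ?A ?f) ?f p + sa_mult ?A (sa_star ?A ?h) ?h p = complex_of_real (B\<^sup>2) * ?e p" for p
      unfolding ff hh by (auto simp: on_section_def split: prod.splits)
  qed
  show ?thesis
  proof (rule operator_norm_leI[OF B0])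
    fix \<xi> assume x: "\<xi> \<in> ell2 (fst \<rho>)"
    note ffcc = cc_mult[OF cc_star[OF fcc] fcc] and hhcc = cc_mult[OF cc_star[OF hcc] hcc]
    have "complex_of_real ((ell2_norm (snd \<rho> ?f \<xi>))\<^sup>2 + (ell2_norm (snd \<rho> ?h \<xi>))\<^sup>2) =
       ell2_inner \<xi> (snd \<rho> (sa_mult ?A (sa_star ?A ?f) ?f) \<xi>) + ell2_inner \<xi> (snd \<rho> (sa_mult ?A (sa_star ?A ?h) ?h) \<xi>)"
      by (simp only: cc_rep_norm_power2[OF fcc x] cc_rep_norm_power2[OF hcc x] of_real_add)
    also have "\<dots> = ell2_inner \<xi> (snd \<rho> (\<lambda>p. sa_mult ?A (sa_star ?A ?f) ?f p + sa_mult ?A (sa_star ?A ?h) ?h p) \<xi>)"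
      unfolding cc_rep_add[OF rep ffcc hhcc]
      by (rule ell2_inner_add_right[symmetric, OF x bop_in[OF cc_rep_bop[OF rep ffcc] x] bop_in[OF cc_rep_bop[OF rep hhcc] x]])
    also have "\<dots> = complex_of_real (B\<^sup>2) * ell2_inner \<xi> (snd \<rho> ?e \<xi>)"
      unfolding sum cc_rep_scale[OF rep ecc] ell2_inner_scale_right ..
    also have "\<dots> = complex_of_real (B\<^sup>2 * (ell2_norm (snd \<rho> ?e \<xi>))\<^sup>2)"
      by (simp only: cc_rep_unit(2)[OF x, symmetric] of_real_mult)
    finally have "(ell2_norm (snd \<rho> ?f \<xi>))\<^sup>2 + (ell2_norm (snd \<rho> ?h \<xi>))\<^sup>2 = B\<^sup>2 * (ell2_norm (snd \<rho> ?e \<xi>))\<^sup>2"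
      by (simp only: of_real_eq_iff)
    then have "(ell2_norm (snd \<rho> ?f \<xi>))\<^sup>2 \<le> B\<^sup>2 * (ell2_norm (snd \<rho> ?e \<xi>))\<^sup>2"
      by (metis le_add_same_cancel1 zero_le_power2)
    also have "\<dots> \<le> B\<^sup>2 * (ell2_norm \<xi>)\<^sup>2"
      using cc_rep_unit(1)[OF x] by (intro mult_left_mono power_mono) auto
    finally have "(ell2_norm (snd \<rho> ?f \<xi>))\<^sup>2 \<le> (B * ell2_norm \<xi>)\<^sup>2" by (simp add: power_mult_distrib)
    then show "ell2_norm (snd \<rho> ?f \<xi>) \<le> B * ell2_norm \<xi>"
      by (rule power2_le_imp_le) (simp add: B0)
  qed
qed

lemma cc_rep_sum_bound:
  assumes f: "f \<in> cc_functions \<G>" and S: "finite S" "S \<subseteq> carrier \<Gamma>" "{g. \<exists>x. f (g, x) \<noteq> 0} \<subseteq> S"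
    and B: "\<And>g x. g \<in> S \<Longrightarrow> cmod (f (g, x)) \<le> B g"
  shows "operator_norm (fst \<rho>) (snd \<rho> f) \<le> (\<Sum>g\<in>S. B g)"
proof (rule operator_norm_leI)
  have B0: "0 \<le> B g" if "g \<in> S" for g using B[OF that] norm_ge_zero order_trans by blast
  then show "0 \<le> (\<Sum>g\<in>S. B g)" by (rule sum_nonneg)
  fix \<xi> assume x: "\<xi> \<in> ell2 (fst \<rho>)"
  have sf: "section_function g (\<lambda>x. f (g, x))" if "g \<in> S" for g
    using cc_section_function[OF f] S(2) that by blast
  have "snd \<rho> f = snd \<rho> (\<lambda>p. \<Sum>g\<in>S. on_section g (\<lambda>x. f (g, x)) p)"
    by (rule arg_cong[OF cc_decompose[OF f S(1,3)]])
  also have "\<dots> = (\<lambda>\<xi> i. \<Sum>g\<in>S. snd \<rho> (on_section g (\<lambda>x. f (g, x))) \<xi> i)"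
    by (rule cc_rep_sum) (rule on_section_cc[OF sf])
  finally have "ell2_norm (snd \<rho> f \<xi>) = ell2_norm (\<lambda>i. \<Sum>g\<in>S. snd \<rho> (on_section g (\<lambda>x. f (g, x))) \<xi> i)" by simp
  also have "\<dots> \<le> (\<Sum>g\<in>S. ell2_norm (snd \<rho> (on_section g (\<lambda>x. f (g, x))) \<xi>))"
    by (rule ell2_norm_sum_le[of S _ "fst \<rho>"]) (rule bop_in[OF cc_rep_bop[OF rep on_section_cc[OF sf]] x])
  also have "\<dots> \<le> (\<Sum>g\<in>S. B g * ell2_norm \<xi>)"
  proof (rule sum_mono)
    fix g assume g: "g \<in> S"
    have "ell2_norm (snd \<rho> (on_section g (\<lambda>x. f (g, x))) \<xi>) \<le>
        operator_norm (fst \<rho>) (snd \<rho> (on_section g (\<lambda>x. f (g, x)))) * ell2_norm \<xi>"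
      by (rule operator_norm_bound[OF cc_rep_bop[OF rep on_section_cc[OF sf[OF g]]] x])
    also have "\<dots> \<le> B g * ell2_norm \<xi>"
      by (intro mult_right_mono cc_rep_section_bound[OF sf[OF g]] B[OF g]) simp
    finally show "ell2_norm (snd \<rho> (on_section g (\<lambda>x. f (g, x))) \<xi>) \<le> B g * ell2_norm \<xi>" .
  qed
  finally show "ell2_norm (snd \<rho> f \<xi>) \<le> (\<Sum>g\<in>S. B g) * ell2_norm \<xi>" by (simp add: sum_distrib_right)
qed

end

lemma cc_bounded_on_section:
  assumes f: "f \<in> cc_functions \<G>" and g: "g \<in> carrier \<Gamma>"
  shows "\<exists>B. \<forall>x. cmod (f (g, x)) \<le> B"
proof -
  have "Bseq (\<lambda>m. f (g, enat m))" using cc_tendsto[OF f g] convergentI convergent_imp_Bseq by blast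
  then obtain K where K: "\<And>m. cmod (f (g, enat m)) \<le> K" by (auto simp: Bseq_def)
  have "cmod (f (g, x)) \<le> max K (cmod (f (g, \<infinity>)))" for x
    using K by (cases x) (auto simp: le_max_iff_disj)
  then show ?thesis by blast
qed

theorem cstar_algebra_bundle: "cstar_algebra (full_cstar \<G>)"
proof (rule cstar_algebra_full_cstar)
  fix f assume f: "f \<in> cc_functions \<G>"
  let ?S = "{g. \<exists>x. f (g, x) \<noteq> 0}"
  have "\<forall>g\<in>?S. \<exists>B. \<forall>x. cmod (f (g, x)) \<le> B" using cc_bounded_on_section[OF f] cc_support_sub[OF f] by blast
  then obtain B where B: "\<And>g x. g \<in> ?S \<Longrightarrow> cmod (f (g, x)) \<le> B g" by metis
  show "\<exists>C. \<forall>\<rho>\<in>cc_reps \<G>. operator_norm (fst \<rho>) (snd \<rho> f) \<le> C"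
    using cc_rep_sum_bound[OF _ f cc_finite[OF f] cc_support_sub[OF f] order_refl B] by blast
qed (rule cc_zero cc_add cc_scale cc_mult cc_star; assumption)+

end

section \<open>Residual finite-dimensionality\<close>

lemma ell2_norm_le_sum:
  assumes J: "finite J" "\<And>y. y \<notin> J \<Longrightarrow> \<zeta> y = 0"
  shows "ell2_norm \<zeta> \<le> (\<Sum>y\<in>J. cmod (\<zeta> y))"
proof -
  have "ell2_norm \<zeta> = L2_set (\<lambda>y. cmod (\<zeta> y)) J"
    unfolding L2_set_def using ell2_norm_finite[of J \<zeta>] J by (metis ell2_norm_nonneg real_sqrt_unique)
  then show ?thesis by (simp add: L2_set_le_sum)
qed

text \<open>
  Representations of the completion live on index sets of functions, whereas residual
  finite-dimensionality is tested on index sets of natural numbers.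
\<close>

lemma star_representation_transport:
  fixes \<pi> :: "'a \<Rightarrow> 'i operator" and b :: "'j \<Rightarrow> 'i"
  assumes \<pi>: "star_representation A I \<pi>" and I: "finite I" and b: "bij_betw b J I"
    and star_closed: "\<forall>x\<in>carrier A. sa_star A x \<in> carrier A"
  shows "\<exists>\<pi>'. star_representation A J \<pi>' \<and> (\<forall>x\<in>carrier A. \<forall>y\<in>carrier A. \<pi>' x = \<pi>' y \<longrightarrow> \<pi> x = \<pi> y)"
proof -
  have J: "finite J" using I b bij_betw_finite by blast
  define b' where "b' = inv_into J b"
  have b': "b' i \<in> J" "b (b' i) = i" if "i \<in> I" for i
    using that b unfolding b'_def by (auto simp: bij_betw_def inv_into_into f_inv_into_f)
  have bb: "b j \<in> I" "b' (b j) = j" if "j \<in> J" for j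
    using that b unfolding b'_def by (auto simp: bij_betw_def inv_into_f_f)
  define push :: "('i \<Rightarrow> complex) \<Rightarrow> 'j \<Rightarrow> complex" where "push \<zeta> j = (if j \<in> J then \<zeta> (b j) else 0)" for \<zeta> j
  define pull :: "('j \<Rightarrow> complex) \<Rightarrow> 'i \<Rightarrow> complex" where "pull \<xi> i = (if i \<in> I then \<xi> (b' i) else 0)" for \<xi> i
  have pushJ: "push \<zeta> \<in> ell2 J" and pullI: "pull \<xi> \<in> ell2 I" for \<zeta> \<xi>
    by (simp_all add: ell2_finite_iff I J push_def pull_def)
  have pp: "pull (push \<zeta>) = \<zeta>" if "\<zeta> \<in> ell2 I" for \<zeta>
    using that b' by (auto simp: fun_eq_iff push_def pull_def ell2_off)
  have inner: "ell2_inner (push \<zeta>) \<xi> = ell2_inner \<zeta> (pull \<xi>)" if z: "\<zeta> \<in> ell2 I" for \<zeta> \<xi>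
  proof -
    have "ell2_inner (push \<zeta>) \<xi> = (\<Sum>j\<in>J. cnj (push \<zeta> j) * \<xi> j)"
      by (rule ell2_inner_finite[OF J]) (simp add: push_def)
    also have "\<dots> = (\<Sum>j\<in>J. cnj (\<zeta> (b j)) * pull \<xi> (b j))"
      by (rule sum.cong) (auto simp: push_def pull_def bb)
    also have "\<dots> = (\<Sum>i\<in>I. cnj (\<zeta> i) * pull \<xi> i)" by (rule sum.reindex_bij_betw[OF b])
    also have "\<dots> = ell2_inner \<zeta> (pull \<xi>)"
      by (rule ell2_inner_finite[OF I, symmetric]) (rule ell2_off[OF z])
    finally show ?thesis .
  qed
  have norm_push: "ell2_norm (push \<zeta>) = ell2_norm \<zeta>" if z: "\<zeta> \<in> ell2 I" for \<zeta>
  proof -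
    have "complex_of_real ((ell2_norm (push \<zeta>))\<^sup>2) = complex_of_real ((ell2_norm \<zeta>)\<^sup>2)"
      using inner[OF z, of "push \<zeta>"] pp[OF z] ell2_inner_self[OF z] ell2_inner_self[OF pushJ[of \<zeta>]] by simp
    then show ?thesis by (simp only: of_real_eq_iff) (simp add: power2_eq_iff_nonneg)
  qed
  have pp': "push (pull \<xi>) = \<xi>" if "\<xi> \<in> ell2 J" for \<xi>
    using that bb by (auto simp: fun_eq_iff push_def pull_def ell2_off)
  have norm_pull: "ell2_norm (pull \<xi>) = ell2_norm \<xi>" if "\<xi> \<in> ell2 J" for \<xi>
    using norm_push[OF pullI[of \<xi>]] pp'[OF that] by simp
  define \<pi>' where "\<pi>' x \<xi> = (if \<xi> \<in> ell2 J then push (\<pi> x (pull \<xi>)) else (\<lambda>_. 0))" for x \<xi>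
  have B: "\<pi> x \<in> bounded_operators I" if "x \<in> carrier A" for x using \<pi> that by (simp add: star_representation_def)
  have pull_add: "pull (\<lambda>j. \<xi> j + \<eta> j) = (\<lambda>i. pull \<xi> i + pull \<eta> i)"
    and pull_scale: "pull (\<lambda>j. c * \<xi> j) = (\<lambda>i. c * pull \<xi> i)" for \<xi> \<eta> c by (auto simp: pull_def)
  have push_add: "push (\<lambda>i. \<zeta> i + \<theta> i) = (\<lambda>j. push \<zeta> j + push \<theta> j)"
    and push_scale: "push (\<lambda>i. c * \<zeta> i) = (\<lambda>j. c * push \<zeta> j)" for \<zeta> \<theta> c by (auto simp: push_def)
  have "star_representation A J \<pi>'"
    unfolding star_representation_def
  proof (intro conjI ballI allI)
    fix x assume x: "x \<in> carrier A"
    show "\<pi>' x \<in> bounded_operators J"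
    proof (rule bounded_operatorsI)
      fix \<xi> \<eta> :: "'j \<Rightarrow> complex" and c
      show "\<pi>' x \<xi> = (\<lambda>_. 0)" if "\<xi> \<notin> ell2 J" using that by (simp add: \<pi>'_def)
      assume xi: "\<xi> \<in> ell2 J"
      show "\<pi>' x \<xi> \<in> ell2 J" using xi pushJ by (simp add: \<pi>'_def)
      show "\<pi>' x (\<lambda>i. c * \<xi> i) = (\<lambda>i. c * \<pi>' x \<xi> i)"
        using xi bop_scale[OF B[OF x] pullI] by (simp add: \<pi>'_def ell2_scale pull_scale push_scale)
      show "ell2_norm (\<pi>' x \<xi>) \<le> operator_norm I (\<pi> x) * ell2_norm \<xi>"
        using operator_norm_bound[OF B[OF x] pullI[of \<xi>]] norm_push[OF bop_in[OF B[OF x] pullI[of \<xi>]]] norm_pull[OF xi] xi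
        by (simp add: \<pi>'_def)
      assume "\<eta> \<in> ell2 J"
      then show "\<pi>' x (\<lambda>i. \<xi> i + \<eta> i) = (\<lambda>i. \<pi>' x \<xi> i + \<pi>' x \<eta> i)"
        using xi bop_add[OF B[OF x] pullI pullI] by (simp add: \<pi>'_def ell2_add pull_add push_add)
    qed
    show "\<pi>' (sa_scale A c x) = (\<lambda>\<xi> i. c * \<pi>' x \<xi> i)" for c
    proof -
      have "\<pi> (sa_scale A c x) = (\<lambda>\<xi> i. c * \<pi> x \<xi> i)" using \<pi> x by (simp add: star_representation_def)
      then show ?thesis by (auto simp: \<pi>'_def push_def fun_eq_iff)
    qed
    have star: "is_adjoint I (\<pi> x) (\<pi> (sa_star A x))" using \<pi> x by (simp add: star_representation_def)
    show "is_adjoint J (\<pi>' x) (\<pi>' (sa_star A x))"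
      unfolding is_adjoint_def
    proof (intro ballI)
      fix \<xi> \<eta> :: "'j \<Rightarrow> complex" assume xi: "\<xi> \<in> ell2 J" and eta: "\<eta> \<in> ell2 J"
      have "ell2_inner (\<pi>' x \<xi>) \<eta> = ell2_inner (\<pi> x (pull \<xi>)) (pull \<eta>)"
        using inner[OF bop_in[OF B[OF x] pullI]] xi by (simp add: \<pi>'_def)
      also have "\<dots> = ell2_inner (pull \<xi>) (\<pi> (sa_star A x) (pull \<eta>))"
        using star pullI unfolding is_adjoint_def by blast
      also have "\<pi> (sa_star A x) (pull \<eta>) = pull (\<pi>' (sa_star A x) \<eta>)"
      proof -
        have "\<pi> (sa_star A x) (pull \<eta>) \<in> ell2 I" by (rule bop_in[OF B[OF bspec[OF star_closed x]] pullI])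
        then show ?thesis using eta by (simp add: \<pi>'_def pp)
      qed
      also have "ell2_inner (pull \<xi>) (pull (\<pi>' (sa_star A x) \<eta>)) = ell2_inner \<xi> (\<pi>' (sa_star A x) \<eta>)"
        using inner[OF pullI[of \<xi>]] pp'[OF xi] by simp
      finally show "ell2_inner (\<pi>' x \<xi>) \<eta> = ell2_inner \<xi> (\<pi>' (sa_star A x) \<eta>)" .
    qed
    fix y assume y: "y \<in> carrier A"
    show "\<pi>' (sa_add A x y) = (\<lambda>\<xi> i. \<pi>' x \<xi> i + \<pi>' y \<xi> i)"
    proof -
      have "\<pi> (sa_add A x y) = (\<lambda>\<xi> i. \<pi> x \<xi> i + \<pi> y \<xi> i)" using \<pi> x y by (simp add: star_representation_def)
      then show ?thesis by (auto simp: \<pi>'_def push_def fun_eq_iff)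
    qed
    have mult: "\<pi> (sa_mult A x y) = \<pi> x \<circ> \<pi> y" using \<pi> x y by (simp add: star_representation_def)
    show "\<pi>' (sa_mult A x y) = \<pi>' x \<circ> \<pi>' y"
    proof
      fix \<xi>
      have "\<pi>' x (\<lambda>_. 0) = (\<lambda>_. 0)"
      proof -
        have "pull (\<lambda>_. 0) = (\<lambda>_. 0)" "push (\<lambda>_. 0) = (\<lambda>_. 0)" by (auto simp: pull_def push_def)
        then show ?thesis using bop_zero[OF B[OF x]] by (simp add: \<pi>'_def)
      qed
      then show "\<pi>' (sa_mult A x y) \<xi> = (\<pi>' x \<circ> \<pi>' y) \<xi>"
        using pushJ pp[OF bop_in[OF B[OF y] pullI[of \<xi>]]] by (simp add: \<pi>'_def mult)
    qed
  qed
  moreover have "\<pi> x = \<pi> y" if x: "x \<in> carrier A" and y: "y \<in> carrier A" and eq: "\<pi>' x = \<pi>' y" for x y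
  proof
    fix \<zeta> show "\<pi> x \<zeta> = \<pi> y \<zeta>"
    proof (cases "\<zeta> \<in> ell2 I")
      case True
      have "push (\<pi> x \<zeta>) = push (\<pi> y \<zeta>)"
        using fun_cong[OF eq, of "push \<zeta>"] pushJ[of \<zeta>] pp[OF True] by (simp add: \<pi>'_def)
      then show ?thesis using pp[OF bop_in[OF B[OF x] True]] pp[OF bop_in[OF B[OF y] True]] by metis
    qed (simp add: bop_off[OF B[OF x]] bop_off[OF B[OF y]])
  qed
  ultimately show ?thesis by blast
qed

lemma full_cstar_eval_representation:
  fixes G :: "('g, 'x, 'm) gpd_scheme"
  shows "star_representation (full_cstar G) (fst \<rho>) (\<lambda>a. a \<rho>)"
  unfolding star_representation_def full_cstar_simps
  by (auto intro: full_cstar_bop operator_adjoint_adjoint)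

text \<open>
  It suffices that finite-dimensional representations of the convolution algebra determine the
  norms: an element of the completion that all of them annihilate is a limit of functions of
  arbitrarily small norm.
\<close>

theorem RFD_full_cstar:
  fixes G :: "('g, 'x, 'm) gpd_scheme"
  assumes cstar: "cstar_algebra (full_cstar G)"
    and add_cc: "\<And>f h. f \<in> cc_functions G \<Longrightarrow> h \<in> cc_functions G \<Longrightarrow> (\<lambda>g. f g + h g) \<in> cc_functions G"
    and scale_cc: "\<And>c f. f \<in> cc_functions G \<Longrightarrow> (\<lambda>g. c * f g) \<in> cc_functions G"
    and norm_cc: "\<And>f M \<rho>. f \<in> cc_functions G \<Longrightarrow> 0 \<le> M \<Longrightarrow>
      (\<And>\<sigma>. \<sigma> \<in> cc_reps G \<Longrightarrow> finite (fst \<sigma>) \<Longrightarrow> operator_norm (fst \<sigma>) (snd \<sigma> f) \<le> M) \<Longrightarrow>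
      \<rho> \<in> cc_reps G \<Longrightarrow> operator_norm (fst \<rho>) (snd \<rho> f) \<le> M"
  shows "RFD (full_cstar G)"
  unfolding RFD_def
proof (intro ballI impI)
  interpret C: cstar_algebra "full_cstar G" by (rule cstar)
  fix a b assume a: "a \<in> carrier (full_cstar G)" and b: "b \<in> carrier (full_cstar G)" and ne: "a \<noteq> b"
  note aB = full_cstar_bop[OF a] and bB = full_cstar_bop[OF b]
  have "\<exists>\<sigma>\<in>cc_reps G. finite (fst \<sigma>) \<and> a \<sigma> \<noteq> b \<sigma>"
  proof (rule ccontr)
    assume "\<not> (\<exists>\<sigma>\<in>cc_reps G. finite (fst \<sigma>) \<and> a \<sigma> \<noteq> b \<sigma>)"
    then have eq: "a \<sigma> = b \<sigma>" if "\<sigma> \<in> cc_reps G" "finite (fst \<sigma>)" for \<sigma> using that by blast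
    have "a \<rho> = b \<rho>" for \<rho>
    proof (cases "\<rho> \<in> cc_reps G")
      case r: True
      have "operator_norm (fst \<rho>) (\<lambda>\<xi> i. a \<rho> \<xi> i - b \<rho> \<xi> i) \<le> 0 + e" if e: "0 < e" for e
      proof -
        have e4: "0 < e / 4" using e by simp
        obtain f where f: "f \<in> cc_functions G" "\<forall>\<rho>\<in>cc_reps G. operator_norm (fst \<rho>) (\<lambda>\<xi> i. a \<rho> \<xi> i - snd \<rho> f \<xi> i) \<le> e / 4"
          using full_cstar_approx[OF a e4] by auto
        obtain h where h: "h \<in> cc_functions G" "\<forall>\<rho>\<in>cc_reps G. operator_norm (fst \<rho>) (\<lambda>\<xi> i. b \<rho> \<xi> i - snd \<rho> h \<xi> i) \<le> e / 4"
          using full_cstar_approx[OF b e4] by auto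
        define k where "k g = f g + (-1) * h g" for g
        have k: "k \<in> cc_functions G" unfolding k_def by (intro add_cc scale_cc f(1) h(1))
        have krep: "snd \<sigma> k = (\<lambda>\<xi> i. snd \<sigma> f \<xi> i - snd \<sigma> h \<xi> i)" if s: "\<sigma> \<in> cc_reps G" for \<sigma>
          unfolding k_def using cc_rep_add[OF s f(1) scale_cc[OF h(1), of "-1"]] cc_rep_scale[OF s h(1), of "-1"] by simp
        have "operator_norm (fst \<rho>) (snd \<rho> k) \<le> e / 2"
        proof (rule norm_cc[OF k _ _ r])
          show "0 \<le> e / 2" using e by simp
          fix \<sigma> assume s: "\<sigma> \<in> cc_reps G" "finite (fst \<sigma>)"
          note fB = cc_rep_bop[OF s(1) f(1)] and hB = cc_rep_bop[OF s(1) h(1)]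
          have "operator_norm (fst \<sigma>) (snd \<sigma> k) \<le> operator_norm (fst \<sigma>) (\<lambda>\<xi> i. snd \<sigma> f \<xi> i - a \<sigma> \<xi> i) +
              operator_norm (fst \<sigma>) (\<lambda>\<xi> i. a \<sigma> \<xi> i - snd \<sigma> h \<xi> i)"
            unfolding krep[OF s(1)] by (rule operator_norm_triangle_mid[OF fB aB hB])
          also have "\<dots> \<le> e / 4 + e / 4"
            using f(2) h(2) s(1) eq[OF s] operator_norm_minus_commute[OF fB aB] by (intro add_mono) auto
          finally show "operator_norm (fst \<sigma>) (snd \<sigma> k) \<le> e / 2" by simp
        qed
        moreover note fB = cc_rep_bop[OF r f(1)] and hB = cc_rep_bop[OF r h(1)]
        have "operator_norm (fst \<rho>) (\<lambda>\<xi> i. snd \<rho> h \<xi> i - b \<rho> \<xi> i) \<le> e / 4"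
          using h(2) r operator_norm_minus_commute[OF hB bB] by simp
        moreover have "operator_norm (fst \<rho>) (\<lambda>\<xi> i. a \<rho> \<xi> i - snd \<rho> f \<xi> i) \<le> e / 4" using f(2) r by blast
        ultimately show ?thesis
          using operator_norm_triangle_mid[OF aB fB bB] operator_norm_triangle_mid[OF fB hB bB]
          unfolding krep[OF r] by linarith
      qed
      then have "operator_norm (fst \<rho>) (\<lambda>\<xi> i. a \<rho> \<xi> i - b \<rho> \<xi> i) \<le> 0" by (rule field_le_epsilon)
      from antisym[OF this operator_norm_nonneg[OF bop_minus[OF aB bB]]]
      have "(\<lambda>\<xi> i. a \<rho> \<xi> i - b \<rho> \<xi> i) = (\<lambda>_ _. 0)"
        by (rule operator_norm_eq_0[OF bop_minus[OF aB bB]])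
      then show ?thesis by (simp add: fun_eq_iff)
    qed (simp add: full_cstar_off[OF a] full_cstar_off[OF b])
    then show False using ne by blast
  qed
  then obtain \<sigma> where \<sigma>: "\<sigma> \<in> cc_reps G" "finite (fst \<sigma>)" "a \<sigma> \<noteq> b \<sigma>" by blast
  obtain h where "bij_betw h {..<card (fst \<sigma>)} (fst \<sigma>)"
    using ex_bij_betw_nat_finite[OF \<sigma>(2)] by (auto simp: atLeast0LessThan)
  from star_representation_transport[OF full_cstar_eval_representation \<sigma>(2) this ballI[OF C.star_closed]]
  obtain \<pi>' where \<pi>': "star_representation (full_cstar G) {..<card (fst \<sigma>)} \<pi>'"
    and sep: "\<forall>x\<in>carrier (full_cstar G). \<forall>y\<in>carrier (full_cstar G). \<pi>' x = \<pi>' y \<longrightarrow> x \<sigma> = y \<sigma>"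
    by (auto elim!: exE)
  have "\<pi>' a \<noteq> \<pi>' b"
  proof
    assume "\<pi>' a = \<pi>' b"
    from sep[rule_format, OF a b this] show False using \<sigma>(3) by contradiction
  qed
  with \<pi>' show "\<exists>(I :: nat set) \<pi>. finite I \<and> star_representation (full_cstar G) I \<pi> \<and> \<pi> a \<noteq> \<pi> b"
    by (intro exI[of _ "{..<card (fst \<sigma>)}"] exI[of _ \<pi>'] conjI finite_lessThan)
qed

context nilpotent_exhaustion
begin

text \<open>
  Evaluation of functions at the fibre over \<open>n\<close>, followed by the permutation representation of
  \<open>\<Gamma>\<^sub>n\<close> on a finite set \<open>J\<close>.
\<close>

definition perm_rep :: "nat \<Rightarrow> 'y set \<Rightarrow> ('a \<Rightarrow> 'y \<Rightarrow> 'y) \<Rightarrow> ('a \<times> enat \<Rightarrow> complex) \<Rightarrow> 'y operator" where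
  "perm_rep n J \<alpha> f \<psi> = (if \<psi> \<in> ell2 J then
     (\<lambda>y. if y \<in> J then \<Sum>g | f (g, enat n) \<noteq> 0. f (g, enat n) * \<psi> (\<alpha> (inv g) y) else 0) else (\<lambda>_. 0))"

lemma perm_rep_eval:
  assumes "\<psi> \<in> ell2 J" "finite S" "{g. f (g, enat n) \<noteq> 0} \<subseteq> S" "y \<in> J"
  shows "perm_rep n J \<alpha> f \<psi> y = (\<Sum>g\<in>S. f (g, enat n) * \<psi> (\<alpha> (inv g) y))"
  unfolding perm_rep_def using assms by (auto intro: sum.mono_neutral_left)

lemma cc_support_stage:
  assumes f: "f \<in> cc_functions \<G>"
  shows "finite {g. f (g, enat n) \<noteq> 0}" "{g. f (g, enat n) \<noteq> 0} \<subseteq> \<Gamma>s n"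
proof -
  show "finite {g. f (g, enat n) \<noteq> 0}" by (rule finite_subset[OF _ cc_finite[OF f]]) auto
  show "{g. f (g, enat n) \<noteq> 0} \<subseteq> \<Gamma>s n" using cc_off[OF f] by fastforce
qed

lemma perm_rep_representation:
  fixes J :: "'y set"
  assumes n: "1 \<le> n" and J: "finite J" and \<alpha>: "group.action_on (stage n) J \<alpha>"
  shows "star_representation (cc_algebra \<G>) J (perm_rep n J \<alpha>)"
proof -
  have act: "\<alpha> g y \<in> J" "\<alpha> \<one> y = y" "\<alpha> (g \<otimes> h) y = \<alpha> g (\<alpha> h y)"
    if "g \<in> \<Gamma>s n" "h \<in> \<Gamma>s n" "y \<in> J" for g h y
    using \<alpha> that group.action_on_def[OF stage_group[OF n], of J \<alpha>] by auto
  note sub = stage_sub[OF n] and sg = subgroup_stage[OF n]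
  note inv = subgroup.m_inv_closed[OF sg]
  have inv_act: "\<alpha> (inv g) (\<alpha> g y) = y" if "g \<in> \<Gamma>s n" "y \<in> J" for g y
    using act(3)[OF inv[OF that(1)] that(1) that(2)] act(2)[OF that(1) that(1) that(2)] sub[OF that(1)] by simp
  have off: "perm_rep n J \<alpha> f \<psi> y = 0" if "y \<notin> J" for f \<psi> y using that by (simp add: perm_rep_def)
  have in2: "perm_rep n J \<alpha> f \<psi> \<in> ell2 J" for f \<psi> using off J by (simp add: ell2_finite_iff)
  have not2: "perm_rep n J \<alpha> f \<psi> = (\<lambda>_. 0)" if "\<psi> \<notin> ell2 J" for f \<psi> using that by (simp add: perm_rep_def)
  show ?thesis
    unfolding star_representation_def cc_algebra_simps
  proof (intro conjI ballI allI)
    fix f assume f: "f \<in> cc_functions \<G>"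
    let ?S = "{g. f (g, enat n) \<noteq> 0}"
    note S = cc_support_stage[OF f, of n]
    note ev = perm_rep_eval[OF _ S(1) order_refl]
    show "perm_rep n J \<alpha> f \<in> bounded_operators J"
    proof (rule bounded_operatorsI)
      fix \<psi> \<theta> :: "'y \<Rightarrow> complex" and c
      show "perm_rep n J \<alpha> f \<psi> = (\<lambda>_. 0)" if "\<psi> \<notin> ell2 J" by (rule not2[OF that])
      show "perm_rep n J \<alpha> f \<psi> \<in> ell2 J" by (rule in2)
      assume p: "\<psi> \<in> ell2 J"
      show "perm_rep n J \<alpha> f (\<lambda>i. c * \<psi> i) = (\<lambda>i. c * perm_rep n J \<alpha> f \<psi> i)"
        using p by (auto simp: perm_rep_def ell2_scale sum_distrib_left mult_ac intro!: sum.cong)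
      have "ell2_norm (perm_rep n J \<alpha> f \<psi>) \<le> (\<Sum>y\<in>J. cmod (perm_rep n J \<alpha> f \<psi> y))"
        by (rule ell2_norm_le_sum[OF J off])
      also have "\<dots> \<le> (\<Sum>y\<in>J. (\<Sum>g\<in>?S. cmod (f (g, enat n))) * ell2_norm \<psi>)"
      proof (rule sum_mono)
        fix y assume y: "y \<in> J"
        have "cmod (perm_rep n J \<alpha> f \<psi> y) \<le> (\<Sum>g\<in>?S. cmod (f (g, enat n) * \<psi> (\<alpha> (inv g) y)))"
          unfolding ev[OF p y] by (rule norm_sum)
        also have "\<dots> \<le> (\<Sum>g\<in>?S. cmod (f (g, enat n)) * ell2_norm \<psi>)"
          unfolding norm_mult by (intro sum_mono mult_left_mono cmod_le_ell2_norm[OF p]) auto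
        finally show "cmod (perm_rep n J \<alpha> f \<psi> y) \<le> (\<Sum>g\<in>?S. cmod (f (g, enat n))) * ell2_norm \<psi>"
          by (simp add: sum_distrib_right)
      qed
      also have "\<dots> = (card J * (\<Sum>g\<in>?S. cmod (f (g, enat n)))) * ell2_norm \<psi>" by simp
      finally show "ell2_norm (perm_rep n J \<alpha> f \<psi>) \<le> (card J * (\<Sum>g\<in>?S. cmod (f (g, enat n)))) * ell2_norm \<psi>" .
      assume "\<theta> \<in> ell2 J"
      then show "perm_rep n J \<alpha> f (\<lambda>i. \<psi> i + \<theta> i) = (\<lambda>i. perm_rep n J \<alpha> f \<psi> i + perm_rep n J \<alpha> f \<theta> i)"
        using p by (auto simp: perm_rep_def ell2_add distrib_left sum.distrib)
    qed
    show "perm_rep n J \<alpha> (\<lambda>g. c * f g) = (\<lambda>\<psi> i. c * perm_rep n J \<alpha> f \<psi> i)" for c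
    proof (intro ext)
      fix \<psi> y
      show "perm_rep n J \<alpha> (\<lambda>g. c * f g) \<psi> y = c * perm_rep n J \<alpha> f \<psi> y"
      proof (cases "\<psi> \<in> ell2 J \<and> y \<in> J")
        case True
        have "{g. c * f (g, enat n) \<noteq> 0} \<subseteq> ?S" by auto
        then show ?thesis
          using True perm_rep_eval[of \<psi> J ?S "\<lambda>g. c * f g" n y \<alpha>] S(1) ev[of \<psi> J y \<alpha>]
          by (simp add: sum_distrib_left mult.assoc)
      next
        case False then show ?thesis using off not2 by auto
      qed
    qed
    show "is_adjoint J (perm_rep n J \<alpha> f) (perm_rep n J \<alpha> (sa_star (cc_algebra \<G>) f))"
      unfolding is_adjoint_def
    proof (intro ballI)
      fix \<psi> \<theta> :: "'y \<Rightarrow> complex" assume p: "\<psi> \<in> ell2 J" and q: "\<theta> \<in> ell2 J"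
      let ?fs = "sa_star (cc_algebra \<G>) f"
      have star: "perm_rep n J \<alpha> ?fs \<theta> z = (\<Sum>g\<in>?S. cnj (f (g, enat n)) * \<theta> (\<alpha> g z))" if z: "z \<in> J" for z
      proof -
        have "{g. ?fs (g, enat n) \<noteq> 0} \<subseteq> m_inv \<Gamma> ` ?S"
        proof
          fix g assume "g \<in> {g. ?fs (g, enat n) \<noteq> 0}"
          then have "g \<in> \<Gamma>s n" "inv g \<in> ?S" by (auto simp: star_eval split: if_splits)
          moreover from this have "g = inv (inv g)" using sub by simp
          ultimately show "g \<in> m_inv \<Gamma> ` ?S" by blast
        qed
        then have "perm_rep n J \<alpha> ?fs \<theta> z = (\<Sum>g\<in>m_inv \<Gamma> ` ?S. ?fs (g, enat n) * \<theta> (\<alpha> (inv g) z))"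
          using S(1) by (intro perm_rep_eval[OF q _ _ z]) auto
        also have "\<dots> = (\<Sum>g\<in>?S. ?fs (inv g, enat n) * \<theta> (\<alpha> (inv (inv g)) z))"
          by (rule sum.reindex_cong[of "m_inv \<Gamma>"]) (use S(2) sub in \<open>auto intro!: inj_onI dest: arg_cong[of _ _ "m_inv \<Gamma>"] simp: subset_iff\<close>)
        also have "\<dots> = (\<Sum>g\<in>?S. cnj (f (g, enat n)) * \<theta> (\<alpha> g z))"
        proof (rule sum.cong[OF refl])
          fix g assume "g \<in> ?S"
          then have "g \<in> \<Gamma>s n" "inv (inv g) = g" using S(2) sub by auto
          then show "?fs (inv g, enat n) * \<theta> (\<alpha> (inv (inv g)) z) = cnj (f (g, enat n)) * \<theta> (\<alpha> g z)"
            using inv n by (simp add: star_eval)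
        qed
        finally show ?thesis .
      qed
      have "ell2_inner (perm_rep n J \<alpha> f \<psi>) \<theta> = (\<Sum>y\<in>J. cnj (perm_rep n J \<alpha> f \<psi> y) * \<theta> y)"
        by (rule ell2_inner_finite[OF J off])
      also have "\<dots> = (\<Sum>y\<in>J. \<Sum>g\<in>?S. cnj (f (g, enat n)) * (cnj (\<psi> (\<alpha> (inv g) y)) * \<theta> y))"
        by (intro sum.cong refl) (simp add: ev[OF p] sum_distrib_right mult.assoc)
      also have "\<dots> = (\<Sum>g\<in>?S. \<Sum>y\<in>J. cnj (f (g, enat n)) * (cnj (\<psi> (\<alpha> (inv g) y)) * \<theta> y))"
        by (rule sum.swap)
      also have "\<dots> = (\<Sum>g\<in>?S. \<Sum>z\<in>J. cnj (f (g, enat n)) * (cnj (\<psi> z) * \<theta> (\<alpha> g z)))"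
      proof (rule sum.cong[OF refl])
        fix g assume "g \<in> ?S"
        then have g: "g \<in> \<Gamma>s n" using S(2) by blast
        have ii: "inv (inv g) = g" using sub[OF g] by simp
        have bij: "bij_betw (\<alpha> g) J J"
          by (rule bij_betwI[where g="\<alpha> (inv g)"])
            (use act(1)[OF g g] act(1)[OF inv[OF g] g] inv_act[OF g] inv_act[OF inv[OF g], unfolded ii] in auto)
        have "(\<Sum>y\<in>J. cnj (f (g, enat n)) * (cnj (\<psi> (\<alpha> (inv g) y)) * \<theta> y)) =
            (\<Sum>z\<in>J. cnj (f (g, enat n)) * (cnj (\<psi> (\<alpha> (inv g) (\<alpha> g z))) * \<theta> (\<alpha> g z)))"
          by (rule sum.reindex_bij_betw[OF bij, symmetric])
        then show "(\<Sum>y\<in>J. cnj (f (g, enat n)) * (cnj (\<psi> (\<alpha> (inv g) y)) * \<theta> y)) =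
            (\<Sum>z\<in>J. cnj (f (g, enat n)) * (cnj (\<psi> z) * \<theta> (\<alpha> g z)))"
          using inv_act[OF g] by simp
      qed
      also have "\<dots> = (\<Sum>z\<in>J. \<Sum>g\<in>?S. cnj (f (g, enat n)) * (cnj (\<psi> z) * \<theta> (\<alpha> g z)))"
        by (rule sum.swap)
      also have "\<dots> = (\<Sum>z\<in>J. cnj (\<psi> z) * perm_rep n J \<alpha> ?fs \<theta> z)"
        by (intro sum.cong refl) (simp add: star sum_distrib_left mult_ac)
      also have "\<dots> = ell2_inner \<psi> (perm_rep n J \<alpha> ?fs \<theta>)"
        by (rule ell2_inner_finite[OF J, symmetric]) (rule ell2_off[OF p])
      finally show "ell2_inner (perm_rep n J \<alpha> f \<psi>) \<theta> = ell2_inner \<psi> (perm_rep n J \<alpha> ?fs \<theta>)" .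
    qed
    fix h assume h: "h \<in> cc_functions \<G>"
    let ?T = "{g. h (g, enat n) \<noteq> 0}"
    note T = cc_support_stage[OF h, of n]
    note evh = perm_rep_eval[OF _ T(1) order_refl]
    show "perm_rep n J \<alpha> (\<lambda>g. f g + h g) = (\<lambda>\<psi> i. perm_rep n J \<alpha> f \<psi> i + perm_rep n J \<alpha> h \<psi> i)"
    proof (intro ext)
      fix \<psi> y
      show "perm_rep n J \<alpha> (\<lambda>g. f g + h g) \<psi> y = perm_rep n J \<alpha> f \<psi> y + perm_rep n J \<alpha> h \<psi> y"
      proof (cases "\<psi> \<in> ell2 J \<and> y \<in> J")
        case True
        have U: "finite (?S \<union> ?T)" "{g. f (g, enat n) + h (g, enat n) \<noteq> 0} \<subseteq> ?S \<union> ?T" using S(1) T(1) by auto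
        show ?thesis
          using True U(2) perm_rep_eval[of \<psi> J "?S \<union> ?T" "\<lambda>g. f g + h g" n y \<alpha>]
            perm_rep_eval[of \<psi> J "?S \<union> ?T" f n y \<alpha>] perm_rep_eval[of \<psi> J "?S \<union> ?T" h n y \<alpha>] U(1)
          by (simp add: distrib_right sum.distrib)
      next
        case False then show ?thesis using off not2 by auto
      qed
    qed
    show "perm_rep n J \<alpha> (sa_mult (cc_algebra \<G>) f h) = perm_rep n J \<alpha> f \<circ> perm_rep n J \<alpha> h"
    proof (intro ext)
      fix \<psi> y
      let ?m = "sa_mult (cc_algebra \<G>) f h"
      show "perm_rep n J \<alpha> ?m \<psi> y = (perm_rep n J \<alpha> f \<circ> perm_rep n J \<alpha> h) \<psi> y"
      proof (cases "\<psi> \<in> ell2 J \<and> y \<in> J")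
        case True
        then have p: "\<psi> \<in> ell2 J" and y: "y \<in> J" by auto
        define K where "K = (\<lambda>(g, h). g \<otimes> h) ` (?S \<times> ?T) \<union> {g. ?m (g, enat n) \<noteq> 0}"
        note M = cc_support_stage[OF cc_mult[OF f h], of n]
        have prod: "g \<otimes> h \<in> \<Gamma>s n" if "g \<in> ?S" "h \<in> ?T" for g h
          using subgroup.m_closed[OF sg subsetD[OF S(2) that(1)] subsetD[OF T(2) that(2)]] .
        have K: "finite K" "K \<subseteq> \<Gamma>s n"
          unfolding K_def using S(1) T(1) M prod by (simp, intro Un_least image_subsetI) auto
        have "perm_rep n J \<alpha> ?m \<psi> y = (\<Sum>k\<in>K. ?m (k, enat n) * \<psi> (\<alpha> (inv k) y))"
          by (rule perm_rep_eval[OF p K(1) _ y]) (auto simp: K_def)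
        also have "\<dots> = (\<Sum>k\<in>K. \<Sum>g\<in>?S. f (g, enat n) * (h (inv g \<otimes> k, enat n) * \<psi> (\<alpha> (inv k) y)))"
        proof (rule sum.cong[OF refl])
          fix k assume "k \<in> K"
          then have "?m (k, enat n) = (\<Sum>g\<in>?S. f (g, enat n) * h (inv g \<otimes> k, enat n))"
            using K(2) n cc_off[OF f] by (intro conv_eval[OF _ S(1)]) auto
          then show "?m (k, enat n) * \<psi> (\<alpha> (inv k) y) = (\<Sum>g\<in>?S. f (g, enat n) * (h (inv g \<otimes> k, enat n) * \<psi> (\<alpha> (inv k) y)))"
            by (simp add: sum_distrib_right mult.assoc)
        qed
        also have "\<dots> = (\<Sum>g\<in>?S. f (g, enat n) * (\<Sum>k\<in>K. h (inv g \<otimes> k, enat n) * \<psi> (\<alpha> (inv k) y)))"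
          unfolding sum_distrib_left by (rule sum.swap)
        also have "\<dots> = (\<Sum>g\<in>?S. f (g, enat n) * perm_rep n J \<alpha> h \<psi> (\<alpha> (inv g) y))"
        proof (intro sum.cong refl arg_cong[where f="\<lambda>z. _ * z"])
          fix g assume gS: "g \<in> ?S"
          then have g: "g \<in> \<Gamma>s n" "g \<in> carrier \<Gamma>" using S(2) sub by auto
          have "(\<Sum>k\<in>K. h (inv g \<otimes> k, enat n) * \<psi> (\<alpha> (inv k) y)) =
              (\<Sum>k\<in>(\<lambda>l. g \<otimes> l) ` ?T. h (inv g \<otimes> k, enat n) * \<psi> (\<alpha> (inv k) y))"
          proof (rule sum.mono_neutral_right[OF K(1)])
            show "(\<lambda>l. g \<otimes> l) ` ?T \<subseteq> K" using gS unfolding K_def by auto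
            show "\<forall>k\<in>K - (\<lambda>l. g \<otimes> l) ` ?T. h (inv g \<otimes> k, enat n) * \<psi> (\<alpha> (inv k) y) = 0"
            proof
              fix k assume k: "k \<in> K - (\<lambda>l. g \<otimes> l) ` ?T"
              have "k \<in> carrier \<Gamma>" using k K(2) sub by blast
              then have "k = g \<otimes> (inv g \<otimes> k)" using g by (simp add: inv_mult_cancel_left)
              then have "inv g \<otimes> k \<notin> ?T" using k by blast
              then show "h (inv g \<otimes> k, enat n) * \<psi> (\<alpha> (inv k) y) = 0" by simp
            qed
          qed
          also have "\<dots> = (\<Sum>l\<in>?T. h (l, enat n) * \<psi> (\<alpha> (inv l) (\<alpha> (inv g) y)))"
          proof (rule sum.reindex_cong[of "\<lambda>l. g \<otimes> l"])
            show "inj_on (\<lambda>l. g \<otimes> l) ?T"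
            proof (rule inj_onI)
              fix l l' assume "l \<in> ?T" "l' \<in> ?T" "g \<otimes> l = g \<otimes> l'"
              moreover from this have "l \<in> carrier \<Gamma>" "l' \<in> carrier \<Gamma>" using T(2) sub by blast+
              ultimately show "l = l'" using g(2) by (metis inv_mult_cancel_left(1))
            qed
            fix l assume "l \<in> ?T"
            then have l: "l \<in> \<Gamma>s n" "l \<in> carrier \<Gamma>" using T(2) sub by auto
            show "h (inv g \<otimes> (g \<otimes> l), enat n) * \<psi> (\<alpha> (inv (g \<otimes> l)) y) = h (l, enat n) * \<psi> (\<alpha> (inv l) (\<alpha> (inv g) y))"
              using g l act(3)[OF inv[OF l(1)] inv[OF g(1)] y] by (simp add: inv_mult_cancel_left inv_mult_group)
          qed simp
          also have "\<dots> = perm_rep n J \<alpha> h \<psi> (\<alpha> (inv g) y)"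
            by (rule evh[OF p act(1)[OF inv[OF g(1)] g(1) y], symmetric])
          finally show "(\<Sum>k\<in>K. h (inv g \<otimes> k, enat n) * \<psi> (\<alpha> (inv k) y)) = perm_rep n J \<alpha> h \<psi> (\<alpha> (inv g) y)" .
        qed
        also have "\<dots> = perm_rep n J \<alpha> f (perm_rep n J \<alpha> h \<psi>) y" by (rule ev[OF in2 y, symmetric])
        finally show ?thesis by simp
      next
        case False
        then have "perm_rep n J \<alpha> ?m \<psi> y = 0" using off not2 by auto
        moreover have "perm_rep n J \<alpha> f (perm_rep n J \<alpha> h \<psi>) y = 0"
        proof (cases "y \<in> J")
          case True
          then have "perm_rep n J \<alpha> h \<psi> = (\<lambda>_. 0)" using False not2 by blast
          then show ?thesis by (simp add: perm_rep_def)
        qed (rule off)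
        ultimately show ?thesis by simp
      qed
    qed
  qed
qed

text \<open>
  Up to a small error a function is constant along the sections beyond some \<open>N\<close> and then splits
  into the parts over the single points \<open>1, \<dots>, N - 1\<close> and over \<open>[N, \<infinity>]\<close>.  On the range of the
  corresponding central projections a representation is given by unitary representations of the
  finitely generated groups \<open>\<Gamma>\<^sub>1, \<dots>, \<Gamma>\<^sub>N\<close>; the group over infinity is never seen.
\<close>

theorem cc_rep_norm_le:
  assumes f: "f \<in> cc_functions \<G>" and M: "0 \<le> M"
    and fin: "\<And>\<sigma>. \<sigma> \<in> cc_reps \<G> \<Longrightarrow> finite (fst \<sigma>) \<Longrightarrow> operator_norm (fst \<sigma>) (snd \<sigma> f) \<le> M"
    and rep: "\<rho> \<in> cc_reps \<G>"
  shows "operator_norm (fst \<rho>) (snd \<rho> f) \<le> M"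
proof -
  let ?A = "cc_algebra \<G>"
  define S where "S = {g. \<exists>x. f (g, x) \<noteq> 0}"
  have S: "finite S" "S \<subseteq> carrier \<Gamma>" "{g. \<exists>x. f (g, x) \<noteq> 0} \<subseteq> S"
    using cc_finite[OF f] cc_support_sub[OF f] by (auto simp: S_def)
  have "operator_norm (fst \<rho>) (snd \<rho> f) \<le> M + real (card S) * e" if e: "0 < e" for e :: real
  proof -
    have "\<exists>N. \<forall>m\<ge>N. cmod (f (g, enat m) - f (g, \<infinity>)) < e / 2" if "g \<in> S" for g
      using LIMSEQ_D[OF cc_tendsto[OF f], of g "e / 2"] S(2) that e by auto
    then obtain N0 where N0: "\<And>g m. g \<in> S \<Longrightarrow> m \<ge> N0 g \<Longrightarrow> cmod (f (g, enat m) - f (g, \<infinity>)) < e / 2" by metis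
    obtain N1 where N1: "N1 \<ge> 1" "\<forall>n\<ge>N1. S \<subseteq> \<Gamma>s n" using finite_in_stage[OF S(1,2)] by blast
    define N where "N = N1 + (\<Sum>g\<in>S. N0 g)"
    have N: "1 \<le> N" "S \<subseteq> \<Gamma>s N" using N1 by (auto simp: N_def)
    have NN: "N0 g \<le> N" if "g \<in> S" for g
      using member_le_sum[of g S N0] that S(1) by (simp add: N_def)
    \<comment> \<open>The part over \<open>{n}\<close> for \<open>n < N\<close> and over \<open>[N, \<infinity>]\<close> for \<open>n = N\<close>, made constant along sections.\<close>
    define part where "part n = (\<lambda>(g, x). if 1 \<le> x \<and> cut N x = n then f (g, enat n) else 0)" for n
    define ind where "ind n x = (if 1 \<le> x \<and> cut N x = n then 1 else 0 :: complex)" for n x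
    have sf: "section_function g (ind n)" if n: "1 \<le> n" and g: "g \<in> \<Gamma>s n" for g n
      unfolding section_function_def
    proof (intro conjI allI impI)
      show "g \<in> carrier \<Gamma>" using stage_sub[OF n g] .
      show "(g, x) \<in> arrows" if "ind n x \<noteq> 0" for x
        using that cut_fibre[OF N(1), of x] g by (auto simp: ind_def split: if_splits)
      have "\<forall>\<^sub>F m in sequentially. ind n (enat m) = ind n \<infinity>"
        unfolding eventually_sequentially using N(1) by (intro exI[of _ N]) (auto simp: ind_def min_def)
      then show "(\<lambda>m. ind n (enat m)) \<longlonglongrightarrow> ind n \<infinity>" by (rule tendsto_eventually)
    qed
    define u where "u n g = snd \<rho> (on_section g (ind n))" for n g
    have uB: "u n g \<in> bounded_operators (fst \<rho>)" if "1 \<le> n" "g \<in> \<Gamma>s n" for n g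
      unfolding u_def by (rule cc_rep_bop[OF rep on_section_cc[OF sf[OF that]]])
    have ind2: "(\<lambda>x. ind n x * ind n x) = ind n" "(\<lambda>x. cnj (ind n x)) = ind n" for n by (auto simp: ind_def)
    have u_mult: "u n (g \<otimes> h) = u n g \<circ> u n h" if n: "1 \<le> n" and g: "g \<in> \<Gamma>s n" and h: "h \<in> \<Gamma>s n" for n g h
      unfolding u_def cc_rep_mult[OF rep on_section_cc[OF sf[OF n g]] on_section_cc[OF sf[OF n h]], symmetric]
        on_section_mult[OF sf[OF n g] sf[OF n h]] ind2 ..
    have u_adj: "is_adjoint (fst \<rho>) (u n g) (u n (inv g))" if n: "1 \<le> n" and g: "g \<in> \<Gamma>s n" for n g
      using cc_rep_star[OF rep on_section_cc[OF sf[OF n g]]] unfolding on_section_star[OF sf[OF n g]] ind2 u_def .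
    let ?C = "\<lambda>n. {g. f (g, enat n) \<noteq> 0}"
    note C = cc_support_stage[OF f]
    have part_eq: "part n = (\<lambda>p. \<Sum>g\<in>?C n. f (g, enat n) * on_section g (ind n) p)" for n
    proof
      fix p :: "'a \<times> enat"
      obtain k x where p: "p = (k, x)" by (cases p)
      have "(\<Sum>g\<in>?C n. f (g, enat n) * on_section g (ind n) p) = (\<Sum>g\<in>?C n. if k = g then f (g, enat n) * ind n x else 0)"
        by (intro sum.cong) (auto simp: p on_section_def)
      also have "\<dots> = part n p" using C(1)[of n] by (auto simp: p part_def ind_def)
      finally show "part n p = (\<Sum>g\<in>?C n. f (g, enat n) * on_section g (ind n) p)" by simp
    qed
    have part_cc: "part n \<in> cc_functions \<G>" if n: "1 \<le> n" for n
      unfolding part_eq using C(2)[of n] sf[OF n] by (intro cc_sum cc_scale on_section_cc) auto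
    have part_rep: "snd \<rho> (part n) = (\<lambda>\<xi> i. \<Sum>g\<in>?C n. f (g, enat n) * u n g \<xi> i)" if n: "1 \<le> n" for n
    proof -
      have cc: "on_section g (ind n) \<in> cc_functions \<G>" if "g \<in> ?C n" for g
        using on_section_cc[OF sf[OF n]] C(2) that by blast
      have "snd \<rho> (part n) = (\<lambda>\<xi> i. \<Sum>g\<in>?C n. snd \<rho> (\<lambda>p. f (g, enat n) * on_section g (ind n) p) \<xi> i)"
        unfolding part_eq by (rule cc_rep_sum[OF rep]) (rule cc_scale[OF cc])
      also have "\<dots> = (\<lambda>\<xi> i. \<Sum>g\<in>?C n. f (g, enat n) * u n g \<xi> i)"
        by (intro ext sum.cong refl) (simp add: cc_rep_scale[OF rep cc] u_def)
      finally show ?thesis .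
    qed
    have wc: "ell2_norm (snd \<rho> (part n) \<xi>) \<le> M * ell2_norm (u n \<one> \<xi>)" if n: "1 \<le> n" and x: "\<xi> \<in> ell2 (fst \<rho>)" for n \<xi>
    proof -
      interpret St: group "stage n" by (rule stage_group[OF n])
      obtain T where T: "finite T" "T \<subseteq> carrier (stage n)" "carrier (stage n) = generate (stage n) T"
        using stage_generators[OF n] by blast
      have inf: "infinite (UNIV :: ('a \<times> enat \<Rightarrow> complex) set)"
      proof
        assume "finite (UNIV :: ('a \<times> enat \<Rightarrow> complex) set)"
        then have "finite (range (\<lambda>z _. z :: complex) :: ('a \<times> enat \<Rightarrow> complex) set)" by (rule finite_subset[rotated]) auto
        then have "finite (UNIV :: complex set)" by (rule finite_imageD) (auto simp: inj_on_def fun_eq_iff)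
        then show False using infinite_UNIV_char_0 by blast
      qed
      have "ell2_norm (\<lambda>i. \<Sum>g\<in>?C n. f (g, enat n) * u n g \<xi> i) \<le> M * ell2_norm (u n \<one>\<^bsub>stage n\<^esub> \<xi>)"
      proof (rule St.nilpotent_weak_containment[where u="u n" and c="\<lambda>g. f (g, enat n)" and C="?C n" and
            \<xi>=\<xi> and I="fst \<rho>" and M=M, OF T stage_nilpotent[OF n] inf])
        show "finite (?C n)" by (rule C(1))
        show "?C n \<subseteq> carrier (stage n)" using C(2) by simp
        show "\<xi> \<in> ell2 (fst \<rho>)" by (rule x)
        show "0 \<le> M" by (rule M)
        fix g assume g: "g \<in> carrier (stage n)"
        then show "u n g \<in> bounded_operators (fst \<rho>)" using uB[OF n] by simp
        show "is_adjoint (fst \<rho>) (u n g) (u n (inv\<^bsub>stage n\<^esub> g))" using u_adj[OF n] g stage_inv[OF n] by simp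
        fix h assume "h \<in> carrier (stage n)"
        then show "u n (g \<otimes>\<^bsub>stage n\<^esub> h) = u n g \<circ> u n h" using u_mult[OF n] g by simp
      next
        fix J :: "('a \<times> enat \<Rightarrow> complex) set" and \<alpha> and \<psi> :: "('a \<times> enat \<Rightarrow> complex) \<Rightarrow> complex"
        assume J: "finite J" and \<alpha>: "St.action_on J \<alpha>"
        let ?\<sigma> = "(J, perm_rep n J \<alpha>)"
        have s: "?\<sigma> \<in> cc_reps \<G>" using perm_rep_representation[OF n J \<alpha>] by (simp add: cc_reps_def)
        \<comment> \<open>Values of \<open>\<psi>\<close> off \<open>J\<close> are arbitrary, whereas vectors of \<open>\<ell>\<^sup>2(J)\<close> vanish there.\<close>
        define \<theta> where "\<theta> y = (if y \<in> J then \<psi> y else 0)" for y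
        have chi: "\<theta> \<in> ell2 J" using J by (simp add: ell2_finite_iff \<theta>_def)
        have act: "\<alpha> (inv g) y \<in> J" if "g \<in> ?C n" "y \<in> J" for g y
          using \<alpha> that C(2)[of n] subgroup.m_inv_closed[OF subgroup_stage[OF n]] unfolding St.action_on_def by auto
        have "(\<Sum>y\<in>J. (cmod (\<Sum>g\<in>?C n. f (g, enat n) * \<psi> (\<alpha> (inv\<^bsub>stage n\<^esub> g) y)))\<^sup>2) =
            (\<Sum>y\<in>J. (cmod (perm_rep n J \<alpha> f \<theta> y))\<^sup>2)"
        proof (rule sum.cong[OF refl])
          fix y assume y: "y \<in> J"
          have "(\<Sum>g\<in>?C n. f (g, enat n) * \<psi> (\<alpha> (inv\<^bsub>stage n\<^esub> g) y)) = (\<Sum>g\<in>?C n. f (g, enat n) * \<theta> (\<alpha> (inv g) y))"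
          proof (rule sum.cong[OF refl])
            fix g assume g: "g \<in> ?C n"
            then have "inv\<^bsub>stage n\<^esub> g = inv g" using stage_inv[OF n] C(2) by blast
            then show "f (g, enat n) * \<psi> (\<alpha> (inv\<^bsub>stage n\<^esub> g) y) = f (g, enat n) * \<theta> (\<alpha> (inv g) y)"
              using act[OF g y] by (simp add: \<theta>_def)
          qed
          then show "(cmod (\<Sum>g\<in>?C n. f (g, enat n) * \<psi> (\<alpha> (inv\<^bsub>stage n\<^esub> g) y)))\<^sup>2 = (cmod (perm_rep n J \<alpha> f \<theta> y))\<^sup>2"
            using perm_rep_eval[where \<alpha>=\<alpha>, OF chi C(1) order_refl y] by simp
        qed
        also have "\<dots> = (ell2_norm (perm_rep n J \<alpha> f \<theta>))\<^sup>2"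
          by (rule ell2_norm_finite[OF J, symmetric]) (simp add: perm_rep_def)
        also have "\<dots> \<le> (M * ell2_norm \<theta>)\<^sup>2"
        proof (rule power_mono)
          have "ell2_norm (snd ?\<sigma> f \<theta>) \<le> operator_norm J (snd ?\<sigma> f) * ell2_norm \<theta>"
            using operator_norm_bound[OF cc_rep_bop[OF s f]] chi by simp
          also have "\<dots> \<le> M * ell2_norm \<theta>" using fin[OF s] J by (intro mult_right_mono) auto
          finally show "ell2_norm (perm_rep n J \<alpha> f \<theta>) \<le> M * ell2_norm \<theta>" by simp
        qed simp
        also have "\<dots> = M\<^sup>2 * (\<Sum>y\<in>J. (cmod (\<theta> y))\<^sup>2)"
          using ell2_norm_finite[OF J, of \<theta>] by (simp add: power_mult_distrib \<theta>_def)
        also have "(\<Sum>y\<in>J. (cmod (\<theta> y))\<^sup>2) = (\<Sum>y\<in>J. (cmod (\<psi> y))\<^sup>2)" by (simp add: \<theta>_def)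
        finally show "(\<Sum>y\<in>J. (cmod (\<Sum>g\<in>?C n. f (g, enat n) * \<psi> (\<alpha> (inv\<^bsub>stage n\<^esub> g) y)))\<^sup>2) \<le>
            M\<^sup>2 * (\<Sum>y\<in>J. (cmod (\<psi> y))\<^sup>2)" .
      qed
      then show ?thesis unfolding part_rep[OF n] by simp
    qed
    have orth: "ell2_inner (snd \<rho> h \<xi>) (snd \<rho> k \<xi>) = 0"
      if h: "h \<in> cc_functions \<G>" and k: "k \<in> cc_functions \<G>" and x: "\<xi> \<in> ell2 (fst \<rho>)"
        and disj: "\<And>g g' x. h (g, x) \<noteq> 0 \<Longrightarrow> k (g', x) = 0" for h k \<xi>
    proof -
      have "sa_mult ?A (sa_star ?A h) k = (\<lambda>_. 0)"
      proof
        fix p :: "'a \<times> enat"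
        obtain l x where p: "p = (l, x)" by (cases p)
        show "sa_mult ?A (sa_star ?A h) k p = 0"
        proof (cases "p \<in> arrows")
          case True
          have hs: "sa_star ?A h \<in> cc_functions \<G>" by (rule cc_star[OF h])
          have "sa_mult ?A (sa_star ?A h) k (l, x) =
              (\<Sum>g\<in>{g. \<exists>x. sa_star ?A h (g, x) \<noteq> 0}. sa_star ?A h (g, x) * k (inv g \<otimes> l, x))"
            by (rule conv_eval[OF _ cc_finite[OF hs]]) (use True p cc_off[OF hs] in auto)
          also have "\<dots> = 0" using disj by (intro sum.neutral) (auto simp: star_eval)
          finally show ?thesis by (simp add: p)
        qed (rule conv_off)
      qed
      then show ?thesis using cc_rep_inner[OF rep h k x x] by (simp add: cc_rep_zero[OF rep])
    qed
    define f' where "f' p = (\<Sum>n\<in>{1..N}. part n p)" for p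
    have f'_cc: "f' \<in> cc_functions \<G>" unfolding f'_def using part_cc by (intro cc_sum) auto
    have f'_eq: "f' (g, x) = (if 1 \<le> x then f (g, enat (cut N x)) else 0)" for g x
    proof -
      have "f' (g, x) = (\<Sum>n\<in>{1..N}. if n = cut N x then (if 1 \<le> x then f (g, enat n) else 0) else 0)"
        unfolding f'_def by (intro sum.cong) (auto simp: part_def)
      then show ?thesis using cut_ge[OF N(1), of x] cut_le[OF N(1), of x] by auto
    qed
    have f'_norm: "operator_norm (fst \<rho>) (snd \<rho> f') \<le> M"
    proof (rule operator_norm_leI[OF M])
      fix \<xi> assume x: "\<xi> \<in> ell2 (fst \<rho>)"
      have one: "\<one> \<in> \<Gamma>s n" if "1 \<le> n" for n using subgroup.one_closed[OF subgroup_stage[OF that]] .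
      have e_eq: "on_section \<one> unit_function = (\<lambda>p. \<Sum>n\<in>{1..N}. on_section \<one> (ind n) p)"
      proof
        fix p :: "'a \<times> enat"
        obtain k x where p: "p = (k, x)" by (cases p)
        have "(\<Sum>n\<in>{1..N}. on_section \<one> (ind n) p) =
            (\<Sum>n\<in>{1..N}. if n = cut N x then (if k = \<one> \<and> 1 \<le> x then 1 else 0) else 0)"
          by (intro sum.cong) (auto simp: p on_section_def ind_def)
        also have "\<dots> = on_section \<one> unit_function p"
          using cut_ge[OF N(1), of x] cut_le[OF N(1), of x] by (auto simp: p on_section_def unit_function_def)
        finally show "on_section \<one> unit_function p = (\<Sum>n\<in>{1..N}. on_section \<one> (ind n) p)" by simp
      qed
      have ucc: "on_section \<one> (ind n) \<in> cc_functions \<G>" if "n \<in> {1..N}" for n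
        using on_section_cc[OF sf[OF _ one]] that by simp
      have e_rep: "snd \<rho> (on_section \<one> unit_function) \<xi> = (\<lambda>i. \<Sum>n\<in>{1..N}. u n \<one> \<xi> i)"
        unfolding e_eq u_def using cc_rep_sum[OF rep ucc, of "{1..N}"] by simp
      have "(ell2_norm (snd \<rho> f' \<xi>))\<^sup>2 = (ell2_norm (\<lambda>i. \<Sum>n\<in>{1..N}. snd \<rho> (part n) \<xi> i))\<^sup>2"
        unfolding f'_def[abs_def] by (subst cc_rep_sum[OF rep]) (use part_cc in auto)
      also have "\<dots> = (\<Sum>n\<in>{1..N}. (ell2_norm (snd \<rho> (part n) \<xi>))\<^sup>2)"
      proof (rule ell2_Pythagoras_sum[where I="fst \<rho>"])
        show "snd \<rho> (part n) \<xi> \<in> ell2 (fst \<rho>)" if "n \<in> {1..N}" for n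
          using bop_in[OF cc_rep_bop[OF rep part_cc] x] that by simp
        show "ell2_inner (snd \<rho> (part n) \<xi>) (snd \<rho> (part m) \<xi>) = 0" if "n \<in> {1..N}" "m \<in> {1..N}" "n \<noteq> m" for n m
          using that by (intro orth[OF part_cc part_cc x]) (auto simp: part_def split: if_splits)
      qed simp
      also have "\<dots> \<le> (\<Sum>n\<in>{1..N}. (M * ell2_norm (u n \<one> \<xi>))\<^sup>2)"
        by (intro sum_mono power_mono wc x) auto
      also have "\<dots> = M\<^sup>2 * (\<Sum>n\<in>{1..N}. (ell2_norm (u n \<one> \<xi>))\<^sup>2)"
        by (simp add: power_mult_distrib sum_distrib_left)
      also have "(\<Sum>n\<in>{1..N}. (ell2_norm (u n \<one> \<xi>))\<^sup>2) = (ell2_norm (\<lambda>i. \<Sum>n\<in>{1..N}. u n \<one> \<xi> i))\<^sup>2"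
      proof (rule ell2_Pythagoras_sum[where I="fst \<rho>", symmetric])
        show "u n \<one> \<xi> \<in> ell2 (fst \<rho>)" if "n \<in> {1..N}" for n
          using bop_in[OF uB[OF _ one] x] that by simp
        show "ell2_inner (u n \<one> \<xi>) (u m \<one> \<xi>) = 0" if "n \<in> {1..N}" "m \<in> {1..N}" "n \<noteq> m" for n m
          unfolding u_def using that
          by (intro orth[OF ucc ucc x]) (auto simp: on_section_def ind_def split: if_splits)
      qed simp
      also have "\<dots> = (ell2_norm (snd \<rho> (on_section \<one> unit_function) \<xi>))\<^sup>2" by (simp only: e_rep)
      also have "M\<^sup>2 * \<dots> \<le> M\<^sup>2 * (ell2_norm \<xi>)\<^sup>2"
        using cc_rep_unit(1)[OF rep x] by (intro mult_left_mono power_mono) auto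
      finally have "(ell2_norm (snd \<rho> f' \<xi>))\<^sup>2 \<le> (M * ell2_norm \<xi>)\<^sup>2" by (simp add: power_mult_distrib)
      then show "ell2_norm (snd \<rho> f' \<xi>) \<le> M * ell2_norm \<xi>" by (rule power2_le_imp_le) (simp add: M)
    qed
    \<comment> \<open>The error of replacing \<open>f\<close> by \<open>f'\<close>, which vanishes before \<open>N\<close>.\<close>
    define d where "d p = f p + (-1) * f' p" for p
    have d_cc: "d \<in> cc_functions \<G>" unfolding d_def by (intro cc_add cc_scale f f'_cc)
    have "operator_norm (fst \<rho>) (snd \<rho> d) \<le> (\<Sum>g\<in>S. e)"
    proof (rule cc_rep_sum_bound[OF rep d_cc S(1,2)])
      have "f (g, x) = 0" if "g \<notin> S" for g x using that S(3) by blast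
      then show "{g. \<exists>x. d (g, x) \<noteq> 0} \<subseteq> S" by (auto simp: d_def f'_eq split: if_splits)
      fix g x assume g: "g \<in> S"
      show "cmod (d (g, x)) \<le> e"
      proof (cases "1 \<le> x \<and> enat N \<le> x")
        case True
        have "cmod (f (g, enat N) - f (g, \<infinity>)) < e / 2" using N0[OF g NN[OF g]] .
        moreover have "cmod (f (g, x) - f (g, \<infinity>)) < e / 2"
          using N0[OF g] NN[OF g] True e by (cases x) auto
        moreover have "d (g, x) = (f (g, x) - f (g, \<infinity>)) - (f (g, enat N) - f (g, \<infinity>))"
          using True by (cases x) (auto simp: d_def f'_eq min_def)
        ultimately show ?thesis using norm_triangle_ineq4[of "f (g, x) - f (g, \<infinity>)" "f (g, enat N) - f (g, \<infinity>)"] by simp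
      next
        case False
        then have "d (g, x) = 0"
          using cc_off[OF f, of "(g, x)"] by (cases x) (auto simp: d_def f'_eq min_def)
        then show ?thesis using e by simp
      qed
    qed
    moreover have "snd \<rho> d = (\<lambda>\<xi> i. snd \<rho> f \<xi> i - snd \<rho> f' \<xi> i)"
      unfolding d_def using cc_rep_add[OF rep f cc_scale[OF f'_cc, of "-1"]] cc_rep_scale[OF rep f'_cc, of "-1"] by simp
    ultimately show ?thesis
      using operator_norm_triangle_sub[OF cc_rep_bop[OF rep f] cc_rep_bop[OF rep f'_cc]] f'_norm by simp
  qed
  then have le: "operator_norm (fst \<rho>) (snd \<rho> f) \<le> M + real (card S) * e" if "0 < e" for e :: real using that by blast
  show ?thesis
  proof (rule field_le_epsilon)
    fix e :: real assume "0 < e"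
    then obtain d where "0 < d" "real (card S) * d \<le> e" using ex_small_factor[of "real (card S)" e] by auto
    then show "operator_norm (fst \<rho>) (snd \<rho> f) \<le> M + e" using le[of d] by linarith
  qed
qed

theorem RFD_bundle: "RFD (full_cstar \<G>)"
  by (rule RFD_full_cstar[OF cstar_algebra_bundle cc_add cc_scale cc_rep_norm_le])

end

section \<open>The rational Heisenberg group\<close>

definition heis :: "rat \<Rightarrow> rat \<Rightarrow> rat \<Rightarrow> rat^3^3" where
  "heis x y z = vector [vector [1, x, y], vector [0, 1, z], vector [0, 0, 1]]"

lemma heis_mult: "heis x y z ** heis x' y' z' = heis (x + x') (y + y' + x * z') (z + z')"
  by (simp add: heis_def vec_eq_iff forall_3 matrix_matrix_mult_def sum_3 algebra_simps)

lemma heis_one: "mat 1 = heis 0 0 0"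
  by (simp add: heis_def vec_eq_iff forall_3 mat_def)

lemma heis_eq_iff: "heis x y z = heis x' y' z' \<longleftrightarrow> x = x' \<and> y = y' \<and> z = z'"
  by (auto simp: heis_def vec_eq_iff forall_3)

lemma heisenberg_simps [simp]:
  "carrier heisenberg_rat = {heis x y z | x y z. True}"
  "mult heisenberg_rat = (**)" "one heisenberg_rat = heis 0 0 0"
  by (simp_all add: heisenberg_rat_def heis_def heis_one[unfolded heis_def])

lemma group_heisenberg: "group heisenberg_rat"
proof (rule groupI)
  fix g assume "g \<in> carrier heisenberg_rat"
  then obtain x y z where g: "g = heis x y z" by auto
  have "heis (- x) (x * z - y) (- z) ** g = heis 0 0 0" by (simp add: g heis_mult)
  then show "\<exists>h\<in>carrier heisenberg_rat. h \<otimes>\<^bsub>heisenberg_rat\<^esub> g = \<one>\<^bsub>heisenberg_rat\<^esub>" by auto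
next
  fix g h assume "g \<in> carrier heisenberg_rat" "h \<in> carrier heisenberg_rat"
  then show "g \<otimes>\<^bsub>heisenberg_rat\<^esub> h \<in> carrier heisenberg_rat" by (auto simp: heis_mult) blast
qed (auto simp: heis_mult algebra_simps)

lemma inv_heis: "inv\<^bsub>heisenberg_rat\<^esub> (heis x y z) = heis (- x) (x * z - y) (- z)"
  by (rule group.inv_equality[OF group_heisenberg]) (auto simp: heis_mult)

lemma countable_heisenberg: "countable (carrier heisenberg_rat)"
proof -
  have "carrier heisenberg_rat = (\<lambda>(x, y, z). heis x y z) ` UNIV" by (auto simp: image_iff) blast
  then show ?thesis by (metis countable_image countableI_type)
qed

lemma nilpotent_heisenberg: "nilpotent_group heisenberg_rat"
proof -
  interpret group heisenberg_rat by (rule group_heisenberg)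
  let ?Z = "{heis 0 y 0 | y. True}"
  have Z: "subgroup ?Z heisenberg_rat"
    by (rule subgroupI) (auto simp: heis_mult inv_heis)
  have 1: "lower_central_series heisenberg_rat 1 \<subseteq> ?Z"
    unfolding One_nat_def lower_central_series.simps
    by (rule generate_subgroup_incl[OF _ Z]) (auto simp: heis_mult inv_heis heis_eq_iff)
  have "lower_central_series heisenberg_rat (Suc 1) \<subseteq> {\<one>\<^bsub>heisenberg_rat\<^esub>}"
    unfolding lower_central_series.simps(2)[of heisenberg_rat 1]
  proof (rule generate_subgroup_incl)
    show "subgroup {\<one>\<^bsub>heisenberg_rat\<^esub>} heisenberg_rat" by (rule triv_subgroup)
    show "{g \<otimes>\<^bsub>heisenberg_rat\<^esub> h \<otimes>\<^bsub>heisenberg_rat\<^esub> inv\<^bsub>heisenberg_rat\<^esub> g \<otimes>\<^bsub>heisenberg_rat\<^esub> inv\<^bsub>heisenberg_rat\<^esub> h |g h.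
       g \<in> lower_central_series heisenberg_rat 1 \<and> h \<in> carrier heisenberg_rat} \<subseteq> {\<one>\<^bsub>heisenberg_rat\<^esub>}"
    proof clarify
      fix g h assume "g \<in> lower_central_series heisenberg_rat 1" "h \<in> carrier heisenberg_rat"
      then obtain v x y z where "g = heis 0 v 0" "h = heis x y z" using 1 by auto
      then show "g \<otimes>\<^bsub>heisenberg_rat\<^esub> h \<otimes>\<^bsub>heisenberg_rat\<^esub> inv\<^bsub>heisenberg_rat\<^esub> g \<otimes>\<^bsub>heisenberg_rat\<^esub> inv\<^bsub>heisenberg_rat\<^esub> h =
        \<one>\<^bsub>heisenberg_rat\<^esub>" by (simp add: heis_mult inv_heis heis_eq_iff)
    qed
  qed
  moreover have "\<one>\<^bsub>heisenberg_rat\<^esub> \<in> lower_central_series heisenberg_rat (Suc 1)"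
    unfolding lower_central_series.simps(2) by (rule generate.one)
  ultimately have "lower_central_series heisenberg_rat (Suc 1) = {\<one>\<^bsub>heisenberg_rat\<^esub>}" by blast
  then show ?thesis unfolding nilpotent_group_def using group_heisenberg by blast
qed

text \<open>
  Rounding the matrix entries to a grid leaves finitely many possibilities, so two powers
  \<open>V\<^sup>n\<close>, \<open>V\<^sup>m\<close> are close to each other, and then \<open>V\<^sup>m\<^sup>-\<^sup>n\<close> is close to the identity.
\<close>

lemma unitary_powers_recurrent:
  fixes V :: "nat \<Rightarrow> 'i operator"
  assumes I: "finite I" and V: "\<And>n. V n \<in> bounded_operators I"
    and iso: "\<And>n \<xi>. \<xi> \<in> ell2 I \<Longrightarrow> ell2_norm (V n \<xi>) = ell2_norm \<xi>"
    and add: "\<And>m n. V (m + n) = V m \<circ> V n" and e: "0 < e"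
  shows "\<exists>n\<ge>1. \<forall>\<xi>\<in>ell2 I. ell2_norm (\<lambda>i. V n \<xi> i - \<xi> i) \<le> e * ell2_norm \<xi>"
proof -
  define ket where "ket j = (\<lambda>i. if i = j then 1 else 0 :: complex)" for j :: 'i
  have ket: "ket j \<in> ell2 I" if "j \<in> I" for j
    using that I by (simp add: ell2_finite_iff ket_def)
  have norm_ket: "ell2_norm (ket j) = 1" for j
  proof -
    have "(ell2_norm (ket j))\<^sup>2 = 1" using ell2_norm_finite[of "{j}" "ket j"] by (simp add: ket_def)
    then show ?thesis by (metis ell2_norm_nonneg one_power2 power2_eq_iff_nonneg zero_le_one)
  qed
  define a where "a n i j = V n (ket j) i" for n i j
  have a1: "cmod (a n i j) \<le> 1" if "j \<in> I" for n i j
    using cmod_le_ell2_norm[OF bop_in[OF V[of n] ket[OF that]], of i] iso[OF ket[OF that]] norm_ket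
    by (simp add: a_def)
  have exp: "V n \<xi> i = (\<Sum>j\<in>I. a n i j * \<xi> j)" if xi: "\<xi> \<in> ell2 I" for n \<xi> i
  proof -
    have "\<xi> = (\<lambda>i. \<Sum>j\<in>I. \<xi> j * ket j i)"
      using I ell2_off[OF xi] by (auto simp: fun_eq_iff ket_def if_distrib cong: if_cong)
    then have "V n \<xi> = V n (\<lambda>i. \<Sum>j\<in>I. \<xi> j * ket j i)" by (rule arg_cong)
    also have "\<dots> = (\<lambda>i. \<Sum>j\<in>I. V n (\<lambda>i. \<xi> j * ket j i) i)"
      by (rule bop_sum[OF V]) (rule ell2_scale[OF ket])
    also have "\<dots> = (\<lambda>i. \<Sum>j\<in>I. \<xi> j * V n (ket j) i)"
      by (intro ext sum.cong refl) (simp add: bop_scale[OF V ket])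
    finally show ?thesis by (simp add: a_def mult.commute)
  qed
  \<comment> \<open>A matrix with entries of modulus at most \<open>\<epsilon>\<close> has norm at most \<open>d \<epsilon>\<close>.\<close>
  define d where "d = card I * card I"
  obtain k :: nat where k: "2 * real d / e < k" using reals_Archimedean2 by blast
  have "0 \<le> 2 * real d / e" using e by simp
  then have k0: "0 < real k" using k by linarith
  have kd: "real d * (2 / k) \<le> e" using k k0 e by (simp add: field_simps)
  define F where "F n = (\<lambda>p\<in>I \<times> I. (\<lfloor>k * Re (a n (fst p) (snd p))\<rfloor>, \<lfloor>k * Im (a n (fst p) (snd p))\<rfloor>))" for n
  have fl: "\<lfloor>real k * t\<rfloor> \<in> {- int k..int k}" if "\<bar>t\<bar> \<le> 1" for t
  proof -
    have "\<bar>real k * t\<bar> \<le> real k" using that by (simp add: abs_mult mult_left_le)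
    then have "real k * t \<le> real k" "- real k \<le> real k * t" by (auto simp: abs_le_iff)
    then show ?thesis by (auto simp: le_floor_iff floor_le_iff)
  qed
  have "range F \<subseteq> (\<Pi>\<^sub>E p\<in>I \<times> I. {- int k..int k} \<times> {- int k..int k})"
    unfolding F_def
  proof (intro image_subsetI restrict_PiE_iff[THEN iffD2] ballI)
    fix n p assume "p \<in> I \<times> I"
    then have "cmod (a n (fst p) (snd p)) \<le> 1" using a1 by auto
    then have "\<bar>Re (a n (fst p) (snd p))\<bar> \<le> 1" "\<bar>Im (a n (fst p) (snd p))\<bar> \<le> 1"
      using abs_Re_le_cmod abs_Im_le_cmod order_trans by blast+
    then show "(\<lfloor>k * Re (a n (fst p) (snd p))\<rfloor>, \<lfloor>k * Im (a n (fst p) (snd p))\<rfloor>) \<in> {- int k..int k} \<times> {- int k..int k}"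
      using fl by blast
  qed
  then have "finite (range F)" by (rule finite_subset) (simp add: finite_PiE I)
  then have "\<not> inj F" using finite_imageD by blast
  then obtain m n where "F n = F m" "n \<noteq> m" by (auto simp: inj_def)
  then obtain m n where mn: "F n = F m" "n < m" by (metis linorder_neqE_nat)
  have close: "\<bar>s - t\<bar> \<le> 1 / k" if "\<lfloor>real k * s\<rfloor> = \<lfloor>real k * t\<rfloor>" for s t
  proof -
    have "\<bar>real k * s - real k * t\<bar> \<le> 1"
      using that floor_correct[of "real k * s"] floor_correct[of "real k * t"] by linarith
    then have "real k * \<bar>s - t\<bar> \<le> 1" using k0 by (simp add: abs_mult flip: right_diff_distrib)
    then show ?thesis using k0 by (simp add: field_simps)
  qed
  have diff: "cmod (a n i j - a m i j) \<le> 2 / k" if "i \<in> I" "j \<in> I" for i j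
  proof -
    have "F n (i, j) = F m (i, j)" using mn(1) by simp
    then have "\<bar>Re (a n i j) - Re (a m i j)\<bar> \<le> 1 / k" "\<bar>Im (a n i j) - Im (a m i j)\<bar> \<le> 1 / k"
      using that by (auto simp: F_def intro: close)
    then show ?thesis using cmod_le[of "a n i j - a m i j"] by simp
  qed
  have "ell2_norm (\<lambda>i. V (m - n) \<xi> i - \<xi> i) \<le> e * ell2_norm \<xi>" if xi: "\<xi> \<in> ell2 I" for \<xi>
  proof -
    define \<eta> where "\<eta> = (\<lambda>i. V (m - n) \<xi> i - \<xi> i)"
    have Vx: "V (m - n) \<xi> \<in> ell2 I" by (rule bop_in[OF V xi])
    have eta: "\<eta> \<in> ell2 I" unfolding \<eta>_def by (rule ell2_diff[OF Vx xi])
    have "V n \<eta> = (\<lambda>i. V n (V (m - n) \<xi>) i - V n \<xi> i)"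
      unfolding \<eta>_def by (rule bop_diff[OF V Vx xi])
    moreover have "V n (V (m - n) \<xi>) = V m \<xi>" using add[of n "m - n"] mn(2) by simp
    ultimately have eq: "V n \<eta> = (\<lambda>i. V m \<xi> i - V n \<xi> i)" by simp
    have "ell2_norm \<eta> = ell2_norm (V n \<eta>)" using iso[OF eta] by simp
    also have "\<dots> \<le> (\<Sum>i\<in>I. cmod (V n \<eta> i))"
      by (rule ell2_norm_le_sum[OF I]) (rule ell2_off[OF bop_in[OF V eta]])
    also have "\<dots> \<le> (\<Sum>i\<in>I. \<Sum>j\<in>I. (2 / k) * ell2_norm \<xi>)"
    proof (rule sum_mono)
      fix i assume i: "i \<in> I"
      have "V n \<eta> i = (\<Sum>j\<in>I. (a m i j - a n i j) * \<xi> j)"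
        by (simp add: eq exp[OF xi] left_diff_distrib sum_subtractf)
      also have "cmod \<dots> \<le> (\<Sum>j\<in>I. cmod ((a m i j - a n i j) * \<xi> j))" by (rule norm_sum)
      also have "\<dots> \<le> (\<Sum>j\<in>I. (2 / k) * ell2_norm \<xi>)"
        unfolding norm_mult using diff[OF i] k0
        by (intro sum_mono mult_mono cmod_le_ell2_norm[OF xi]) (auto simp: norm_minus_commute)
      finally show "cmod (V n \<eta> i) \<le> (\<Sum>j\<in>I. (2 / k) * ell2_norm \<xi>)" .
    qed
    also have "\<dots> = (real d * (2 / k)) * ell2_norm \<xi>" by (simp add: d_def)
    also have "\<dots> \<le> e * ell2_norm \<xi>" by (intro mult_right_mono kd) simp
    finally show ?thesis unfolding \<eta>_def .
  qed
  then show ?thesis using mn(2) by (intro exI[of _ "m - n"]) auto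
qed

text \<open>
  The central element \<open>c = heis 0 1 0\<close> acts trivially in every finite-dimensional unitary
  representation: for every \<open>n \<ge> 1\<close> it is the commutator of \<open>heis (1/n) 0 0\<close> and \<open>b\<^sup>n\<close>, where
  \<open>b = heis 0 0 1\<close>, and by recurrence \<open>n\<close> can be chosen such that \<open>b\<^sup>n\<close> acts almost trivially.
\<close>

lemma heisenberg_not_MAP: "\<not> MAP_group heisenberg_rat"
proof
  assume MAP: "MAP_group heisenberg_rat"
  have ne: "heis 0 1 0 \<noteq> heis 0 0 0" by (simp add: heis_eq_iff)
  have car: "heis x y z \<in> carrier heisenberg_rat" for x y z by auto
  from MAP[unfolded MAP_group_def, rule_format, OF car car ne]
  obtain I :: "nat set" and u where I: "finite I" and u: "u \<in> hom heisenberg_rat (unitary_group I)"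
    and neq: "u (heis 0 1 0) \<noteq> u (heis 0 0 0)" by (elim exE conjE)
  define w where "w x y z = u (heis x y z)" for x y z
  have wc: "w x y z \<in> carrier (unitary_group I)" for x y z
    unfolding w_def using u car[of x y z] by (auto simp: hom_def)
  have B: "w x y z \<in> bounded_operators I" and bij: "bij_betw (w x y z) (ell2 I) (ell2 I)"
    and inner: "\<And>\<xi> \<eta>. \<xi> \<in> ell2 I \<Longrightarrow> \<eta> \<in> ell2 I \<Longrightarrow> ell2_inner (w x y z \<xi>) (w x y z \<eta>) = ell2_inner \<xi> \<eta>" for x y z
    using wc[of x y z] by (auto simp: unitary_group_def)
  have iso: "ell2_norm (w x y z \<xi>) = ell2_norm \<xi>" if xi: "\<xi> \<in> ell2 I" for x y z \<xi>
  proof -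
    have "complex_of_real ((ell2_norm (w x y z \<xi>))\<^sup>2) = complex_of_real ((ell2_norm \<xi>)\<^sup>2)"
      using inner[OF xi xi, of x y z] ell2_inner_self[OF xi] ell2_inner_self[OF bop_in[OF B xi], of x y z] by simp
    then show ?thesis by (simp only: of_real_eq_iff) (simp add: power2_eq_iff_nonneg)
  qed
  have mult: "w (x + x') (y + y' + x * z') (z + z') = w x y z \<circ> w x' y' z'" for x y z x' y' z'
  proof -
    have "u (heis x y z ** heis x' y' z') = u (heis x y z) \<otimes>\<^bsub>unitary_group I\<^esub> u (heis x' y' z')"
      using u car[of x y z] car[of x' y' z'] by (auto simp: hom_def)
    then show ?thesis by (simp add: w_def heis_mult unitary_group_def)
  qed
  have one: "w 0 0 0 \<eta> = \<eta>" if eta: "\<eta> \<in> ell2 I" for \<eta>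
  proof -
    have "w 0 0 0 (w 0 0 0 \<eta>) = w 0 0 0 \<eta>" using mult[of 0 0 0 0 0 0] by (simp add: fun_eq_iff)
    then show ?thesis
      using bij_betw_imp_inj_on[OF bij[of 0 0 0]] bop_in[OF B[of 0 0 0] eta] eta by (meson inj_onD)
  qed
  have c: "w 0 1 0 \<eta> = \<eta>" if eta: "\<eta> \<in> ell2 I" for \<eta>
  proof -
    \<comment> \<open>With \<open>A\<close>, \<open>C\<close>, \<open>V\<close> the images of \<open>heis (1/n) 0 0\<close>, \<open>c\<close> and \<open>b\<^sup>n\<close>, the relation \<open>A V = C V A\<close> turns \<open>V \<approx> 1\<close> into \<open>C \<approx> 1\<close>.\<close>
    have small: "ell2_norm (\<lambda>i. w 0 1 0 \<eta> i - \<eta> i) \<le> 0 + e" if e: "0 < e" for e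
    proof -
      obtain d where d: "0 < d" "(2 * ell2_norm \<eta>) * d \<le> e" using ex_small_factor[of "2 * ell2_norm \<eta>" e] e by auto
      have "\<exists>n\<ge>1. \<forall>\<xi>\<in>ell2 I. ell2_norm (\<lambda>i. w 0 0 (of_nat n) \<xi> i - \<xi> i) \<le> d * ell2_norm \<xi>"
      proof (rule unitary_powers_recurrent[OF I B iso _ d(1)])
        show "w 0 0 (of_nat (m + n)) = w 0 0 (of_nat m) \<circ> w 0 0 (of_nat n)" for m n
          using mult[of 0 0 0 0 "of_nat n" "of_nat m"] by simp
      qed
      then obtain n where n: "n \<ge> 1"
        "\<And>\<xi>. \<xi> \<in> ell2 I \<Longrightarrow> ell2_norm (\<lambda>i. w 0 0 (of_nat n) \<xi> i - \<xi> i) \<le> d * ell2_norm \<xi>" by blast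
      define A where "A = w (1 / of_nat n) 0 0"
      define C where "C = w 0 1 0"
      define V where "V = w 0 0 (of_nat n)"
      have AB: "A \<in> bounded_operators I" and CB: "C \<in> bounded_operators I" and VB: "V \<in> bounded_operators I"
        by (simp_all add: A_def C_def V_def B)
      have "A \<circ> V = w (1 / of_nat n) 1 (of_nat n)"
        using mult[of "1 / of_nat n" 0 0 0 "of_nat n" 0] n(1) by (simp add: A_def V_def)
      moreover have "C \<circ> V = w 0 1 (of_nat n)" using mult[of 0 0 1 0 "of_nat n" 0] by (simp add: C_def V_def)
      moreover have "w 0 1 (of_nat n) \<circ> A = w (1 / of_nat n) 1 (of_nat n)"
        using mult[of 0 "1 / of_nat n" 1 0 0 "of_nat n"] by (simp add: A_def)
      ultimately have comm: "A \<circ> V = C \<circ> V \<circ> A" by simp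
      have "A ` ell2 I = ell2 I" unfolding A_def by (rule bij_betw_imp_surj_on[OF bij])
      then have "\<eta> \<in> A ` ell2 I" using eta by simp
      then obtain \<xi> where xi: "\<xi> \<in> ell2 I" "A \<xi> = \<eta>" by blast
      have nxi: "ell2_norm \<xi> = ell2_norm \<eta>" using iso[OF xi(1), of "1 / of_nat n" 0 0] unfolding A_def[symmetric] xi(2) by (rule sym)
      have CV: "C (V \<eta>) = A (V \<xi>)" using fun_cong[OF comm, of \<xi>] xi(2) by simp
      have V\<eta>: "V \<eta> \<in> ell2 I" and V\<xi>: "V \<xi> \<in> ell2 I" and C\<eta>: "C \<eta> \<in> ell2 I"
        by (rule bop_in[OF VB eta], rule bop_in[OF VB xi(1)], rule bop_in[OF CB eta])
      define p where "p = (\<lambda>i. C \<eta> i - C (V \<eta>) i)"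
      define q where "q = (\<lambda>i. A (V \<xi>) i - A \<xi> i)"
      have p: "p = C (\<lambda>i. \<eta> i - V \<eta> i)" unfolding p_def by (rule bop_diff[OF CB eta V\<eta>, symmetric])
      have q: "q = A (\<lambda>i. V \<xi> i - \<xi> i)" unfolding q_def by (rule bop_diff[OF AB V\<xi> xi(1), symmetric])
      have dp: "(\<lambda>i. \<eta> i - V \<eta> i) \<in> ell2 I" and dq: "(\<lambda>i. V \<xi> i - \<xi> i) \<in> ell2 I"
        by (rule ell2_diff[OF eta V\<eta>], rule ell2_diff[OF V\<xi> xi(1)])
      have "ell2_norm p = ell2_norm (\<lambda>i. \<eta> i - V \<eta> i)" unfolding p C_def by (rule iso[OF dp])
      also have "\<dots> = ell2_norm (\<lambda>i. V \<eta> i - \<eta> i)" using ell2_norm_uminus[of "\<lambda>i. V \<eta> i - \<eta> i"] by simp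
      also have "\<dots> \<le> d * ell2_norm \<eta>" unfolding V_def by (rule n(2)[OF eta])
      finally have np: "ell2_norm p \<le> d * ell2_norm \<eta>" .
      have "ell2_norm q = ell2_norm (\<lambda>i. V \<xi> i - \<xi> i)" unfolding q A_def by (rule iso[OF dq])
      also have "\<dots> \<le> d * ell2_norm \<eta>" using n(2)[OF xi(1)] unfolding V_def nxi .
      finally have nq: "ell2_norm q \<le> d * ell2_norm \<eta>" .
      have "(\<lambda>i. C \<eta> i - \<eta> i) = (\<lambda>i. p i + q i)" using CV xi(2) by (simp add: p_def q_def)
      moreover have "p \<in> ell2 I" "q \<in> ell2 I" unfolding p q by (rule bop_in[OF CB dp], rule bop_in[OF AB dq])
      ultimately have "ell2_norm (\<lambda>i. C \<eta> i - \<eta> i) \<le> ell2_norm p + ell2_norm q"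
        using ell2_norm_triangle by metis
      also have "\<dots> \<le> (2 * ell2_norm \<eta>) * d" using np nq by (simp add: algebra_simps)
      finally show ?thesis using d(2) unfolding C_def by simp
    qed
    then have "ell2_norm (\<lambda>i. w 0 1 0 \<eta> i - \<eta> i) \<le> 0" by (rule field_le_epsilon)
    then have "(\<lambda>i. w 0 1 0 \<eta> i - \<eta> i) = (\<lambda>_. 0)"
      by (intro ell2_norm_eq_0[OF ell2_diff[OF bop_in[OF B eta] eta]] antisym ell2_norm_nonneg)
    then show ?thesis by (simp add: fun_eq_iff)
  qed
  have "w 0 1 0 = w 0 0 0"
  proof
    fix \<eta> show "w 0 1 0 \<eta> = w 0 0 0 \<eta>"
      using c one bop_off[OF B[of 0 1 0]] bop_off[OF B[of 0 0 0]] by (cases "\<eta> \<in> ell2 I") auto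
  qed
  then show False using neq by (simp add: w_def)
qed

section \<open>The groupoid of a nilpotent group that is not maximally almost periodic\<close>

theorem proposition2p11:
  shows "(\<forall>(\<Gamma> :: ('g, 'b) monoid_scheme) (\<Gamma>s :: nat \<Rightarrow> 'g set).
       group \<Gamma> \<and> countable (carrier \<Gamma>) \<and> \<not> MAP_group \<Gamma> \<and> nilpotent_group \<Gamma> \<and>
       (\<forall>n\<ge>1. fin_gen_subgroup \<Gamma> (\<Gamma>s n)) \<and>
       (\<forall>m n. 1 \<le> m \<and> m \<le> n \<longrightarrow> \<Gamma>s m \<subseteq> \<Gamma>s n) \<and>
       (\<Union>n\<in>{1..}. \<Gamma>s n) = carrier \<Gamma>
     \<longrightarrow>
       etale_groupoid (bundle_groupoid \<Gamma> \<Gamma>s) \<and>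
       topologically_amenable (bundle_groupoid \<Gamma> \<Gamma>s) \<and>
       (\<exists>x\<in>topspace (gpd_units (bundle_groupoid \<Gamma> \<Gamma>s)).
          \<not> MAP_group (isotropy_group (bundle_groupoid \<Gamma> \<Gamma>s) x)) \<and>
       cstar_algebra (full_cstar (bundle_groupoid \<Gamma> \<Gamma>s)) \<and>
       RFD (full_cstar (bundle_groupoid \<Gamma> \<Gamma>s)))
   \<and> group heisenberg_rat \<and> countable (carrier heisenberg_rat) \<and>
     \<not> MAP_group heisenberg_rat \<and> nilpotent_group heisenberg_rat"
proof (intro conjI[OF _ conjI[OF group_heisenberg conjI[OF countable_heisenberg
        conjI[OF heisenberg_not_MAP nilpotent_heisenberg]]]] allI impI, elim conjE)
  fix \<Gamma> :: "('g, 'b) monoid_scheme" and \<Gamma>s :: "nat \<Rightarrow> 'g set"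
  assume group: "group \<Gamma>" and count: "countable (carrier \<Gamma>)" and not_MAP: "\<not> MAP_group \<Gamma>"
    and nilp: "nilpotent_group \<Gamma>" and fg: "\<forall>n\<ge>1. fin_gen_subgroup \<Gamma> (\<Gamma>s n)"
    and mono: "\<forall>m n. 1 \<le> m \<and> m \<le> n \<longrightarrow> \<Gamma>s m \<subseteq> \<Gamma>s n" and un: "(\<Union>n\<in>{1..}. \<Gamma>s n) = carrier \<Gamma>"
  obtain c where c: "lower_central_series \<Gamma> c = {\<one>\<^bsub>\<Gamma>\<^esub>}" using nilp by (auto simp: nilpotent_group_def)
  have "subgroup_exhaustion \<Gamma> \<Gamma>s"
    by (intro subgroup_exhaustion.intro subgroup_exhaustion_axioms.intro group)
      (use fg mono un in \<open>auto simp only: fin_gen_subgroup_def\<close>)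
  then interpret nilpotent_exhaustion \<Gamma> \<Gamma>s c
    by (intro nilpotent_exhaustion.intro nilpotent_exhaustion_axioms.intro) (use fg c in auto)
  show "etale_groupoid (bundle_groupoid \<Gamma> \<Gamma>s) \<and> topologically_amenable (bundle_groupoid \<Gamma> \<Gamma>s) \<and>
      (\<exists>x\<in>topspace (gpd_units (bundle_groupoid \<Gamma> \<Gamma>s)). \<not> MAP_group (isotropy_group (bundle_groupoid \<Gamma> \<Gamma>s) x)) \<and>
      cstar_algebra (full_cstar (bundle_groupoid \<Gamma> \<Gamma>s)) \<and> RFD (full_cstar (bundle_groupoid \<Gamma> \<Gamma>s))"
  proof (intro conjI)
    show "\<exists>x\<in>topspace (gpd_units (bundle_groupoid \<Gamma> \<Gamma>s)). \<not> MAP_group (isotropy_group (bundle_groupoid \<Gamma> \<Gamma>s) x)"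
      by (rule bexI[of _ \<infinity>]) (use isotropy_not_MAP[OF not_MAP] in simp_all)
  qed (rule etale_bundle[OF count] amenable_bundle[OF count] cstar_algebra_bundle RFD_bundle)+
qed

end
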